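(* Fix $\alpha,\beta\in(0,1)$ and $\gamma\ge 1$. Let $p_n\ge n$ with $p_n/n\to\gamma$, $r_n=n^{1-\beta}$, $\delta_n=n^{-\alpha}$, and write $p=p_n$, $r=r_n$, $\delta=\delta_n$. Given the data $X_1,\dots,X_n\in\mathbb{R}^p$, consider testing $H_0^{(n)}$ against $H_1^{(n)}$, where under $H_0^{(n)}$: $X_i\stackrel{iid}{\sim}N(0,I_p)$, and under $H_1^{(n)}$: $(X_i\mid Q)\stackrel{iid}{\sim}N\big(0,\ I_p+\tfrac{\delta}{1-\delta}QQ'\big)$ with $Q$ uniformly distributed on the Stiefel manifold $\mathbb{S}(p,r)$. Let $\lambda_1>\lambda_2>\dots>\lambda_n>0$ be the nonzero eigenvalues of $\hat\Sigma=\frac1n\sum_{i=1}^nX_iX_i'$, $S_k=\sum_{i=1}^k\lambda_i$, and $\tilde L_n=[\log(n)]^{\log^2(\log(n))}$. (i) If $\alpha+\beta<1$, then as $n\to\infty$, the level of the CuSum test, which rejects $H_0^{(n)}$ if and only if $CS_n^+\ge\tilde L_n$ where $$CS_n^+=\max_{1\le k\le n}\Big\{\frac{S_k-E_0[S_k]}{(k/n)^{2/3}}\Big\},$$ tends to $0$, while its power tends to $1$. (ii) If $\alpha+\beta>1$ and $H_1^{(n)}$ holds, then there is a constant $C>0$ such that for all sufficiently large $n$, with probability at least $1-C\log(n)\,n^{1-(\alpha+\beta)}$, $$\big|S_k-E_0[S_k]\big|\le C\tilde L_n(k/n)^{2/3}\qquad\text{for all }1\le k\le n.$$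
   Context: $\mathbb{S}(p,r)=\{Q\in\mathbb{R}^{p\times r}:Q'Q=I_r\}$ is the Stiefel manifold; "uniform" means the law invariant under left multiplication by orthogonal $p\times p$ matrices. $r_n=n^{1-\beta}$ is understood as rounded to an integer. Since $p\ge n$, $\hat\Sigma$ has almost surely exactly $n$ distinct positive eigenvalues. $E_0$ denotes expectation under $H_0^{(n)}$. Under $H_1^{(n)}$ the law of the data is the mixture over $Q$ (one $Q$ is drawn, common to all $i$). The level of a test is its rejection probability under $H_0^{(n)}$; its power is its rejection probability under $H_1^{(n)}$. *)

theory Defs
  imports "HOL-Probability.Probability" "Jordan_Normal_Form.Char_Poly"
    "Jordan_Normal_Form.Gauss_Jordan_Elimination"
begin

text \<open>
  The dimension varies with the sample size, so a vector in \<open>p\<close>-dimensional space is a function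
  on \<open>{..<p}\<close> (a point of the product of \<open>p\<close> copies of the Borel line), and a data set
  \<open>X\<close> consists of such vectors \<open>X 1, ..., X n\<close>.  Matrices are those of Jordan Normal Form.
\<close>

definition data_space :: "nat \<Rightarrow> nat \<Rightarrow> (nat \<Rightarrow> nat \<Rightarrow> real) measure" where
  "data_space n p = (\<Pi>\<^sub>M i\<in>{1..n}. \<Pi>\<^sub>M j\<in>{..<p}. borel)"


text \<open>
  The normal law with mean zero and covariance \<open>\<Sigma>\<close>, through its Lebesgue density; meant for
  symmetric positive definite \<open>\<Sigma>\<close>, for which \<open>mat_inverse \<Sigma>\<close> is not \<open>None\<close>.
\<close>

definition mvnormal_density :: "nat \<Rightarrow> real mat \<Rightarrow> (nat \<Rightarrow> real) \<Rightarrow> real" where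
  "mvnormal_density p \<Sigma> x =
     exp (- scalar_prod (vec p x) (mult_mat_vec (the (mat_inverse \<Sigma>)) (vec p x)) / 2)
     / sqrt ((2 * pi) ^ p * Determinant.det \<Sigma>)"

definition mvnormal :: "nat \<Rightarrow> real mat \<Rightarrow> (nat \<Rightarrow> real) measure" where
  "mvnormal p \<Sigma> =
     density (\<Pi>\<^sub>M j\<in>{..<p}. lborel) (\<lambda>x. ennreal (mvnormal_density p \<Sigma> x))"

definition iid_mvnormal :: "nat \<Rightarrow> nat \<Rightarrow> real mat \<Rightarrow> (nat \<Rightarrow> nat \<Rightarrow> real) measure" where
  "iid_mvnormal n p \<Sigma> = (\<Pi>\<^sub>M i\<in>{1..n}. mvnormal p \<Sigma>)"


definition stiefel :: "nat \<Rightarrow> nat \<Rightarrow> real mat set" where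
  "stiefel p r = {Q \<in> carrier_mat p r. transpose_mat Q * Q = 1\<^sub>m r}"

text \<open>The Borel structure of the Stiefel manifold is the one generated by the matrix entries.\<close>

definition stiefel_borel :: "nat \<Rightarrow> nat \<Rightarrow> real mat measure" where
  "stiefel_borel p r =
     vimage_algebra (stiefel p r) (\<lambda>Q. \<lambda>ij\<in>{..<p} \<times> {..<r}. index_mat Q ij)
       (\<Pi>\<^sub>M ij\<in>{..<p} \<times> {..<r}. borel)"

text \<open>Orthogonal \<open>p\<close> by \<open>p\<close> matrices are the elements of \<open>stiefel p p\<close>.\<close>

definition uniform_on_stiefel :: "nat \<Rightarrow> nat \<Rightarrow> real mat measure \<Rightarrow> bool" where
  "uniform_on_stiefel p r \<nu> \<longleftrightarrow>
     prob_space \<nu> \<and> sets \<nu> = sets (stiefel_borel p r) \<and>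
     (\<forall>U \<in> stiefel p p. distr \<nu> \<nu> (\<lambda>Q. U * Q) = \<nu>)"


definition null_law :: "nat \<Rightarrow> nat \<Rightarrow> (nat \<Rightarrow> nat \<Rightarrow> real) measure" where
  "null_law n p = iid_mvnormal n p (1\<^sub>m p)"

definition spiked_cov :: "nat \<Rightarrow> real \<Rightarrow> real mat \<Rightarrow> real mat" where
  "spiked_cov p \<delta> Q = 1\<^sub>m p + (\<delta> / (1 - \<delta>)) \<cdot>\<^sub>m (Q * transpose_mat Q)"

text \<open>
  One \<open>Q\<close> is drawn from the prior \<open>\<nu>\<close>, and is common to all observations.
\<close>

definition alt_law ::
    "nat \<Rightarrow> nat \<Rightarrow> real \<Rightarrow> real mat measure \<Rightarrow> (nat \<Rightarrow> nat \<Rightarrow> real) measure" where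
  "alt_law n p \<delta> \<nu> = \<nu> \<bind> (\<lambda>Q. iid_mvnormal n p (spiked_cov p \<delta> Q))"


definition sample_cov :: "nat \<Rightarrow> nat \<Rightarrow> (nat \<Rightarrow> nat \<Rightarrow> real) \<Rightarrow> real mat" where
  "sample_cov n p X = mat p p (\<lambda>(j, k). (1 / real n) * (\<Sum>i=1..n. X i j * X i k))"

text \<open>
  The nonzero eigenvalues in decreasing order, listed with multiplicity.  Almost surely there are
  exactly \<open>n\<close> of them, all simple; the multiplicities only settle the remaining null set.
\<close>

definition nonzero_eigenvalues :: "real mat \<Rightarrow> real list" where
  "nonzero_eigenvalues A =
     rev (sorted_list_of_multiset (filter_mset (\<lambda>x. x \<noteq> 0) (proots (char_poly A))))"

lemma set_nonzero_eigenvalues: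
  assumes "A \<in> carrier_mat p p"
  shows "set (nonzero_eigenvalues A) = {x. eigenvalue A x \<and> x \<noteq> 0}"
proof -
  have "char_poly A \<noteq> 0"
    using degree_monic_char_poly[OF assms] by auto
  then show ?thesis
    using eigenvalue_root_char_poly[OF assms]
    by (auto simp: nonzero_eigenvalues_def)
qed

definition partial_sum :: "nat \<Rightarrow> nat \<Rightarrow> nat \<Rightarrow> (nat \<Rightarrow> nat \<Rightarrow> real) \<Rightarrow> real" where
  "partial_sum n p k X = sum_list (take k (nonzero_eigenvalues (sample_cov n p X)))"

definition centred_sum :: "nat \<Rightarrow> nat \<Rightarrow> nat \<Rightarrow> (nat \<Rightarrow> nat \<Rightarrow> real) \<Rightarrow> real" where
  "centred_sum n p k X =
     partial_sum n p k X - integral\<^sup>L (null_law n p) (partial_sum n p k)"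


definition L_tilde :: "nat \<Rightarrow> real" where
  "L_tilde n = ln (real n) powr ((ln (ln (real n)))\<^sup>2)"

definition cusum_stat :: "nat \<Rightarrow> nat \<Rightarrow> (nat \<Rightarrow> nat \<Rightarrow> real) \<Rightarrow> real" where
  "cusum_stat n p X =
     Max ((\<lambda>k. centred_sum n p k X / (real k / real n) powr (2/3)) ` {1..n})"

definition cusum_rejects :: "nat \<Rightarrow> nat \<Rightarrow> (nat \<Rightarrow> nat \<Rightarrow> real) set" where
  "cusum_rejects n p = {X \<in> space (data_space n p). cusum_stat n p X \<ge> L_tilde n}"

definition test_level :: "nat \<Rightarrow> nat \<Rightarrow> (nat \<Rightarrow> nat \<Rightarrow> real) set \<Rightarrow> real" where
  "test_level n p R = measure (null_law n p) R"

definition test_power ::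
    "nat \<Rightarrow> nat \<Rightarrow> real \<Rightarrow> real mat measure \<Rightarrow> (nat \<Rightarrow> nat \<Rightarrow> real) set \<Rightarrow> real" where
  "test_power n p \<delta> \<nu> R = measure (alt_law n p \<delta> \<nu>) R"

end

theory Submission
  imports Defs "HOL-Real_Asymp.Real_Asymp"
begin

text \<open>
 Under the null hypothesis a sum of top eigenvalues depends only on the spectrum, so reflections
 reduce the Gaussian array to one with independent chi variables on two diagonals.  On a good event
 its quadratic form is comparable, below the edge \<open>(sqrt p + sqrt n)\<^sup>2\<close>, with a discrete Airy
 operator, and trial functions bound the \<open>k\<close>-th eigenvalue from below at scale
 \<open>n\<^sup>1\<^sup>/\<^sup>3 k\<^sup>2\<^sup>/\<^sup>3\<close>.  An Agmon-type estimate then delocalises the top \<open>k\<close> eigenvectors, which bounds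
 the Lipschitz constants of the sum in the entries; after a McShane extension off the good event,
 concentration for product measures gives fluctuations of order \<open>(k / n)\<^sup>2\<^sup>/\<^sup>3\<close> up to logarithms,
 outside an event whose probability is smaller than any power of \<open>n\<close>.

 For \<open>\<alpha> + \<beta> > 1\<close> the likelihood ratio has a bounded second moment, because the squared overlap of
 two independent uniform frames is small; so an event that rare stays rare under the alternative.
 For \<open>\<alpha> + \<beta> < 1\<close> the trace alone (\<open>k = n\<close>) detects the spike: its lower tail under the
 alternative is controlled by an exact Laplace transform.
\<close>

subsection \<open>Standard Gaussian arrays\<close>

text \<open>For the full Gaussian array, concentration only gives fluctuations of order sqrt(k/n)
  for the sum of the \<open>k\<close> largest eigenvalues, too large by a factor (n/k)^(1/6). The
  bidiagonal array has about 2n random entries, and the derivative of the sum in one of them is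
  n^(-1/2) times an entry of the spectral projection near the diagonal. With x = (k/n)^(1/3), the
  diagonal entry at coordinate i is at most of order n x^2 / sqrt(n(i+1)). The squared derivatives,
  x^4/(i+1), then sum harmonically to x^4 ln n, and this is where the exponent 2/3 comes from. The
  noise in the quadratic form is summed over blocks of length n^(1/3), the Airy scale. Its energy is
  then of order n^(1/3), which never exceeds the scale n x^2 of the \<open>k\<close>-th eigenvalue.
  Since the sums are centred at their null mean, no expansion of that mean enters.
  \<open>L_tilde\<close> grows faster than every power of ln n, which absorbs the logarithms, and
  slower than every power of n, which leaves room for the shift of the trace, of order
  n^(1-(\<alpha>+\<beta>)).\<close>

lemma PiM_density:
 assumes I: "finite I" and M: "!!i. i \<in> I ==> sigma_finite_measure (M i)"
  and D: "!!i. i \<in> I ==> sigma_finite_measure (density (M i) (f i))"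
  and f: "!!i. i \<in> I ==> f i \<in> borel_measurable (M i)"
 shows "PiM I (\<lambda>i. density (M i) (f i)) = density (PiM I M) (\<lambda>x. \<Prod>i\<in>I. f i (x i))"
proof -
 \<comment> \<open>The locale for products quantifies over all indices, whereas the hypotheses speak
   of \<open>I\<close> only; outside \<open>I\<close> the factors are padded by a one-point
   space.\<close>
 define M' where "M' i = (if i \<in> I then M i else count_space {undefined})" for i
 define f' where "f' i = (if i \<in> I then f i else (\<lambda>_. 1))" for i
 have sfM: "sigma_finite_measure (M' i)" for i
  using M by (auto simp: M'_def intro: sigma_finite_measure_count_space_finite)
 have sfD: "sigma_finite_measure (density (M' i) (f' i))" for i
  using D sfM[of i] by (auto simp: M'_def f'_def density_1)
 interpret M': product_sigma_finite M' by (rule product_sigma_finite.intro) (rule sfM)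
 interpret D': product_sigma_finite "\<lambda>i. density (M' i) (f' i)" by (rule product_sigma_finite.intro) (rule sfD)
 have f': "f' i \<in> borel_measurable (M' i)" for i using f by (auto simp: M'_def f'_def)
 have prodm: "(\<lambda>x. \<Prod>i\<in>I. f' i (x i)) \<in> borel_measurable (PiM I M')"
  by (intro borel_measurable_prod_ennreal, rule measurable_compose[OF _ f'], rule measurable_component_singleton)
 have "density (PiM I M') (\<lambda>x. \<Prod>i\<in>I. f' i (x i)) = PiM I (\<lambda>i. density (M' i) (f' i))"
 proof (rule D'.PiM_eqI[OF I])
  show "sets (density (PiM I M') (\<lambda>x. \<Prod>i\<in>I. f' i (x i))) = sets (PiM I (\<lambda>i. density (M' i) (f' i)))"
   by (simp cong: sets_PiM_cong)
  fix A assume "!!i. i \<in> I ==> A i \<in> sets (density (M' i) (f' i))"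
  hence A: "!!i. i \<in> I ==> A i \<in> sets (M' i)" by simp
  have PA: "Pi\<^sub>E I A \<in> sets (PiM I M')" using A I by (intro sets_PiM_I_finite) auto
  have "emeasure (density (PiM I M') (\<lambda>x. \<Prod>i\<in>I. f' i (x i))) (Pi\<^sub>E I A)
    = (\<integral>\<^sup>+x. (\<Prod>i\<in>I. f' i (x i))*indicator (Pi\<^sub>E I A) x \<partial>PiM I M')"
   by (rule emeasure_density[OF prodm PA])
  also have "... = (\<integral>\<^sup>+x. (\<Prod>i\<in>I. f' i (x i)*indicator (A i) (x i)) \<partial>PiM I M')"
  proof (rule nn_integral_cong)
   fix x assume "x \<in> space (PiM I M')"
   hence "(\<Prod>i\<in>I. indicator (A i) (x i)) = (indicator (Pi\<^sub>E I A) x :: ennreal)"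
    using I by (auto simp: indicator_def space_PiM PiE_iff prod_zero_iff)
   thus "(\<Prod>i\<in>I. f' i (x i))*indicator (Pi\<^sub>E I A) x = (\<Prod>i\<in>I. f' i (x i)*indicator (A i) (x i))"
    by (simp add: prod.distrib)
  qed
  also have "... = (\<Prod>i\<in>I. \<integral>\<^sup>+x. f' i x*indicator (A i) x \<partial>M' i)"
   using f' A by (intro M'.product_nn_integral_prod[OF I]) auto
  also have "... = (\<Prod>i\<in>I. emeasure (density (M' i) (f' i)) (A i))"
   using f' A by (intro prod.cong refl) (simp add: emeasure_density)
  finally show "emeasure (density (PiM I M') (\<lambda>x. \<Prod>i\<in>I. f' i (x i))) (Pi\<^sub>E I A)
    = (\<Prod>i\<in>I. emeasure (density (M' i) (f' i)) (A i))" .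
 qed
 moreover have "PiM I M' = PiM I M" by (intro PiM_cong) (auto simp: M'_def)
 moreover have "PiM I (\<lambda>i. density (M' i) (f' i)) = PiM I (\<lambda>i. density (M i) (f i))"
  by (intro PiM_cong) (auto simp: M'_def f'_def)
 moreover have "(\<lambda>x. \<Prod>i\<in>I. f' i (x i)) = (\<lambda>x. \<Prod>i\<in>I. f i (x i))" by (auto simp: f'_def intro!: prod.cong)
 ultimately show ?thesis by simp
qed

definition std_gauss :: "real measure" where
 "std_gauss = density lborel (\<lambda>x. ennreal (std_normal_density x))"

definition gauss :: "'i set => ('i => real) measure" where
 "gauss I = PiM I (\<lambda>_. std_gauss)"

lemma prob_space_std_gauss [simp]: "prob_space std_gauss"
 unfolding std_gauss_def by (rule prob_space_normal_density) simp

lemma sets_std_gauss [simp, measurable_cong]: "sets std_gauss = sets borel"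
 and space_std_gauss [simp]: "space std_gauss = UNIV"
 by (simp_all add: std_gauss_def)

lemma sets_gauss [measurable_cong]: "sets (gauss I) = sets (PiM I (\<lambda>_. borel))"
 unfolding gauss_def by (rule sets_PiM_cong) auto

lemma measurable_gauss_component: "i \<in> R ==> (\<lambda>x. x i) \<in> borel_measurable (gauss R)"
 using measurable_component_singleton[of i R "\<lambda>_. std_gauss"] measurable_cong_sets[OF refl sets_std_gauss, of "gauss R"]
 by (simp add: gauss_def)

lemma prob_space_gauss: "prob_space (gauss I)"
 unfolding gauss_def by (rule prob_space_PiM) simp

lemma gauss_density:
 assumes "finite I"
 shows "gauss I = density (PiM I (\<lambda>_. lborel)) (\<lambda>x. ennreal ((1 / sqrt (2*pi)) ^ card I*exp (- (\<Sum>i\<in>I. (x i)\<^sup>2)/2)))"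
proof -
 have sf: "sigma_finite_measure (density lborel (\<lambda>x. ennreal (std_normal_density x)))"
  using prob_space_std_gauss unfolding std_gauss_def
  by (simp add: prob_space_imp_sigma_finite)
 have "gauss I = density (PiM I (\<lambda>_. lborel)) (\<lambda>x. \<Prod>i\<in>I. ennreal (std_normal_density (x i)))"
  unfolding gauss_def std_gauss_def
  by (rule PiM_density[OF assms]) (auto intro: sf sigma_finite_lborel)
 also have "(\<lambda>x. \<Prod>i\<in>I. ennreal (std_normal_density (x i))) = (\<lambda>x. ennreal ((1 / sqrt (2*pi)) ^ card I*exp (- (\<Sum>i\<in>I. (x i)\<^sup>2)/2)))"
  using assms by (auto simp: prod_ennreal std_normal_density_def prod.distrib exp_sum[symmetric] power_divide
    sum_negf sum_divide_distrib[symmetric] fun_eq_iff prod_dividef)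
 finally show ?thesis .
qed

subsection \<open>Reflections preserve the Gaussian measure\<close>

definition preserves :: "'a measure => ('a => 'a) => bool" where
 "preserves M T \<longleftrightarrow> T \<in> measurable M M \<and> distr M M T = M"

lemma preserves_id: "preserves M (\<lambda>x. x)"
 by (simp add: preserves_def distr_id2)

lemma preserves_comp: "preserves M S ==> preserves M T ==> preserves M (\<lambda>x. S (T x))"
 unfolding preserves_def using distr_distr[of S M M T M] by (auto simp: comp_def)

lemma preserves_nn_integral: "preserves M T ==> f \<in> borel_measurable M ==> (\<integral>\<^sup>+x. f (T x) \<partial>M) = (\<integral>\<^sup>+x. f x \<partial>M)"
 unfolding preserves_def using nn_integral_distr[of T M M f] by simp

lemma preservesI:
 assumes T: "T \<in> measurable M M"
  and "!!A. A \<in> sets M ==> (\<integral>\<^sup>+x. indicator A (T x) \<partial>M) = (\<integral>\<^sup>+x. indicator A x \<partial>M)"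
 shows "preserves M T"
 unfolding preserves_def
proof
 show "distr M M T = M"
 proof (rule measure_eqI)
  fix A assume "A \<in> sets (distr M M T)"
  hence A: "A \<in> sets M" by simp
  have "emeasure (distr M M T) A = (\<integral>\<^sup>+x. indicator A x \<partial>distr M M T)" using A by simp
  also have "... = (\<integral>\<^sup>+x. indicator A (T x) \<partial>M)" using A T by (intro nn_integral_distr) auto
  finally show "emeasure (distr M M T) A = emeasure M A" using assms(2)[OF A] A by simp
 qed simp
qed fact

lemma preserves_cong: "preserves M T ==> (!!x. x \<in> space M ==> S x = T x) ==> preserves M S"
 unfolding preserves_def by (metis distr_cong measurable_cong)

abbreviation lebs :: "'i set => ('i => real) measure" where
 "lebs I \<equiv> PiM I (\<lambda>_. lborel)"

text \<open>By Fubini the coordinate \<open>i\<close> is integrated while the others are frozen. By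
  \<open>hi\<close> the shift is then a constant, and the map is an affine isometry of the
  line.\<close>

lemma preserves_update:
 fixes h :: "('i => real) => real"
 assumes K: "finite K" "i \<in> K" and s: "\<bar>s\<bar> = 1"
  and h: "h \<in> borel_measurable (lebs K)" and hi: "!!x y. h (x(i := y)) = h x"
 shows "preserves (lebs K) (\<lambda>x. x(i := s*x i + h x))"
proof (rule preservesI)
 interpret L: product_sigma_finite "\<lambda>_::'i. lborel :: real measure"
  by (rule product_sigma_finite.intro) (rule sigma_finite_lborel)
 have [measurable]: "(\<lambda>x. x i) \<in> borel_measurable (lebs K)"
  using measurable_component_singleton[OF K(2), of "\<lambda>_. lborel :: real measure"] by simp
 note h[measurable]
 have T: "(\<lambda>x. x(i := s*x i + h x)) \<in> measurable (lebs K) (lebs K)"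
 proof (rule measurable_PiM_single')
  show "(\<lambda>x. x(i := s*x i + h x)) \<in> space (lebs K) \<rightarrow> (\<Pi>\<^sub>E i\<in>K. space lborel)"
   using K(2) by (auto simp: space_PiM PiE_iff extensional_def)
  fix j assume j: "j \<in> K"
  have "(\<lambda>x. if j = i then s*x i + h x else x j) \<in> borel_measurable (lebs K)"
   using measurable_component_singleton[OF j, of "\<lambda>_. lborel :: real measure"] by (cases "j = i") auto
  thus "(\<lambda>x. (x(i := s*x i + h x)) j) \<in> measurable (lebs K) lborel"
   by (simp add: fun_upd_def)
 qed
 thus "(\<lambda>x. x(i := s*x i + h x)) \<in> measurable (lebs K) (lebs K)" .
 fix A assume A: "A \<in> sets (lebs K)"
 define J where "J = K - {i}"
 have J: "finite J" "i \<notin> J" "K = insert i J" using K by (auto simp: J_def)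
 have f: "(\<lambda>x. indicator A x :: ennreal) \<in> borel_measurable (lebs (insert i J))" using A J by simp
 have fT: "(\<lambda>x. indicator A (x(i := s*x i + h x)) :: ennreal) \<in> borel_measurable (lebs (insert i J))"
  using measurable_compose[OF T, of "indicator A :: _ => ennreal" borel] A unfolding J(3)[symmetric] by simp
 have "(\<integral>\<^sup>+x. indicator A (x(i := s*x i + h x)) \<partial>lebs K)
   = (\<integral>\<^sup>+x. \<integral>\<^sup>+y. indicator A (x(i := h x + s*y)) \<partial>lborel \<partial>lebs J)"
  unfolding J(3) by (subst L.product_nn_integral_insert[OF J(1,2) fT]) (simp add: hi add.commute)
 also have "... = (\<integral>\<^sup>+x. \<integral>\<^sup>+y. indicator A (x(i := y)) \<partial>lborel \<partial>lebs J)"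
 proof (rule nn_integral_cong)
  fix x assume x: "x \<in> space (lebs J)"
  have "(\<lambda>y. indicator A (x(i := y)) :: ennreal) \<in> borel_measurable borel"
   using measurable_comp[OF measurable_component_update[OF x J(2)] f] by (simp add: comp_def)
  from nn_integral_real_affine[OF this, of s "h x"] s
  show "(\<integral>\<^sup>+y. indicator A (x(i := h x + s*y)) \<partial>lborel) = (\<integral>\<^sup>+y. indicator A (x(i := y)) \<partial>lborel)"
   by auto
 qed
 also have "... = (\<integral>\<^sup>+x. indicator A x \<partial>lebs K)"
  unfolding J(3) by (subst L.product_nn_integral_insert[OF J(1,2) f]) simp
 finally show "(\<integral>\<^sup>+x. indicator A (x(i := s*x i + h x)) \<partial>lebs K) = (\<integral>\<^sup>+x. indicator A x \<partial>lebs K)" .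
qed

text \<open>The shear is a composition of updates of single coordinates, each adding a multiple of
  the untouched coordinate \<open>i\<close>.\<close>

lemma preserves_shear:
 assumes K: "finite K" "i \<in> K" and S: "finite S" "S \<subseteq> K - {i}"
 shows "preserves (lebs K) (\<lambda>x. \<lambda>j\<in>K. if j \<in> S then x j + c j*x i else x j)"
 using S
proof (induction S rule: finite_induct)
 case empty
 show ?case by (rule preserves_cong[OF preserves_id]) (auto simp: space_PiM restrict_PiE_iff PiE_iff extensional_def)
next
 case (insert k S)
 hence k: "k \<in> K" "k ~= i" and S: "S \<subseteq> K - {i}" by auto
 have [measurable]: "(\<lambda>x. x i) \<in> borel_measurable (lebs K)"
  using measurable_component_singleton[OF K(2), of "\<lambda>_. lborel :: real measure"] by simp
 have "preserves (lebs K) (\<lambda>x. x(k := 1*x k + c k*x i))"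
  by (rule preserves_update[OF K(1) k(1)]) (use k in auto)
 from preserves_comp[OF this insert.IH[OF S]] show ?case
  by (rule preserves_cong) (use k K insert in \<open>auto simp: fun_eq_iff restrict_def\<close>)
qed

text \<open>Reflection in the hyperplane orthogonal to \<open>u\<close>. For \<open>u = 0\<close>
  the convention \<open>x / 0 = 0\<close> turns it into the identity on \<open>K\<close>, so every
  \<open>u\<close> is covered.\<close>

definition householder :: "'i set => ('i => real) => ('i => real) => 'i => real" where
 "householder K u x = (\<lambda>i\<in>K. x i - 2*(\<Sum>j\<in>K. u j*x j)/(\<Sum>j\<in>K. (u j)\<^sup>2)*u i)"

lemma householder_trivial:
 assumes "finite K" "(\<Sum>j\<in>K. (u j)\<^sup>2) = 0"
 shows "householder K u x = restrict x K"
 using assms by (auto simp: householder_def fun_eq_iff restrict_def)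

lemma householder_norm:
 assumes "finite K"
 shows "(\<Sum>j\<in>K. (householder K u x j)\<^sup>2) = (\<Sum>j\<in>K. (x j)\<^sup>2)"
proof (cases "(\<Sum>j\<in>K. (u j)\<^sup>2) = 0")
 case True
 thus ?thesis using assms by (simp add: householder_trivial)
next
 case False
 define D s where "D = (\<Sum>j\<in>K. (u j)\<^sup>2)" and "s = (\<Sum>j\<in>K. u j*x j)"
 have "(\<Sum>j\<in>K. (householder K u x j)\<^sup>2) = (\<Sum>j\<in>K. (x j)\<^sup>2 - (4 * s/D)*(u j*x j) + (2 * s/D)^2*(u j)^2)"
 proof (intro sum.cong refl)
  fix j assume "j \<in> K"
  hence *: "householder K u x j = x j - 2 * s/D*u j" by (simp add: householder_def D_def s_def)
  show "(householder K u x j)^2 = (x j)^2 - (4 * s/D)*(u j*x j) + (2 * s/D)^2*(u j)^2"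
   unfolding*by (simp add: power2_eq_square algebra_simps)
 qed
 also have "... = (\<Sum>j\<in>K. (x j)\<^sup>2) - (4 * s/D) * s + (2 * s/D)^2*D"
  unfolding sum.distrib sum_subtractf sum_distrib_left[symmetric] by (simp only: D_def[symmetric] s_def[symmetric])
 also have "... = (\<Sum>j\<in>K. (x j)\<^sup>2)" using False by (simp add: D_def[symmetric] power2_eq_square field_simps)
 finally show ?thesis .
qed

text \<open>A coordinate \<open>i\<close> with \<open>u i ~= 0\<close> serves as pivot. The shear
  \<open>?A (-1)\<close> passes to coordinates that are constant along \<open>u\<close>, except for
  the \<open>i\<close>-th. In these the reflection changes only coordinate \<open>i\<close>, by a
  sign and a shift, and the inverse shear \<open>?A 1\<close> returns. No determinant or change of
  variables is involved.\<close>

lemma preserves_householder_lebs: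
 assumes K: "finite K"
 shows "preserves (lebs K) (householder K u)"
proof (cases "(\<Sum>j\<in>K. (u j)\<^sup>2) = 0")
 case True
 show ?thesis
  by (rule preserves_cong[OF preserves_id]) (simp only: householder_trivial[OF K True] space_PiM PiE_restrict)
next
 case False
 have "\<exists>i\<in>K. u i ~= 0"
 proof (rule ccontr)
  assume "\<not> ?thesis"
  hence "(\<Sum>j\<in>K. (u j)\<^sup>2) = 0" by (intro sum.neutral) auto
  thus False using False by simp
 qed
 then obtain i where i: "i \<in> K" "u i ~= 0" by blast
 define D where "D = (\<Sum>j\<in>K. (u j)\<^sup>2)"
 have D: "D > 0" using False by (simp add: D_def sum_nonneg order_less_le)
 let ?A = "\<lambda>t x. \<lambda>j\<in>K. if j \<in> K - {i} then x j + (t*u j/u i)*x i else x j"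
 let ?h = "\<lambda>x. - 2*u i/D*(\<Sum>j\<in>K - {i}. u j*x j)"
 let ?F = "\<lambda>x. x(i := (-1)*x i + ?h x)"
 have hm: "?h \<in> borel_measurable (lebs K)"
  using measurable_component_singleton[of _ K "\<lambda>_. lborel :: real measure"]
  by (intro borel_measurable_times borel_measurable_sum borel_measurable_const) auto
 have F: "preserves (lebs K) ?F"
  by (rule preserves_update[OF K i(1) _ hm]) auto
 have A: "preserves (lebs K) (?A t)" for t
  using preserves_shear[OF K i(1), of "K - {i}" "\<lambda>j. t*u j/u i"] K by simp
 have "householder K u x = ?A 1 (?F (?A (-1) x))" for x
 proof
  fix j
  define s where "s = (\<Sum>j\<in>K - {i}. u j*x j)"
  have sK: "(\<Sum>j\<in>K. u j*x j) = u i*x i + s" unfolding s_def by (rule sum.remove[OF K i(1)])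
  have DK: "(\<Sum>j\<in>K - {i}. (u j)\<^sup>2) = D - (u i)\<^sup>2" unfolding D_def using sum.remove[OF K i(1), of "\<lambda>j. (u j)\<^sup>2"] by simp
  have "(\<Sum>j\<in>K - {i}. u j * ?A (-1) x j) = (\<Sum>j\<in>K - {i}. u j*x j - (x i/u i)*(u j)^2)"
   by (intro sum.cong refl) (simp add: algebra_simps power2_eq_square)
  also have "... = s - (x i/u i)*(D - (u i)\<^sup>2)"
   unfolding sum_subtractf sum_distrib_left[symmetric] by (simp only: s_def DK)
  finally have "?h (?A (-1) x) = - 2*u i/D*(s - (x i/u i)*(D - (u i)\<^sup>2))" by simp
  also have "... = 2*x i - 2*u i/D*(u i*x i + s)"
   using i D by (simp add: field_simps power2_eq_square)
  finally have h: "?F (?A (-1) x) i = x i - 2*u i/D*(u i*x i + s)"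
   using i by simp
  show "householder K u x j = ?A 1 (?F (?A (-1) x)) j"
  proof (cases "j \<in> K \<and> j ~= i")
   case True
   hence "?A 1 (?F (?A (-1) x)) j = x j - (u j/u i)*x i + (u j/u i)*(x i - 2*u i/D*(u i*x i + s))"
    unfolding h[symmetric] by simp
   also have "... = x j - 2*(u i*x i + s)/D*u j" using i D by (simp add: field_simps)
   finally show ?thesis using True by (simp add: householder_def sK D_def[symmetric])
  next
   case False
   then consider "j \<notin> K" | "j = i" by blast
   thus ?thesis
   proof cases
    case 2
    hence "?A 1 (?F (?A (-1) x)) j = ?F (?A (-1) x) i" using i by simp
    thus ?thesis unfolding h using 2 i by (simp add: householder_def sK D_def[symmetric])
   qed (simp add: householder_def)
  qed
 qed
 thus ?thesis using preserves_comp[OF A preserves_comp[OF F A]] by (auto intro: preserves_cong)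
qed

lemma preserves_householder_gauss:
 assumes K: "finite K"
 shows "preserves (gauss K) (householder K u)"
proof (rule preservesI)
 let ?g = "\<lambda>x. ennreal ((1 / sqrt (2*pi)) ^ card K*exp (- (\<Sum>i\<in>K. (x i)\<^sup>2)/2))"
 have L: "preserves (lebs K) (householder K u)" by (rule preserves_householder_lebs[OF K])
 have [measurable]: "(\<lambda>x. x i) \<in> borel_measurable (lebs K)" if "i \<in> K" for i
  using measurable_component_singleton[OF that, of "\<lambda>_. lborel :: real measure"] by simp
 have gm: "?g \<in> borel_measurable (lebs K)" by measurable
 have sL: "sets (lebs K) = sets (gauss K)" by (simp add: gauss_density[OF K])
 have Rm: "householder K u \<in> measurable (lebs K) (lebs K)" using L by (simp add: preserves_def)
 thus "householder K u \<in> measurable (gauss K) (gauss K)" using sL by (simp cong: measurable_cong_sets)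
 fix A assume "A \<in> sets (gauss K)"
 hence A: "A \<in> sets (lebs K)" using sL by simp
 have iR: "(\<lambda>x. indicator A (householder K u x) :: ennreal) \<in> borel_measurable (lebs K)"
  using measurable_compose[OF Rm, of "indicator A" borel] A by simp
 have "(\<integral>\<^sup>+x. indicator A (householder K u x) \<partial>gauss K) = (\<integral>\<^sup>+x. ?g x*indicator A (householder K u x) \<partial>lebs K)"
  unfolding gauss_density[OF K] by (rule nn_integral_density[OF gm iR])
 also have "... = (\<integral>\<^sup>+x. ?g (householder K u x)*indicator A (householder K u x) \<partial>lebs K)"
  by (simp add: householder_norm[OF K])
 also have "... = (\<integral>\<^sup>+x. ?g x*indicator A x \<partial>lebs K)"
  by (rule preserves_nn_integral[OF L]) (use A gm in measurable)
 also have "... = (\<integral>\<^sup>+x. indicator A x \<partial>gauss K)"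
  unfolding gauss_density[OF K] by (rule nn_integral_density[OF gm, symmetric]) (use A in simp)
 finally show "(\<integral>\<^sup>+x. indicator A (householder K u x) \<partial>gauss K) = (\<integral>\<^sup>+x. indicator A x \<partial>gauss K)" .
qed

text \<open>The chi law with \<open>card R\<close> degrees of freedom, kept as an image of the
  Gaussian on the block itself so that the elimination of a block can name the entries it
  replaces.\<close>

definition chi :: "'i set => real measure" where
 "chi R = distr (gauss R) borel (\<lambda>x. sqrt (\<Sum>i\<in>R. (x i)\<^sup>2))"

abbreviation point0 :: "real measure" where "point0 \<equiv> return borel 0"

lemma measurable_sqnorm: "(\<lambda>x. sqrt (\<Sum>i\<in>R. (x i)\<^sup>2)) \<in> borel_measurable (gauss R)"
proof -
 note measurable_gauss_component[measurable]
 show ?thesis by measurable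
qed

lemma sets_chi [simp, measurable_cong]: "sets (chi R) = sets borel"
 and space_chi [simp]: "space (chi R) = UNIV"
 by (simp_all add: chi_def)

lemma prob_space_chi [simp]: "prob_space (chi R)"
 unfolding chi_def by (rule prob_space.prob_space_distr[OF prob_space_gauss measurable_sqnorm])

lemma prob_space_point0 [simp]: "prob_space point0"
 by (rule prob_space_return) simp

text \<open>
 Simultaneous reflection of the columns \<open>{i \<in> I. rw i \<in> R \<and> cl i = c}\<close> of an array
 indexed by \<open>I\<close>.
\<close>

definition act :: "'i set => ('i => 'a) => ('i => 'b) => 'a set => 'b set => ('a => real) => ('i => real) => 'i => real" where
 "act I rw cl R S u \<xi> = (\<lambda>i\<in>I. if rw i \<in> R \<and> cl i \<in> S
   then householder {k\<in>I. rw k \<in> R \<and> cl k = cl i} (\<lambda>k. u (rw k)) \<xi> i else \<xi> i)"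

lemma measurable_householder_gen:
 assumes "!!i. i \<in> K ==> (\<lambda>x. f x i) \<in> borel_measurable M" "i \<in> K"
 shows "(\<lambda>x. householder K u (f x) i) \<in> borel_measurable M"
 using assms by (simp add: householder_def)

locale prob_array =
 fixes I :: "'i set" and \<mu> :: "'i => real measure"
 assumes finI: "finite I" and prob\<mu>: "!!i. prob_space (\<mu> i)" and sets\<mu>: "!!i. sets (\<mu> i) = sets borel"
begin

sublocale product_prob_space \<mu>
 by (intro product_prob_space.intro product_sigma_finite.intro product_prob_space_axioms.intro
   prob\<mu> prob_space_imp_sigma_finite)

lemma sets_PiM_borel: "sets (PiM J \<mu>) = sets (PiM J (\<lambda>_. borel))"
 by (rule sets_PiM_cong) (simp_all add: sets\<mu>)

lemma space_PiM_borel: "space (PiM J \<mu>) = (\<Pi>\<^sub>E i\<in>J. UNIV)"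
 using sets_eq_imp_space_eq[OF sets\<mu>] by (simp add: space_PiM)

lemma meas_comp: "i \<in> J ==> (\<lambda>x. x i) \<in> borel_measurable (PiM J \<mu>)"
 using measurable_component_singleton[of i J \<mu>] sets\<mu>[of i] by (simp cong: measurable_cong_sets)

lemma preserves_block:
 assumes C: "C \<subseteq> I" and T: "preserves (PiM C \<mu>) T"
 shows "preserves (PiM I \<mu>) (\<lambda>\<xi>. merge C (I - C) (T (restrict \<xi> C), restrict \<xi> (I - C)))"
proof -
 have fin: "finite C" "finite (I - C)" "C \<inter> (I - C) = {}" "C \<union> (I - C) = I"
  using C finI finite_subset by auto
 have Tm: "T \<in> measurable (PiM C \<mu>) (PiM C \<mu>)" using T by (simp add: preserves_def)
 have m: "(\<lambda>\<xi>. merge C (I - C) (T (restrict \<xi> C), restrict \<xi> (I - C))) \<in> measurable (PiM I \<mu>) (PiM I \<mu>)"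
 proof -
  have "(\<lambda>\<xi>. (T (restrict \<xi> C), restrict \<xi> (I - C))) \<in> measurable (PiM I \<mu>) (PiM C \<mu> \<Otimes>\<^sub>M PiM (I - C) \<mu>)"
   by (intro measurable_Pair measurable_compose[OF measurable_restrict_subset Tm] measurable_restrict_subset)
    (use C in auto)
  from measurable_comp[OF this measurable_merge] show ?thesis using fin(4) by (simp add: comp_def)
 qed
 show ?thesis
 proof (rule preservesI[OF m])
  fix A assume A: "A \<in> sets (PiM I \<mu>)"
  let ?f = "indicator A :: _ => ennreal"
  let ?T = "\<lambda>\<xi>. merge C (I - C) (T (restrict \<xi> C), restrict \<xi> (I - C))"
  have f: "?f \<in> borel_measurable (PiM (C \<union> (I - C)) \<mu>)" using A fin by simp
  have fT: "(\<lambda>\<xi>. ?f (?T \<xi>)) \<in> borel_measurable (PiM (C \<union> (I - C)) \<mu>)"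
   using measurable_compose[OF m, of ?f borel] A fin(4) by simp
  have "(\<integral>\<^sup>+x. ?f (?T x) \<partial>PiM I \<mu>) = (\<integral>\<^sup>+x. \<integral>\<^sup>+y. ?f (?T (merge C (I - C) (x, y))) \<partial>PiM (I - C) \<mu> \<partial>PiM C \<mu>)"
   using product_nn_integral_fold[OF fin(3,1,2) fT] fin(4) by simp
  also have "... = (\<integral>\<^sup>+x. \<integral>\<^sup>+y. ?f (merge C (I - C) (T x, y)) \<partial>PiM (I - C) \<mu> \<partial>PiM C \<mu>)"
  proof (intro nn_integral_cong)
   fix x y assume "x \<in> space (PiM C \<mu>)" "y \<in> space (PiM (I - C) \<mu>)"
   hence "restrict (merge C (I - C) (x, y)) C = x" "restrict (merge C (I - C) (x, y)) (I - C) = y"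
    by (auto simp: space_PiM PiE_iff extensional_restrict)
   thus "?f (?T (merge C (I - C) (x, y))) = ?f (merge C (I - C) (T x, y))" by simp
  qed
  also have "... = (\<integral>\<^sup>+x. \<integral>\<^sup>+y. ?f (merge C (I - C) (x, y)) \<partial>PiM (I - C) \<mu> \<partial>PiM C \<mu>)"
  proof -
   interpret R: finite_product_sigma_finite \<mu> "I - C" by standard (rule fin(2))
   have "(\<lambda>z. ?f (merge C (I - C) z)) \<in> borel_measurable (PiM C \<mu> \<Otimes>\<^sub>M PiM (I - C) \<mu>)"
    using measurable_comp[OF measurable_merge f] by (simp add: comp_def)
   hence "(\<lambda>x. \<integral>\<^sup>+y. ?f (merge C (I - C) (x, y)) \<partial>PiM (I - C) \<mu>) \<in> borel_measurable (PiM C \<mu>)"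
    by (intro R.borel_measurable_nn_integral) (simp add: case_prod_unfold)
   from preserves_nn_integral[OF T this] show ?thesis .
  qed
  also have "... = (\<integral>\<^sup>+x. ?f x \<partial>PiM I \<mu>)"
   using product_nn_integral_fold[OF fin(3,1,2) f] fin(4) by simp
  finally show "(\<integral>\<^sup>+x. ?f (?T x) \<partial>PiM I \<mu>) = (\<integral>\<^sup>+x. ?f x \<partial>PiM I \<mu>)" .
 qed
qed

lemma AE_point0:
 assumes "i \<in> J" "\<mu> i = point0"
 shows "AE \<xi> in PiM J \<mu>. \<xi> i = 0"
proof -
 have "AE x in point0. x = 0" by (subst AE_return) auto
 hence "AE x in \<mu> i. x = 0" by (simp only: assms(2))
 from AE_PiM_component[of J \<mu> i "\<lambda>x. x = 0", OF _ assms(1) this] prob\<mu> show ?thesis by blast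
qed

lemma act_apply:
 "i \<in> I ==> act I rw cl R S u \<xi> i = (if rw i \<in> R \<and> cl i \<in> S
   then householder {k\<in>I. rw k \<in> R \<and> cl k = cl i} (\<lambda>k. u (rw k)) \<xi> i else \<xi> i)"
 by (simp add: act_def)

lemma act_outside: "i \<notin> I ==> act I rw cl R S u \<xi> i = undefined"
 by (simp add: act_def)

lemma householder_cong: "(!!k. k \<in> K ==> \<xi>' k = \<xi> k) ==> householder K v \<xi>' = householder K v \<xi>"
 unfolding householder_def by (intro restrict_ext arg_cong2[where f = minus] arg_cong2[where f = times]
   arg_cong2[where f = divide] sum.cong) auto

lemma act_insert:
 assumes "c \<notin> S"
 shows "act I rw cl R (insert c S) u \<xi> = act I rw cl R {c} u (act I rw cl R S u \<xi>)"
proof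
 fix i
 have *: "householder {k \<in> I. rw k \<in> R \<and> cl k = c} v (act I rw cl R S u \<xi>) = householder {k \<in> I. rw k \<in> R \<and> cl k = c} v \<xi>" for v
  by (rule householder_cong) (use assms in \<open>auto simp: act_apply\<close>)
 show "act I rw cl R (insert c S) u \<xi> i = act I rw cl R {c} u (act I rw cl R S u \<xi>) i"
 proof (cases "i \<in> I")
  case True
  show ?thesis
  proof (cases "rw i \<in> R \<and> cl i = c")
   case True
   thus ?thesis using*\<open>i \<in> I\<close> by (simp add: act_apply)
  next
   case False
   thus ?thesis using \<open>i \<in> I\<close> by (auto simp: act_apply)
  qed
 qed (simp add: act_outside)
qed

text \<open>A column of standard normals is rotation invariant, and a column of point masses at 0 is
  almost surely fixed by a linear map. Mixed columns are excluded; the order of elimination keeps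
  them from occurring.\<close>

lemma preserves_act_single:
 assumes c: "(\<forall>i\<in>I. rw i \<in> R \<and> cl i = c --> \<mu> i = std_gauss) \<or> (\<forall>i\<in>I. rw i \<in> R \<and> cl i = c --> \<mu> i = point0)"
 shows "preserves (PiM I \<mu>) (act I rw cl R {c} u)"
 using c
proof
 assume g: "\<forall>i\<in>I. rw i \<in> R \<and> cl i = c --> \<mu> i = std_gauss"
 let ?C = "{k\<in>I. rw k \<in> R \<and> cl k = c}"
 have "PiM ?C \<mu> = gauss ?C" unfolding gauss_def by (rule PiM_cong) (use g in auto)
 hence "preserves (PiM ?C \<mu>) (householder ?C (\<lambda>k. u (rw k)))"
  using preserves_householder_gauss[of ?C "\<lambda>k. u (rw k)"] finI by simp
 from preserves_block[OF _ this] show ?thesis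
 proof (rule preserves_cong)
  fix \<xi> assume "\<xi> \<in> space (PiM I \<mu>)"
  have "householder ?C (\<lambda>k. u (rw k)) (restrict \<xi> ?C) = householder ?C (\<lambda>k. u (rw k)) \<xi>"
   by (auto simp: householder_def fun_eq_iff restrict_def intro!: sum.cong)
  thus "act I rw cl R {c} u \<xi> = merge ?C (I - ?C) (householder ?C (\<lambda>k. u (rw k)) (restrict \<xi> ?C), restrict \<xi> (I - ?C))"
   by (auto simp: act_def merge_def fun_eq_iff restrict_def)
 qed auto
next
 assume g: "\<forall>i\<in>I. rw i \<in> R \<and> cl i = c --> \<mu> i = point0"
 let ?C = "{k\<in>I. rw k \<in> R \<and> cl k = c}"
 have m: "act I rw cl R {c} u \<in> measurable (PiM I \<mu>) (PiM I \<mu>)"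
 proof (rule measurable_PiM_single')
  show "act I rw cl R {c} u \<in> space (PiM I \<mu>) \<rightarrow> (\<Pi>\<^sub>E i\<in>I. space (\<mu> i))"
   using sets_eq_imp_space_eq[OF sets\<mu>] by (auto simp: act_def)
  fix i assume i: "i \<in> I"
  have "(\<lambda>\<xi>. act I rw cl R {c} u \<xi> i) \<in> borel_measurable (PiM I \<mu>)"
  proof (cases "rw i \<in> R \<and> cl i = c")
   case True
   hence "(\<lambda>\<xi>. householder ?C (\<lambda>k. u (rw k)) \<xi> i) \<in> borel_measurable (PiM I \<mu>)"
    by (intro measurable_householder_gen meas_comp) (use i in auto)
   thus ?thesis using i True by (simp add: act_apply)
  next
   case False
   thus ?thesis using i meas_comp[OF i] by (simp add: act_apply del: de_Morgan_conj)
  qed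
  thus "(\<lambda>\<xi>. act I rw cl R {c} u \<xi> i) \<in> measurable (PiM I \<mu>) (\<mu> i)"
   using sets\<mu>[of i] by (simp cong: measurable_cong_sets)
 qed
 have "AE \<xi> in PiM I \<mu>. \<forall>i\<in>?C. \<xi> i = 0"
  using finI g AE_point0[of _ I] by (intro AE_finite_allI) auto
 moreover have "AE \<xi> in PiM I \<mu>. \<xi> \<in> space (PiM I \<mu>)" by (rule AE_space)
 ultimately have ae: "AE \<xi> in PiM I \<mu>. act I rw cl R {c} u \<xi> = \<xi>"
 proof eventually_elim
  case (elim \<xi>)
  hence "\<xi> \<in> extensional I" by (auto simp: space_PiM PiE_def)
  moreover have "(\<Sum>j\<in>?C. u (rw j)*\<xi> j) = 0" by (rule sum.neutral) (use elim in auto)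
  ultimately show ?case using elim by (auto simp: act_def householder_def fun_eq_iff extensional_def restrict_def)
 qed
 show ?thesis
 proof (rule preservesI[OF m])
  fix A assume A: "A \<in> sets (PiM I \<mu>)"
  show "(\<integral>\<^sup>+x. indicator A (act I rw cl R {c} u x) \<partial>PiM I \<mu>) = (\<integral>\<^sup>+x. indicator A x \<partial>PiM I \<mu>)"
   by (rule nn_integral_cong_AE) (use ae in \<open>auto elim!: eventually_mono\<close>)
 qed
qed

lemma preserves_act:
 assumes S: "finite S"
  and c: "!!c. c \<in> S ==> (\<forall>i\<in>I. rw i \<in> R \<and> cl i = c --> \<mu> i = std_gauss) \<or> (\<forall>i\<in>I. rw i \<in> R \<and> cl i = c --> \<mu> i = point0)"
 shows "preserves (PiM I \<mu>) (act I rw cl R S u)"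
 using S c
proof (induction S rule: finite_induct)
 case empty
 show ?case by (rule preserves_cong[OF preserves_id]) (auto simp: act_def space_PiM PiE_iff extensional_restrict)
next
 case (insert c S)
 have "preserves (PiM I \<mu>) (\<lambda>\<xi>. act I rw cl R {c} u (act I rw cl R S u \<xi>))"
  by (rule preserves_comp[OF preserves_act_single insert.IH]) (use insert in auto)
 thus ?case by (rule preserves_cong) (rule act_insert[OF insert(2)])
qed

end

subsection \<open>Concentration for product measures\<close>

text \<open>
 One-dimensional laws whose symmetrisation has a bounded exponential moment.  Both the norm of a
 standard Gaussian vector and the point mass at \<open>0\<close> belong here, uniformly in the dimension.
\<close>

definition tame :: "real measure => bool" where
 "tame M \<longleftrightarrow> prob_space M \<and> sets M = sets borel \<and>
   (\<integral>\<^sup>+x. \<integral>\<^sup>+y. ennreal (exp (\<bar>x - y\<bar>/4)) \<partial>M \<partial>M) <= 9"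

text \<open>Termwise comparison of power series: s^(2m) is at most s^2 for m at least 1. An
  exponential moment at one fixed scale thereby becomes a quadratic bound at all smaller
  scales.\<close>

lemma cosh_le_interpolate:
 fixes x s :: real
 assumes "\<bar>s\<bar> <= 1"
 shows "cosh (s*x) <= 1 + s^2*(cosh x - 1)"
proof -
 have 1: "(\<lambda>n. if even n then y ^ n /\<^sub>R fact n else 0) sums cosh y" for y :: real
  by (rule cosh_converges)
 have "(\<lambda>n. if n = 0 then 1 else (0::real)) sums 1" using sums_single[of 0 "\<lambda>_. 1::real"] by simp
 hence "(\<lambda>n. (if n = 0 then 1 else 0) + s^2*((if even n then x ^ n /\<^sub>R fact n else 0) - (if n = 0 then 1 else 0)))
  sums (1 + s^2*(cosh x - 1))"
  by (intro sums_add sums_mult sums_diff 1)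
 moreover have "(if even n then (s*x) ^ n /\<^sub>R fact n else 0)
   <= (if n = 0 then 1 else 0) + s^2*((if even n then x ^ n /\<^sub>R fact n else 0) - (if n = 0 then 1 else 0))" for n
 proof (cases "n = 0 \<or> odd n")
  case False
  hence n: "even n" "n \<ge> 2" by auto
  then obtain m where m: "n = 2*m" "m \<ge> 1" by (auto elim!: evenE)
  have "(s^2) ^ m <= (s^2) ^ 1"
   by (rule power_decreasing) (use m assms in \<open>auto simp: abs_square_le_1\<close>)
  hence "s ^ n <= s^2" by (simp add: m power_mult)
  moreover have "0 <= x ^ n/fact n" using n by (simp add: zero_le_even_power)
  ultimately have "s ^ n*(x ^ n/fact n) <= s^2*(x ^ n/fact n)" by (rule mult_right_mono)
  thus ?thesis using n by (simp add: power_mult_distrib divide_inverse mult_ac)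
 qed auto
 ultimately show ?thesis by (rule sums_le[OF _ 1, rotated])
qed

text \<open>Interpolation with weight c = (4s)^2 between the value 1 and the double integral, at
  most 9, gives 1 - c + 9c = 1 + 8c, at most exp(8c) = exp(128 s^2).\<close>

lemma tame_cosh:
 assumes M: "tame M" and s: "\<bar>s\<bar> <= 1/4"
 shows "(\<integral>\<^sup>+x. \<integral>\<^sup>+y. ennreal (cosh (s*\<bar>x - y\<bar>)) \<partial>M \<partial>M) <= ennreal (exp (128 * s^2))"
proof -
 interpret prob_space M using M by (simp add: tame_def)
 have sM: "sets M = sets borel" and bd: "(\<integral>\<^sup>+x. \<integral>\<^sup>+y. ennreal (exp (\<bar>x - y\<bar>/4)) \<partial>M \<partial>M) <= 9"
  using M by (auto simp: tame_def)
 have [measurable_cong]: "sets M = sets borel" by (rule sM)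
 define c where "c = (4 * s)^2"
 have c: "0 <= c" "c <= 1" using s abs_square_le_1[of "4 * s"] by (auto simp: c_def abs_mult)
 have pt: "ennreal (cosh (s*\<bar>x - y\<bar>)) <= ennreal (1 - c) + ennreal c*ennreal (exp (\<bar>x - y\<bar>/4))" for x y
 proof -
  have "cosh (s*\<bar>x - y\<bar>) = cosh ((4 * s)*(\<bar>x - y\<bar>/4))" by simp
  also have "... <= 1 + c*(cosh (\<bar>x - y\<bar>/4) - 1)" unfolding c_def by (rule cosh_le_interpolate) (use s in auto)
  also have "... <= 1 + c*(exp (\<bar>x - y\<bar>/4) - 1)"
   using c by (intro add_left_mono mult_left_mono) (auto simp: cosh_def)
  also have "... = (1 - c) + c*exp (\<bar>x - y\<bar>/4)" by (simp add: algebra_simps)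
  finally show ?thesis using c by (simp flip: ennreal_mult ennreal_plus add: ennreal_leI)
 qed
 have "(\<integral>\<^sup>+x. \<integral>\<^sup>+y. ennreal (cosh (s*\<bar>x - y\<bar>)) \<partial>M \<partial>M)
   <= (\<integral>\<^sup>+x. \<integral>\<^sup>+y. ennreal (1 - c) + ennreal c*ennreal (exp (\<bar>x - y\<bar>/4)) \<partial>M \<partial>M)"
  by (intro nn_integral_mono pt)
 also have "... = ennreal (1 - c) + ennreal c*(\<integral>\<^sup>+x. \<integral>\<^sup>+y. ennreal (exp (\<bar>x - y\<bar>/4)) \<partial>M \<partial>M)"
  by (simp add: nn_integral_add nn_integral_cmult emeasure_space_1)
 also have "... <= ennreal (1 - c) + ennreal c*ennreal 9" using bd by (intro add_left_mono mult_left_mono) auto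
 also have "... = ennreal ((1 - c) + c*9)"
  using c by (subst ennreal_mult[symmetric], simp, simp, subst ennreal_plus[symmetric]) auto
 also have "... = ennreal (1 + 8*c)" by (simp add: algebra_simps)
 also have "... <= ennreal (exp (8*c))" by (intro ennreal_leI) (rule exp_ge_add_one_self)
 finally show ?thesis by (simp add: c_def power_mult_distrib)
qed

text \<open>The product of the two integrals is the double integral of P x / P y. Symmetrising in x
  and y produces 2 cosh(ln P x - ln P y), and \<open>Plip\<close> says that ln P is Lipschitz with
  constant \<open>s\<close>.\<close>

lemma tame_product_exp:
 assumes M: "tame M" and P: "P \<in> borel_measurable borel" and Ppos: "!!x. 0 < P x"
  and Plip: "!!x y. P x <= exp (s*\<bar>x - y\<bar>)*P y" and s: "0 <= s" "s <= 1/4"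
 shows "(\<integral>\<^sup>+x. ennreal (P x) \<partial>M)*(\<integral>\<^sup>+y. ennreal (1/P y) \<partial>M) <= ennreal (exp (128 * s^2))"
proof -
 interpret prob_space M using M by (simp add: tame_def)
 have [measurable_cong]: "sets M = sets borel" using M by (simp add: tame_def)
 note P[measurable]
 have pt: "P x/P y + P y/P x <= 2*cosh (s*\<bar>x - y\<bar>)" for x y
 proof -
  define d where "d = ln (P x/P y)"
  have e: "exp d = P x/P y" "exp (-d) = P y/P x" using Ppos by (auto simp: d_def exp_minus)
  have "exp d <= exp (s*\<bar>x - y\<bar>)" "exp (-d) <= exp (s*\<bar>x - y\<bar>)"
   unfolding e using Plip[of x y] Plip[of y x] Ppos[of x] Ppos[of y] by (auto simp: divide_le_eq abs_minus_commute)
  hence "\<bar>d\<bar> <= s*\<bar>x - y\<bar>" by auto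
  hence "cosh \<bar>d\<bar> <= cosh (s*\<bar>x - y\<bar>)" by (subst cosh_real_nonneg_le_iff) auto
  hence "cosh d <= cosh (s*\<bar>x - y\<bar>)" by simp
  thus ?thesis using e by (simp add: cosh_def)
 qed
 let ?A = "(\<integral>\<^sup>+x. ennreal (P x) \<partial>M)*(\<integral>\<^sup>+y. ennreal (1/P y) \<partial>M)"
 have 1: "?A = (\<integral>\<^sup>+x. \<integral>\<^sup>+y. ennreal (P x/P y) \<partial>M \<partial>M)"
 proof -
  have "(\<integral>\<^sup>+y. ennreal (P x/P y) \<partial>M) = ennreal (P x)*(\<integral>\<^sup>+y. ennreal (1/P y) \<partial>M)" for x
   using Ppos by (subst nn_integral_cmult[symmetric]) (auto simp: ennreal_mult[symmetric] less_imp_le)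
  thus ?thesis by (simp add: nn_integral_multc)
 qed
 have 2: "?A = (\<integral>\<^sup>+x. \<integral>\<^sup>+y. ennreal (P y/P x) \<partial>M \<partial>M)"
 proof -
  have "(\<integral>\<^sup>+y. ennreal (P y/P x) \<partial>M) = (\<integral>\<^sup>+y. ennreal (P y) \<partial>M)*ennreal (1/P x)" for x
   using Ppos by (subst nn_integral_multc[symmetric]) (auto simp: ennreal_mult[symmetric] less_imp_le)
  thus ?thesis by (simp add: nn_integral_cmult)
 qed
 have "?A + ?A = (\<integral>\<^sup>+x. \<integral>\<^sup>+y. ennreal (P x/P y) + ennreal (P y/P x) \<partial>M \<partial>M)"
  by (subst (1) 1, subst 2) (simp add: nn_integral_add)
 also have "... <= (\<integral>\<^sup>+x. \<integral>\<^sup>+y. 2*ennreal (cosh (s*\<bar>x - y\<bar>)) \<partial>M \<partial>M)"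
 proof (intro nn_integral_mono)
  fix x y
  show "ennreal (P x/P y) + ennreal (P y/P x) <= 2*ennreal (cosh (s*\<bar>x - y\<bar>))"
   using ennreal_leI[OF pt[of x y]] Ppos[of x] Ppos[of y] by (simp add: ennreal_plus[symmetric] ennreal_mult less_imp_le del: ennreal_plus)
 qed
 also have "... = 2*(\<integral>\<^sup>+x. \<integral>\<^sup>+y. ennreal (cosh (s*\<bar>x - y\<bar>)) \<partial>M \<partial>M)"
 proof -
  have "(\<integral>\<^sup>+y. 2*ennreal (cosh (s*\<bar>x - y\<bar>)) \<partial>M) = 2*(\<integral>\<^sup>+y. ennreal (cosh (s*\<bar>x - y\<bar>)) \<partial>M)" for x
   unfolding cosh_field_def by (rule nn_integral_cmult) measurable
  moreover have "(\<integral>\<^sup>+x. 2*(\<integral>\<^sup>+y. ennreal (cosh (s*\<bar>x - y\<bar>)) \<partial>M) \<partial>M) = 2*(\<integral>\<^sup>+x. \<integral>\<^sup>+y. ennreal (cosh (s*\<bar>x - y\<bar>)) \<partial>M \<partial>M)"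
   unfolding cosh_field_def by (rule nn_integral_cmult) measurable
  ultimately show ?thesis by simp
 qed
 also have "... <= 2*ennreal (exp (128 * s^2))" by (intro mult_left_mono tame_cosh[OF M]) (use s in auto)
 finally have "2 * ?A <= 2*ennreal (exp (128 * s^2))" by (simp add: mult_2)
 thus ?thesis by (simp add: ennreal_mult_le_mult_iff)
qed

text \<open>
 Stating the bound for the product of the two Laplace transforms makes it stable under
 integrating out one coordinate at a time.
\<close>

lemma tame_product_Laplace:
 fixes g :: "('i => real) => real"
 assumes I: "finite I" and \<mu>: "!!i. i \<in> I ==> tame (\<mu> i)"
  and g: "g \<in> borel_measurable (PiM I \<mu>)" and c: "!!i. i \<in> I ==> 0 <= c i \<and> c i <= 1/4"
  and lip: "!!x y. x \<in> space (PiM I \<mu>) ==> y \<in> space (PiM I \<mu>) ==> g x - g y <= (\<Sum>i\<in>I. c i*\<bar>x i - y i\<bar>)"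
 shows "(\<integral>\<^sup>+x. ennreal (exp (g x)) \<partial>PiM I \<mu>)*(\<integral>\<^sup>+x. ennreal (exp (- g x)) \<partial>PiM I \<mu>)
   <= ennreal (exp (128*(\<Sum>i\<in>I. (c i)\<^sup>2)))"
 using I \<mu> g c lip
proof (induction I arbitrary: g rule: finite_induct)
 case empty
 show ?case by (simp add: PiM_empty nn_integral_count_space_finite ennreal_mult[symmetric] exp_minus)
next
 case (insert i I)
 define \<mu>' where "\<mu>' j = (if j \<in> insert i I then \<mu> j else return borel 0)" for j
 have sets': "sets (\<mu>' j) = sets borel" for j using insert.prems(1) by (auto simp: \<mu>'_def tame_def)
 have space': "space (\<mu>' j) = UNIV" for j using sets_eq_imp_space_eq[OF sets'[of j]] by simp
 have prob': "prob_space (\<mu>' j)" for j using insert.prems(1) by (auto simp: \<mu>'_def tame_def intro: prob_space_return)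
 interpret P: product_sigma_finite \<mu>' by (rule product_sigma_finite.intro) (rule prob_space_imp_sigma_finite[OF prob'])
 have eq: "PiM (insert i I) \<mu> = PiM (insert i I) \<mu>'" "PiM I \<mu> = PiM I \<mu>'" by (auto intro!: PiM_cong simp: \<mu>'_def)
 have sp: "space (PiM J \<mu>') = (\<Pi>\<^sub>E j\<in>J. UNIV)" for J by (simp add: space_PiM space')
 note g = insert.prems(2)[unfolded eq]
 note g[measurable]
 have lip: "g x - g y <= (\<Sum>j\<in>insert i I. c j*\<bar>x j - y j\<bar>)"
  if "x \<in> space (PiM (insert i I) \<mu>')" "y \<in> space (PiM (insert i I) \<mu>')" for x y
  using insert.prems(4) that by (simp add: eq)
 have upd: "x(i := t) \<in> space (PiM (insert i I) \<mu>')" if "x \<in> space (PiM I \<mu>')" for x t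
  using that by (auto simp: sp PiE_iff extensional_def)
 have updm: "(\<lambda>t. g (x(i := t))) \<in> borel_measurable borel" if "x \<in> space (PiM I \<mu>')" for x
 proof -
  have "(\<lambda>t. g (x(i := t))) \<in> borel_measurable (\<mu>' i)"
   using measurable_comp[OF measurable_component_update[OF that insert(2)] g] by (simp add: comp_def)
  thus ?thesis using sets' by (simp cong: measurable_cong_sets)
 qed
 have gim: "(\<lambda>x. g (x(i := t))) \<in> borel_measurable (PiM I \<mu>')" for t
 proof -
  have "(\<lambda>x. x(i := t)) \<in> measurable (PiM I \<mu>') (PiM (insert i I) \<mu>')"
   by (rule measurable_fun_upd[where J = I]) (auto simp: space')
  from measurable_comp[OF this g] show ?thesis by (simp add: comp_def)
 qed
 \<comment> \<open>\<open>P\<close> and \<open>N\<close> are the Laplace transforms of g and of -g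
   in all coordinates but \<open>i\<close>, as functions of the value \<open>t\<close> of that
   coordinate.\<close>
 define P where "P t = (\<integral>\<^sup>+x. ennreal (exp (g (x(i := t)))) \<partial>PiM I \<mu>')" for t
 define N where "N t = (\<integral>\<^sup>+x. ennreal (exp (- g (x(i := t)))) \<partial>PiM I \<mu>')" for t
 interpret PI: prob_space "PiM I \<mu>'" by (rule prob_space_PiM) (rule prob')
 interpret Mi: prob_space "\<mu>' i" by (rule prob')
 have Pl: "P t <= ennreal (exp (c i*\<bar>t - t'\<bar>))*P t'" for t t'
 proof -
  have "P t <= (\<integral>\<^sup>+x. ennreal (exp (c i*\<bar>t - t'\<bar>))*ennreal (exp (g (x(i := t')))) \<partial>PiM I \<mu>')"
   unfolding P_def
  proof (intro nn_integral_mono)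
   fix x assume x: "x \<in> space (PiM I \<mu>')"
   have "g (x(i := t)) - g (x(i := t')) <= (\<Sum>j\<in>insert i I. c j*\<bar>(x(i := t)) j - (x(i := t')) j\<bar>)"
    by (rule lip) (intro upd[OF x])+
   also have "... = c i*\<bar>t - t'\<bar>" using insert(1,2) by (simp add: sum.neutral)
   finally have "exp (g (x(i := t))) <= exp (c i*\<bar>t - t'\<bar> + g (x(i := t')))" by simp
   thus "ennreal (exp (g (x(i := t)))) <= ennreal (exp (c i*\<bar>t - t'\<bar>))*ennreal (exp (g (x(i := t'))))"
    by (simp add: exp_add ennreal_mult[symmetric] ennreal_leI)
  qed
  also have "... = ennreal (exp (c i*\<bar>t - t'\<bar>))*P t'"
   unfolding P_def using gim by (intro nn_integral_cmult) auto
  finally show ?thesis .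
 qed
 have IH: "P t*N t <= ennreal (exp (128*(\<Sum>j\<in>I. (c j)\<^sup>2)))" for t
  unfolding P_def N_def
 proof (subst (1 2) eq(2)[symmetric], rule insert.IH)
  show "(\<lambda>x. g (x(i := t))) \<in> borel_measurable (PiM I \<mu>)" using gim by (simp add: eq)
  fix x y assume xy: "x \<in> space (PiM I \<mu>)" "y \<in> space (PiM I \<mu>)"
  have "g (x(i := t)) - g (y(i := t)) <= (\<Sum>j\<in>insert i I. c j*\<bar>(x(i := t)) j - (y(i := t)) j\<bar>)"
   by (rule lip) (use xy in \<open>auto simp: eq intro!: upd\<close>)
  also have "... = (\<Sum>j\<in>I. c j*\<bar>x j - y j\<bar>)" using insert(1,2) by (auto intro!: sum.cong)
  finally show "g (x(i := t)) - g (y(i := t)) <= (\<Sum>j\<in>I. c j*\<bar>x j - y j\<bar>)" .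
 qed (use insert.prems in auto)
 have Ppos: "P t > 0" for t
 proof -
  have "P t ~= 0"
  proof
   assume "P t = 0"
   hence "AE x in PiM I \<mu>'. ennreal (exp (g (x(i := t)))) = 0"
    unfolding P_def using gim[of t] by (subst (asm) nn_integral_0_iff_AE) auto
   hence "AE x in PiM I \<mu>'. False" by (auto elim!: eventually_mono)
   thus False using PI.AE_False by blast
  qed
  thus ?thesis by (simp add: zero_less_iff_neq_zero)
 qed
 have Npos: "N t > 0" for t
 proof -
  have "N t ~= 0"
  proof
   assume "N t = 0"
   hence "AE x in PiM I \<mu>'. ennreal (exp (- g (x(i := t)))) = 0"
    unfolding N_def using gim[of t] by (subst (asm) nn_integral_0_iff_AE) auto
   hence "AE x in PiM I \<mu>'. False" by (auto elim!: eventually_mono)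
   thus False using PI.AE_False by blast
  qed
  thus ?thesis by (simp add: zero_less_iff_neq_zero)
 qed
 have Pfin: "P t < \<infinity>" for t
 proof (rule ccontr)
  assume "\<not> P t < \<infinity>"
  hence "P t*N t = \<infinity>" using Npos[of t] by (auto simp: top_unique less_top[symmetric] ennreal_top_mult)
  thus False using IH[of t] by (simp add: top_unique)
 qed
 define p where "p t = enn2real (P t)" for t
 have Pp: "P t = ennreal (p t)" for t using Pfin[of t] by (simp add: p_def)
 have ppos: "p t > 0" for t using Ppos[of t] Pp[of t] by simp
 define E where "E = exp (128*(\<Sum>j\<in>I. (c j)\<^sup>2))"
 \<comment> \<open>The induction hypothesis bounds the product of \<open>P\<close> and
   \<open>N\<close> uniformly in \<open>t\<close>, so \<open>N\<close> may be replaced by a multiple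
   of 1/P. The outer integration then has exactly the form of
   \<open>tame_product_exp\<close>.\<close>
 have Nle: "N t <= ennreal E*ennreal (1/p t)" for t
 proof -
  have "N t = (P t*N t)*ennreal (1/p t)"
   using ppos[of t] by (simp add: Pp mult.commute mult.left_commute ennreal_mult[symmetric] mult.assoc[symmetric])
  also have "... <= ennreal E*ennreal (1/p t)" unfolding E_def by (intro mult_right_mono IH) simp
  finally show ?thesis .
 qed
 have pm: "p \<in> borel_measurable borel"
 proof -
  have "(\<lambda>(t, x). ennreal (exp (g (x(i := t))))) \<in> borel_measurable (\<mu>' i \<Otimes>\<^sub>M PiM I \<mu>')"
  proof -
   have "(\<lambda>z. (snd z)(i := fst z)) \<in> measurable (\<mu>' i \<Otimes>\<^sub>M PiM I \<mu>') (PiM (insert i I) \<mu>')"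
    by (rule measurable_fun_upd[where J = I]) auto
   from measurable_comp[OF this g] show ?thesis by (simp add: comp_def case_prod_unfold)
  qed
  hence "P \<in> borel_measurable (\<mu>' i)" unfolding P_def
   by (intro PI.borel_measurable_nn_integral) (simp add: case_prod_unfold)
  hence "P \<in> borel_measurable borel" using sets' by (simp cong: measurable_cong_sets)
  thus ?thesis unfolding p_def by simp
 qed
 have plip: "p t <= exp (c i*\<bar>t - t'\<bar>)*p t'" for t t'
  using Pl[of t t'] ppos[of t'] by (simp add: Pp ennreal_mult[symmetric] less_imp_le ennreal_le_iff)
 have tm: "tame (\<mu>' i)" using insert.prems(1) by (simp add: \<mu>'_def)
 have "(\<integral>\<^sup>+t. P t \<partial>\<mu>' i)*(\<integral>\<^sup>+t. N t \<partial>\<mu>' i)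
   <= (\<integral>\<^sup>+t. ennreal (p t) \<partial>\<mu>' i)*(\<integral>\<^sup>+t. ennreal E*ennreal (1/p t) \<partial>\<mu>' i)"
  by (intro mult_mono nn_integral_mono Nle) (auto simp: Pp)
 also have "... = ennreal E*((\<integral>\<^sup>+t. ennreal (p t) \<partial>\<mu>' i)*(\<integral>\<^sup>+t. ennreal (1/p t) \<partial>\<mu>' i))"
 proof -
  have "(\<lambda>t. ennreal (1/p t)) \<in> borel_measurable (\<mu>' i)"
   using pm sets' by (simp cong: measurable_cong_sets)
  thus ?thesis by (subst nn_integral_cmult) (auto simp: mult_ac)
 qed
 also have "... <= ennreal E*ennreal (exp (128*(c i)^2))"
  by (intro mult_left_mono tame_product_exp[OF tm pm ppos plip]) (use insert.prems(3) in auto)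
 also have "... = ennreal (exp (128*(\<Sum>j\<in>insert i I. (c j)\<^sup>2)))"
  using insert(1,2) by (simp add: E_def ennreal_mult[symmetric] exp_add[symmetric] algebra_simps)
 finally have fin: "(\<integral>\<^sup>+t. P t \<partial>\<mu>' i)*(\<integral>\<^sup>+t. N t \<partial>\<mu>' i) <= ennreal (exp (128*(\<Sum>j\<in>insert i I. (c j)\<^sup>2)))" .
 have f1: "(\<lambda>x. ennreal (exp (g x))) \<in> borel_measurable (PiM (insert i I) \<mu>')"
  and f2: "(\<lambda>x. ennreal (exp (- g x))) \<in> borel_measurable (PiM (insert i I) \<mu>')" by measurable
 show ?case
  unfolding eq P.product_nn_integral_insert_rev[OF insert(1,2) f1] P.product_nn_integral_insert_rev[OF insert(1,2) f2]
  using fin unfolding P_def N_def .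
qed

lemma nn_integral_std_gauss:
 assumes f: "f \<in> borel_measurable borel"
 shows "(\<integral>\<^sup>+x. f x \<partial>std_gauss) = (\<integral>\<^sup>+x. ennreal (std_normal_density x)*f x \<partial>lborel)"
 unfolding std_gauss_def by (rule nn_integral_density) (use f in auto)

lemma std_gauss_exp_quadratic:
 assumes t: "t < 1/2"
 shows "(\<integral>\<^sup>+x. ennreal (exp (t*x^2 + s*x)) \<partial>std_gauss) = ennreal (exp (s^2/(2*(1 - 2*t))) / sqrt (1 - 2*t))"
proof -
 define d where "d = 1 - 2*t"
 have d: "d > 0" using t by (simp add: d_def)
 define \<sigma> where "\<sigma> = 1 / sqrt d"
 have \<sigma>: "\<sigma> > 0" and \<sigma>2: "\<sigma>\<^sup>2 = 1/d" using d by (auto simp: \<sigma>_def power_divide)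
 have "std_normal_density x*exp (t*x^2 + s*x) = exp (s^2/(2*d))*\<sigma>*normal_density (s/d) \<sigma> x" for x
 proof -
  have "- x\<^sup>2/2 + (t*x^2 + s*x) = s^2/(2*d) + - (x - s/d)\<^sup>2/(2*\<sigma>\<^sup>2)"
   using d unfolding \<sigma>2 by (simp add: field_simps power2_eq_square) (simp add: d_def algebra_simps)
  moreover have "sqrt (2*pi*\<sigma>\<^sup>2) = sqrt (2*pi)*\<sigma>" using \<sigma> by (simp add: real_sqrt_mult)
  ultimately show ?thesis using \<sigma>
   by (simp add: std_normal_density_def normal_density_def exp_add[symmetric])
 qed
 hence "(\<integral>\<^sup>+x. ennreal (exp (t*x^2 + s*x)) \<partial>std_gauss)
   = (\<integral>\<^sup>+x. ennreal (exp (s^2/(2*d))*\<sigma>)*ennreal (normal_density (s/d) \<sigma> x) \<partial>lborel)"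
  using \<sigma> by (subst nn_integral_std_gauss) (simp_all add: ennreal_mult[symmetric])
 also have "... = ennreal (exp (s^2/(2*d))*\<sigma>)*(\<integral>\<^sup>+x. ennreal (normal_density (s/d) \<sigma> x) \<partial>lborel)"
  by (rule nn_integral_cmult) simp
 also have "(\<integral>\<^sup>+x. ennreal (normal_density (s/d) \<sigma> x) \<partial>lborel) = 1"
  using nn_integral_eq_integral[OF integrable_normal_density[OF \<sigma>, of "s/d"]] integral_normal_density[OF \<sigma>, of "s/d"] \<sigma>
  by simp
 finally show ?thesis by (simp add: \<sigma>_def d_def)
qed

lemma nn_integral_gauss_prod:
 assumes "finite C" "!!i. i \<in> C ==> f i \<in> borel_measurable borel"
 shows "(\<integral>\<^sup>+x. (\<Prod>i\<in>C. f i (x i)) \<partial>gauss C) = (\<Prod>i\<in>C. \<integral>\<^sup>+x. f i x \<partial>std_gauss)"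
proof -
 interpret product_sigma_finite "\<lambda>_. std_gauss"
  by (rule product_sigma_finite.intro) (rule prob_space_imp_sigma_finite[OF prob_space_std_gauss])
 show ?thesis unfolding gauss_def
  by (rule product_nn_integral_prod) (use assms in \<open>auto cong: measurable_cong_sets\<close>)
qed

lemma gauss_exp_quadratic:
 assumes C: "finite C" and t: "t < 1/2"
 shows "(\<integral>\<^sup>+x. ennreal (exp (t*(\<Sum>i\<in>C. (x i)\<^sup>2) + (\<Sum>i\<in>C. s i*x i))) \<partial>gauss C)
  = ennreal (exp ((\<Sum>i\<in>C. (s i)\<^sup>2)/(2*(1 - 2*t))) / sqrt (1 - 2*t) ^ card C)"
proof -
 have "(\<integral>\<^sup>+x. ennreal (exp (t*(\<Sum>i\<in>C. (x i)\<^sup>2) + (\<Sum>i\<in>C. s i*x i))) \<partial>gauss C)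
  = (\<integral>\<^sup>+x. (\<Prod>i\<in>C. ennreal (exp (t*(x i)^2 + s i*x i))) \<partial>gauss C)"
  using C by (simp add: prod_ennreal exp_sum sum_distrib_left sum.distrib[symmetric])
 also have "... = (\<Prod>i\<in>C. \<integral>\<^sup>+x. ennreal (exp (t*x^2 + s i*x)) \<partial>std_gauss)"
  by (rule nn_integral_gauss_prod[OF C]) simp
 also have "... = (\<Prod>i\<in>C. ennreal (exp ((s i)^2/(2*(1 - 2*t))) / sqrt (1 - 2*t)))"
  by (simp only: std_gauss_exp_quadratic[OF t])
 also have "... = ennreal (\<Prod>i\<in>C. exp ((s i)^2/(2*(1 - 2*t))) / sqrt (1 - 2*t))"
  using t by (intro prod_ennreal) auto
 also have "(\<Prod>i\<in>C. exp ((s i)^2/(2*(1 - 2*t))) / sqrt (1 - 2*t))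
   = exp ((\<Sum>i\<in>C. (s i)\<^sup>2)/(2*(1 - 2*t))) / sqrt (1 - 2*t) ^ card C"
  using C by (simp add: prod_dividef exp_sum sum_divide_distrib)
 finally show ?thesis .
qed

text \<open>The left side is the Laplace transform at \<open>t\<close> of a centred squared standard
  normal, and this is its sub-Gaussian bound for small \<open>t\<close>.\<close>

lemma exp_neg_div_sqrt_le:
 fixes t :: real
 assumes "\<bar>t\<bar> <= 1/4"
 shows "exp (- t) / sqrt (1 - 2*t) <= exp (4*t^2)"
proof -
 have pos: "1 - 2*t > 0" using assms by auto
 have "- (2*t) - 2*(2*t)^2 <= ln (1 - 2*t)"
 proof (cases "t \<ge> 0")
  case True
  thus ?thesis using ln_one_minus_pos_lower_bound[of "2*t"] assms by auto
 next
  case False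
  hence "- (2*t) - (2*t)\<^sup>2 <= ln (1 - 2*t)"
   using ln_one_plus_pos_lower_bound[of "- 2*t"] assms by auto
  thus ?thesis using zero_le_power2[of "2*t"] by linarith
 qed
 hence "- t - ln (1 - 2*t)/2 <= 4*t^2" by (simp add: power_mult_distrib)
 hence "exp (- t - ln (1 - 2*t)/2) <= exp (4*t^2)" by simp
 moreover have "exp (ln (1 - 2*t)/2) = sqrt (1 - 2*t)"
  using pos by (simp add: ln_sqrt[symmetric])
 ultimately show ?thesis by (simp add: exp_diff)
qed

text \<open>For a norm r in dimension m, |r - sqrt m| is at most |r^2 - m| / sqrt m. With t = 1/(4
  sqrt m) the deviation is controlled by the exponential moments of r^2 - m at t and -t. Each is at
  most exp(4 t^2 m) = exp(1/4), whatever the dimension, and exp(1/4) is at most 4/3.\<close>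

lemma chi_exp_deviation:
 assumes C: "finite C" "C ~= {}"
 shows "(\<integral>\<^sup>+x. ennreal (exp (\<bar>x - sqrt (card C)\<bar>/4)) \<partial>chi C) <= 3"
proof -
 define m where "m = real (card C)"
 have m: "m \<ge> 1" using C by (simp add: m_def Suc_le_eq card_gt_0_iff)
 define t where "t = 1/(4 * sqrt m)"
 have t: "0 < t" "t <= 1/4" using m by (auto simp: t_def field_simps)
 have t2: "4*t^2*m = 1/4" using m by (simp add: t_def power_mult_distrib power_divide)
 let ?q = "\<lambda>x. \<Sum>i\<in>C. (x i)\<^sup>2"
 have E: "(\<integral>\<^sup>+x. ennreal (exp (u*(?q x - m))) \<partial>gauss C) <= ennreal (exp (1/4))" if u: "u = t \<or> u = - t" for u
 proof -
  have u4: "\<bar>u\<bar> <= 1/4" "u < 1/2" using t u by auto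
  have "(\<integral>\<^sup>+x. ennreal (exp (u*(?q x - m))) \<partial>gauss C) = (\<integral>\<^sup>+x. ennreal (exp (- u*m))*ennreal (exp (u * ?q x + (\<Sum>i\<in>C. 0*x i))) \<partial>gauss C)"
  proof (rule nn_integral_cong)
   fix x
   have "exp (u*(?q x - m)) = exp (- u*m)*exp (u * ?q x + (\<Sum>i\<in>C. 0*x i))"
    unfolding exp_add[symmetric] by (simp add: right_diff_distrib)
   thus "ennreal (exp (u*(?q x - m))) = ennreal (exp (- u*m))*ennreal (exp (u * ?q x + (\<Sum>i\<in>C. 0*x i)))"
    by (simp add: ennreal_mult)
  qed
  also have "... = ennreal (exp (- u*m))*(\<integral>\<^sup>+x. ennreal (exp (u * ?q x + (\<Sum>i\<in>C. 0*x i))) \<partial>gauss C)"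
  proof (rule nn_integral_cmult)
   note measurable_gauss_component[measurable]
   show "(\<lambda>x. ennreal (exp (u * ?q x + (\<Sum>i\<in>C. 0*x i)))) \<in> borel_measurable (gauss C)" by measurable
  qed
  also have "... = ennreal (exp (- u*m))*ennreal (1 / sqrt (1 - 2*u) ^ card C)"
   by (subst gauss_exp_quadratic[OF C(1) u4(2)]) simp
  also have "... = ennreal ((exp (- u) / sqrt (1 - 2*u)) ^ card C)"
   using u4 by (simp add: ennreal_mult[symmetric] power_divide m_def exp_of_nat_mult[symmetric] mult.commute)
  also have "... <= ennreal (exp (4*u^2) ^ card C)"
   using u4 by (intro ennreal_leI power_mono exp_neg_div_sqrt_le) auto
  also have "exp (4*u^2) ^ card C = exp (4*t^2*m)" using u by (auto simp: m_def exp_of_nat_mult[symmetric] mult_ac)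
  finally show ?thesis by (simp only: t2)
 qed
 have pt: "exp (\<bar>sqrt (?q x) - sqrt m\<bar>/4) <= exp (t*(?q x - m)) + exp (- t*(?q x - m))" for x
 proof -
  define r where "r = sqrt (?q x)"
  have r: "r \<ge> 0" "r^2 = ?q x" by (simp_all add: r_def sum_nonneg)
  have "\<bar>r - sqrt m\<bar> * sqrt m <= \<bar>r - sqrt m\<bar>*(r + sqrt m)" using r by (intro mult_left_mono) auto
  also have "... = \<bar>(r - sqrt m)*(r + sqrt m)\<bar>" using r m by (simp add: abs_mult)
  also have "(r - sqrt m)*(r + sqrt m) = ?q x - m" using r m by (simp add: algebra_simps power2_eq_square[symmetric])
  finally have "\<bar>r - sqrt m\<bar>/4 <= t*\<bar>?q x - m\<bar>" using m by (simp add: t_def field_simps)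
  hence "exp (\<bar>r - sqrt m\<bar>/4) <= exp (t*\<bar>?q x - m\<bar>)" by simp
  also have "... <= exp (t*(?q x - m)) + exp (- t*(?q x - m))"
  proof -
   have "exp (t*\<bar>a\<bar>) <= exp (t*a) + exp (- t*a)" for a :: real
    by (cases "a \<ge> 0") (auto simp: abs_if)
   thus ?thesis .
  qed
  finally show ?thesis by (simp add: r_def)
 qed
 have "(\<integral>\<^sup>+x. ennreal (exp (\<bar>x - sqrt (card C)\<bar>/4)) \<partial>chi C) = (\<integral>\<^sup>+x. ennreal (exp (\<bar>sqrt (?q x) - sqrt m\<bar>/4)) \<partial>gauss C)"
  unfolding chi_def m_def by (rule nn_integral_distr[OF measurable_sqnorm]) simp
 also have "... <= (\<integral>\<^sup>+x. ennreal (exp (t*(?q x - m))) + ennreal (exp (- t*(?q x - m))) \<partial>gauss C)"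
 proof (intro nn_integral_mono)
  fix x
  show "ennreal (exp (\<bar>sqrt (?q x) - sqrt m\<bar>/4)) <= ennreal (exp (t*(?q x - m))) + ennreal (exp (- t*(?q x - m)))"
   using ennreal_leI[OF pt[of x]] by (subst ennreal_plus[symmetric]) auto
 qed
 also have "... = (\<integral>\<^sup>+x. ennreal (exp (t*(?q x - m))) \<partial>gauss C) + (\<integral>\<^sup>+x. ennreal (exp (- t*(?q x - m))) \<partial>gauss C)"
 proof (rule nn_integral_add)
  note measurable_gauss_component[measurable]
  show "(\<lambda>x. ennreal (exp (t*(?q x - m)))) \<in> borel_measurable (gauss C)"
   "(\<lambda>x. ennreal (exp (- t*(?q x - m)))) \<in> borel_measurable (gauss C)" by measurable
 qed
 also have "... <= ennreal (exp (1/4)) + ennreal (exp (1/4))" by (intro add_mono E) auto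
 also have "... <= 3"
 proof -
  have "1 - 1/4 <= exp (- (1/4 :: real))" using exp_ge_add_one_self[of "- (1/4 :: real)"] by simp
  hence "exp (1/4) <= (4/3 :: real)" by (simp add: exp_minus field_simps)
  hence "ennreal (exp (1/4) + exp (1/4)) <= ennreal 3" by (intro ennreal_leI) simp
  moreover have "ennreal (exp (1/4)) + ennreal (exp (1/4)) = ennreal (exp (1/4) + exp (1/4))"
   by (rule ennreal_plus[symmetric]) auto
  ultimately show ?thesis by (simp only: ennreal_numeral)
 qed
 finally show ?thesis .
qed

text \<open>The triangle inequality through the centre \<open>a\<close> bounds the double integral
  by the square of the single one; hence the 9 in \<open>tame\<close>.\<close>

lemma tameI:
 assumes "prob_space M" "sets M = sets borel" and b: "(\<integral>\<^sup>+x. ennreal (exp (\<bar>x - a\<bar>/4)) \<partial>M) <= 3"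
 shows "tame M"
proof -
 have [measurable_cong]: "sets M = sets borel" by fact
 let ?e = "\<lambda>x. ennreal (exp (\<bar>x - a\<bar>/4))"
 have "(\<integral>\<^sup>+x. \<integral>\<^sup>+y. ennreal (exp (\<bar>x - y\<bar>/4)) \<partial>M \<partial>M) <= (\<integral>\<^sup>+x. \<integral>\<^sup>+y. ?e x * ?e y \<partial>M \<partial>M)"
  by (intro nn_integral_mono) (simp add: ennreal_mult[symmetric] exp_add[symmetric] ennreal_leI)
 also have "... = (\<integral>\<^sup>+x. ?e x \<partial>M)*(\<integral>\<^sup>+x. ?e x \<partial>M)"
  by (simp add: nn_integral_cmult nn_integral_multc)
 also have "... <= 3*3" by (intro mult_mono b) auto
 finally show ?thesis using assms by (simp add: tame_def)
qed

lemma tame_chi: "finite C ==> C ~= {} ==> tame (chi C)"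
 using tameI[of "chi C" "sqrt (card C)"] chi_exp_deviation[of C] by simp

lemma tame_point0: "tame point0"
 by (rule tameI[of _ 0]) (simp_all add: nn_integral_return)

lemma nn_integral_chi_sq:
 assumes C: "finite C"
 shows "(\<integral>\<^sup>+x. ennreal (x^2) \<partial>chi C) = of_nat (card C)"
proof -
 interpret product_prob_space "\<lambda>_. std_gauss"
  by (intro product_prob_space.intro product_sigma_finite.intro product_prob_space_axioms.intro
   prob_space_imp_sigma_finite prob_space_std_gauss)
 note measurable_gauss_component[measurable]
 have one: "(\<integral>\<^sup>+x. ennreal (x^2) \<partial>std_gauss) = 1"
 proof -
  have "integrable lborel (\<lambda>x. std_normal_density x*x ^ 2)" "(\<integral>x. std_normal_density x*x ^ 2 \<partial>lborel) = 1"
   using integrable_std_normal_moment[of 2] integral_std_normal_moment_even[of 1] by (auto simp: fact_numeral)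
  hence "(\<integral>\<^sup>+x. ennreal (std_normal_density x*x ^ 2) \<partial>lborel) = 1"
   by (subst nn_integral_eq_integral) auto
  thus ?thesis by (subst nn_integral_std_gauss) (simp_all add: ennreal_mult[symmetric])
 qed
 have comp: "(\<integral>\<^sup>+x. ennreal ((x i)^2) \<partial>gauss C) = 1" if "i \<in> C" for i
 proof -
  have "(\<integral>\<^sup>+x. ennreal ((x i)^2) \<partial>gauss C) = (\<integral>\<^sup>+x. ennreal (x^2) \<partial>distr (gauss C) std_gauss (\<lambda>x. x i))"
   using that by (subst nn_integral_distr) (auto simp: gauss_def cong: measurable_cong_sets)
  also have "distr (gauss C) std_gauss (\<lambda>x. x i) = std_gauss"
   unfolding gauss_def by (rule distr_PiM_component) (use that in auto)
  finally show ?thesis using one by simp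
 qed
 have "(\<integral>\<^sup>+x. ennreal (x^2) \<partial>chi C) = (\<integral>\<^sup>+x. ennreal (\<Sum>i\<in>C. (x i)\<^sup>2) \<partial>gauss C)"
  unfolding chi_def by (subst nn_integral_distr[OF measurable_sqnorm]) (simp_all add: sum_nonneg)
 also have "... = (\<integral>\<^sup>+x. (\<Sum>i\<in>C. ennreal ((x i)^2)) \<partial>gauss C)" by (simp add: sum_ennreal)
 also have "... = (\<Sum>i\<in>C. \<integral>\<^sup>+x. ennreal ((x i)^2) \<partial>gauss C)" by (rule nn_integral_sum) measurable
 also have "... = of_nat (card C)" using comp by simp
 finally show ?thesis .
qed

text \<open>
 The variance bound is the only place where the mean of the norm of a Gaussian vector is compared
 with the square root of the dimension.
\<close>

lemma chi_mean:
 assumes C: "finite C" "C ~= {}"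
 shows "integrable (chi C) (\<lambda>x. x)" "integrable (chi C) (\<lambda>x. x\<^sup>2)" "0 <= (\<integral>x. x \<partial>chi C)"
  "(\<integral>x. x \<partial>chi C)^2 <= card C" "real (card C) - 144 <= (\<integral>x. x \<partial>chi C)^2"
proof -
 let ?M = "chi C"
 interpret prob_space ?M by simp
 have pU: "prob UNIV = 1" using prob_space by simp
 have eU: "emeasure ?M UNIV = 1" using emeasure_space_1 by simp
 have sq: "integrable ?M (\<lambda>x. x\<^sup>2)"
  by (rule integrableI_bounded) (use nn_integral_chi_sq[OF C(1)] in \<open>auto simp: of_nat_less_top\<close>)
 have sqi: "(\<integral>x. x\<^sup>2 \<partial>?M) = card C"
  using nn_integral_eq_integral[OF sq] nn_integral_chi_sq[OF C(1)]
  by (simp add: ennreal_of_nat_eq_real_of_nat)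
 show i1: "integrable ?M (\<lambda>x. x)" by (rule square_integrable_imp_integrable[OF _ sq]) simp
 show "integrable ?M (\<lambda>x. x\<^sup>2)" by (rule sq)
 have "AE x in ?M. 0 <= x" unfolding chi_def
  by (subst AE_distr_iff[OF measurable_sqnorm]) (auto simp: sum_nonneg)
 thus "0 <= (\<integral>x. x \<partial>?M)" by (rule integral_nonneg_AE)
 define A where "A = (\<integral>x. x \<partial>?M)"
 have V: "variance (\<lambda>x. x) = card C - A\<^sup>2"
  using variance_eq[OF i1 sq] by (simp add: sqi A_def)
 have "0 <= variance (\<lambda>x. x)" by simp
 thus "(\<integral>x. x \<partial>?M)^2 <= card C" using V by (simp add: A_def)
 define v where "v = real (card C) - A\<^sup>2"
 have v0: "v \<ge> 0" using \<open>0 <= variance (\<lambda>x. x)\<close> V by (simp add: v_def)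
 have inner: "(\<integral>\<^sup>+y. ennreal ((x - y)^2) \<partial>?M) = ennreal ((x - A)^2 + v)" for x
 proof -
  have int: "integrable ?M (\<lambda>y. x\<^sup>2 - 2*x*y + y^2)" using i1 sq by auto
  have ex: "(\<lambda>y. (x - y)\<^sup>2) = (\<lambda>y. x\<^sup>2 - 2*x*y + y^2)" by (simp add: fun_eq_iff power2_diff)
  have "(\<integral>\<^sup>+y. ennreal ((x - y)^2) \<partial>?M) = ennreal (\<integral>y. (x - y)\<^sup>2 \<partial>?M)"
   by (rule nn_integral_eq_integral, simp only: ex, rule int, simp)
  also have "(\<integral>y. (x - y)\<^sup>2 \<partial>?M) = (\<integral>y. x\<^sup>2 - 2*x*y + y^2 \<partial>?M)" by (simp only: ex)
  also have "(\<integral>y. x\<^sup>2 - 2*x*y + y^2 \<partial>?M) = x^2 - 2*x*A + card C"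
   using i1 sq by (simp add: sqi A_def pU)
  also have "... = (x - A)^2 + v" by (simp add: v_def power2_diff)
  finally show ?thesis .
 qed
 have "ennreal v <= (\<integral>\<^sup>+x. ennreal ((x - A)^2 + v) \<partial>?M)"
 proof -
  have "ennreal v = (\<integral>\<^sup>+x. ennreal v \<partial>?M)" by (simp add: eU)
  also have "... <= (\<integral>\<^sup>+x. ennreal ((x - A)^2 + v) \<partial>?M)" by (intro nn_integral_mono ennreal_leI) simp
  finally show ?thesis .
 qed
 have i2: "integrable ?M (\<lambda>x. (x - A)\<^sup>2)"
 proof -
  have "integrable ?M (\<lambda>x. x\<^sup>2 - 2*x*A + A\<^sup>2)" using i1 sq by auto
  thus ?thesis by (simp only: power2_diff) (simp add: algebra_simps)
 qed
 have i3: "integrable ?M (\<lambda>x. (x - A)\<^sup>2 + v)" using i2 by simp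
 \<comment> \<open>Twice the variance is the mean square of the difference of two independent
   copies, which tameness bounds by 32 * 9 = 288. Half of this is the 144 of the statement.\<close>
 have "2 * v = (\<integral>x. (x - A)\<^sup>2 + v \<partial>?M)"
  using i2 V by (simp add: pU A_def v_def)
 hence "ennreal (2 * v) = ennreal (\<integral>x. (x - A)\<^sup>2 + v \<partial>?M)" by (simp only:)
 also have "... = (\<integral>\<^sup>+x. ennreal ((x - A)^2 + v) \<partial>?M)"
  by (rule nn_integral_eq_integral[symmetric, OF i3]) (use v0 in simp)
 also have "... = (\<integral>\<^sup>+x. \<integral>\<^sup>+y. ennreal ((x - y)^2) \<partial>?M \<partial>?M)" by (simp only: inner)
 also have "... <= (\<integral>\<^sup>+x. \<integral>\<^sup>+y. 32*ennreal (exp (\<bar>x - y\<bar>/4)) \<partial>?M \<partial>?M)"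
 proof (intro nn_integral_mono)
  fix x y :: real
  define z where "z = \<bar>x - y\<bar>/4"
  have "1 + z + z^2/2 <= exp z" by (rule exp_lower_Taylor_quadratic) (simp add: z_def)
  moreover have "0 <= z" by (simp add: z_def)
  ultimately have "z^2/2 <= exp z" by linarith
  moreover have "(x - y)^2 = 16*z^2" by (simp add: z_def power_divide)
  ultimately have "(x - y)^2 <= 32*exp z" by simp
  hence "ennreal ((x - y)^2) <= ennreal (32*exp z)" by (rule ennreal_leI)
  thus "ennreal ((x - y)^2) <= 32*ennreal (exp (\<bar>x - y\<bar>/4))" by (simp add: ennreal_mult z_def)
 qed
 also have "... = 32*(\<integral>\<^sup>+x. \<integral>\<^sup>+y. ennreal (exp (\<bar>x - y\<bar>/4)) \<partial>?M \<partial>?M)"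
  by (simp add: nn_integral_cmult)
 also have "... <= 32*9" using tame_chi[OF C] by (intro mult_left_mono) (auto simp: tame_def)
 finally have "ennreal (2 * v) <= ennreal 288" by simp
 hence "2 * v <= 288" by (subst (asm) ennreal_le_iff) auto
 thus "real (card C) - 144 <= (\<integral>x. x \<partial>?M)^2" by (simp add: v_def A_def)
qed

text \<open>After division by 4 \<sigma> every Lipschitz constant is at most 1/4 and their squares
  sum to at most 1/16, so the product of the two Laplace transforms is at most exp 8. Jensen's
  inequality bounds either factor from below by the exponential of plus or minus the mean, so the
  other factor is bounded relative to the mean, and Markov's inequality finishes. The tail is
  exponential in \<open>L\<close>, not Gaussian, because \<open>tame\<close> offers exponential
  moments only.\<close>

lemma tame_concentration:
 fixes g :: "('i => real) => real"
 assumes I: "finite I" and \<mu>: "!!i. i \<in> I ==> tame (\<mu> i)"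
  and g: "g \<in> borel_measurable (PiM I \<mu>)" and \<sigma>: "\<sigma> > 0"
  and c: "!!i. i \<in> I ==> 0 <= c i" and c2: "(\<Sum>i\<in>I. (c i)\<^sup>2) <= \<sigma>\<^sup>2"
  and lip: "!!x y. x \<in> space (PiM I \<mu>) ==> y \<in> space (PiM I \<mu>) ==> g x - g y <= (\<Sum>i\<in>I. c i*\<bar>x i - y i\<bar>)"
 shows "integrable (PiM I \<mu>) g"
  and "measure (PiM I \<mu>) {x \<in> space (PiM I \<mu>). \<bar>g x - (\<integral>x. g x \<partial>PiM I \<mu>)\<bar> \<ge> L*\<sigma>} <= 2*exp (8 - L/4)"
proof -
 let ?M = "PiM I \<mu>"
 interpret prob_space ?M by (rule prob_space_PiM) (use \<mu> in \<open>auto simp: tame_def\<close>)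
 note g[measurable]
 define h where "h x = g x/(4*\<sigma>)" for x
 have hm[measurable]: "h \<in> borel_measurable ?M" unfolding h_def by measurable
 define d where "d i = c i/(4*\<sigma>)" for i
 have ci: "c i <= \<sigma>" if "i \<in> I" for i
 proof -
  have "(c i)^2 <= (\<Sum>i\<in>I. (c i)\<^sup>2)" using I that by (intro member_le_sum) auto
  thus ?thesis using c2 \<sigma> by (intro power2_le_imp_le[of "c i" \<sigma>]) auto
 qed
 have d: "0 <= d i \<and> d i <= 1/4" if "i \<in> I" for i
  using c[OF that] ci[OF that] \<sigma> by (simp add: d_def field_simps)
 have "(\<Sum>i\<in>I. (d i)\<^sup>2) = (\<Sum>i\<in>I. (c i)\<^sup>2)/(16*\<sigma>\<^sup>2)"
  by (simp add: d_def power_divide power_mult_distrib sum_divide_distrib)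
 also have "... <= 1/16" using c2 \<sigma> by (simp add: field_simps)
 finally have d2: "128*(\<Sum>i\<in>I. (d i)\<^sup>2) <= 8" by simp
 have liph: "h x - h y <= (\<Sum>i\<in>I. d i*\<bar>x i - y i\<bar>)" if "x \<in> space ?M" "y \<in> space ?M" for x y
 proof -
  have "h x - h y = (g x - g y)/(4*\<sigma>)" by (simp add: h_def diff_divide_distrib)
  also have "... <= (\<Sum>i\<in>I. c i*\<bar>x i - y i\<bar>)/(4*\<sigma>)" using lip[OF that] \<sigma> by (intro divide_right_mono) auto
  finally show ?thesis by (simp add: d_def sum_divide_distrib)
 qed
 have prod: "(\<integral>\<^sup>+x. ennreal (exp (h x)) \<partial>?M)*(\<integral>\<^sup>+x. ennreal (exp (- h x)) \<partial>?M) <= ennreal (exp 8)"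
 proof -
  have "(\<integral>\<^sup>+x. ennreal (exp (h x)) \<partial>?M)*(\<integral>\<^sup>+x. ennreal (exp (- h x)) \<partial>?M) <= ennreal (exp (128*(\<Sum>i\<in>I. (d i)\<^sup>2)))"
   by (rule tame_product_Laplace[OF I _ hm]) (use \<mu> d liph in auto)
  also have "... <= ennreal (exp 8)" using d2 by (intro ennreal_leI) simp
  finally show ?thesis .
 qed
 have nz: "(\<integral>\<^sup>+x. ennreal (exp (f x)) \<partial>?M) ~= 0" if [measurable]: "f \<in> borel_measurable ?M" for f
  by (subst nn_integral_0_iff_AE) (auto simp: AE_False)
 have fin1: "(\<integral>\<^sup>+x. ennreal (exp (h x)) \<partial>?M) < \<infinity>"
  using prod nz[of "\<lambda>x. - h x"] by (auto simp: top_unique less_top[symmetric] ennreal_top_mult dest: order_trans)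
 have fin2: "(\<integral>\<^sup>+x. ennreal (exp (- h x)) \<partial>?M) < \<infinity>"
  using prod nz[of h] by (auto simp: top_unique less_top[symmetric] ennreal_mult_top dest: order_trans)
 have e1: "integrable ?M (\<lambda>x. exp (h x))" and e2: "integrable ?M (\<lambda>x. exp (- h x))"
  using fin1 fin2 by (auto intro!: integrableI_bounded)
 have ih: "integrable ?M h"
 proof (rule Bochner_Integration.integrable_bound[OF Bochner_Integration.integrable_add[OF e1 e2] hm], rule AE_I2)
  fix x
  show "norm (h x) <= norm (exp (h x) + exp (- h x))"
  proof -
   have "h x <= exp (h x)" "- h x <= exp (- h x)"
    using exp_ge_add_one_self[of "h x"] exp_ge_add_one_self[of "- h x"] by linarith+
   hence "\<bar>h x\<bar> <= exp (h x) + exp (- h x)"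
    using exp_gt_zero[of "h x"] exp_gt_zero[of "- h x"] by (simp only: abs_le_iff) linarith
   thus ?thesis by simp
  qed
 qed
 have gh: "g = (\<lambda>x. (4*\<sigma>)*h x)" using \<sigma> by (simp add: h_def)
 show ig: "integrable ?M g" unfolding gh using ih by simp
 define a where "a = (\<integral>x. h x \<partial>?M)"
 have Eg: "(\<integral>x. g x \<partial>?M) = 4*\<sigma>*a" unfolding gh a_def by simp
 have J: "exp (s*a) <= (\<integral>x. exp (s*h x) \<partial>?M)" if i: "integrable ?M (\<lambda>x. exp (s*h x))" for s
 proof -
  have "exp (s*a) = (\<integral>x. exp (s*a)*(1 + (s*h x - s*a)) \<partial>?M)"
   using ih by (simp add: a_def prob_space)
  also have "... <= (\<integral>x. exp (s*h x) \<partial>?M)"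
  proof (rule integral_mono)
   fix x
   have "exp (s*a)*(1 + (s*h x - s*a)) <= exp (s*a)*exp (s*h x - s*a)"
    by (intro mult_left_mono exp_ge_add_one_self) auto
   thus "exp (s*a)*(1 + (s*h x - s*a)) <= exp (s*h x)" by (simp add: exp_add[symmetric])
  qed (use ih i in auto)
  finally show ?thesis .
 qed
 have nn1: "(\<integral>\<^sup>+x. ennreal (exp (h x)) \<partial>?M) = ennreal (\<integral>x. exp (h x) \<partial>?M)"
  and nn2: "(\<integral>\<^sup>+x. ennreal (exp (- h x)) \<partial>?M) = ennreal (\<integral>x. exp (- h x) \<partial>?M)"
  using e1 e2 by (auto intro!: nn_integral_eq_integral)
 have pr: "(\<integral>x. exp (h x) \<partial>?M)*(\<integral>x. exp (- h x) \<partial>?M) <= exp 8"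
  using prod unfolding nn1 nn2 by (simp add: ennreal_mult[symmetric])
 have up: "(\<integral>x. exp (h x) \<partial>?M) <= exp (8 + a)"
 proof -
  have "(\<integral>x. exp (h x) \<partial>?M)*exp (- a) <= (\<integral>x. exp (h x) \<partial>?M)*(\<integral>x. exp (- h x) \<partial>?M)"
   using J[of "-1"] e2 by (intro mult_left_mono) auto
  hence "(\<integral>x. exp (h x) \<partial>?M)*exp (- a) <= exp 8" using pr by linarith
  thus ?thesis by (simp add: exp_add exp_minus field_simps)
 qed
 have lo: "(\<integral>x. exp (- h x) \<partial>?M) <= exp (8 - a)"
 proof -
  have "exp a*(\<integral>x. exp (- h x) \<partial>?M) <= (\<integral>x. exp (h x) \<partial>?M)*(\<integral>x. exp (- h x) \<partial>?M)"
   using J[of 1] e1 by (intro mult_right_mono) auto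
  hence "exp a*(\<integral>x. exp (- h x) \<partial>?M) <= exp 8" using pr by linarith
  thus ?thesis by (simp add: exp_diff field_simps)
 qed
 have M1: "measure ?M {x \<in> space ?M. exp (L/4 + a) <= exp (h x)} <= exp (8 - L/4)"
 proof -
  have "measure ?M {x \<in> space ?M. exp (h x) \<ge> exp (L/4 + a)} <= (\<integral>x. exp (h x) \<partial>?M)/exp (L/4 + a)"
   by (rule integral_Markov_inequality_measure[OF e1, where A = "space ?M"]) auto
  also have "... <= exp (8 + a)/exp (L/4 + a)" using up by (intro divide_right_mono) auto
  finally show ?thesis by (simp add: exp_diff[symmetric])
 qed
 have M2: "measure ?M {x \<in> space ?M. exp (L/4 - a) <= exp (- h x)} <= exp (8 - L/4)"
 proof -
  have "measure ?M {x \<in> space ?M. exp (- h x) \<ge> exp (L/4 - a)} <= (\<integral>x. exp (- h x) \<partial>?M)/exp (L/4 - a)"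
   by (rule integral_Markov_inequality_measure[OF e2, where A = "space ?M"]) auto
  also have "... <= exp (8 - a)/exp (L/4 - a)" using lo by (intro divide_right_mono) auto
  finally show ?thesis by (simp add: exp_diff[symmetric])
 qed
 have sub: "{x \<in> space ?M. \<bar>g x - (\<integral>x. g x \<partial>?M)\<bar> \<ge> L*\<sigma>}
  \<subseteq> {x \<in> space ?M. exp (L/4 + a) <= exp (h x)} \<union> {x \<in> space ?M. exp (L/4 - a) <= exp (- h x)}"
 proof
  fix x assume x: "x \<in> {x \<in> space ?M. \<bar>g x - (\<integral>x. g x \<partial>?M)\<bar> \<ge> L*\<sigma>}"
  have "g x = 4*\<sigma>*h x" using \<sigma> by (simp add: h_def)
  hence "g x - (\<integral>x. g x \<partial>?M) = (4*\<sigma>)*(h x - a)" unfolding Eg by (simp add: right_diff_distrib)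
  hence "\<bar>g x - (\<integral>x. g x \<partial>?M)\<bar> = (4*\<bar>h x - a\<bar>)*\<sigma>" using \<sigma> by (simp add: abs_mult)
  hence "L*\<sigma> <= (4*\<bar>h x - a\<bar>)*\<sigma>" using x by auto
  hence "L <= 4*\<bar>h x - a\<bar>" by (simp only: mult_le_cancel_right_pos[OF \<sigma>])
  hence "L/4 + a <= h x \<or> L/4 - a <= - h x" by (cases "h x \<ge> a") auto
  thus "x \<in> {x \<in> space ?M. exp (L/4 + a) <= exp (h x)} \<union> {x \<in> space ?M. exp (L/4 - a) <= exp (- h x)}"
   using x by auto
 qed
 have "measure ?M {x \<in> space ?M. \<bar>g x - (\<integral>x. g x \<partial>?M)\<bar> \<ge> L*\<sigma>}
  <= measure ?M ({x \<in> space ?M. exp (L/4 + a) <= exp (h x)} \<union> {x \<in> space ?M. exp (L/4 - a) <= exp (- h x)})"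
  by (rule finite_measure_mono[OF sub]) measurable
 also have "... <= measure ?M {x \<in> space ?M. exp (L/4 + a) <= exp (h x)} + measure ?M {x \<in> space ?M. exp (L/4 - a) <= exp (- h x)}"
  by (rule measure_Un_le) measurable
 also have "... <= 2*exp (8 - L/4)" using M1 M2 by simp
 finally show "measure ?M {x \<in> space ?M. \<bar>g x - (\<integral>x. g x \<partial>?M)\<bar> \<ge> L*\<sigma>} <= 2*exp (8 - L/4)" .
qed

subsection \<open>Sums of top eigenvalues\<close>

text \<open>Vectors are functions on \<open>nat\<close> of which only the first \<open>p\<close>
  values count, so that the dimension may vary with the sample size.\<close>

definition ip :: "nat => (nat => real) => (nat => real) => real" where
 "ip p u v = (\<Sum>j<p. u j * v j)"

definition orthonormal :: "nat => nat => (nat => nat => real) => bool" where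
 "orthonormal p k w \<longleftrightarrow> (\<forall>a<k. \<forall>b<k. ip p (w a) (w b) = (if a = b then 1 else 0))"

definition app :: "nat => (nat => nat => real) => (nat => real) => nat => real" where
 "app p A u j = (\<Sum>k<p. A j k*u k)"

lemma ip_commute: "ip p u v = ip p v u"
 by (simp add: ip_def mult.commute)

lemma ip_add_left: "ip p (\<lambda>j. u j + v j) w = ip p u w + ip p v w"
 and ip_diff_left: "ip p (\<lambda>j. u j - v j) w = ip p u w - ip p v w"
 and ip_scale_left: "ip p (\<lambda>j. c*u j) w = c*ip p u w"
 by (simp_all add: ip_def algebra_simps sum.distrib sum_subtractf sum_distrib_left)

lemma ip_add_right: "ip p w (\<lambda>j. u j + v j) = ip p w u + ip p w v"
 and ip_diff_right: "ip p w (\<lambda>j. u j - v j) = ip p w u - ip p w v"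
 and ip_scale_right: "ip p w (\<lambda>j. c*u j) = c*ip p w u"
 by (simp_all add: ip_def algebra_simps sum.distrib sum_subtractf sum_distrib_left)

lemma ip_sum_left: "ip p (\<lambda>j. \<Sum>a\<in>S. u a j) w = (\<Sum>a\<in>S. ip p (u a) w)"
 unfolding ip_def by (simp add: sum_distrib_right, subst sum.swap, simp)

lemma ip_sum_right: "ip p w (\<lambda>j. \<Sum>a\<in>S. u a j) = (\<Sum>a\<in>S. ip p w (u a))"
 using ip_sum_left[of p u S w] by (simp add: ip_commute)

lemma ip_divide_left: "ip p (\<lambda>j. u j/c) w = ip p u w/c"
 and ip_divide_right: "ip p w (\<lambda>j. u j/c) = ip p w u/c"
 by (simp_all add: ip_def sum_divide_distrib)

lemmas ip_simps = ip_add_left ip_diff_left ip_scale_left ip_add_right ip_diff_right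
 ip_scale_right ip_sum_left ip_sum_right ip_divide_left ip_divide_right

lemma ip_self_nonneg [simp]: "0 <= ip p u u"
 by (simp add: ip_def sum_nonneg)

lemma ip_self_eq: "ip p u u = (\<Sum>j<p. (u j)\<^sup>2)"
 by (simp add: ip_def power2_eq_square)

lemma ip_self_0: "ip p u u = 0 ==> j < p ==> u j = 0"
 by (simp add: ip_self_eq sum_nonneg_eq_0_iff)

lemma ip_cong: "(!!j. j < p ==> u j = u' j) ==> (!!j. j < p ==> v j = v' j) ==> ip p u v = ip p u' v'"
 by (simp add: ip_def)

lemma orthonormalD: "orthonormal p k w ==> a < k ==> b < k ==> ip p (w a) (w b) = (if a = b then 1 else 0)"
 by (simp add: orthonormal_def)

lemma orthonormal_mono: "orthonormal p k w ==> m <= k ==> orthonormal p m w"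
 by (simp add: orthonormal_def)

lemma ip_residual:
 assumes "orthonormal p m w" "a < m"
 shows "ip p (w a) (\<lambda>j. v j - (\<Sum>b<m. ip p (w b) v * w b j)) = 0"
proof -
 have "(\<Sum>b<m. ip p (w b) v * ip p (w a) (w b)) = (\<Sum>b<m. if b = a then ip p (w a) v else 0)"
  using assms by (intro sum.cong) (auto simp: orthonormal_def)
 also have "... = ip p (w a) v" using assms by simp
 finally show ?thesis by (simp add: ip_simps)
qed

lemma ip_residual_self:
 assumes "orthonormal p m w"
 shows "ip p (\<lambda>j. v j - (\<Sum>b<m. ip p (w b) v * w b j)) (\<lambda>j. v j - (\<Sum>b<m. ip p (w b) v * w b j))
  = ip p v v - (\<Sum>b<m. (ip p (w b) v)\<^sup>2)"
proof -
 let ?z = "\<lambda>j. v j - (\<Sum>b<m. ip p (w b) v * w b j)"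
 have "ip p ?z ?z = ip p v ?z - (\<Sum>b<m. ip p (w b) v * ip p (w b) ?z)"
  by (simp only: ip_diff_left ip_sum_left ip_scale_left)
 also have "(\<Sum>b<m. ip p (w b) v * ip p (w b) ?z) = 0"
  by (intro sum.neutral) (use ip_residual[OF assms] in auto)
 finally show ?thesis by (simp add: ip_simps power2_eq_square ip_commute)
qed

lemma Bessel:
 assumes "orthonormal p m w"
 shows "(\<Sum>b<m. (ip p (w b) v)\<^sup>2) <= ip p v v"
 using ip_residual_self[OF assms, of v] ip_self_nonneg[of p "\<lambda>j. v j - (\<Sum>b<m. ip p (w b) v * w b j)"]
 by linarith

lemma ip_delta: "j < p ==> ip p u (\<lambda>i. if i = j then 1 else 0) = u j"
 by (simp add: ip_def if_distrib cong: if_cong)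

lemma Bessel_coord:
 assumes "orthonormal p m w" "j < p"
 shows "(\<Sum>b<m. (w b j)\<^sup>2) <= 1"
 using Bessel[OF assms(1), of "\<lambda>i. if i = j then 1 else 0"] assms(2) by (simp add: ip_delta)

lemma orthonormal_card: "orthonormal p m w ==> m <= p"
proof -
 assume o: "orthonormal p m w"
 have "real m = (\<Sum>b<m. ip p (w b) (w b))" using o by (simp add: orthonormal_def)
 also have "... = (\<Sum>j<p. \<Sum>b<m. (w b j)\<^sup>2)" by (simp add: ip_self_eq, rule sum.swap)
 also have "... <= (\<Sum>j<p. 1)" by (intro sum_mono Bessel_coord[OF o]) auto
 finally show ?thesis by simp
qed

text \<open>If every coordinate vector lay in the span, summing the coordinatewise Bessel sums would
  give p <= m. The normalised residual of one that does not is the new vector.\<close>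

lemma orthonormal_extend:
 assumes o: "orthonormal p m w" and m: "m < p"
 shows "\<exists>u. ip p u u = 1 \<and> (\<forall>a<m. ip p (w a) u = 0) \<and> (\<forall>j\<ge>p. u j = 0)"
proof -
 let ?e = "\<lambda>j i. (if i = j then 1 else 0 :: real)"
 have "\<exists>j<p. (\<Sum>b<m. (w b j)\<^sup>2) < 1"
 proof (rule ccontr)
  assume "\<not> ?thesis"
  hence "(\<Sum>j<p. 1) <= (\<Sum>j<p. \<Sum>b<m. (w b j)\<^sup>2)" by (intro sum_mono) auto
  also have "... = (\<Sum>b<m. ip p (w b) (w b))" by (simp add: ip_self_eq, rule sum.swap)
  also have "... = real m" using o by (simp add: orthonormal_def)
  finally show False using m by (simp)
 qed
 then obtain j where j: "j < p" "(\<Sum>b<m. (w b j)\<^sup>2) < 1" by blast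
 define z where "z i = ?e j i - (\<Sum>b<m. ip p (w b) (?e j)*w b i)" for i
 define c where "c = ip p z z"
 have zw: "ip p (w a) z = 0" if "a < m" for a unfolding z_def using ip_residual[OF o that] by simp
 have "c = ip p (?e j) (?e j) - (\<Sum>b<m. (ip p (w b) (?e j))\<^sup>2)"
  unfolding c_def z_def using ip_residual_self[OF o] by simp
 also have "... = 1 - (\<Sum>b<m. (w b j)\<^sup>2)" using j by (simp add: ip_delta)
 finally have c: "c > 0" using j by simp
 define u where "u i = (if i < p then z i / sqrt c else 0)" for i
 have "ip p u u = ip p (\<lambda>i. z i / sqrt c) (\<lambda>i. z i / sqrt c)" by (rule ip_cong) (auto simp: u_def)
 also have "... = 1" using c by (simp add: ip_simps c_def[symmetric])
 finally have "ip p u u = 1" .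
 moreover have "ip p (w a) u = 0" if "a < m" for a
 proof -
  have "ip p (w a) u = ip p (w a) (\<lambda>i. z i / sqrt c)" by (rule ip_cong) (auto simp: u_def)
  thus ?thesis using zw[OF that] by (simp add: ip_simps)
 qed
 moreover have "\<forall>j\<ge>p. u j = 0" by (simp add: u_def)
 ultimately show ?thesis by blast
qed

lemma compact_fun_box: "compact {u :: nat => real. (\<forall>j<p. \<bar>u j\<bar> <= 1) \<and> (\<forall>j\<ge>p. u j = 0)}"
proof -
 have "{u :: nat => real. (\<forall>j<p. \<bar>u j\<bar> <= 1) \<and> (\<forall>j\<ge>p. u j = 0)}
   = Pi\<^sub>E UNIV (\<lambda>j. if j < p then {-1..1} else {0})"
  (is "?L = ?R")
 proof (intro Set.set_eqI)
  fix u :: "nat => real"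
  have "u \<in> ?R \<longleftrightarrow> (\<forall>j. u j \<in> (if j < p then {-1..1} else {0}))" by (simp add: PiE_iff)
  also have "... \<longleftrightarrow> (\<forall>j. (j < p --> \<bar>u j\<bar> <= 1) \<and> (j \<ge> p --> u j = 0))"
   by (rule all_cong1) (auto simp: abs_le_iff)
  also have "... \<longleftrightarrow> u \<in> ?L" by auto
  finally show "u \<in> ?L \<longleftrightarrow> u \<in> ?R" by simp
 qed
 moreover have "compactin (product_topology (\<lambda>_. euclidean) UNIV) (Pi\<^sub>E (UNIV :: nat set) (\<lambda>j. if j < p then {-1..1} else {0 :: real}))"
  by (subst compactin_PiE) (auto simp: compactin_euclidean_iff)
 ultimately show ?thesis by (simp add: euclidean_product_topology flip: compactin_euclidean_iff)
qed

lemma ip_app_sym: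
 assumes "\<forall>j<p. \<forall>k<p. A j k = A k j"
 shows "ip p (app p A u) v = ip p u (app p A v)"
proof -
 have "ip p (app p A u) v = (\<Sum>j<p. \<Sum>k<p. A j k*u k * v j)"
  by (simp add: ip_def app_def sum_distrib_right)
 also have "... = (\<Sum>k<p. \<Sum>j<p. A j k*u k * v j)" by (rule sum.swap)
 also have "... = (\<Sum>k<p. \<Sum>j<p. u k*(A k j * v j))"
  by (intro sum.cong refl) (use assms in auto)
 also have "... = ip p u (app p A v)" by (simp add: ip_def app_def sum_distrib_left)
 finally show ?thesis .
qed

lemma app_add_scale: "app p A (\<lambda>j. u j + t * v j) = (\<lambda>j. app p A u j + t*app p A v j)"
 by (rule ext) (simp add: app_def algebra_simps sum.distrib sum_distrib_left)

text \<open>The quadratic form is maximised over the unit vectors orthogonal to the eigenvectors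
  already found, and a vanishing first variation makes the maximiser an eigenvector. Compactness is
  that of a cube of functions vanishing from \<open>p\<close> on.\<close>

lemma spectral_step:
 assumes sym: "\<forall>j<p. \<forall>k<p. A j k = A k j"
  and o: "orthonormal p m w" and m: "m < p"
  and eig: "\<forall>a<m. \<forall>j<p. app p A (w a) j = l a*w a j"
 shows "\<exists>v lam. ip p v v = 1 \<and> (\<forall>a<m. ip p (w a) v = 0) \<and> (\<forall>j<p. app p A v j = lam * v j) \<and>
  (\<forall>u. ip p u u = 1 \<and> (\<forall>a<m. ip p (w a) u = 0) --> ip p u (app p A u) <= lam)"
proof -
 define K where "K = {u :: nat => real. (\<forall>j<p. \<bar>u j\<bar> <= 1) \<and> (\<forall>j\<ge>p. u j = 0)}"
 define S where "S = K \<inter> ({u. ip p u u = 1} \<inter> (\<Inter>a\<in>{..<m}. {u. ip p (w a) u = 0}))"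
 have cont: "continuous_on UNIV (\<lambda>u. ip p u u)" "!!a. continuous_on UNIV (\<lambda>u. ip p (w a) u)"
  "continuous_on UNIV (\<lambda>u. ip p u (app p A u))"
  unfolding ip_def app_def by (intro continuous_intros continuous_on_product_coordinates)+
 have cl: "closed ({u. ip p u u = 1} \<inter> (\<Inter>a\<in>{..<m}. {u. ip p (w a) u = 0}))"
  by (intro closed_Int closed_INT ballI closed_Collect_eq cont continuous_on_const)
 have "compact S" unfolding S_def
  by (rule compact_Int_closed[OF _ cl]) (simp add: K_def compact_fun_box)
 moreover have inK: "u \<in> K" if "ip p u u = 1" "\<forall>j\<ge>p. u j = 0" for u
 proof -
  have "(u j)^2 <= 1" if "j < p" for j
   using that \<open>ip p u u = 1\<close> member_le_sum[of j "{..<p}" "\<lambda>j. (u j)\<^sup>2"] by (simp add: ip_self_eq)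
  thus ?thesis using that by (auto simp: K_def abs_square_le_1)
 qed
 moreover have "S ~= {}"
  using orthonormal_extend[OF o m] inK unfolding S_def by blast
 ultimately obtain v where v: "v \<in> S" "!!u. u \<in> S ==> ip p u (app p A u) <= ip p v (app p A v)"
  using continuous_attains_sup[of S "\<lambda>u. ip p u (app p A u)"] cont(3)
  by (meson continuous_on_subset subset_UNIV)
 define lam where "lam = ip p v (app p A v)"
 have v1: "ip p v v = 1" and vw: "!!a. a < m ==> ip p (w a) v = 0" using v(1) by (auto simp: S_def)
 have max1: "ip p u (app p A u) <= lam" if "ip p u u = 1" "\<forall>a<m. ip p (w a) u = 0" for u
 proof -
  define u' where "u' j = (if j < p then u j else 0)" for j
  have eq: "!!x. ip p u' x = ip p u x" "!!x. ip p x u' = ip p x u" "app p A u' = app p A u"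
   by (auto simp: u'_def ip_def app_def fun_eq_iff intro!: sum.cong)
  have "u' \<in> S" unfolding S_def using inK[of u'] that by (auto simp: eq) (simp add: u'_def)
  thus ?thesis using v(2)[of u'] by (simp add: eq lam_def)
 qed
 have maxc: "ip p u (app p A u) <= lam*ip p u u" if "\<forall>a<m. ip p (w a) u = 0" for u
 proof (cases "ip p u u = 0")
  case True
  hence "u j = 0" if "j < p" for j using that by (rule ip_self_0)
  hence "ip p u (app p A u) = 0" by (simp add: ip_def)
  thus ?thesis using True by simp
 next
  case False
  hence c: "ip p u u > 0" using ip_self_nonneg[of p u] by linarith
  let ?c = "sqrt (ip p u u)"
  let ?u = "\<lambda>j. (1 / ?c)*u j"
  have a: "app p A ?u = (\<lambda>j. (1 / ?c)*app p A u j)"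
   by (rule ext) (simp add: app_def sum_divide_distrib)
  have "ip p ?u ?u = 1" unfolding ip_scale_left ip_scale_right using c by simp
  moreover have "\<forall>a<m. ip p (w a) ?u = 0" unfolding ip_scale_right using that by simp
  ultimately have "ip p ?u (app p A ?u) <= lam" by (rule max1)
  hence "ip p u (app p A u)/ip p u u <= lam"
   unfolding a ip_scale_left ip_scale_right using c by simp
  thus ?thesis using c by (simp add: field_simps)
 qed
 define z where "z j = app p A v j - lam * v j" for j
 have zv: "ip p v z = 0" unfolding z_def ip_diff_right ip_scale_right v1 by (simp add: lam_def)
 have zw: "ip p (w a) z = 0" if "a < m" for a
 proof -
  have "ip p (w a) (app p A v) = ip p (app p A (w a)) v" by (rule ip_app_sym[of p A, OF sym, symmetric])
  also have "... = ip p (\<lambda>j. l a*w a j) v" by (rule ip_cong) (use eig that in auto)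
  finally show ?thesis unfolding z_def ip_diff_right ip_scale_right ip_scale_left using vw[OF that] by simp
 qed
 have Bz: "ip p v (app p A z) = ip p z z"
 proof -
  have "ip p v (app p A z) = ip p (app p A v) z" using ip_app_sym[of p A, OF sym] by metis
  also have "... = ip p (\<lambda>j. z j + lam * v j) z" by (simp add: z_def)
  also have "... = ip p z z" unfolding ip_add_left ip_scale_left using zv by simp
  finally show ?thesis .
 qed
 \<comment> \<open>The maximiser is perturbed along its own residual \<open>z\<close>. The
   inequality has a linear term 2 t |z|^2 on the left and a quadratic one on the right, so a small
   positive \<open>t\<close> forces z = 0.\<close>
 have key: "2*t*ip p z z <= t^2*(lam*ip p z z - ip p z (app p A z))" for t
 proof -
  let ?u = "\<lambda>j. v j + t*z j"
  have "\<forall>a<m. ip p (w a) ?u = 0" unfolding ip_add_right ip_scale_right using vw zw by simp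
  hence "ip p ?u (app p A ?u) <= lam*ip p ?u ?u" by (rule maxc)
  moreover have "ip p z (app p A v) = ip p z z"
   using Bz ip_app_sym[of p A v z, OF sym] by (metis ip_commute)
  ultimately show ?thesis
   unfolding app_add_scale ip_add_left ip_add_right ip_scale_left ip_scale_right
   using zv Bz v1 ip_commute[of p z v] lam_def[symmetric]
   by (simp add: algebra_simps power2_eq_square)
 qed
 have "ip p z z = 0"
 proof (rule ccontr)
  assume "ip p z z ~= 0"
  hence pos: "ip p z z > 0" using ip_self_nonneg[of p z] by linarith
  define D where "D = \<bar>lam*ip p z z - ip p z (app p A z)\<bar> + 1"
  have D: "D > 0" by (simp add: D_def)
  define t where "t = ip p z z/D"
  have t: "t > 0" using pos D by (simp add: t_def)
  have "2*t*ip p z z <= t^2*(lam*ip p z z - ip p z (app p A z))" by (rule key)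
  also have "... <= t^2*D" by (intro mult_left_mono) (auto simp: D_def)
  also have "... = t*ip p z z" using D by (simp add: t_def power2_eq_square)
  finally show False using t pos by simp
 qed
 hence "\<forall>j<p. app p A v j = lam * v j" using ip_self_0[of p z] by (auto simp: z_def)
 thus ?thesis using v1 vw max1 by blast
qed

lemma spectral_aux:
 assumes sym: "\<forall>j<p. \<forall>k<p. A j k = A k j" and "m <= p"
 shows "\<exists>w l. orthonormal p m w \<and> (\<forall>a<m. \<forall>j<p. app p A (w a) j = l a*w a j) \<and>
  (\<forall>a<m. \<forall>u. ip p u u = 1 \<and> (\<forall>b<a. ip p (w b) u = 0) --> ip p u (app p A u) <= l a)"
 using \<open>m <= p\<close>
proof (induction m)
 case 0
 show ?case by (simp add: orthonormal_def)
next
 case (Suc m)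
 from Suc.IH[OF Suc_leD[OF Suc.prems]] obtain w l where w: "orthonormal p m w" and e': "\<forall>a<m. \<forall>j<p. app p A (w a) j = l a*w a j"
  and mx: "\<forall>a<m. \<forall>u. ip p u u = 1 \<and> (\<forall>b<a. ip p (w b) u = 0) --> ip p u (app p A u) <= l a"
  by (elim exE conjE) (rule that)
 have e: "!!a j. a < m ==> j < p ==> app p A (w a) j = l a*w a j" using e' by blast
 from Suc.prems have "m < p" by simp
 from spectral_step[of p A m w l, OF sym w this e'] obtain v lam where v: "ip p v v = 1" "\<forall>a<m. ip p (w a) v = 0"
   "\<forall>j<p. app p A v j = lam * v j"
   "\<forall>u. ip p u u = 1 \<and> (\<forall>a<m. ip p (w a) u = 0) --> ip p u (app p A u) <= lam"
  by (elim exE conjE) (rule that)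
 let ?w = "w(m := v)" and ?l = "l(m := lam)"
 have "orthonormal p (Suc m) ?w"
 proof (unfold orthonormal_def, intro allI impI)
  fix a b assume "a < Suc m" "b < Suc m"
  then consider "a < m" "b < m" | "a < m" "b = m" | "a = m" "b < m" | "a = m" "b = m"
   by (auto simp: less_Suc_eq)
  thus "ip p (?w a) (?w b) = (if a = b then 1 else 0)"
   using v(1,2) orthonormalD[OF w] ip_commute[of p v "w b"] by cases auto
 qed
 moreover have "\<forall>a<Suc m. \<forall>j<p. app p A (?w a) j = ?l a * ?w a j"
  using e v by (auto simp: less_Suc_eq)
 moreover have "\<forall>a<Suc m. \<forall>u. ip p u u = 1 \<and> (\<forall>b<a. ip p (?w b) u = 0) --> ip p u (app p A u) <= ?l a"
  using mx v(4) by (auto simp: less_Suc_eq)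
 ultimately show ?case by blast
qed

lemma spectral_theorem:
 assumes sym: "\<forall>j<p. \<forall>k<p. A j k = A k j"
 obtains w l where "orthonormal p p w" "!!a j. a < p ==> j < p ==> app p A (w a) j = l a*w a j"
  "!!a b. a <= b ==> b < p ==> l b <= l a"
proof -
 from spectral_aux[of p A p, OF sym order_refl] obtain w l where w: "orthonormal p p w"
  and e': "\<forall>a<p. \<forall>j<p. app p A (w a) j = l a*w a j"
  and mx: "\<forall>a<p. \<forall>u. ip p u u = 1 \<and> (\<forall>b<a. ip p (w b) u = 0) --> ip p u (app p A u) <= l a"
  by (elim exE conjE) (rule that)
 have e: "!!a j. a < p ==> j < p ==> app p A (w a) j = l a*w a j" using e' by blast
 have "l b <= l a" if ab: "a <= b" "b < p" for a b
 proof -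
  have "ip p (w b) (app p A (w b)) = ip p (w b) (\<lambda>j. l b*w b j)"
   by (rule ip_cong) (use e ab in auto)
  also have "... = l b" unfolding ip_scale_right using w ab by (simp add: orthonormal_def)
  finally show ?thesis using mx[rule_format, of a "w b"] w ab by (auto simp: orthonormal_def)
 qed
 thus ?thesis using that w e by blast
qed

text \<open>A left inverse of a square matrix is a right inverse, so orthonormal columns have
  orthonormal rows.\<close>

lemma orthonormal_complete:
 assumes w: "orthonormal p p w" and ij: "i < p" "j < p"
 shows "(\<Sum>a<p. w a i*w a j) = (if i = j then 1 else 0)"
proof -
 define W where "W = mat p p (\<lambda>(i, a). w a i)"
 have c: "W \<in> carrier_mat p p" "transpose_mat W \<in> carrier_mat p p" by (auto simp: W_def)
 have "transpose_mat W*W = 1\<^sub>m p"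
 proof (rule eq_matI)
  fix a b assume "a < dim_row (1\<^sub>m p :: real mat)" "b < dim_col (1\<^sub>m p :: real mat)"
  hence ab: "a < p" "b < p" by auto
  thus "(transpose_mat W*W) $$ (a, b) = 1\<^sub>m p $$ (a, b)"
   using orthonormalD[OF w ab] by (simp add: W_def scalar_prod_def ip_def atLeast0LessThan)
 qed (auto simp: W_def)
 hence "W*transpose_mat W = 1\<^sub>m p"
  using mat_mult_left_right_inverse[OF c(2) c(1)] by simp
 hence "(W*transpose_mat W) $$ (i, j) = (if i = j then 1 else 0)" using ij by simp
 thus ?thesis using ij by (simp add: W_def scalar_prod_def atLeast0LessThan)
qed

lemma orthonormal_expand:
 assumes w: "orthonormal p p w"
 shows "ip p u v = (\<Sum>a<p. ip p (w a) u*ip p (w a) v)"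
proof -
 have "(\<Sum>a<p. ip p (w a) u*ip p (w a) v) = (\<Sum>a<p. \<Sum>i<p. \<Sum>j<p. (w a i*w a j)*(u i * v j))"
  by (simp add: ip_def sum_product mult_ac)
 also have "... = (\<Sum>i<p. \<Sum>a<p. \<Sum>j<p. (w a i*w a j)*(u i * v j))" by (rule sum.swap)
 also have "... = (\<Sum>i<p. \<Sum>j<p. \<Sum>a<p. (w a i*w a j)*(u i * v j))"
  by (rule sum.cong[OF refl], rule sum.swap)
 also have "... = (\<Sum>i<p. \<Sum>j<p. (if i = j then 1 else 0)*(u i * v j))"
  by (intro sum.cong refl) (simp add: orthonormal_complete[OF w] flip: sum_distrib_right)
 also have "... = ip p u v" by (simp add: ip_def if_distrib[of "\<lambda>x. x*_"] cong: if_cong)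
 finally show ?thesis by simp
qed

text \<open>Multiplicities matter here: conjugation to a diagonal matrix identifies the whole list
  of roots of the characteristic polynomial, not just their set.\<close>

lemma char_poly_orthonormal_eigen:
 assumes w: "orthonormal p p w" and A: "A \<in> carrier_mat p p"
  and e: "!!a j. a < p ==> j < p ==> app p (\<lambda>j k. A $$ (j, k)) (w a) j = l a*w a j"
 shows "char_poly A = (\<Prod>a\<leftarrow>map l [0..<p]. [:- a, 1:])"
proof -
 define W where "W = mat p p (\<lambda>(i, a). w a i)"
 define D where "D = mat p p (\<lambda>(a, b). if a = b then l a else 0)"
 have c: "W \<in> carrier_mat p p" "transpose_mat W \<in> carrier_mat p p" "D \<in> carrier_mat p p"
  by (auto simp: W_def D_def)
 have 1: "transpose_mat W*W = 1\<^sub>m p"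
 proof (rule eq_matI)
  fix a b assume "a < dim_row (1\<^sub>m p :: real mat)" "b < dim_col (1\<^sub>m p :: real mat)"
  hence ab: "a < p" "b < p" by auto
  thus "(transpose_mat W*W) $$ (a, b) = 1\<^sub>m p $$ (a, b)"
   using orthonormalD[OF w ab] by (simp add: W_def scalar_prod_def ip_def atLeast0LessThan)
 qed (auto simp: W_def)
 hence 2: "W*transpose_mat W = 1\<^sub>m p"
  using mat_mult_left_right_inverse[OF c(2) c(1)] by simp
 have AW: "A*W = W*D"
 proof (rule eq_matI)
  fix j a assume "j < dim_row (W*D)" "a < dim_col (W*D)"
  hence ja: "j < p" "a < p" using c by auto
  have "(A*W) $$ (j, a) = app p (\<lambda>j k. A $$ (j, k)) (w a) j"
   using ja A by (simp add: W_def scalar_prod_def app_def atLeast0LessThan)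
  also have "... = l a*w a j" using e ja by simp
  also have "... = (W*D) $$ (j, a)"
   using ja by (simp add: W_def D_def scalar_prod_def atLeast0LessThan if_distrib cong: if_cong)
  finally show "(A*W) $$ (j, a) = (W*D) $$ (j, a)" .
 qed (use A c in auto)
 have "A = A*(W*transpose_mat W)" using A 2 by simp
 also have "... = W*D*transpose_mat W"
  using A c AW assoc_mult_mat[of A p p W p "transpose_mat W" p] by simp
 finally have "similar_mat_wit A D W (transpose_mat W)"
  using similar_mat_witI[OF 2 1 _ A c(3) c(1) c(2)] by blast
 hence "similar_mat A D" unfolding similar_mat_def by blast
 moreover have "upper_triangular D" by (auto simp: D_def)
 moreover have "diag_mat D = map l [0..<p]" by (auto simp: diag_mat_def D_def)
 ultimately show ?thesis
  using char_poly_similar char_poly_upper_triangular[OF c(3)] by metis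
qed

text \<open>The squared length of the data matrix applied to \<open>w\<close>, that is,
  \<open>n\<close> times the quadratic form of the sample covariance. The factor 1/n stays with the
  eigenvalues.\<close>

definition qf :: "nat => nat => (nat => nat => real) => (nat => real) => real" where
 "qf n p X w = (\<Sum>i=1..n. (ip p (X i) w)\<^sup>2)"

definition bf :: "nat => nat => (nat => nat => real) => (nat => real) => (nat => real) => real" where
 "bf n p X u v = (\<Sum>i=1..n. ip p (X i) u*ip p (X i) v)"

text \<open>All that is used about the spectrum, phrased through the bilinear form instead of a
  matrix: a full orthonormal basis of eigenvectors with decreasing eigenvalues, zeros
  included.\<close>

definition eigen_system ::
  "nat => nat => (nat => nat => real) => (nat => nat => real) => (nat => real) => bool" where
 "eigen_system n p X w l \<longleftrightarrow> orthonormal p p w \<and> (\<forall>a<p. 0 <= l a) \<and>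
   (\<forall>b<p. \<forall>a\<le>b. l b <= l a) \<and> (\<forall>a<p. \<forall>u. bf n p X (w a) u = real n*l a*ip p (w a) u) \<and>
   (\<forall>k\<le>p. partial_sum n p k X = (\<Sum>a<k. l a))"

lemma qf_eq_bf: "qf n p X w = bf n p X w w"
 by (simp add: qf_def bf_def power2_eq_square)

lemma qf_nonneg [simp]: "0 <= qf n p X w"
 by (simp add: qf_def sum_nonneg)

text \<open>In a decreasing list of nonnegative numbers the zeros stand at the end and add nothing.
  This reconciles \<open>partial_sum\<close>, which lists nonzero eigenvalues, with the full
  spectrum.\<close>

lemma sum_list_take_filter_nonzero:
 fixes xs :: "real list"
 assumes "sorted_wrt (\<ge>) xs" "\<forall>x\<in>set xs. 0 <= x"
 shows "sum_list (take k (filter (\<lambda>x. x ~= 0) xs)) = sum_list (take k xs)"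
 using assms
proof (induction xs arbitrary: k)
 case (Cons x xs)
 show ?case
 proof (cases "x = 0")
  case True
  hence z: "\<forall>y\<in>set (x # xs). y = 0" using Cons.prems by force
  hence "filter (\<lambda>x. x ~= 0) (x # xs) = []" by (auto simp: filter_empty_conv)
  moreover have "sum_list (take k (x # xs)) = 0"
   using z by (intro sum_list_neutral) (metis in_set_takeD)
  ultimately show ?thesis by simp
 next
  case False
  thus ?thesis using Cons by (cases k) auto
 qed
qed simp

lemma nonzero_eigenvalues_sorted:
 assumes cp: "char_poly A = (\<Prod>a\<leftarrow>xs. [:- a, 1:])" and xs: "sorted_wrt (\<ge>) xs"
 shows "nonzero_eigenvalues A = filter (\<lambda>x. x ~= 0) xs"
proof -
 have "proots (char_poly A) = mset xs"
  unfolding cp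
 proof (induction xs)
  case (Cons x xs)
  have "(\<Prod>a\<leftarrow>xs. [:- a, 1:]) ~= 0" by (auto simp: prod_list_zero_iff)
  hence "proots ([:- x, 1:] * (\<Prod>a\<leftarrow>xs. [:- a, 1:])) = proots [:- x, 1:] + proots (\<Prod>a\<leftarrow>xs. [:- a, 1:])"
   by (intro proots_mult) auto
  thus ?case using Cons by (simp del: mult_pCons_left)
 qed simp
 hence "filter_mset (\<lambda>x. x ~= 0) (proots (char_poly A)) = mset (filter (\<lambda>x. x ~= 0) xs)" by simp
 moreover have "sort (filter (\<lambda>x. x ~= 0) xs) = rev (filter (\<lambda>x. x ~= 0) xs)"
  by (rule properties_for_sort) (use xs in \<open>auto simp: sorted_wrt_rev intro: sorted_wrt_filter\<close>)
 ultimately show ?thesis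
  unfolding nonzero_eigenvalues_def by (simp only: sorted_list_of_multiset_mset rev_rev_ident)
qed

lemma bf_conv_app:
 assumes "n \<ge> 1"
 shows "bf n p X u v = real n*ip p (app p (\<lambda>j k. sample_cov n p X $$ (j, k)) u) v"
proof -
 have "bf n p X u v = (\<Sum>i=1..n. \<Sum>j<p. \<Sum>k<p. X i j*X i k*u k * v j)"
  unfolding bf_def ip_def sum_product
  by (rule sum.cong[OF refl], subst sum.swap) (simp add: mult_ac)
 also have "... = (\<Sum>j<p. \<Sum>i=1..n. \<Sum>k<p. X i j*X i k*u k * v j)" by (rule sum.swap)
 also have "... = (\<Sum>j<p. \<Sum>k<p. \<Sum>i=1..n. X i j*X i k*u k * v j)"
  by (rule sum.cong[OF refl], rule sum.swap)
 also have "... = (\<Sum>j<p. \<Sum>k<p. real n*(sample_cov n p X $$ (j, k)*u k * v j))"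
  using assms by (intro sum.cong refl) (simp add: sample_cov_def sum_distrib_right)
 also have "... = real n*ip p (app p (\<lambda>j k. sample_cov n p X $$ (j, k)) u) v"
  by (simp add: ip_def app_def sum_distrib_left sum_distrib_right)
 finally show ?thesis .
qed

lemma eigen_system_exists:
 assumes n: "n \<ge> 1"
 obtains w l where "eigen_system n p X w l"
proof -
 let ?A = "sample_cov n p X"
 let ?a = "\<lambda>j k. ?A $$ (j, k)"
 have sym: "\<forall>j<p. \<forall>k<p. ?a j k = ?a k j" by (simp add: sample_cov_def mult.commute)
 obtain w l where w: "orthonormal p p w" and e: "!!a j. a < p ==> j < p ==> app p ?a (w a) j = l a*w a j"
  and mono: "!!a b. a <= b ==> b < p ==> l b <= l a" using spectral_theorem[OF sym] by blast
 have b: "bf n p X (w a) u = real n*l a*ip p (w a) u" if "a < p" for a u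
 proof -
  have "ip p (app p ?a (w a)) u = ip p (\<lambda>j. l a*w a j) u" by (rule ip_cong) (use e that in auto)
  thus ?thesis using n by (simp add: bf_conv_app ip_scale_left)
 qed
 have nn: "0 <= l a" if "a < p" for a
 proof -
  have "0 <= bf n p X (w a) (w a)" by (simp flip: qf_eq_bf)
  thus ?thesis using b[OF that] n that w by (simp add: orthonormal_def zero_le_mult_iff)
 qed
 have srt: "sorted_wrt (\<ge>) (map l [0..<p])"
  by (auto simp: sorted_wrt_iff_nth_less intro: mono)
 have "char_poly ?A = (\<Prod>a\<leftarrow>map l [0..<p]. [:- a, 1:])"
  by (rule char_poly_orthonormal_eigen[OF w _ e]) (auto simp: sample_cov_def)
 hence ne: "nonzero_eigenvalues ?A = filter (\<lambda>x. x ~= 0) (map l [0..<p])"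
  using srt by (rule nonzero_eigenvalues_sorted)
 have "partial_sum n p k X = (\<Sum>a<k. l a)" if "k <= p" for k
 proof -
  have "partial_sum n p k X = sum_list (take k (map l [0..<p]))"
   unfolding partial_sum_def ne
   by (rule sum_list_take_filter_nonzero[OF srt]) (use nn in auto)
  also have "take k (map l [0..<p]) = map l [0..<k]" using that by (simp add: take_map)
  finally show ?thesis by (simp add: interv_sum_list_conv_sum_set_nat atLeast0LessThan)
 qed
 thus ?thesis using that[of w l] w b nn mono by (auto simp: eigen_system_def)
qed

context
 fixes n p X w l
 assumes es: "eigen_system n p X w l"
begin

lemma es_orthonormal: "orthonormal p p w"
 and es_nonneg: "a < p ==> 0 <= l a"
 and es_antimono: "a <= b ==> b < p ==> l b <= l a"
 and es_bf: "a < p ==> bf n p X (w a) u = real n*l a*ip p (w a) u"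
 and es_partial_sum: "k <= p ==> partial_sum n p k X = (\<Sum>a<k. l a)"
 using es by (auto simp: eigen_system_def)

lemma es_qf: "a < p ==> qf n p X (w a) = real n*l a"
 using es_bf[of a "w a"] es_orthonormal by (simp add: qf_eq_bf orthonormal_def)

lemma es_qf_expand: "qf n p X u = real n*(\<Sum>a<p. l a*(ip p (w a) u)^2)"
proof -
 have "ip p (X i) u = (\<Sum>a<p. ip p (w a) u*ip p (X i) (w a))" for i
  using orthonormal_expand[OF es_orthonormal, of "X i" u] by (simp add: ip_commute mult.commute)
 hence "qf n p X u = (\<Sum>i=1..n. ip p (X i) u*(\<Sum>a<p. ip p (w a) u*ip p (X i) (w a)))"
  by (simp add: qf_def power2_eq_square)
 also have "... = (\<Sum>a<p. ip p (w a) u*bf n p X (w a) u)"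
  unfolding sum_distrib_left bf_def by (subst sum.swap) (simp add: mult_ac)
 also have "... = (\<Sum>a<p. real n*(l a*(ip p (w a) u)^2))"
  by (intro sum.cong refl) (simp add: es_bf power2_eq_square)
 finally show ?thesis by (simp add: sum_distrib_left)
qed

end

text \<open>The weight \<open>t a\<close> is the squared length of the projection of the
  \<open>a\<close>-th eigenvector onto the span of \<open>u\<close>. The weights lie in [0,1] and
  sum to \<open>k\<close>, so against a decreasing sequence the best choice is weight 1 on the first
  \<open>k\<close>. The comparison is made relative to the pivot \<open>l (k - 1)\<close>, where
  every summand has a sign.\<close>

lemma Ky_Fan:
 assumes n: "n \<ge> 1" and u: "orthonormal p k u"
 shows "(\<Sum>m<k. qf n p X (u m)) <= real n*partial_sum n p k X"
proof (cases "k = 0")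
 case True
 thus ?thesis by (simp add: partial_sum_def)
next
 case False
 have kp: "k <= p" using orthonormal_card[OF u] .
 obtain w l where es: "eigen_system n p X w l" using eigen_system_exists[OF n] .
 define t where "t a = (\<Sum>m<k. (ip p (w a) (u m))\<^sup>2)" for a
 have t0: "0 <= t a" for a by (simp add: t_def sum_nonneg)
 have t1: "t a <= 1" if "a < p" for a
 proof -
  have "t a = (\<Sum>m<k. (ip p (u m) (w a))\<^sup>2)" unfolding t_def by (simp only: ip_commute)
  thus ?thesis using Bessel[OF u, of "w a"] es_orthonormal[OF es] that by (simp add: orthonormal_def)
 qed
 have "(\<Sum>a<p. t a) = (\<Sum>m<k. \<Sum>a<p. (ip p (w a) (u m))\<^sup>2)" unfolding t_def by (rule sum.swap)
 also have "... = (\<Sum>m<k. ip p (u m) (u m))"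
  by (simp add: orthonormal_expand[OF es_orthonormal[OF es], of "u m" "u m" for m] power2_eq_square)
 also have "... = real k" using u by (simp add: orthonormal_def)
 finally have ts: "(\<Sum>a<p. t a) = real k" .
 have ind: "(\<Sum>a<p. f a*(if a < k then 1 else 0)) = (\<Sum>a<k. f a)" for f :: "nat => real"
 proof -
  have "(\<Sum>a<p. f a*(if a < k then 1 else 0)) = (\<Sum>a\<in>{..<p} \<inter> {a. a < k}. f a)"
   by (subst sum.inter_restrict) (auto intro!: sum.cong)
  also have "{..<p} \<inter> {a. a < k} = {..<k}" using kp by auto
  finally show ?thesis .
 qed
 have "(\<Sum>a<p. (l a - l (k - 1))*(t a - (if a < k then 1 else 0))) <= 0"
 proof (intro sum_nonpos)
  fix a assume "a \<in> {..<p}"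
  hence a: "a < p" by simp
  show "(l a - l (k - 1))*(t a - (if a < k then 1 else 0)) <= 0"
  proof (cases "a < k")
   case True
   hence "l (k - 1) <= l a" using es_antimono[OF es, of a "k - 1"] kp False by auto
   thus ?thesis using t1[OF a] True by (simp add: mult_nonneg_nonpos)
  next
   case nk: False
   hence "l a <= l (k - 1)" using es_antimono[OF es, of "k - 1" a] a by auto
   thus ?thesis using t0[of a] nk by (simp add: mult_nonpos_nonneg)
  qed
 qed
 moreover have "(\<Sum>a<p. (l a - l (k - 1))*(t a - (if a < k then 1 else 0)))
   = (\<Sum>a<p. l a*t a) - (\<Sum>a<p. l a*(if a < k then 1 else 0))
    - l (k - 1)*((\<Sum>a<p. t a) - (\<Sum>a<p. 1*(if a < k then 1 else 0)))"
  by (simp only: left_diff_distrib right_diff_distrib sum_subtractf sum_distrib_left mult_1)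
 ultimately have "(\<Sum>a<p. l a*t a) <= (\<Sum>a<k. l a)"
  unfolding ind ts by simp
 moreover have "(\<Sum>m<k. qf n p X (u m)) = real n*(\<Sum>a<p. l a*t a)"
 proof -
  have "(\<Sum>m<k. qf n p X (u m)) = real n*(\<Sum>m<k. \<Sum>a<p. l a*(ip p (w a) (u m))^2)"
   by (simp add: es_qf_expand[OF es] sum_distrib_left)
  also have "(\<Sum>m<k. \<Sum>a<p. l a*(ip p (w a) (u m))^2) = (\<Sum>a<p. \<Sum>m<k. l a*(ip p (w a) (u m))^2)"
   by (rule sum.swap)
  finally show ?thesis by (simp add: t_def sum_distrib_left)
 qed
 ultimately show ?thesis using es_partial_sum[OF es kp] by (simp add: mult_left_mono)
qed

lemma Ky_Fan_attained:
 assumes "n \<ge> 1" "k <= p" "eigen_system n p X w l"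
 shows "(\<Sum>m<k. qf n p X (w m)) = real n*partial_sum n p k X"
 using assms(2) es_qf[OF assms(3)] es_partial_sum[OF assms(3,2)] by (simp add: sum_distrib_left)

lemma sum_qf_orthonormal:
 assumes "orthonormal p p w"
 shows "(\<Sum>a<p. qf n p X (w a)) = (\<Sum>i=1..n. \<Sum>j<p. (X i j)\<^sup>2)"
proof -
 have "(\<Sum>a<p. qf n p X (w a)) = (\<Sum>i=1..n. \<Sum>a<p. (ip p (X i) (w a))\<^sup>2)"
  unfolding qf_def by (rule sum.swap)
 also have "... = (\<Sum>i=1..n. ip p (X i) (X i))"
  by (intro sum.cong refl) (simp add: orthonormal_expand[OF assms, of "X i" "X i" for i] power2_eq_square ip_commute)
 finally show ?thesis by (simp add: ip_self_eq)
qed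

lemma partial_sum_nonneg: "n \<ge> 1 ==> k <= p ==> 0 <= partial_sum n p k X"
proof -
 assume n: "n \<ge> 1" and k: "k <= p"
 obtain w l where es: "eigen_system n p X w l" using eigen_system_exists[OF n] .
 show ?thesis using es_nonneg[OF es] k by (subst es_partial_sum[OF es k]) (intro sum_nonneg, auto)
qed

lemma partial_sum_le_trace:
 assumes n: "n \<ge> 1" and k: "k <= p"
 shows "real n*partial_sum n p k X <= (\<Sum>i=1..n. \<Sum>j<p. (X i j)\<^sup>2)"
proof -
 obtain w l where es: "eigen_system n p X w l" using eigen_system_exists[OF n] .
 have "(\<Sum>m<k. qf n p X (w m)) <= (\<Sum>m<p. qf n p X (w m))"
  by (rule sum_mono2) (use k in auto)
 thus ?thesis using Ky_Fan_attained[OF n k es] sum_qf_orthonormal[OF es_orthonormal[OF es]] by simp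
qed

text \<open>The rank is at most \<open>n\<close>: were an eigenvalue of index \<open>n\<close> or
  more positive, the normalised images of n + 1 eigenvectors under the data matrix would be n + 1
  orthonormal vectors in dimension \<open>n\<close>.\<close>

lemma partial_sum_eq_trace:
 assumes n: "n \<ge> 1" and np: "n <= p"
 shows "real n*partial_sum n p n X = (\<Sum>i=1..n. \<Sum>j<p. (X i j)\<^sup>2)"
proof -
 obtain w l where es: "eigen_system n p X w l" using eigen_system_exists[OF n] .
 have z: "l a = 0" if a: "n <= a" "a < p" for a
 proof (rule ccontr)
  assume "l a ~= 0"
  hence pos: "l b > 0" if "b < Suc n" for b
   using es_antimono[OF es, of b a] es_nonneg[OF es, of a] that a by auto
  define y where "y b i = ip p (X (Suc i)) (w b) / sqrt (real n*l b)" for b i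
  have "orthonormal n (Suc n) y"
   unfolding orthonormal_def
  proof (intro allI impI)
   fix b c assume bc: "b < Suc n" "c < Suc n"
   have bcp: "b < p" "c < p" using bc a by auto
   have "ip n (y b) (y c) = (\<Sum>i<n. ip p (X (Suc i)) (w b)*ip p (X (Suc i)) (w c))/(sqrt (real n*l b) * sqrt (real n*l c))"
    by (simp add: ip_def[of n] y_def sum_divide_distrib)
   also have "(\<Sum>i<n. ip p (X (Suc i)) (w b)*ip p (X (Suc i)) (w c)) = bf n p X (w b) (w c)"
    unfolding bf_def by (simp add: sum.atLeast1_atMost_eq)
   also have "... = real n*l b*(if b = c then 1 else 0)"
    using es_bf[OF es bcp(1)] orthonormalD[OF es_orthonormal[OF es] bcp] by simp
   finally have *: "ip n (y b) (y c) = real n*l b*(if b = c then 1 else 0)/(sqrt (real n*l b) * sqrt (real n*l c))" .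
   have **: "0 < real n*l b" using pos[OF bc(1)] n by simp
   show "ip n (y b) (y c) = (if b = c then 1 else 0)"
   proof (cases "b = c")
    case True
    have "sqrt (real n*l b) * sqrt (real n*l b) = real n*l b" using ** by simp
    thus ?thesis using*pos[OF bc(1)] n True ** by auto
   qed (use*in simp)
  qed
  from orthonormal_card[OF this] show False by simp
 qed
 have "(\<Sum>a<p. l a) = (\<Sum>a<n. l a)"
  by (rule sum.mono_neutral_right) (use np z in auto)
 hence "(\<Sum>a<p. qf n p X (w a)) = real n*partial_sum n p n X"
  using es_qf[OF es] es_partial_sum[OF es np] sum_distrib_left[of "real n" l "{..<p}"] by simp
 thus ?thesis using sum_qf_orthonormal[OF es_orthonormal[OF es]] by simp
qed

section \<open>Measurability of eigenvalue sums\<close>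

lemma measurable_entry [measurable]:
 "i \<in> {1..n} ==> j < p ==> (\<lambda>X. X i j) \<in> borel_measurable (data_space n p)"
 unfolding data_space_def
 by (rule measurable_compose[where N = "PiM {..<p} (\<lambda>_. borel)" and f = "\<lambda>X. X i"])
  (rule measurable_component_singleton, simp)+

lemma borel_measurable_qf [measurable]: "(\<lambda>X. qf n p X w) \<in> borel_measurable (data_space n p)"
 unfolding qf_def ip_def
 by (intro borel_measurable_sum borel_measurable_power borel_measurable_times measurable_entry) auto

lemma continuous_on_qf_families:
 "continuous_on UNIV (\<lambda>u :: nat => nat => real. \<Sum>m<k. qf n p X (u m))"
proof -
 have "continuous_on UNIV (\<lambda>u :: nat => nat => real. u m j)" for m j
  by (rule continuous_on_product_then_coordinatewise) (rule continuous_on_product_coordinates)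
 thus ?thesis unfolding qf_def ip_def by (intro continuous_intros)
qed

text \<open>Gives measurability without a measurable choice of eigenvectors: by
  \<open>Ky_Fan\<close> the sum is a supremum over orthonormal families, and continuity in the
  family allows a countable dense set, the same for all \<open>X\<close>.\<close>

lemma partial_sum_SUP:
 assumes n: "n \<ge> 1" and k: "k <= p"
 obtains D :: "(nat => nat => real) set" where "countable D" "D ~= {}"
  "!!X. bdd_above ((\<lambda>u. (\<Sum>m<k. qf n p X (u m))/real n) ` D)"
  "!!X. partial_sum n p k X = (SUP u\<in>D. (\<Sum>m<k. qf n p X (u m))/real n)"
proof -
 obtain D where D: "countable D" "D \<subseteq> Collect (orthonormal p k)" "Collect (orthonormal p k) \<subseteq> closure D"
  using separable[of "Collect (orthonormal p k)"] by blast
 have up: "(\<Sum>m<k. qf n p X (u m))/real n <= partial_sum n p k X" if "u \<in> D" for u X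
  using Ky_Fan[OF n, of p k u X] that D(2) n by (auto simp: field_simps)
 have at: "\<exists>w\<in>closure D. (\<Sum>m<k. qf n p X (w m))/real n = partial_sum n p k X" for X
 proof -
  obtain w l where es: "eigen_system n p X w l" using eigen_system_exists[OF n] .
  have "w \<in> closure D" using D(3) orthonormal_mono[OF es_orthonormal[OF es] k] by blast
  thus ?thesis using Ky_Fan_attained[OF n k es] n by (intro bexI[of _ w]) auto
 qed
 have ne: "D ~= {}" using at by (metis closure_empty empty_iff)
 have bdd: "bdd_above ((\<lambda>u. (\<Sum>m<k. qf n p X (u m))/real n) ` D)" for X
  by (rule bdd_aboveI2[of _ _ "partial_sum n p k X"]) (rule up)
 have "partial_sum n p k X = (SUP u\<in>D. (\<Sum>m<k. qf n p X (u m))/real n)" for X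
 proof (rule antisym)
  obtain w where w: "w \<in> closure D" "(\<Sum>m<k. qf n p X (w m))/real n = partial_sum n p k X"
   using at by blast
  have "continuous_on (closure D) (\<lambda>u. (\<Sum>m<k. qf n p X (u m))/real n)"
   using n by (intro continuous_on_divide continuous_on_const continuous_on_subset[OF continuous_on_qf_families]) auto
  hence "(\<Sum>m<k. qf n p X (w m))/real n <= (SUP u\<in>D. (\<Sum>m<k. qf n p X (u m))/real n)"
   by (rule continuous_le_on_closure[OF _ w(1)]) (intro cSUP_upper bdd)
  thus "partial_sum n p k X <= (SUP u\<in>D. (\<Sum>m<k. qf n p X (u m))/real n)" using w(2) by simp
  show "(SUP u\<in>D. (\<Sum>m<k. qf n p X (u m))/real n) <= partial_sum n p k X"
   by (rule cSUP_least[OF ne up])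
 qed
 with D(1) ne bdd show ?thesis by (rule that)
qed

lemma borel_measurable_partial_sum [measurable]:
 assumes n: "n \<ge> 1" and k: "k <= p"
 shows "partial_sum n p k \<in> borel_measurable (data_space n p)"
proof -
 obtain D where D: "countable D" "D ~= {}" "!!X. bdd_above ((\<lambda>u. (\<Sum>m<k. qf n p X (u m))/real n) ` D)"
  "!!X. partial_sum n p k X = (SUP u\<in>D. (\<Sum>m<k. qf n p X (u m))/real n)"
  by (rule partial_sum_SUP[OF n k], rule that, assumption+)
 have "(\<lambda>X. SUP u\<in>D. (\<Sum>m<k. qf n p X (u m))/real n) \<in> borel_measurable (data_space n p)"
  by (rule borel_measurable_cSUP[OF D(1) _ D(3)])
   (intro borel_measurable_divide borel_measurable_sum borel_measurable_qf borel_measurable_const)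
 moreover have "partial_sum n p k = (\<lambda>X. SUP u\<in>D. (\<Sum>m<k. qf n p X (u m))/real n)"
  using D(4) by (rule ext)
 ultimately show ?thesis by (simp only:)
qed

section \<open>Eliminating one block of a Gaussian array\<close>

text \<open>Reflection in the difference of \<open>x\<close> and its norm placed at
  \<open>i0\<close>. For this \<open>u\<close> the squared norm of \<open>u\<close> is twice the
  inner product of \<open>u\<close> and \<open>x\<close>, so the coefficient in
  \<open>householder\<close> is 1. If the difference vanishes, \<open>x\<close> is already on the
  axis.\<close>

lemma householder_to_axis:
 assumes C: "finite C" "i0 \<in> C" and x: "x \<in> extensional C"
  and u: "!!k. k \<in> C ==> u k = x k - (if k = i0 then sqrt (\<Sum>j\<in>C. (x j)\<^sup>2) else 0)"
 shows "householder C u x = (\<lambda>k\<in>C. if k = i0 then sqrt (\<Sum>j\<in>C. (x j)\<^sup>2) else 0)"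
proof -
 define r where "r = sqrt (\<Sum>j\<in>C. (x j)\<^sup>2)"
 define D where "D = (\<Sum>j\<in>C. (u j)\<^sup>2)"
 have u': "u k = x k - (if k = i0 then r else 0)" if "k \<in> C" for k using u[OF that] by (simp add: r_def)
 have r2: "r^2 = (\<Sum>j\<in>C. (x j)\<^sup>2)" by (simp add: r_def sum_nonneg)
 have split: "(\<Sum>j\<in>C. f j*(if j = i0 then r else 0)) = f i0*r" for f
  using C by (simp add: if_distrib cong: if_cong)
 have "(\<Sum>j\<in>C. u j*x j) = (\<Sum>j\<in>C. (x j)\<^sup>2 - x j*(if j = i0 then r else 0))"
  by (intro sum.cong refl) (simp add: u' power2_eq_square algebra_simps)
 also have "... = r^2 - x i0*r" by (simp only: sum_subtractf split r2)
 finally have s: "(\<Sum>j\<in>C. u j*x j) = r^2 - x i0*r" .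
 have "D = (\<Sum>j\<in>C. (x j)\<^sup>2 - 2*x j*(if j = i0 then r else 0) + (if j = i0 then r else 0)*(if j = i0 then r else 0))"
  unfolding D_def by (intro sum.cong refl) (simp add: u' power2_eq_square algebra_simps)
 also have "... = 2*(r^2 - x i0*r)"
  by (simp only: sum.distrib sum_subtractf split r2[symmetric]) (simp add: power2_eq_square)
 finally have D: "D = 2*(r^2 - x i0*r)" .
 show ?thesis
 proof (cases "D = 0")
  case True
  hence "u k = 0" if "k \<in> C" for k
   using that C by (simp add: D_def sum_nonneg_eq_0_iff)
  hence "x k = (if k = i0 then r else 0)" if "k \<in> C" for k using u[OF that] that by (simp add: r_def)
  hence "restrict x C = (\<lambda>k\<in>C. if k = i0 then r else 0)" by (intro restrict_ext) auto
  moreover have "householder C u x = restrict x C"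
   using householder_trivial[OF C(1), of u x] True by (simp add: D_def)
  ultimately show ?thesis by (simp only: r_def)
 next
  case False
  hence "2*(\<Sum>j\<in>C. u j*x j)/D = 1" unfolding s using D by simp
  thus ?thesis unfolding householder_def D_def[symmetric]
   by (intro restrict_ext) (simp add: u r_def)
 qed
qed

lemma act_at:
 "i \<in> I ==> act I rw cl R S u \<xi> i = (if rw i \<in> R \<and> cl i \<in> S
   then householder {k\<in>I. rw k \<in> R \<and> cl k = cl i} (\<lambda>k. u (rw k)) \<xi> i else \<xi> i)"
 by (simp add: act_def)

context prob_array
begin

text \<open>Given the values on the block \<open>C\<close>, some reflection moves them to their norm
  at \<open>i0\<close> and zeros elsewhere. It depends on these values only, so it preserves the law
  of the remaining, independent columns, on which it acts as well; \<open>\<Phi>\<close> does not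
  notice the simultaneous reflection. Hence the block may be replaced by a chi variable and
  zeros.\<close>

lemma block_step:
 fixes rw :: "'i => 'a" and cl :: "'i => 'b"
 assumes C: "C = {k\<in>I. rw k \<in> R \<and> cl k = c0}" and i0: "i0 \<in> C" and inj: "inj_on rw C"
  and g: "!!k. k \<in> C ==> \<mu> k = std_gauss"
  and cols: "!!c. c ~= c0 ==> (\<forall>i\<in>I. rw i \<in> R \<and> cl i = c --> \<mu> i = std_gauss) \<or> (\<forall>i\<in>I. rw i \<in> R \<and> cl i = c --> \<mu> i = point0)"
  and \<Phi>: "\<Phi> \<in> borel_measurable (PiM I (\<lambda>_. borel))"
  and inv: "!!u \<xi>. \<xi> \<in> extensional I ==> \<Phi> (act I rw cl R (cl ` I) u \<xi>) = (\<Phi> \<xi> :: ennreal)"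
 shows "(\<integral>\<^sup>+\<xi>. \<Phi> \<xi> \<partial>PiM I \<mu>) = (\<integral>\<^sup>+\<xi>. \<Phi> \<xi> \<partial>PiM I (\<lambda>i. if i = i0 then chi C else if i \<in> C then point0 else \<mu> i))"
proof -
 define \<mu>' where "\<mu>' i = (if i = i0 then chi C else if i \<in> C then point0 else \<mu> i)" for i
 define J where "J = I - C"
 have CI: "C \<subseteq> I" using C by auto
 have fin: "finite C" "finite J" "C \<inter> J = {}" "C \<union> J = I"
  using CI finI finite_subset by (auto simp: J_def)
 interpret A': prob_array I \<mu>'
  by (rule prob_array.intro) (simp_all add: \<mu>'_def finI prob\<mu> sets\<mu>)
 interpret J: prob_array J \<mu> by (rule prob_array.intro) (simp_all add: prob\<mu> sets\<mu> fin(2))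
 have \<Phi>m: "\<Phi> \<in> borel_measurable (PiM (C \<union> J) \<mu>)" "\<Phi> \<in> borel_measurable (PiM (C \<union> J) \<mu>')"
  using \<Phi> unfolding fin(4) by (simp_all cong: measurable_cong_sets add: sets_PiM_borel A'.sets_PiM_borel)
 define hat where "hat x = (\<lambda>k\<in>C. if k = i0 then sqrt (\<Sum>j\<in>C. (x j)\<^sup>2) else 0)" for x :: "'i => real"
 have gC: "PiM C \<mu> = gauss C" unfolding gauss_def by (rule PiM_cong) (use g in auto)
 have hatm: "hat \<in> measurable (gauss C) (PiM C (\<lambda>_. borel))"
 proof (rule measurable_PiM_single')
  fix k assume "k \<in> C"
  thus "(\<lambda>x. hat x k) \<in> borel_measurable (gauss C)"
   using measurable_sqnorm[of C] by (cases "k = i0") (simp_all add: hat_def)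
 qed (auto simp: hat_def)
 have law: "PiM C \<mu>' = distr (gauss C) (PiM C (\<lambda>_. borel)) hat"
 proof (rule A'.PiM_eqI[symmetric, OF fin(1)])
  show "sets (distr (gauss C) (PiM C (\<lambda>_. borel)) hat) = sets (PiM C \<mu>')"
   by (simp add: A'.sets_PiM_borel)
  fix A assume "!!i. i \<in> C ==> A i \<in> sets (\<mu>' i)"
  hence A: "!!i. i \<in> C ==> A i \<in> sets borel" by (simp add: A'.sets\<mu>)
  have PA: "Pi\<^sub>E C A \<in> sets (PiM C (\<lambda>_. borel))" using A fin(1) by (intro sets_PiM_I_finite) auto
  let ?N = "\<lambda>x :: 'i => real. sqrt (\<Sum>j\<in>C. (x j)\<^sup>2)"
  have chiA: "emeasure (chi C) (A i0) = emeasure (gauss C) (?N -` A i0 \<inter> space (gauss C))"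
   unfolding chi_def by (rule emeasure_distr[OF measurable_sqnorm A[OF i0]])
  have hit: "hat x \<in> Pi\<^sub>E C A \<longleftrightarrow> ?N x \<in> A i0 \<and> (\<forall>k\<in>C - {i0}. 0 \<in> A k)" for x
   using i0 by (auto simp: hat_def PiE_iff)
  have pr: "(\<Prod>i\<in>C. emeasure (\<mu>' i) (A i)) = emeasure (chi C) (A i0)*(\<Prod>k\<in>C - {i0}. indicator (A k) 0)"
  proof -
   have "(\<Prod>k\<in>C - {i0}. emeasure (\<mu>' k) (A k)) = (\<Prod>k\<in>C - {i0}. indicator (A k) 0)"
    using A by (intro prod.cong refl) (auto simp: \<mu>'_def)
   thus ?thesis using fin(1) i0 by (subst prod.remove[of C i0]) (auto simp: \<mu>'_def)
  qed
  have "emeasure (distr (gauss C) (PiM C (\<lambda>_. borel)) hat) (Pi\<^sub>E C A) = emeasure (gauss C) (hat -` Pi\<^sub>E C A \<inter> space (gauss C))"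
   by (rule emeasure_distr[OF hatm PA])
  also have "hat -` Pi\<^sub>E C A \<inter> space (gauss C) = (if \<forall>k\<in>C - {i0}. 0 \<in> A k then ?N -` A i0 \<inter> space (gauss C) else {})"
   using hit by auto
  also have "emeasure (gauss C) ... = (\<Prod>i\<in>C. emeasure (\<mu>' i) (A i))"
  proof (cases "\<forall>k\<in>C - {i0}. 0 \<in> A k")
   case True
   hence "(\<Prod>k\<in>C - {i0}. indicator (A k) 0) = (1 :: ennreal)" by (intro prod.neutral) auto
   thus ?thesis using True by (simp add: pr chiA)
  next
   case False
   then obtain k where "k \<in> C - {i0}" "0 \<notin> A k" by blast
   hence "(\<Prod>k\<in>C - {i0}. indicator (A k) 0) = (0 :: ennreal)"
    using fin(1) by (intro prod_zero bexI[of _ k]) simp_all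
   thus ?thesis unfolding if_not_P[OF False] pr by simp
  qed
  finally show "emeasure (distr (gauss C) (PiM C (\<lambda>_. borel)) hat) (Pi\<^sub>E C A) = (\<Prod>i\<in>C. emeasure (\<mu>' i) (A i))" .
 qed
 have JJ: "PiM J \<mu>' = PiM J \<mu>" by (rule PiM_cong) (use i0 in \<open>auto simp: \<mu>'_def J_def\<close>)
 define G where "G x = (\<integral>\<^sup>+y. \<Phi> (merge C J (x, y)) \<partial>PiM J \<mu>)" for x
 have Gm: "G \<in> borel_measurable (PiM C (\<lambda>_. borel))"
 proof -
  have sfJ: "sigma_finite_measure (PiM J \<mu>)"
   by (intro prob_space_imp_sigma_finite prob_space_PiM prob\<mu>)
  have "(\<lambda>z. \<Phi> (merge C J z)) \<in> borel_measurable (PiM C \<mu> \<Otimes>\<^sub>M PiM J \<mu>)"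
   using measurable_comp[OF measurable_merge \<Phi>m(1)] by (simp add: comp_def)
  hence "G \<in> borel_measurable (PiM C \<mu>)" unfolding G_def
   by (intro sigma_finite_measure.borel_measurable_nn_integral[OF sfJ]) (simp add: case_prod_unfold)
  thus ?thesis by (simp add: sets_PiM_borel cong: measurable_cong_sets)
 qed
 \<comment> \<open>\<open>G\<close> is the integral of \<open>\<Phi>\<close> over the other columns
   with the block fixed. It takes the same value at a block and at its reflected image.\<close>
 have Ghat: "G x = G (hat x)" if x: "x \<in> extensional C" for x
 proof -
  define v where "v k = x k - (if k = i0 then sqrt (\<Sum>j\<in>C. (x j)\<^sup>2) else 0)" for k
  \<comment> \<open>The reflecting vector has to be indexed by rows, so that one vector serves all
    columns; injectivity of \<open>rw\<close> on \<open>C\<close> transports it there.\<close>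
  define u where "u r = v (inv_into C rw r)" for r
  have uv: "u (rw k) = v k" if "k \<in> C" for k using that inj by (simp add: u_def)
  have hx: "householder C (\<lambda>k. u (rw k)) x = hat x"
   unfolding hat_def by (rule householder_to_axis[OF fin(1) i0 x]) (simp add: uv v_def)
  have actm: "act I rw cl R (cl ` I) u (merge C J (x, y)) = merge C J (hat x, act J rw cl R (cl ` I - {c0}) u y)"
   for y
  proof
   fix i
   consider "i \<in> C" | "i \<in> J" "rw i \<in> R" "cl i ~= c0" | "i \<in> J" "rw i \<notin> R" | "i \<notin> I"
    using C by (auto simp: J_def)
   thus "act I rw cl R (cl ` I) u (merge C J (x, y)) i = merge C J (hat x, act J rw cl R (cl ` I - {c0}) u y) i"
   proof cases
    case 1
    have "householder C (\<lambda>k. u (rw k)) (merge C J (x, y)) = householder C (\<lambda>k. u (rw k)) x"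
     by (rule householder_cong) (simp add: merge_def)
    moreover have "{k \<in> I. rw k \<in> R \<and> cl k = cl i} = C" using 1 C by auto
    ultimately have "act I rw cl R (cl ` I) u (merge C J (x, y)) i = hat x i"
     using 1 CI C hx by (subst act_at) auto
    thus ?thesis using 1 by (simp add: merge_def)
   next
    case 2
    have eq: "{k \<in> I. rw k \<in> R \<and> cl k = cl i} = {k \<in> J. rw k \<in> R \<and> cl k = cl i}"
     using 2 C by (auto simp: J_def)
    have "householder {k \<in> J. rw k \<in> R \<and> cl k = cl i} (\<lambda>k. u (rw k)) (merge C J (x, y))
     = householder {k \<in> J. rw k \<in> R \<and> cl k = cl i} (\<lambda>k. u (rw k)) y"
     by (rule householder_cong) (use fin in \<open>auto simp: merge_def\<close>)
    thus ?thesis using 2 fin eq by (auto simp: act_at J_def merge_def)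
   next
    case 3
    thus ?thesis using fin by (auto simp: act_at J_def merge_def)
   next
    case 4
    thus ?thesis using CI by (auto simp: act_outside merge_def J_def)
   qed
  qed
  have pr: "preserves (PiM J \<mu>) (act J rw cl R (cl ` I - {c0}) u)"
  proof (rule J.preserves_act)
   fix c assume "c \<in> cl ` I - {c0}"
   thus "(\<forall>i\<in>J. rw i \<in> R \<and> cl i = c --> \<mu> i = std_gauss) \<or> (\<forall>i\<in>J. rw i \<in> R \<and> cl i = c --> \<mu> i = point0)"
    using cols[of c] by (auto simp: J_def)
  qed (use finI in simp)
  have hx_sp: "hat x \<in> space (PiM C \<mu>)" by (simp add: space_PiM_borel hat_def)
  have ym: "(\<lambda>y. \<Phi> (merge C J (hat x, y))) \<in> borel_measurable (PiM J \<mu>)"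
  proof -
   have "(\<lambda>z. \<Phi> (merge C J z)) \<in> borel_measurable (PiM C \<mu> \<Otimes>\<^sub>M PiM J \<mu>)"
    using measurable_comp[OF measurable_merge \<Phi>m(1)] by (simp add: comp_def)
   from measurable_compose[OF measurable_Pair1'[OF hx_sp] this] show ?thesis .
  qed
  have "G x = (\<integral>\<^sup>+y. \<Phi> (act I rw cl R (cl ` I) u (merge C J (x, y))) \<partial>PiM J \<mu>)"
   unfolding G_def by (intro nn_integral_cong inv[symmetric]) (use fin(4) in \<open>auto simp: extensional_def merge_def\<close>)
  also have "... = (\<integral>\<^sup>+y. \<Phi> (merge C J (hat x, act J rw cl R (cl ` I - {c0}) u y)) \<partial>PiM J \<mu>)"
   by (simp only: actm)
  also have "... = G (hat x)" unfolding G_def by (rule preserves_nn_integral[OF pr ym])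
  finally show ?thesis .
 qed
 have "(\<integral>\<^sup>+\<xi>. \<Phi> \<xi> \<partial>PiM I \<mu>) = (\<integral>\<^sup>+x. G x \<partial>gauss C)"
  using product_nn_integral_fold[OF fin(3,1,2) \<Phi>m(1)] by (simp add: fin(4) G_def gC)
 also have "... = (\<integral>\<^sup>+x. G (hat x) \<partial>gauss C)"
  by (intro nn_integral_cong Ghat) (auto simp: gauss_def space_PiM PiE_def)
 also have "... = (\<integral>\<^sup>+x. G x \<partial>PiM C \<mu>')"
  unfolding law by (rule nn_integral_distr[symmetric, OF hatm]) (use Gm in simp)
 also have "... = (\<integral>\<^sup>+\<xi>. \<Phi> \<xi> \<partial>PiM I \<mu>')"
  using A'.product_nn_integral_fold[OF fin(3,1,2) \<Phi>m(2)] by (simp add: fin(4) G_def JJ)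
 finally show ?thesis by (simp add: \<mu>'_def[abs_def])
qed

end

subsection \<open>Reduction to bidiagonal form\<close>

abbreviation grid :: "nat => nat => (nat \<times> nat) set" where
 "grid n p \<equiv> {1..n} \<times> {..<p}"

text \<open>Samples are numbered from 1 and coordinates from 0, so the main diagonal is
  \<open>i = j + 1\<close> and the one below it \<open>i = j + 2\<close>. Their degrees of freedom
  are p - j and n - 1 - j.\<close>

definition bidiag :: "nat => nat => nat \<times> nat => real measure" where
 "bidiag n p = (\<lambda>(i, j). if i = j + 1 then chi ({i} \<times> {j..<p})
   else if i = j + 2 then chi ({i..n} \<times> {j}) else point0)"

text \<open>The law after \<open>s\<close> rounds: the lower right corner is still Gaussian,
  everything else has its final form.\<close>

definition bidiag_stage :: "nat => nat => nat => nat \<times> nat => real measure" where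
 "bidiag_stage n p s = (\<lambda>(i, j). if s < i \<and> s <= j then std_gauss else bidiag n p (i, j))"

lemma prob_array_bidiag: "prob_array (grid n p) (bidiag n p)"
 by (rule prob_array.intro) (simp_all add: bidiag_def case_prod_beta)

lemma prob_array_bidiag_stage: "prob_array (grid n p) (bidiag_stage n p s)"
 by (rule prob_array.intro) (simp_all add: bidiag_def bidiag_stage_def case_prod_beta)

text \<open>One round reflects the coordinates \<open>{s..<p}\<close> to clear row
  \<open>Suc s\<close> right of the diagonal, then the samples \<open>{s + 2..n}\<close> to clear
  column \<open>s\<close> below the subdiagonal. The second reflection starts one row lower and so
  leaves the cleared row alone. In the last row there is nothing to do for it.\<close>

lemma bidiag_stage_step:
 fixes \<Phi> :: "(nat \<times> nat => real) => ennreal"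
 assumes s: "s < n" and np: "n <= p" and \<Phi>: "\<Phi> \<in> borel_measurable (PiM (grid n p) (\<lambda>_. borel))"
  and inv1: "\<forall>R u \<xi>. R \<subseteq> {..<p} --> \<xi> \<in> extensional (grid n p) -->
   \<Phi> (act (grid n p) snd fst R (fst ` grid n p) u \<xi>) = \<Phi> \<xi>"
  and inv2: "\<forall>R u \<xi>. R \<subseteq> {1..n} --> \<xi> \<in> extensional (grid n p) -->
   \<Phi> (act (grid n p) fst snd R (snd ` grid n p) u \<xi>) = \<Phi> \<xi>"
 shows "(\<integral>\<^sup>+\<xi>. \<Phi> \<xi> \<partial>PiM (grid n p) (bidiag_stage n p s)) = (\<integral>\<^sup>+\<xi>. \<Phi> \<xi> \<partial>PiM (grid n p) (bidiag_stage n p (Suc s)))"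
proof -
 let ?I = "grid n p"
 define C1 where "C1 = {Suc s} \<times> {s..<p}"
 define \<mu>1 where "\<mu>1 i = (if i = (Suc s, s) then chi C1 else if i \<in> C1 then point0 else bidiag_stage n p s i)" for i
 interpret A: prob_array ?I "bidiag_stage n p s" by (rule prob_array_bidiag_stage)
 have 1: "(\<integral>\<^sup>+\<xi>. \<Phi> \<xi> \<partial>PiM ?I (bidiag_stage n p s)) = (\<integral>\<^sup>+\<xi>. \<Phi> \<xi> \<partial>PiM ?I \<mu>1)"
  unfolding \<mu>1_def
 proof (rule A.block_step[where rw = snd and cl = fst and R = "{s..<p}" and ?c0.0 = "Suc s", OF _ _ _ _ _ \<Phi>])
  fix c :: nat assume "c ~= Suc s"
  thus "(\<forall>i\<in>?I. snd i \<in> {s..<p} \<and> fst i = c --> bidiag_stage n p s i = std_gauss) \<or>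
   (\<forall>i\<in>?I. snd i \<in> {s..<p} \<and> fst i = c --> bidiag_stage n p s i = point0)"
   by (cases "s < c") (auto simp: bidiag_stage_def bidiag_def)
 next
  show "\<Phi> (act ?I snd fst {s..<p} (fst ` ?I) u \<xi>) = \<Phi> \<xi>" if "\<xi> \<in> extensional ?I" for u \<xi>
   using inv1[rule_format, of "{s..<p}" \<xi> u] that by fastforce
 qed (use s np in \<open>auto simp: C1_def bidiag_stage_def inj_on_def\<close>)
 show ?thesis
 proof (cases "Suc s = n")
  case True
  have "PiM ?I \<mu>1 = PiM ?I (bidiag_stage n p (Suc s))"
   by (rule PiM_cong) (use True in \<open>auto simp: \<mu>1_def C1_def bidiag_stage_def bidiag_def split: if_splits\<close>)
  thus ?thesis using 1 by simp
 next
  case False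
  hence s2: "s + 2 <= n" using s by simp
  define C2 where "C2 = {s + 2..n} \<times> {s}"
  define \<mu>2 where "\<mu>2 i = (if i = (s + 2, s) then chi C2 else if i \<in> C2 then point0 else \<mu>1 i)" for i
  interpret B: prob_array ?I \<mu>1
   by (rule prob_array.intro) (simp_all add: \<mu>1_def A.prob\<mu> A.sets\<mu>)
  have 2: "(\<integral>\<^sup>+\<xi>. \<Phi> \<xi> \<partial>PiM ?I \<mu>1) = (\<integral>\<^sup>+\<xi>. \<Phi> \<xi> \<partial>PiM ?I \<mu>2)"
   unfolding \<mu>2_def
  proof (rule B.block_step[where rw = fst and cl = snd and R = "{s + 2..n}" and ?c0.0 = s, OF _ _ _ _ _ \<Phi>])
   fix c :: nat assume "c ~= s"
   thus "(\<forall>i\<in>?I. fst i \<in> {s + 2..n} \<and> snd i = c --> \<mu>1 i = std_gauss) \<or>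
    (\<forall>i\<in>?I. fst i \<in> {s + 2..n} \<and> snd i = c --> \<mu>1 i = point0)"
    by (cases "s < c") (auto simp: \<mu>1_def C1_def bidiag_stage_def bidiag_def)
  next
   show "\<Phi> (act ?I fst snd {s + 2..n} (snd ` ?I) u \<xi>) = \<Phi> \<xi>" if "\<xi> \<in> extensional ?I" for u \<xi>
    using inv2[rule_format, of "{s + 2..n}" \<xi> u] that by fastforce
   qed (use s s2 np in \<open>auto simp: C2_def C1_def \<mu>1_def bidiag_stage_def inj_on_def\<close>)
  have "PiM ?I \<mu>2 = PiM ?I (bidiag_stage n p (Suc s))"
   by (rule PiM_cong) (use s2 in \<open>auto simp: \<mu>2_def C2_def \<mu>1_def C1_def bidiag_stage_def bidiag_def split: if_splits\<close>)
  thus ?thesis using 1 2 by simp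
 qed
qed

text \<open>The reflections employed depend on the data, so the statement is about integrals of
  reflection-invariant functionals and not about the array itself.\<close>

theorem bidiagonalisation:
 fixes \<Phi> :: "(nat \<times> nat => real) => ennreal"
 assumes np: "n <= p" and \<Phi>: "\<Phi> \<in> borel_measurable (PiM (grid n p) (\<lambda>_. borel))"
  and inv1: "\<forall>R u \<xi>. R \<subseteq> {..<p} --> \<xi> \<in> extensional (grid n p) -->
   \<Phi> (act (grid n p) snd fst R (fst ` grid n p) u \<xi>) = \<Phi> \<xi>"
  and inv2: "\<forall>R u \<xi>. R \<subseteq> {1..n} --> \<xi> \<in> extensional (grid n p) -->
   \<Phi> (act (grid n p) fst snd R (snd ` grid n p) u \<xi>) = \<Phi> \<xi>"
 shows "(\<integral>\<^sup>+\<xi>. \<Phi> \<xi> \<partial>gauss (grid n p)) = (\<integral>\<^sup>+\<xi>. \<Phi> \<xi> \<partial>PiM (grid n p) (bidiag n p))"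
proof -
 have "(\<integral>\<^sup>+\<xi>. \<Phi> \<xi> \<partial>PiM (grid n p) (bidiag_stage n p 0)) = (\<integral>\<^sup>+\<xi>. \<Phi> \<xi> \<partial>PiM (grid n p) (bidiag_stage n p s))"
  if "s <= n" for s
  using that
 proof (induction s)
  case (Suc s)
  thus ?case using bidiag_stage_step[OF _ np \<Phi> inv1 inv2, of s] by simp
 qed simp
 from this[of n] have "(\<integral>\<^sup>+\<xi>. \<Phi> \<xi> \<partial>PiM (grid n p) (bidiag_stage n p 0)) = (\<integral>\<^sup>+\<xi>. \<Phi> \<xi> \<partial>PiM (grid n p) (bidiag_stage n p n))"
  by simp
 moreover have "PiM (grid n p) (bidiag_stage n p 0) = gauss (grid n p)"
  unfolding gauss_def by (rule PiM_cong) (auto simp: bidiag_stage_def)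
 moreover have "PiM (grid n p) (bidiag_stage n p n) = PiM (grid n p) (bidiag n p)"
  by (rule PiM_cong) (auto simp: bidiag_stage_def)
 ultimately show ?thesis by simp
qed

lemma sum_col_grid:
 assumes "R \<subseteq> {..<p}" "i \<in> {1..n}"
 shows "(\<Sum>k\<in>{k \<in> grid n p. snd k \<in> R \<and> fst k = i}. f k) = (\<Sum>j\<in>R. f (i, j))"
proof -
 have "{k \<in> grid n p. snd k \<in> R \<and> fst k = i} = Pair i ` R" using assms by auto
 thus ?thesis by (simp add: sum.reindex inj_on_def)
qed

lemma sum_row_grid:
 assumes "R \<subseteq> {1..n}" "j < p"
 shows "(\<Sum>k\<in>{k \<in> grid n p. fst k \<in> R \<and> snd k = j}. f k) = (\<Sum>i\<in>R. f (i, j))"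
proof -
 have "{k \<in> grid n p. fst k \<in> R \<and> snd k = j} = (\<lambda>i. (i, j)) ` R" using assms by auto
 thus ?thesis by (simp add: sum.reindex inj_on_def)
qed

text \<open>An isometry carries optimal families for \<open>X'\<close> to admissible families for
  \<open>X\<close>. Applied in both directions it yields equality of the eigenvalue sums.\<close>

lemma partial_sum_le_isometry:
 assumes n: "n \<ge> 1" and k: "k <= p" and q: "!!w. qf n p X' w = qf n p X (T w)"
  and T: "!!u v. ip p (T u) (T v) = ip p u v"
 shows "partial_sum n p k X' <= partial_sum n p k X"
proof -
 obtain w l where es: "eigen_system n p X' w l" using eigen_system_exists[OF n] .
 have o: "orthonormal p k (\<lambda>m. T (w m))"
  using orthonormal_mono[OF es_orthonormal[OF es] k] by (simp add: orthonormal_def T)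
 have "real n*partial_sum n p k X' = (\<Sum>m<k. qf n p X (T (w m)))"
  using Ky_Fan_attained[OF n k es] by (simp add: q)
 also have "... <= real n*partial_sum n p k X" by (rule Ky_Fan[OF n o])
 finally show ?thesis using n by simp
qed

text \<open>Reflecting coordinates multiplies the data matrix on the right by a symmetric orthogonal
  \<open>T\<close>, which can be moved onto the test vector. For a vanishing reflecting vector,
  \<open>T\<close> is the identity by \<open>x / 0 = 0\<close>.\<close>

lemma partial_sum_act_coord:
 assumes n: "n \<ge> 1" and k: "k <= p" and R: "R \<subseteq> {..<p}"
 shows "partial_sum n p k (\<lambda>i j. act (grid n p) snd fst R (fst ` grid n p) u \<xi> (i, j)) = partial_sum n p k (\<lambda>i j. \<xi> (i, j))"
  (is "partial_sum n p k ?X' = partial_sum n p k ?X")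
proof (rule antisym)
 define v where "v j = (if j \<in> R then u j else 0)" for j
 define D where "D = ip p v v"
 have fR: "finite R" using R finite_subset by blast
 have sR: "(\<Sum>j\<in>R. f j*u j) = ip p f v" for f
 proof -
  have "(\<Sum>j<p. f j*(if j \<in> R then u j else 0)) = (\<Sum>j\<in>R. f j*(if j \<in> R then u j else 0))"
   by (rule sum.mono_neutral_right) (use R in auto)
  thus ?thesis by (simp add: ip_def v_def)
 qed
 define T where "T w = (\<lambda>j. w j - (2*ip p v w/D) * v j)" for w
 have D: "D = (\<Sum>j\<in>R. (u j)\<^sup>2)"
  unfolding D_def sR[symmetric] by (auto simp: v_def power2_eq_square intro!: sum.cong)
 have T_self: "ip p (T x) y = ip p x (T y)" for x y
  unfolding T_def ip_diff_left ip_diff_right ip_scale_left ip_scale_right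
  by (simp add: ip_commute[of p x v])
 have vv: "ip p v v = D" by (simp add: D_def)
 have T_iso: "ip p (T x) (T y) = ip p x y" for x y
 proof (cases "D = 0")
  case True
  thus ?thesis by (simp add: T_def)
 next
  case False
  thus ?thesis
   unfolding T_def ip_diff_left ip_diff_right ip_scale_left ip_scale_right vv
   by (simp add: ip_commute[of p x v] field_simps)
 qed
 have X': "?X' i j = T (?X i) j" if "i \<in> {1..n}" "j < p" for i j
 proof (cases "j \<in> R")
  case True
  have "?X' i j = ?X i j - 2*(\<Sum>j\<in>R. ?X i j*u j)/(\<Sum>j\<in>R. (u j)\<^sup>2)*u j"
   using that True sum_col_grid[OF R that(1), of "\<lambda>k. u (snd k)*\<xi> k"] sum_col_grid[OF R that(1), of "\<lambda>k. (u (snd k))\<^sup>2"]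
   by (auto simp: act_at householder_def image_iff mult.commute)
  thus ?thesis using True by (simp add: T_def v_def D[symmetric] sR ip_commute)
 next
  case False
  thus ?thesis using that by (simp add: act_at T_def v_def)
 qed
 have ipX': "ip p (?X' i) w = ip p (?X i) (T w)" if "i \<in> {1..n}" for i w
 proof -
  have "ip p (?X' i) w = ip p (T (?X i)) w" by (rule ip_cong) (use X' that in auto)
  thus ?thesis by (simp add: T_self)
 qed
 have TT: "ip p (?X i) w = ip p (?X' i) (T w)" if "i \<in> {1..n}" for i w
 proof -
  have "ip p (?X' i) (T w) = ip p (T (?X i)) (T w)" by (rule ip_cong) (use X' that in auto)
  thus ?thesis by (simp add: T_iso)
 qed
 show "partial_sum n p k ?X' <= partial_sum n p k ?X"
  by (rule partial_sum_le_isometry[OF n k _ T_iso]) (unfold qf_def, intro sum.cong refl arg_cong[where f = "\<lambda>x. x\<^sup>2"] ipX')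
 show "partial_sum n p k ?X <= partial_sum n p k ?X'"
  by (rule partial_sum_le_isometry[OF n k _ T_iso]) (unfold qf_def, intro sum.cong refl arg_cong[where f = "\<lambda>x. x\<^sup>2"] TT)
qed

text \<open>Reflecting samples multiplies the data matrix on the left by an orthogonal matrix, which
  leaves the quadratic form itself unchanged.\<close>

lemma partial_sum_act_sample:
 assumes n: "n \<ge> 1" and k: "k <= p" and R: "R \<subseteq> {1..n}"
 shows "partial_sum n p k (\<lambda>i j. act (grid n p) fst snd R (snd ` grid n p) u \<xi> (i, j)) = partial_sum n p k (\<lambda>i j. \<xi> (i, j))"
  (is "partial_sum n p k ?X' = partial_sum n p k ?X")
proof -
 have fR: "finite R" using R finite_subset by blast
 have X': "?X' i j = (if i \<in> R then householder R u (\<lambda>i. ?X i j) i else ?X i j)" if "i \<in> {1..n}" "j < p" for i j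
  using that sum_row_grid[OF R that(2), of "\<lambda>k. u (fst k)*\<xi> k"] sum_row_grid[OF R that(2), of "\<lambda>k. (u (fst k))\<^sup>2"]
  by (auto simp: act_at householder_def image_iff)
 have q: "qf n p ?X' w = qf n p ?X w" for w
 proof -
  define y where "y i = ip p (?X i) w" for i
  have hl: "ip p (\<lambda>j. householder R u (\<lambda>i. ?X i j) i) w = householder R u y i" if "i \<in> R" for i
  proof -
   have "ip p (\<lambda>j. householder R u (\<lambda>i. ?X i j) i) w
     = ip p (\<lambda>j. ?X i j - (2/(\<Sum>j\<in>R. (u j)\<^sup>2)*u i)*(\<Sum>k\<in>R. u k * ?X k j)) w"
    by (rule ip_cong) (use that in \<open>simp_all add: householder_def\<close>)
   also have "... = y i - (2/(\<Sum>j\<in>R. (u j)\<^sup>2)*u i)*(\<Sum>k\<in>R. u k*y k)"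
    unfolding ip_diff_left ip_scale_left ip_sum_left y_def ..
   finally show ?thesis using that by (simp add: householder_def)
  qed
  have "ip p (?X' i) w = (if i \<in> R then householder R u y i else y i)" if "i \<in> {1..n}" for i
  proof -
   have "ip p (?X' i) w = ip p (\<lambda>j. if i \<in> R then householder R u (\<lambda>i. ?X i j) i else ?X i j) w"
    by (rule ip_cong) (use X' that in auto)
   thus ?thesis using hl by (auto simp: y_def)
  qed
  hence "qf n p ?X' w = (\<Sum>i=1..n. (if i \<in> R then householder R u y i else y i)\<^sup>2)"
   unfolding qf_def by (intro sum.cong) auto
  also have "... = (\<Sum>i\<in>{1..n} - R. (y i)\<^sup>2) + (\<Sum>i\<in>R. (householder R u y i)\<^sup>2)"
   by (subst sum.subset_diff[OF R]) (auto intro!: sum.cong arg_cong2[where f = plus])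
  also have "... = (\<Sum>i\<in>{1..n} - R. (y i)\<^sup>2) + (\<Sum>i\<in>R. (y i)\<^sup>2)"
   by (simp add: householder_norm[OF fR])
  also have "... = qf n p ?X w" unfolding qf_def y_def[symmetric] by (subst sum.subset_diff[OF R]) auto
  finally show ?thesis .
 qed
 show ?thesis
 proof (rule antisym)
  show "partial_sum n p k ?X' <= partial_sum n p k ?X"
   by (rule partial_sum_le_isometry[OF n k, where T = "\<lambda>w. w"]) (rule q, rule refl)
  show "partial_sum n p k ?X <= partial_sum n p k ?X'"
   by (rule partial_sum_le_isometry[OF n k, where T = "\<lambda>w. w"]) (rule q[symmetric], rule refl)
 qed
qed

subsection \<open>Noise against kinetic and potential energy\<close>

lemma Abel_block_bound:
 fixes x y :: "nat => real"
 assumes T: "!!r. r <= Suc m ==> \<bar>\<Sum>j<r. x j\<bar> <= T"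
 shows "\<bar>\<Sum>j<Suc m. x j*y j\<bar> <= T*(\<bar>y m\<bar> + (\<Sum>j<m. \<bar>y (Suc j) - y j\<bar>))"
proof -
 have T0: "T \<ge> 0" using T[of 0] by simp
 have eq: "(\<Sum>j<Suc m. x j*y j) = (\<Sum>j<Suc m. x j)*y m - (\<Sum>j<m. (\<Sum>i<Suc j. x i)*(y (Suc j) - y j))"
  by (induction m) (simp_all add: algebra_simps)
 have "\<bar>\<Sum>j<m. (\<Sum>i<Suc j. x i)*(y (Suc j) - y j)\<bar> <= (\<Sum>j<m. T*\<bar>y (Suc j) - y j\<bar>)"
  by (rule order_trans[OF sum_abs]) (intro sum_mono, unfold abs_mult, intro mult_right_mono T, auto)
 moreover have "\<bar>(\<Sum>j<Suc m. x j)*y m\<bar> <= T*\<bar>y m\<bar>"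
  unfolding abs_mult by (intro mult_right_mono T) auto
 ultimately show ?thesis unfolding eq by (simp only: distrib_left sum_distrib_left)
qed

text \<open>
 The value at the end of the block is compared with the block average, at the price of the
 total variation.
\<close>

lemma Abel_block_average:
 fixes x y :: "nat => real"
 assumes T: "!!r. r <= l ==> \<bar>\<Sum>j<r. x j\<bar> <= T" and l: "l \<ge> 1" and y: "!!j. 0 <= y j"
 shows "\<bar>\<Sum>j<l. x j*y j\<bar> <= T*((\<Sum>j<l. y j)/l + 2*(\<Sum>j<l - 1. \<bar>y (Suc j) - y j\<bar>))"
proof -
 obtain m where m: "l = Suc m" using l by (cases l) auto
 have T0: "T \<ge> 0" using T[of 0] by simp
 define V where "V = (\<Sum>j<m. \<bar>y (Suc j) - y j\<bar>)"
 have "y m <= y i + V" if "i <= m" for i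
 proof -
  have "y m - y i = (\<Sum>j\<in>{i..<m}. y (Suc j) - y j)" using that by (simp add: sum_Suc_diff')
  also have "... <= (\<Sum>j\<in>{i..<m}. \<bar>y (Suc j) - y j\<bar>)" by (intro sum_mono) auto
  also have "... <= V" unfolding V_def by (rule sum_mono2) auto
  finally show ?thesis by simp
 qed
 hence "(\<Sum>i<l. y m) <= (\<Sum>i<l. y i + V)" by (intro sum_mono) (auto simp: m)
 hence "real l*y m <= (\<Sum>i<l. y i) + real l*V" by (simp add: sum.distrib)
 hence "y m <= (\<Sum>i<l. y i)/l + V" using l by (simp add: field_simps)
 hence "T*(\<bar>y m\<bar> + V) <= T*((\<Sum>i<l. y i)/l + 2*V)" using y[of m] T0 by (intro mult_left_mono) auto
 moreover have "\<bar>\<Sum>j<l. x j*y j\<bar> <= T*(\<bar>y m\<bar> + V)"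
  unfolding m V_def by (rule Abel_block_bound) (use T m in auto)
 ultimately show ?thesis by (simp add: V_def m)
qed

text \<open>Summation by parts in each block trades the noise for increments of u^2. An increment
  factors into a difference and a sum, which a weighted arithmetic-geometric inequality charges to
  kinetic energy and to mass. The kinetic share n/8 is half of the coefficient n/4 provided later by
  \<open>kin_lower\<close>.\<close>

lemma noise_bound:
 fixes x u :: "nat => real"
 assumes T: "!!c r. c < K ==> r <= l ==> \<bar>\<Sum>j\<in>{c*l..<c*l + r}. x j\<bar> <= T"
  and l: "l \<ge> 1" and n: "n > 0"
 shows "\<bar>\<Sum>j<K*l. x j*(u j)^2\<bar> <= n/8*(\<Sum>j<K*l - 1. (u (Suc j) - u j)\<^sup>2) + (T/l + 32*T\<^sup>2/n)*(\<Sum>j<K*l. (u j)\<^sup>2)"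
proof -
 let ?D = "\<lambda>j. (u (Suc j) - u j)\<^sup>2"
 let ?G = "\<lambda>j. n/8 * ?D j + 16*T\<^sup>2/n*((u (Suc j))^2 + (u j)^2)"
 have nn: "0 <= ?G j" for j using n by simp
 have pt: "2*T*\<bar>(u (Suc j))\<^sup>2 - (u j)\<^sup>2\<bar> <= ?G j" if T0: "T \<ge> 0" for j
 proof -
  define d s where "d = \<bar>u (Suc j) - u j\<bar>" and "s = \<bar>u (Suc j) + u j\<bar>"
  have "\<bar>(u (Suc j))\<^sup>2 - (u j)\<^sup>2\<bar> = d * s"
   by (simp add: d_def s_def abs_mult[symmetric] power2_eq_square algebra_simps)
  moreover have "2*T*(d * s) <= n/8*d^2 + 8/n*(T * s)^2"
  proof -
   have "0 <= (n/8*d - T * s)^2*(8/n)" using n by simp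
   also have "... = n/8*d^2 + 8/n*(T * s)^2 - 2*T*(d * s)"
    using n by (simp add: power2_eq_square field_simps)
   finally show ?thesis by simp
  qed
  moreover have "s^2 <= 2*((u (Suc j))^2 + (u j)^2)"
   using sum_squares_bound[of "u (Suc j)" "u j"] by (simp add: s_def power2_sum)
  hence "8/n*(T\<^sup>2 * s^2) <= 8/n*(T\<^sup>2*(2*((u (Suc j))^2 + (u j)^2)))"
   using n by (intro mult_left_mono) auto
  hence "8/n*(T * s)^2 <= 16*T\<^sup>2/n*((u (Suc j))^2 + (u j)^2)"
   by (simp add: power_mult_distrib mult_ac)
  moreover have "d^2 = ?D j" by (simp add: d_def)
  ultimately show ?thesis by (simp only:)
 qed
 have blk: "\<bar>\<Sum>j\<in>{c*l..<c*l + l}. x j*(u j)^2\<bar>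
   <= T/l*(\<Sum>j\<in>{c*l..<c*l + l}. (u j)\<^sup>2) + (\<Sum>j\<in>{c*l..<c*l + l - 1}. ?G j)" if c: "c < K" for c
 proof -
  have sh: "(\<Sum>j\<in>{c*l..<c*l + r}. f j) = (\<Sum>j<r. f (c*l + j))" for f :: "nat => real" and r
   using sum.shift_bounds_nat_ivl[of f 0 "c*l" r] by (simp add: atLeast0LessThan add.commute)
  have T0: "T \<ge> 0" using T[OF c, of 0] by simp
  have "\<bar>\<Sum>j<l. x (c*l + j)*(u (c*l + j))^2\<bar>
   <= T*((\<Sum>j<l. (u (c*l + j))\<^sup>2)/l + 2*(\<Sum>j<l - 1. \<bar>(u (c*l + Suc j))\<^sup>2 - (u (c*l + j))\<^sup>2\<bar>))"
   by (rule Abel_block_average[OF _ l]) (use T[OF c] in \<open>auto simp: sh\<close>)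
  also have "... = T/l*(\<Sum>j<l. (u (c*l + j))\<^sup>2) + (\<Sum>j<l - 1. 2*T*\<bar>(u (Suc (c*l + j)))\<^sup>2 - (u (c*l + j))\<^sup>2\<bar>)"
   by (simp add: distrib_left sum_distrib_left[symmetric])
  also have "... <= T/l*(\<Sum>j<l. (u (c*l + j))\<^sup>2) + (\<Sum>j<l - 1. ?G (c*l + j))"
   by (intro add_left_mono sum_mono pt T0)
  finally have F: "\<bar>\<Sum>j<l. x (c*l + j)*(u (c*l + j))^2\<bar> <= T/l*(\<Sum>j<l. (u (c*l + j))\<^sup>2) + (\<Sum>j<l - 1. ?G (c*l + j))" .
  have eq: "c*l + l - 1 = c*l + (l - 1)" using l by simp
  show ?thesis unfolding eq sh by (rule F)
 qed
 have un: "(\<Sum>j<K*l. f j) = (\<Sum>c<K. \<Sum>j\<in>{c*l..<c*l + l}. f j)" for f :: "nat => real"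
  using sum.nat_group[of f l K] by simp
 have "\<bar>\<Sum>j<K*l. x j*(u j)^2\<bar> <= (\<Sum>c<K. \<bar>\<Sum>j\<in>{c*l..<c*l + l}. x j*(u j)^2\<bar>)"
  unfolding un by (rule sum_abs)
 also have "... <= (\<Sum>c<K. T/l*(\<Sum>j\<in>{c*l..<c*l + l}. (u j)\<^sup>2) + (\<Sum>j\<in>{c*l..<c*l + l - 1}. ?G j))"
  by (intro sum_mono blk) simp
 also have "... = T/l*(\<Sum>j<K*l. (u j)\<^sup>2) + (\<Sum>c<K. \<Sum>j\<in>{c*l..<c*l + l - 1}. ?G j)"
  by (simp add: un sum.distrib sum_distrib_left)
 \<comment> \<open>The increments inside the blocks are among all increments below
   \<open>K*l - 1\<close>, and the terms are nonnegative. Only the increment leaving the last block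
   must stay excluded.\<close>
 also have "(\<Sum>c<K. \<Sum>j\<in>{c*l..<c*l + l - 1}. ?G j) <= (\<Sum>j<K*l - 1. ?G j)"
 proof -
  have "(\<Sum>c<K. \<Sum>j\<in>{c*l..<c*l + l - 1}. ?G j) = (\<Sum>c<K. \<Sum>j\<in>{c*l..<c*l + l}. if j = c*l + l - 1 then 0 else ?G j)"
  proof (rule sum.cong[OF refl])
   fix c
   have "{c*l..<c*l + l} = insert (c*l + l - 1) {c*l..<c*l + l - 1}" using l by auto
   thus "(\<Sum>j\<in>{c*l..<c*l + l - 1}. ?G j) = (\<Sum>j\<in>{c*l..<c*l + l}. if j = c*l + l - 1 then 0 else ?G j)"
    by (simp add: sum.neutral cong: sum.cong_simp)
  qed
  also have "... <= (\<Sum>c<K. \<Sum>j\<in>{c*l..<c*l + l}. if j = K*l - 1 then 0 else ?G j)"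
  proof (intro sum_mono)
   fix c j assume cj: "c \<in> {..<K}" "j \<in> {c*l..<c*l + l}"
   show "(if j = c*l + l - 1 then 0 else ?G j) <= (if j = K*l - 1 then 0 else ?G j)"
   proof (cases "j = K*l - 1")
    case True
    have "Suc c*l <= K*l" using cj by (intro mult_right_mono) auto
    hence "j = c*l + l - 1" using cj l True by auto
    thus ?thesis using True by simp
   next
    case False
    thus ?thesis using nn[of j] by auto
   qed
  qed
  also have "... = (\<Sum>j<K*l. if j = K*l - 1 then 0 else ?G j)" by (simp only: un)
  also have "... = (\<Sum>j<K*l - 1. ?G j)"
  proof -
   have "(\<Sum>j<K*l. if j = K*l - 1 then 0 else ?G j) = (\<Sum>j<K*l - 1. if j = K*l - 1 then 0 else ?G j)"
    by (rule sum.mono_neutral_right) (auto simp: not_less)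
   also have "... = (\<Sum>j<K*l - 1. ?G j)" by (rule sum.cong) auto
   finally show ?thesis .
  qed
  finally show ?thesis .
 qed
 also have "(\<Sum>j<K*l - 1. ?G j) = n/8*(\<Sum>j<K*l - 1. ?D j) + 16*T\<^sup>2/n*((\<Sum>j<K*l - 1. (u (Suc j))\<^sup>2) + (\<Sum>j<K*l - 1. (u j)\<^sup>2))"
  by (simp only: sum.distrib sum_distrib_left[symmetric])
 also have "... <= n/8*(\<Sum>j<K*l - 1. ?D j) + 16*T\<^sup>2/n*((\<Sum>j<K*l. (u j)\<^sup>2) + (\<Sum>j<K*l. (u j)\<^sup>2))"
 proof -
  have "(\<Sum>j<K*l - 1. (u (Suc j))\<^sup>2) = (\<Sum>j\<in>{1..<K*l}. (u j)\<^sup>2)"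
  proof (cases "K*l = 0")
   case False
   hence "Suc (K*l - 1) = K*l" by simp
   thus ?thesis using sum.shift_bounds_Suc_ivl[of "\<lambda>j. (u j)\<^sup>2" 0 "K*l - 1"]
    by (simp only: lessThan_atLeast0 One_nat_def)
  qed auto
  also have "... <= (\<Sum>j<K*l. (u j)\<^sup>2)" by (rule sum_mono2) auto
  finally have 1: "(\<Sum>j<K*l - 1. (u (Suc j))\<^sup>2) <= (\<Sum>j<K*l. (u j)\<^sup>2)" .
  have 2: "(\<Sum>j<K*l - 1. (u j)\<^sup>2) <= (\<Sum>j<K*l. (u j)\<^sup>2)" by (rule sum_mono2) auto
  show ?thesis using n 1 2 by (intro add_left_mono mult_left_mono add_mono) auto
 qed
 finally show ?thesis using n by (simp add: algebra_simps)
qed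

subsection \<open>The quadratic form of a bidiagonal array\<close>

text \<open>The potential that remains after 2 w w' = w^2 + w'^2 - (w' - w)^2 has turned the
  off-diagonal products of the quadratic form into squared differences, which carry the kinetic
  coefficient \<open>a (Suc j) * b j\<close>.\<close>

definition diag_coeff :: "(nat => real) => (nat => real) => nat => real" where
 "diag_coeff a b j = (a j)^2 + (b j)^2 + a (Suc j)*b j + (if j = 0 then 0 else a j*b (j - 1))"

lemma bidiagonal_form_aux:
 fixes a b w :: "nat => real"
 shows "(a 0*w 0)^2 + (\<Sum>i<m. (a (Suc i)*w (Suc i) + b i*w i)\<^sup>2)
   = (\<Sum>j<m. diag_coeff a b j*(w j)^2) + ((a m)^2 + (if m = 0 then 0 else a m*b (m - 1)))*(w m)^2
    - (\<Sum>i<m. a (Suc i)*b i*(w (Suc i) - w i)^2)"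
proof (induction m)
 case 0
 show ?case by (simp add: power_mult_distrib)
next
 case (Suc m)
 show ?case
  unfolding sum.lessThan_Suc using Suc.IH
  by (simp add: diag_coeff_def power2_eq_square algebra_simps)
qed

lemma bidiagonal_form:
 fixes a b w :: "nat => real"
 assumes n: "n \<ge> 1" and b: "b (n - 1) = 0"
 shows "(a 0*w 0)^2 + (\<Sum>i<n - 1. (a (Suc i)*w (Suc i) + b i*w i)\<^sup>2)
   = (\<Sum>j<n. diag_coeff a b j*(w j)^2) - (\<Sum>i<n - 1. a (Suc i)*b i*(w (Suc i) - w i)^2)"
proof -
 obtain m where m: "n = Suc m" using n by (cases n) auto
 show ?thesis using bidiagonal_form_aux[of a w b m] b by (simp add: m diag_coeff_def)
qed

text \<open>A purely deterministic setting: entries \<open>a\<close>, \<open>b\<close> within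
  \<open>L\<close> of their means \<open>A\<close>, \<open>B\<close>, and control of the first-order
  noise in blocks of length \<open>l\<close>. The blocks cover roughly the first half of the
  coordinates, where the means are still of order sqrt n. Beyond, the potential is so large that
  crude bounds do. The hypothesis \<open>large\<close> makes sqrt n at least 1024 \<Gamma>
  L^2.\<close>

locale good_bidiagonal =
 fixes n p l K :: nat and \<Gamma> L :: real and a b A B :: "nat => real" and X :: "nat => nat => real"
 assumes np: "n <= p" and p\<Gamma>: "real p <= \<Gamma>*n" and \<Gamma>1: "1 <= \<Gamma>" and L1: "1 <= L"
  and large: "2 ^ 20*\<Gamma>\<^sup>2*L ^ 4 <= n"
  and l1: "1 <= l" and l_small: "16*l <= n" and K: "K = n div (2*l)"
  and A: "!!j. j < n ==> 0 <= A j \<and> real p - j - 144 <= (A j)^2 \<and> (A j)\<^sup>2 <= real p - j" "!!j. n <= j ==> A j = 0"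
  and B: "!!j. j + 2 <= n ==> 0 <= B j \<and> real n - 1 - j - 144 <= (B j)^2 \<and> (B j)\<^sup>2 <= real n - 1 - j"
   "!!j. n < j + 2 ==> B j = 0"
  and ab: "!!j. 0 <= a j" "!!j. 0 <= b j" "!!j. n <= j ==> a j = 0" "!!j. n < j + 2 ==> b j = 0"
  and dev: "!!j. \<bar>a j - A j\<bar> <= L" "!!j. \<bar>b j - B j\<bar> <= L"
  and blk: "!!c r. c < K ==> r <= l ==> \<bar>\<Sum>j\<in>{c*l..<c*l + r}.
    2*A j*(a j - A j) + 2*B j*(b j - B j) + A (Suc j)*(b j - B j) + B j*(a (Suc j) - A (Suc j))
    + (if j = 0 then 0 else A j*(b (j - 1) - B (j - 1)) + B (j - 1)*(a j - A j))\<bar> <= sqrt (real n*l)*L"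
  and X: "!!w. qf n p X w = (a 0*w 0)^2 + (\<Sum>i<n - 1. (a (Suc i)*w (Suc i) + b i*w i)\<^sup>2)"
begin

definition "N = K*l"
definition "edge = (sqrt p + sqrt n)^2"
text \<open>\<open>T\<close> bounds the partial sums of the potential's noise over a block: the
  first-order part, plus up to \<open>l\<close> second-order remainders of size at most 4 L^2.
  \<open>K3\<close> is the resulting coefficient of the mass in \<open>noise_bound\<close>.\<close>

definition "T = sqrt (real n*l)*L + 4*l*L\<^sup>2"
definition "K3 = T/l + 32*T\<^sup>2/n"

lemma n_ge: "2 ^ 20 <= real n"
proof -
 have "1 <= \<Gamma>\<^sup>2*L ^ 4" using \<Gamma>1 L1 by (intro mult_ge1_I one_le_power) auto
 hence "2 ^ 20*1 <= 2 ^ 20*(\<Gamma>\<^sup>2*L ^ 4)" by (intro mult_left_mono) auto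
 thus ?thesis using large by simp
qed

lemma n_pos: "0 < real n" "1 <= n"
 using n_ge by auto

lemma sqrt_n: "2 ^ 10*\<Gamma>*L\<^sup>2 <= sqrt n"
proof -
 have "sqrt ((2 ^ 10*\<Gamma>*L\<^sup>2)^2) <= sqrt n"
  using large by (intro real_sqrt_le_mono) (simp add: power_mult_distrib power_mult[symmetric])
 thus ?thesis using \<Gamma>1 by simp
qed

lemma sqrt_n_sq: "sqrt n * sqrt n = n" by simp

lemma L_le: "1024*L <= sqrt n" "1024*\<Gamma>*L <= sqrt n" "1024*L\<^sup>2 <= sqrt n"
proof -
 have "L <= L\<^sup>2" using L1 by (simp add: power2_eq_square)
 hence 1: "\<Gamma>*L <= \<Gamma>*L\<^sup>2" using \<Gamma>1 by (intro mult_left_mono) auto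
 show 2: "1024*\<Gamma>*L <= sqrt n" using 1 sqrt_n by simp
 have "1*L <= \<Gamma>*L" using \<Gamma>1 L1 by (intro mult_right_mono) auto
 thus "1024*L <= sqrt n" using 2 by simp
 have "1*L\<^sup>2 <= \<Gamma>*L\<^sup>2" using \<Gamma>1 by (intro mult_right_mono) auto
 thus "1024*L\<^sup>2 <= sqrt n" using sqrt_n by simp
qed

lemma N_bounds: "2*N <= n" "7*n <= 16*N"
proof -
 have "2*N = n div (2*l)*(2*l)" unfolding N_def by (simp add: K)
 also have "... <= n" by (rule div_times_less_eq_dividend)
 finally show "2*N <= n" .
 have "n = n div (2*l)*(2*l) + n mod (2*l)" by (rule div_mult_mod_eq[symmetric])
 moreover have "n mod (2*l) < 2*l" using l1 by simp
 ultimately have "n < 2*N + 2*l" unfolding N_def by (simp add: K)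
 thus "7*n <= 16*N" using l_small by simp
qed

lemma sqrt_p: "sqrt p <= \<Gamma> * sqrt n" "sqrt n <= sqrt p"
proof -
 have "sqrt \<Gamma> <= sqrt (\<Gamma>\<^sup>2)" using \<Gamma>1 by (intro real_sqrt_le_mono) (simp add: power2_eq_square)
 hence "sqrt \<Gamma> <= \<Gamma>" using \<Gamma>1 by simp
 moreover have "sqrt p <= sqrt \<Gamma> * sqrt n" using p\<Gamma> by (simp add: real_sqrt_mult[symmetric])
 ultimately show "sqrt p <= \<Gamma> * sqrt n" using mult_right_mono[of "sqrt \<Gamma>" \<Gamma> "sqrt n"] by simp
 show "sqrt n <= sqrt p" using np by simp
qed

lemma A_le: "0 <= A j" "A j <= sqrt p"
proof -
 have "0 <= A j \<and> (A j)\<^sup>2 <= p" using A[of j] by (cases "j < n") auto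
 thus "0 <= A j" "A j <= sqrt p" by (auto intro: real_le_rsqrt)
qed

lemma B_le: "0 <= B j" "B j <= sqrt n"
proof -
 have "0 <= B j \<and> (B j)\<^sup>2 <= n" using B[of j] by (cases "j + 2 <= n") auto
 thus "0 <= B j" "B j <= sqrt n" by (auto intro: real_le_rsqrt)
qed

lemma a_le: "a j <= 2*\<Gamma> * sqrt n" and b_le: "b j <= 2 * sqrt n"
proof -
 have "L <= sqrt n" using L_le(1) L1 by linarith
 moreover have "sqrt n <= \<Gamma> * sqrt n" using \<Gamma>1 by (simp add: mult_le_cancel_right1)
 moreover have "a j <= A j + L" "b j <= B j + L" using dev[of j] by (auto simp: abs_le_iff)
 ultimately show "a j <= 2*\<Gamma> * sqrt n" "b j <= 2 * sqrt n"
  using A_le[of j] B_le[of j] sqrt_p by linarith+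
qed

text \<open>The part of \<open>diag_coeff a b j - diag_coeff A B j\<close> that is linear in the
  deviations; the rest consists of four products of two deviations.\<close>

definition "lin j = 2*A j*(a j - A j) + 2*B j*(b j - B j) + A (Suc j)*(b j - B j) + B j*(a (Suc j) - A (Suc j))
    + (if j = 0 then 0 else A j*(b (j - 1) - B (j - 1)) + B (j - 1)*(a j - A j))"

lemma dev_prod: "\<bar>(a i - A i)*(b j - B j)\<bar> <= L\<^sup>2" "\<bar>(a i - A i)\<^sup>2\<bar> <= L\<^sup>2" "\<bar>(b i - B i)\<^sup>2\<bar> <= L\<^sup>2"
 using mult_mono[OF dev(1)[of i] dev(2)[of j]] mult_mono[OF dev(1)[of i] dev(1)[of i]] mult_mono[OF dev(2)[of i] dev(2)[of i]] L1
 by (auto simp: abs_mult power2_eq_square)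

lemma diag_diff: "\<bar>diag_coeff a b j - diag_coeff A B j - lin j\<bar> <= 4*L\<^sup>2"
proof -
 define t where "t = (if j = 0 then 0 else (a j - A j)*(b (j - 1) - B (j - 1)))"
 have "diag_coeff a b j - diag_coeff A B j - lin j = (a j - A j)^2 + (b j - B j)^2 + (a (Suc j) - A (Suc j))*(b j - B j) + t"
  by (simp add: t_def diag_coeff_def lin_def power2_eq_square algebra_simps)
 moreover have "\<bar>t\<bar> <= L\<^sup>2" using dev_prod(1)[of j "j - 1"] by (auto simp: t_def)
 moreover note dev_prod(2)[of j] dev_prod(3)[of j] dev_prod(1)[of "Suc j" j]
 ultimately show ?thesis by linarith
qed

lemma diag_blk:
 assumes "c < K" "r <= l"
 shows "\<bar>\<Sum>j\<in>{c*l..<c*l + r}. diag_coeff a b j - diag_coeff A B j\<bar> <= T"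
proof -
 have "\<bar>\<Sum>j\<in>{c*l..<c*l + r}. diag_coeff a b j - diag_coeff A B j\<bar>
  = \<bar>(\<Sum>j\<in>{c*l..<c*l + r}. lin j) + (\<Sum>j\<in>{c*l..<c*l + r}. diag_coeff a b j - diag_coeff A B j - lin j)\<bar>"
  by (simp add: sum.distrib[symmetric])
 also have "... <= sqrt (real n*l)*L + (\<Sum>j\<in>{c*l..<c*l + r}. 4*L\<^sup>2)"
 proof -
  have "\<bar>\<Sum>j\<in>{c*l..<c*l + r}. lin j\<bar> <= sqrt (real n*l)*L"
   using blk[OF assms] unfolding lin_def .
  moreover have "\<bar>\<Sum>j\<in>{c*l..<c*l + r}. diag_coeff a b j - diag_coeff A B j - lin j\<bar> <= (\<Sum>j\<in>{c*l..<c*l + r}. 4*L\<^sup>2)"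
   by (rule order_trans[OF sum_abs]) (intro sum_mono diag_diff)
  ultimately show ?thesis by (rule order_trans[OF abs_triangle_ineq add_mono])
 qed
 also have "(\<Sum>j\<in>{c*l..<c*l + r}. 4*L\<^sup>2) = real r*(4*L\<^sup>2)" by simp
 also have "... <= real l*(4*L\<^sup>2)" using assms by (intro mult_right_mono) auto
 finally show ?thesis by (simp add: T_def mult_ac)
qed

text \<open>From \<open>N\<close> on, \<open>j\<close> is at least 7n/16, whereas the noise is at
  most 8 sqrt(p) L + 4 L^2, which \<open>large\<close> makes at most 12n/1024. Half of the potential
  drop 2j of \<open>edge_lower\<close> absorbs it.\<close>

lemma diag_crude: assumes "N <= j" shows "\<bar>diag_coeff a b j - diag_coeff A B j\<bar> <= j"
proof -
 let ?s = "sqrt p"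
 have m: "\<bar>u * v\<bar> <= ?s*L" if "0 <= u" "u <= ?s" "\<bar>v\<bar> <= L" for u v
  using that mult_mono[of u ?s "\<bar>v\<bar>" L] by (simp add: abs_mult)
 have Bs: "B i <= ?s" for i using B_le[of i] sqrt_p(2) by linarith
 have "\<bar>lin j\<bar> <= 8*(?s*L)"
  using m[OF A_le[of j] dev(1)[of j]] m[OF B_le(1) Bs dev(2)[of j], of j] m[OF A_le[of "Suc j"] dev(2)[of j]]
   m[OF B_le(1) Bs dev(1)[of "Suc j"], of j] m[OF A_le[of j] dev(2)[of "j - 1"]] m[OF B_le(1) Bs dev(1)[of j], of "j - 1"]
  unfolding lin_def by (auto simp: abs_le_iff)
 moreover have "?s*L <= n/1024"
 proof -
  have "?s*L <= \<Gamma> * sqrt n*L" using sqrt_p(1) L1 by (intro mult_right_mono) auto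
  also have "... = sqrt n*(\<Gamma>*L)" by simp
  also have "... <= sqrt n*(sqrt n/1024)" using L_le(2) by (intro mult_left_mono) auto
  finally show ?thesis by simp
 qed
 moreover have "L\<^sup>2 <= n/1024"
 proof -
  have "sqrt n*1 <= sqrt n * sqrt n" using n_ge by (intro mult_left_mono) auto
  thus ?thesis using L_le(3) by simp
 qed
 ultimately have "\<bar>diag_coeff a b j - diag_coeff A B j\<bar> <= 12*(n/1024)"
  using diag_diff[of j] by linarith
 moreover have "7*real n <= 16*real j" using N_bounds(2) assms by linarith
 ultimately show ?thesis by linarith
qed

lemma edge_eq: "edge = real p + real n + 2*(sqrt p * sqrt n)"
 by (simp add: edge_def power2_sum)

text \<open>The potential confines linearly: each of the two squared means has lost
  \<open>j\<close>, and the cross terms never exceed their values at the edge.\<close>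

lemma edge_lower: assumes "j < n" shows "2*real j <= edge - diag_coeff A B j"
proof -
 have "A (Suc j)*B j <= sqrt p * sqrt n" "A j*B (j - 1) <= sqrt p * sqrt n" "0 <= sqrt p * sqrt n"
  using A_le B_le by (auto intro!: mult_mono)
 moreover have "(A j)^2 <= real p - j" using A(1)[OF assms] by simp
 moreover have "(B j)^2 <= real n - 1 - j" using B[of j] assms by (cases "j + 2 <= n") auto
 moreover define t where "t = (if j = 0 then 0 else A j*B (j - 1))"
 moreover have "diag_coeff A B j = (A j)^2 + (B j)^2 + A (Suc j)*B j + t"
  by (simp add: diag_coeff_def t_def)
 moreover have "t <= sqrt p * sqrt n" using calculation(2,3) by (simp add: t_def)
 ultimately show ?thesis unfolding edge_eq by linarith
qed

lemma sqrt_lower: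
 fixes x y s :: real
 assumes "0 <= y" "0 < x" "0 <= s" "s <= x" "x - s <= y^2"
 shows "sqrt x - s / sqrt x <= y"
proof (rule power2_le_imp_le[OF _ assms(1)])
 have e: "sqrt x*(s / sqrt x) = s" "(s / sqrt x)^2 = s*(s/x)" "(sqrt x)^2 = x"
  using assms by (simp_all add: power_divide) (simp add: power2_eq_square)
 have "(sqrt x - s / sqrt x)^2 = x - 2 * s + s*(s/x)"
  unfolding power2_diff e mult.assoc by simp
 also have "... <= x - 2 * s + s*1" using assms by (intro add_left_mono mult_left_mono) (auto simp: field_simps)
 also have "... <= y^2" using assms by simp
 finally show "(sqrt x - s / sqrt x)^2 <= y^2" .
qed

text \<open>The squared means fall short of \<open>p\<close> and \<open>n\<close> by at most j +
  145: 144 from the variance bound for the chi laws, the rest from the position and the shift of the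
  index.\<close>

lemma AB_lower:
 assumes "i <= j + 1" "j < N" "i' <= j"
 shows "sqrt p * sqrt n - (\<Gamma> + 1)*(real j + 145) <= A i*B i'"
proof -
 define s where "s = real j + 145"
 have jn: "2*real j < n" using assms N_bounds by auto
 have sn: "0 <= s" "s <= n" "s <= p" using jn n_ge np by (auto simp: s_def)
 have p0: "0 < real p" using np n_pos by simp
 have "i < n" "i' + 2 <= n" using assms N_bounds n_ge by auto
 hence "sqrt p - s / sqrt p <= A i" "sqrt n - s / sqrt n <= B i'"
  using A(1)[of i] B(1)[of i'] assms sn p0 n_pos by (auto intro!: sqrt_lower simp: s_def)
 moreover have "0 <= sqrt p - s / sqrt p" "0 <= sqrt n - s / sqrt n"
  using sn p0 n_pos by (auto simp: field_simps)
 ultimately have "(sqrt p - s / sqrt p)*(sqrt n - s / sqrt n) <= A i*B i'"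
  using A_le by (intro mult_mono) auto
 moreover have "(sqrt p - s / sqrt p)*(sqrt n - s / sqrt n)
   = sqrt p * sqrt n - s*(sqrt p / sqrt n) - s*(sqrt n / sqrt p) + (s / sqrt p)*(s / sqrt n)"
  by (simp add: algebra_simps)
 moreover have "s*(sqrt p / sqrt n) <= s*\<Gamma>"
  using sqrt_p(1) n_pos sn by (intro mult_left_mono) (auto simp: field_simps)
 moreover have "s*(sqrt n / sqrt p) <= s*1"
  using sqrt_p(2) p0 sn by (intro mult_left_mono) (auto simp: field_simps)
 moreover have "0 <= (s / sqrt p)*(s / sqrt n)" using sn by simp
 moreover have "(\<Gamma> + 1) * s = s*\<Gamma> + s*1" by (simp add: algebra_simps)
 ultimately show ?thesis unfolding s_def[symmetric] by linarith
qed

text \<open>At j = 0 the potential lacks the term \<open>A j * B (j - 1)\<close> and lies below the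
  edge by order n, not by order j. The first coordinate acts as a Dirichlet wall, which is why the
  trial functions have to vanish there.\<close>

lemma edge_upper: assumes "1 <= j" "j < N" shows "edge - diag_coeff A B j <= 1000*\<Gamma>*j"
proof -
 have jn: "j + 2 <= n" using assms N_bounds n_ge by auto
 have 1: "sqrt p * sqrt n - (\<Gamma> + 1)*(real j + 145) <= A (Suc j)*B j"
  by (rule AB_lower) (use assms in auto)
 have 2: "sqrt p * sqrt n - (\<Gamma> + 1)*(real j + 145) <= A j*B (j - 1)"
  by (rule AB_lower) (use assms in auto)
 have "edge - diag_coeff A B j <= 2*real j + 289 + 2*((\<Gamma> + 1)*(real j + 145))"
  using 1 2 A(1)[of j] B(1)[of j] jn assms by (simp add: diag_coeff_def edge_eq)
 also have "... <= 2*(\<Gamma>*j) + 289*(\<Gamma>*j) + 2*((\<Gamma> + \<Gamma>)*(real j + 145*real j))"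
 proof (intro add_mono mult_left_mono mult_mono)
  have "1*1 <= \<Gamma>*real j" using \<Gamma>1 assms by (intro mult_mono) auto
  thus "289 <= 289*(\<Gamma>*j)" by simp
  show "real j <= \<Gamma>*real j" using \<Gamma>1 by (simp add: mult_le_cancel_right1)
 qed (use \<Gamma>1 assms in auto)
 also have "... <= 1000*\<Gamma>*j" using \<Gamma>1 by (simp add: algebra_simps)
 finally show ?thesis .
qed

lemma kin_nonneg: "0 <= a (Suc i)*b i"
 using ab by simp

lemma kin_upper: "a (Suc i)*b i <= 4*\<Gamma>*n"
proof -
 have "a (Suc i)*b i <= (2*\<Gamma> * sqrt n)*(2 * sqrt n)"
  using a_le b_le ab \<Gamma>1 by (intro mult_mono) auto
 also have "... = 4*\<Gamma>*(sqrt n * sqrt n)" by simp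
 finally show ?thesis by (simp only: sqrt_n_sq)
qed

lemma kin_lower: assumes "Suc i < N" shows "real n/4 <= a (Suc i)*b i"
proof -
 have i: "Suc i < n" "i + 2 <= n" "2*real (Suc i) <= n" using assms N_bounds by auto
 have half: "(6/10 * sqrt n)^2 <= real n/2 - 145"
  using n_ge by (simp add: power_mult_distrib power_divide)
 have "6/10 * sqrt n <= A (Suc i)"
 proof (rule power2_le_imp_le)
  have "real n/2 - 145 <= (A (Suc i))^2" using A(1)[OF i(1)] i np by auto
  thus "(6/10 * sqrt n)^2 <= (A (Suc i))^2" using half by linarith
 qed (rule A_le)
 moreover have "6/10 * sqrt n <= B i"
 proof (rule power2_le_imp_le)
  have "real n/2 - 145 <= (B i)^2" using B(1)[OF i(2)] i by auto
  thus "(6/10 * sqrt n)^2 <= (B i)^2" using half by linarith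
 qed (rule B_le)
 ultimately have "sqrt n/2 <= a (Suc i)" "sqrt n/2 <= b i"
  using dev[of "Suc i"] dev(2)[of i] L_le(1) n_pos by (auto simp: abs_le_iff)
 hence "(sqrt n/2)*(sqrt n/2) <= a (Suc i)*b i" by (intro mult_mono) (use ab in auto)
 thus ?thesis by simp
qed

lemma qf_expand: "qf n p X u = (\<Sum>j<n. diag_coeff a b j*(u j)^2) - (\<Sum>i<n - 1. a (Suc i)*b i*(u (Suc i) - u i)^2)"
 unfolding X by (rule bidiagonal_form) (use n_pos ab in auto)

lemma noise: "\<bar>\<Sum>j<N. (diag_coeff a b j - diag_coeff A B j)*(u j)^2\<bar>
  <= real n/8*(\<Sum>j<N - 1. (u (Suc j) - u j)\<^sup>2) + K3*(\<Sum>j<N. (u j)\<^sup>2)"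
 unfolding N_def K3_def by (rule noise_bound[OF diag_blk l1 n_pos(1)])

lemma K3_nonneg: "0 <= K3"
 using L1 by (auto simp: K3_def T_def)

lemma sum_split_n: "(\<Sum>j<n. f j) = (\<Sum>j<N. f j) + (\<Sum>j\<in>{N..<n}. (f j :: real))"
 using N_bounds by (simp add: lessThan_atLeast0 sum.atLeastLessThan_concat)

lemma sum_split: "(\<Sum>j<p. f j) = (\<Sum>j<N. f j) + (\<Sum>j\<in>{N..<n}. f j) + (\<Sum>j\<in>{n..<p}. (f j :: real))"
 using np by (simp only: sum_split_n[symmetric]) (simp add: lessThan_atLeast0 sum.atLeastLessThan_concat)

text \<open>Comparison with a discrete Airy operator, kinetic energy plus the linear potential
  \<open>j\<close>. Half of the kinetic energy has paid for the noise. Coordinates from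
  \<open>n\<close> on are invisible to the form, and there \<open>edge\<close> exceeds
  \<open>j\<close> because it exceeds \<open>p\<close>.\<close>

theorem form_lower:
 "real n/8*(\<Sum>j<N - 1. (u (Suc j) - u j)\<^sup>2) + (\<Sum>j<p. real j*(u j)^2) - K3*ip p u u <= edge*ip p u u - qf n p X u"
proof -
 let ?W = "\<lambda>j. diag_coeff a b j - diag_coeff A B j" and ?D = "\<lambda>j. (u (Suc j) - u j)\<^sup>2"
 have kin: "real n/4*(\<Sum>j<N - 1. ?D j) <= (\<Sum>i<n - 1. a (Suc i)*b i * ?D i)"
 proof -
  have "real n/4*(\<Sum>j<N - 1. ?D j) <= (\<Sum>i<N - 1. a (Suc i)*b i * ?D i)"
   unfolding sum_distrib_left by (intro sum_mono mult_right_mono kin_lower) auto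
  also have "... <= (\<Sum>i<n - 1. a (Suc i)*b i * ?D i)"
   by (rule sum_mono2) (use N_bounds kin_nonneg in auto)
  finally show ?thesis .
 qed
 have p1: "(\<Sum>j<N. real j*(u j)^2) <= (\<Sum>j<N. (edge - diag_coeff A B j)*(u j)^2)"
 proof (intro sum_mono mult_right_mono)
  fix j assume "j \<in> {..<N}"
  hence "j < n" using N_bounds by auto
  thus "real j <= edge - diag_coeff A B j" using edge_lower[of j] by simp
 qed auto
 have p2: "(\<Sum>j\<in>{N..<n}. real j*(u j)^2) <= (\<Sum>j\<in>{N..<n}. (edge - diag_coeff A B j - ?W j)*(u j)^2)"
 proof (intro sum_mono mult_right_mono)
  fix j assume "j \<in> {N..<n}"
  thus "real j <= edge - diag_coeff A B j - ?W j" using edge_lower[of j] diag_crude[of j] by auto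
 qed auto
 have p3: "(\<Sum>j\<in>{n..<p}. real j*(u j)^2) <= (\<Sum>j\<in>{n..<p}. edge*(u j)^2)"
 proof (intro sum_mono mult_right_mono)
  fix j assume "j \<in> {n..<p}"
  hence "real j <= real p" by simp
  also have "... <= edge" unfolding edge_eq by simp
  finally show "real j <= edge" .
 qed auto
 have K: "K3*(\<Sum>j<N. (u j)\<^sup>2) <= K3*ip p u u"
  unfolding ip_self_eq using N_bounds np by (intro mult_left_mono K3_nonneg sum_mono2) auto
 have "edge*ip p u u - qf n p X u = (\<Sum>j<N. (edge - diag_coeff A B j)*(u j)^2) - (\<Sum>j<N. ?W j*(u j)^2)
   + (\<Sum>j\<in>{N..<n}. (edge - diag_coeff A B j - ?W j)*(u j)^2) + (\<Sum>j\<in>{n..<p}. edge*(u j)^2)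
   + (\<Sum>i<n - 1. a (Suc i)*b i * ?D i)"
  unfolding qf_expand ip_self_eq sum_distrib_left sum_split[of "\<lambda>j. edge*(u j)^2"] sum_split_n
  by (simp add: left_diff_distrib sum_subtractf)
 thus ?thesis
  unfolding sum_split[of "\<lambda>j. real j*(u j)^2"] using kin p1 p2 p3 K noise[of u] by linarith
qed

text \<open>The reverse comparison, for functions that vanish at the wall j = 0 and near the end of
  the blocks, where the potential has no sharp upper bound.\<close>

theorem form_upper:
 assumes u: "u 0 = 0" "!!j. N - 1 <= j ==> u j = 0"
 shows "edge*ip p u u - qf n p X u
   <= 1000*\<Gamma>*(\<Sum>j<p. real j*(u j)^2) + K3*ip p u u + 5*\<Gamma>*n*(\<Sum>j<N - 1. (u (Suc j) - u j)\<^sup>2)"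
proof -
 let ?W = "\<lambda>j. diag_coeff a b j - diag_coeff A B j" and ?D = "\<lambda>j. (u (Suc j) - u j)\<^sup>2"
 have z: "(\<Sum>j\<in>{N..<n}. f j*(u j)^2) = 0" "(\<Sum>j\<in>{n..<p}. f j*(u j)^2) = 0" for f
  using u(2) N_bounds by (auto intro!: sum.neutral)
 have kin: "(\<Sum>i<n - 1. a (Suc i)*b i * ?D i) <= 4*\<Gamma>*n*(\<Sum>j<N - 1. ?D j)"
 proof -
  have "(\<Sum>i<n - 1. a (Suc i)*b i * ?D i) = (\<Sum>i<N - 1. a (Suc i)*b i * ?D i)"
   by (rule sum.mono_neutral_right) (use N_bounds u(2) in auto)
  also have "... <= 4*\<Gamma>*n*(\<Sum>j<N - 1. ?D j)"
   unfolding sum_distrib_left by (intro sum_mono mult_right_mono kin_upper) auto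
  finally show ?thesis .
 qed
 have p1: "(\<Sum>j<N. (edge - diag_coeff A B j)*(u j)^2) <= 1000*\<Gamma>*(\<Sum>j<N. real j*(u j)^2)"
  unfolding sum_distrib_left
 proof (intro sum_mono)
  fix j assume "j \<in> {..<N}"
  thus "(edge - diag_coeff A B j)*(u j)^2 <= 1000*\<Gamma>*(real j*(u j)^2)"
   using u(1) mult_right_mono[OF edge_upper[of j], of "(u j)^2"] by (cases "j = 0") (auto simp: mult_ac)
 qed
 have D0: "0 <= (\<Sum>j<N - 1. ?D j)" by (simp add: sum_nonneg)
 have "real n/8*(\<Sum>j<N - 1. ?D j) <= \<Gamma>*n*(\<Sum>j<N - 1. ?D j)"
  using \<Gamma>1 n_pos D0 by (intro mult_right_mono) (auto simp: mult_le_cancel_right1)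
 moreover have "edge*ip p u u - qf n p X u = (\<Sum>j<N. (edge - diag_coeff A B j)*(u j)^2) - (\<Sum>j<N. ?W j*(u j)^2)
   + (\<Sum>i<n - 1. a (Suc i)*b i * ?D i)"
  unfolding qf_expand ip_self_eq sum_distrib_left sum_split[of "\<lambda>j. edge*(u j)^2"] sum_split_n z
  by (simp add: left_diff_distrib sum_subtractf)
 moreover have "ip p u u = (\<Sum>j<N. (u j)\<^sup>2)"
  unfolding ip_self_eq sum_split using z[of "\<lambda>_. 1"] by simp
 moreover have "(\<Sum>j<p. real j*(u j)^2) = (\<Sum>j<N. real j*(u j)^2)"
  unfolding sum_split[of "\<lambda>j. real j*(u j)^2"] using z[of real] by simp
 ultimately show ?thesis using kin p1 noise[of u] by (simp add: algebra_simps)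
qed

end

subsection \<open>Trial functions\<close>

definition hat :: "nat => nat => real" where
 "hat m t = (if t <= m then real t else real (2*m) - real t)"

text \<open>The span of \<open>k\<close> tents of base 2m on consecutive intervals starting at 0;
  \<open>x c\<close> scales the \<open>c\<close>-th tent.\<close>

definition hats :: "nat => nat => (nat => real) => nat => real" where
 "hats m k x j = (if j < 2*m * k then x (j div (2*m))*hat m (j mod (2*m)) else 0)"

lemma sum_blocks:
 fixes f :: "nat => real"
 shows "(\<Sum>j<d * k. f j) = (\<Sum>c<k. \<Sum>t<d. f (c*d + t))"
proof -
 have "(\<Sum>j<d * k. f j) = (\<Sum>c<k. \<Sum>j\<in>{c*d..<c*d + d}. f j)"
  using sum.nat_group[of f d k] by (simp add: mult.commute)
 also have "... = (\<Sum>c<k. \<Sum>t<d. f (c*d + t))"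
 proof (rule sum.cong[OF refl])
  fix c
  show "(\<Sum>j\<in>{c*d..<c*d + d}. f j) = (\<Sum>t<d. f (c*d + t))"
   using sum.shift_bounds_nat_ivl[of f 0 "c*d" d] by (simp add: atLeast0LessThan add.commute)
 qed
 finally show ?thesis .
qed

lemma hats_block: "t < 2*m ==> c < k ==> hats m k x (c*(2*m) + t) = x c*hat m t"
proof -
 assume t: "t < 2*m" and c: "c < k"
 have "c*(2*m) + t < Suc c*(2*m)" using t by simp
 also have "... <= k*(2*m)" using c by (intro mult_right_mono) auto
 finally have "c*(2*m) + t < 2*m * k" by (simp add: mult.commute)
 thus ?thesis using t by (simp add: hats_def)
qed

lemma hats_zero: "2*m * k <= j ==> hats m k x j = 0"
 by (simp add: hats_def)

lemma hats_at_0: "hats m k x 0 = 0"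
 by (simp add: hats_def hat_def)

text \<open>Every step of a tent is 1 or -1 times its scale, including the step out of it: a tent
  ends at height 1 and the next starts at 0. The total kinetic energy thus splits over the blocks
  without boundary terms.\<close>

lemma hats_increment:
 assumes "1 <= m" "t < 2*m" "c < k"
 shows "(hats m k x (Suc (c*(2*m) + t)) - hats m k x (c*(2*m) + t))^2 = (x c)^2"
proof (cases "Suc t < 2*m")
 case True
 have "hats m k x (c*(2*m) + Suc t) - hats m k x (c*(2*m) + t) = x c*(hat m (Suc t) - hat m t)"
  unfolding hats_block[OF True assms(3)] hats_block[OF assms(2,3)] by (simp add: right_diff_distrib)
 moreover have "hat m (Suc t) - hat m t = (if t < m then 1 else - 1)"
  by (cases "t < m"; cases "t = m") (auto simp: hat_def)
 hence "(hat m (Suc t) - hat m t)^2 = 1" by simp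
 ultimately show ?thesis by (simp add: power_mult_distrib)
next
 case False
 hence t: "t = 2*m - 1" using assms by simp
 have "hats m k x (Suc (c*(2*m) + t)) = 0"
 proof (cases "Suc c < k")
  case True
  have eq: "Suc (c*(2*m) + t) = Suc c*(2*m) + 0" using assms t by simp
  have "hats m k x (Suc c*(2*m) + 0) = x (Suc c)*hat m 0"
   by (rule hats_block) (use True assms in auto)
  thus ?thesis unfolding eq by (simp only: hat_def) simp
 next
  case False
  hence "k = Suc c" using assms by simp
  thus ?thesis using t assms by (intro hats_zero) simp
 qed
 moreover have "hat m t = 1" using t assms by (auto simp: hat_def)
 ultimately show ?thesis using hats_block[OF assms(2,3), of x] by simp
qed

text \<open>The heights at t and m + t are paired: t^2 + (m - t)^2 is at least m^2/2.\<close>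

lemma sum_hat_sq: "real m ^ 3/2 <= (\<Sum>t<2*m. (hat m t)\<^sup>2)"
proof -
 have "(\<Sum>t<2*m. (hat m t)\<^sup>2) = (\<Sum>t<m. (hat m t)\<^sup>2) + (\<Sum>t<m. (hat m (m + t))\<^sup>2)"
  using sum_blocks[of "\<lambda>t. (hat m t)\<^sup>2" m 2] by (simp add: numeral_2_eq_2 mult.commute)
 also have "... = (\<Sum>t<m. (real t)\<^sup>2 + (real m - real t)^2)"
  unfolding sum.distrib[symmetric] by (rule sum.cong) (auto simp: hat_def)
 also have "... \<ge> (\<Sum>t<m. (real m)\<^sup>2/2)"
 proof (rule sum_mono)
  fix t
  have "0 <= (real m - 2*real t)^2" by simp
  thus "(real m)^2/2 <= (real t)^2 + (real m - real t)^2"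
   by (simp add: power2_eq_square algebra_simps)
 qed
 finally show ?thesis by (simp add: power3_eq_cube power2_eq_square)
qed

context good_bidiagonal
begin

text \<open>The potential is at most its value 2mk at the end of the support. The kinetic energy 2mS
  stands against a mass of at least m^3 S/2, a quotient of 4/m^2. The constants of
  \<open>form_upper\<close> turn these into 2000 and 20.\<close>

lemma hats_energy:
 fixes x :: "nat => real"
 assumes m: "1 <= m" and fits: "2*m * k < N"
 defines "u \<equiv> hats m k x"
 shows "edge*ip p u u - qf n p X u <= (2000*\<Gamma>*m * k + K3 + 20*\<Gamma>*n/(real m)^2)*ip p u u"
proof -
 define S where "S = (\<Sum>c<k. (x c)\<^sup>2)"
 have S0: "0 <= S" by (simp add: S_def sum_nonneg)
 have kp: "2*m * k <= p" "2*m * k <= N - 1" using fits N_bounds np by auto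
 have ipe: "ip p u u = (\<Sum>c<k. (x c)\<^sup>2*(\<Sum>t<2*m. (hat m t)\<^sup>2))"
 proof -
  have "ip p u u = (\<Sum>j<2*m * k. (u j)\<^sup>2)"
   unfolding ip_self_eq by (rule sum.mono_neutral_right) (use kp in \<open>auto simp: u_def hats_zero\<close>)
  also have "... = (\<Sum>c<k. \<Sum>t<2*m. (u (c*(2*m) + t))\<^sup>2)" by (rule sum_blocks)
  also have "... = (\<Sum>c<k. \<Sum>t<2*m. (x c)\<^sup>2*(hat m t)^2)"
   by (intro sum.cong refl) (simp add: u_def hats_block power_mult_distrib)
  finally show ?thesis by (simp add: sum_distrib_left)
 qed
 have ipS: "real m ^ 3/2*S <= ip p u u"
 proof -
  have "real m ^ 3/2*S <= (\<Sum>t<2*m. (hat m t)\<^sup>2)*S" by (intro mult_right_mono sum_hat_sq S0)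
  moreover have "ip p u u = (\<Sum>t<2*m. (hat m t)\<^sup>2)*S"
   unfolding ipe S_def sum_distrib_right[symmetric] by (rule mult.commute)
  ultimately show ?thesis by simp
 qed
 have kin: "(\<Sum>j<N - 1. (u (Suc j) - u j)\<^sup>2) = 2*m*S"
 proof -
  have "(\<Sum>j<N - 1. (u (Suc j) - u j)\<^sup>2) = (\<Sum>j<2*m * k. (u (Suc j) - u j)\<^sup>2)"
   by (rule sum.mono_neutral_right) (use kp in \<open>auto simp: u_def hats_zero\<close>)
  also have "... = (\<Sum>c<k. \<Sum>t<2*m. (u (Suc (c*(2*m) + t)) - u (c*(2*m) + t))\<^sup>2)" by (rule sum_blocks)
  also have "... = (\<Sum>c<k. \<Sum>t<2*m. (x c)\<^sup>2)"
   unfolding u_def by (intro sum.cong refl hats_increment[OF m]) auto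
  finally show ?thesis by (simp add: S_def sum_distrib_left)
 qed
 have pot: "(\<Sum>j<p. real j*(u j)^2) <= 2*m * k*ip p u u"
  unfolding ip_self_eq sum_distrib_left
 proof (rule sum_mono)
  fix j
  show "real j*(u j)^2 <= real (2*m * k)*(u j)^2"
  proof (cases "j < 2*m * k")
   case True
   thus ?thesis by (intro mult_right_mono) (auto simp del: of_nat_mult)
  qed (simp add: u_def hats_zero)
 qed
 have kinS: "2*real m*S <= 4/(real m)^2*ip p u u"
 proof -
  have "4/(real m)^2*(real m ^ 3/2*S) <= 4/(real m)^2*ip p u u" by (intro mult_left_mono ipS) auto
  moreover have "4/(real m)^2*(real m ^ 3/2*S) = 2*real m*S" using m by (simp add: power2_eq_square power3_eq_cube)
  ultimately show ?thesis by simp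
 qed
 have "edge*ip p u u - qf n p X u <= 1000*\<Gamma>*(\<Sum>j<p. real j*(u j)^2) + K3*ip p u u + 5*\<Gamma>*n*(\<Sum>j<N - 1. (u (Suc j) - u j)\<^sup>2)"
  by (rule form_upper) (use kp in \<open>auto simp: u_def hats_at_0 hats_zero\<close>)
 also have "... <= 1000*\<Gamma>*(2*m * k*ip p u u) + K3*ip p u u + 5*\<Gamma>*n*(4/(real m)^2*ip p u u)"
  unfolding kin using pot kinS \<Gamma>1 by (intro add_mono mult_left_mono order_refl) auto
 also have "... = (2000*\<Gamma>*m * k + K3 + 20*\<Gamma>*n/(real m)^2)*ip p u u" by (simp add: algebra_simps)
 finally show ?thesis .
qed

lemma ip_hats: "ip p v (hats m k x) = (\<Sum>c<k. x c*ip p v (hats m k (\<lambda>i. if i = c then 1 else 0)))"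
proof -
 have "hats m k x j = (\<Sum>c<k. x c*hats m k (\<lambda>i. if i = c then 1 else 0) j)" for j
 proof (cases "j < 2*m * k")
  case True
  hence "j div (2*m) < k" by (simp add: less_mult_imp_div_less mult.commute)
  thus ?thesis using True by (simp add: hats_def if_distrib[of "\<lambda>y. y*_"] if_distrib[of "\<lambda>y. _*y"] cong: if_cong)
 qed (simp add: hats_zero)
 hence e: "hats m k x = (\<lambda>j. \<Sum>c<k. x c*hats m k (\<lambda>i. if i = c then 1 else 0) j)" by (rule ext)
 show ?thesis by (subst e) (simp only: ip_sum_right ip_scale_right)
qed

text \<open>Courant-Fischer: the \<open>k\<close>-dimensional trial space contains a nonzero vector
  orthogonal to the first k - 1 eigenvectors, and its quadratic form cannot exceed n times the
  \<open>k\<close>-th eigenvalue times its mass.\<close>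

lemma eigenvalue_lower:
 fixes e :: "nat => real"
 assumes es: "eigen_system n p X w e" and m: "1 <= m" and fits: "2*m * k < N" and k: "1 <= k"
 shows "edge - (2000*\<Gamma>*m * k + K3 + 20*\<Gamma>*n/(real m)^2) <= n*e (k - 1)"
proof -
 \<comment> \<open>The k - 1 orthogonality conditions on k coefficients, padded by a zero last row.
   The square matrix is then singular, and a kernel vector gives the coefficients.\<close>
 define G where "G = mat k k (\<lambda>(i, c). if i = k - 1 then 0 else ip p (w i) (hats m k (\<lambda>j. if j = c then 1 else 0)))"
 have Gc: "G \<in> carrier_mat k k" by (simp add: G_def)
 have "transpose_mat G *\<^sub>v unit_vec k (k - 1) = 0\<^sub>v k"
 proof (rule eq_vecI)
  fix c assume "c < dim_vec (0\<^sub>v k :: real vec)"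
  hence c: "c < k" by simp
  hence "(transpose_mat G *\<^sub>v unit_vec k (k - 1)) $ c = row (transpose_mat G) c \<bullet> unit_vec k (k - 1)"
   using Gc by simp
  also have "... = row (transpose_mat G) c $ (k - 1)"
   by (rule scalar_prod_right_unit) (use c k Gc in auto)
  also have "... = 0" using c k by (simp add: G_def)
  finally show "(transpose_mat G *\<^sub>v unit_vec k (k - 1)) $ c = 0\<^sub>v k $ c" using c by simp
 qed (simp add: G_def)
 moreover have "unit_vec k (k - 1) ~= (0\<^sub>v k :: real vec)"
 proof
  assume "unit_vec k (k - 1) = (0\<^sub>v k :: real vec)"
  hence "unit_vec k (k - 1) $ (k - 1) = (0\<^sub>v k :: real vec) $ (k - 1)" by simp
  thus False using k by simp
 qed
 moreover have "transpose_mat G \<in> carrier_mat k k" using Gc by simp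
 ultimately have "Determinant.det (transpose_mat G) = 0"
  by (subst det_0_iff_vec_prod_zero_field[of _ k]) (auto intro!: exI[of _ "unit_vec k (k - 1)"])
 hence "Determinant.det G = 0" using det_transpose[OF Gc] by simp
 then obtain v where v: "v \<in> carrier_vec k" "v ~= 0\<^sub>v k" "G *\<^sub>v v = 0\<^sub>v k"
  using det_0_iff_vec_prod_zero_field[OF Gc] by blast
 define x where "x c = v $ c" for c
 define u where "u = hats m k x"
 have orth: "ip p (w i) u = 0" if "i < k - 1" for i
 proof -
  have "(G *\<^sub>v v) $ i = 0" using v(3) that by simp
  hence "(\<Sum>c<k. G $$ (i, c) * v $ c) = 0"
   using that v(1) Gc by (simp add: scalar_prod_def atLeast0LessThan)
  moreover have "G $$ (i, c) * v $ c = x c*ip p (w i) (hats m k (\<lambda>j. if j = c then 1 else 0))" if "c < k" for c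
   using that \<open>i < k - 1\<close> by (simp add: G_def x_def)
  moreover have "ip p (w i) u = (\<Sum>c<k. x c*ip p (w i) (hats m k (\<lambda>j. if j = c then 1 else 0)))"
   unfolding u_def by (rule ip_hats)
  ultimately show ?thesis by simp
 qed
 have "\<exists>c<k. x c ~= 0"
 proof (rule ccontr)
  assume "\<not> ?thesis"
  hence z: "\<forall>c<k. v $ c = 0" unfolding x_def by blast
  have "v = 0\<^sub>v k"
  proof (rule eq_vecI)
   fix i assume "i < dim_vec (0\<^sub>v k :: real vec)"
   hence "i < k" by simp
   thus "v $ i = 0\<^sub>v k $ i" using z by simp
  qed (use v(1) in simp)
  thus False using v(2) by (rule notE[rotated])
 qed
 then obtain c where c: "c < k" "x c ~= 0" by blast
 have kp: "2*m * k <= p" using fits N_bounds np by auto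
 have upos: "0 < ip p u u"
 proof -
  have "u (c*(2*m) + 1) = x c*hat m 1" unfolding u_def by (rule hats_block) (use m c in auto)
  hence nz: "u (c*(2*m) + 1) ~= 0" using c m by (auto simp: hat_def)
  have "c*(2*m) + 1 < Suc c*(2*m)" using m by simp
  also have "... <= k*(2*m)" using c by (intro mult_right_mono) auto
  finally have "c*(2*m) + 1 < p" using kp by (simp add: mult.commute)
  hence "ip p u u ~= 0" using nz ip_self_0 by blast
  thus ?thesis using ip_self_nonneg[of p u] by linarith
 qed
 have "qf n p X u <= n*e (k - 1)*ip p u u"
 proof -
  have kp': "k <= p" using kp m by (metis le_trans mult_le_mono1 nat_mult_1 one_le_numeral mult_le_mono le_numeral_extra(4))
  have "qf n p X u = n*(\<Sum>a<p. e a*(ip p (w a) u)^2)" by (rule es_qf_expand[OF es])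
  also have "... <= n*(\<Sum>a<p. e (k - 1)*(ip p (w a) u)^2)"
  proof (intro mult_left_mono sum_mono)
   fix a assume a: "a \<in> {..<p}"
   show "e a*(ip p (w a) u)^2 <= e (k - 1)*(ip p (w a) u)^2"
   proof (cases "a < k - 1")
    case True
    thus ?thesis using orth by simp
   next
    case False
    thus ?thesis using es_antimono[OF es, of "k - 1" a] a by (intro mult_right_mono) auto
   qed
  qed auto
  also have "(\<Sum>a<p. e (k - 1)*(ip p (w a) u)^2) = e (k - 1)*ip p u u"
   by (simp add: orthonormal_expand[OF es_orthonormal[OF es], of u u] power2_eq_square sum_distrib_left)
  finally show ?thesis by simp
 qed
 moreover have "edge*ip p u u - qf n p X u <= (2000*\<Gamma>*m * k + K3 + 20*\<Gamma>*n/(real m)^2)*ip p u u"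
  unfolding u_def by (rule hats_energy[OF m fits])
 ultimately have "(edge - (2000*\<Gamma>*m * k + K3 + 20*\<Gamma>*n/(real m)^2))*ip p u u <= n*e (k - 1)*ip p u u"
  by (simp add: algebra_simps)
 thus ?thesis using upos by (simp only: mult_le_cancel_right_pos)
qed

subsection \<open>Delocalisation of low-energy vectors\<close>

text \<open>
 A unit vector of energy \<open>H\<close> below the edge has gradient of size \<open>H/n\<close> and is confined to the
 first \<open>H\<close> coordinates; a discrete Agmon inequality turns this into a pointwise bound.
\<close>

lemma low_energy_pointwise:
 assumes u: "ip p u u = 1" and low: "edge - qf n p X u <= h" and h: "1 <= h" and i: "i < n"
 shows "(u i)^2 <= 16*(h + K3) / sqrt (n*(real i + 1))"
proof -
 define H where "H = h + K3"
 let ?D = "\<lambda>j. (u (Suc j) - u j)\<^sup>2"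
 have H: "1 <= H" using h K3_nonneg by (simp add: H_def)
 have D0: "0 <= (\<Sum>j<N - 1. ?D j)" and P0: "0 <= (\<Sum>j<p. real j*(u j)^2)" by (auto intro!: sum_nonneg)
 have fl: "real n/8*(\<Sum>j<N - 1. ?D j) + (\<Sum>j<p. real j*(u j)^2) <= H"
  using form_lower[of u] low by (simp add: u H_def)
 hence kin: "real n*(\<Sum>j<N - 1. ?D j) <= 8*H" using P0 by linarith
 have pot: "(\<Sum>j<p. real j*(u j)^2) <= H" using fl D0 n_pos by (smt (verit) mult_nonneg_nonneg divide_nonneg_nonneg)
 \<comment> \<open>The weight that balances the two bounds below: kinetic energy contributes H/R and
   mass R/n * H/(i + 1), equal up to a constant since R^2 = n(i + 1).\<close>
 define R where "R = sqrt (n*(real i + 1))"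
 have R: "0 < R" "R <= n" "R*R = n*(real i + 1)"
 proof -
  show "0 < R" using n_pos by (simp add: R_def)
  have "sqrt (n*(real i + 1)) <= sqrt (real n*real n)" using i by (intro real_sqrt_le_mono mult_left_mono) auto
  thus "R <= n" by (simp add: R_def)
  show "R*R = n*(real i + 1)" using n_pos by (simp add: R_def)
 qed
 have far: "(u j)^2 <= 4*H/n" if "n <= 4*j" "j < p" for j
 proof -
  have "real j*(u j)^2 <= (\<Sum>j<p. real j*(u j)^2)"
   using that by (intro member_le_sum) auto
  hence "real j*(u j)^2 <= H" using pot by linarith
  moreover have "n/4*(u j)^2 <= real j*(u j)^2" using that by (intro mult_right_mono) auto
  ultimately show ?thesis using n_pos by (simp add: field_simps)
 qed
 have HR: "4*H/n <= 4*H/R" using R H n_pos by (intro divide_left_mono) auto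
 show ?thesis
 proof (cases "n <= 4*i")
  case True
  hence "(u i)^2 <= 4*H/R" using far[of i] HR i np by auto
  also have "... <= 16*H/R" using H R by (intro divide_right_mono) auto
  finally show ?thesis by (simp add: H_def R_def)
 next
  case False
  have Nb: "i <= N - 1" "n <= 4*(N - 1)" "N - 1 < p" "N <= p" using False N_bounds n_ge np by auto
  \<comment> \<open>Markov's inequality in the potential: the mass beyond \<open>i\<close> is at
    most H/i, and for i = 0 the total mass 1 is used.\<close>
  have tail: "(\<Sum>j\<in>{i..<p}. (u j)\<^sup>2) <= 2*H/(real i + 1)"
  proof (cases "i = 0")
   case True
   thus ?thesis using u H by (simp add: ip_self_eq atLeast0LessThan)
  next
   case i0: False
   have "real i*(\<Sum>j\<in>{i..<p}. (u j)\<^sup>2) <= (\<Sum>j\<in>{i..<p}. real j*(u j)^2)"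
    unfolding sum_distrib_left by (intro sum_mono mult_right_mono) auto
   also have "... <= (\<Sum>j<p. real j*(u j)^2)" by (rule sum_mono2) auto
   finally have 1: "real i*(\<Sum>j\<in>{i..<p}. (u j)\<^sup>2) <= H" using pot by linarith
   have "(real i + 1)*(\<Sum>j\<in>{i..<p}. (u j)\<^sup>2) <= (2*real i)*(\<Sum>j\<in>{i..<p}. (u j)\<^sup>2)"
    using i0 by (intro mult_right_mono sum_nonneg) auto
   hence "(real i + 1)*(\<Sum>j\<in>{i..<p}. (u j)\<^sup>2) <= 2*H" using 1 by linarith
   thus ?thesis by (simp add: field_simps)
  qed
  \<comment> \<open>Telescoping up to N - 1, where the potential alone already gives the bound; each
    increment is split with the weight \<open>R\<close>.\<close>
  have "(u i)^2 - (u (N - 1))\<^sup>2 = (\<Sum>j\<in>{i..<N - 1}. (u j)\<^sup>2 - (u (Suc j))\<^sup>2)"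
   using sum_Suc_diff'[OF Nb(1), of "\<lambda>j. - (u j)\<^sup>2"] by simp
  also have "... <= (\<Sum>j\<in>{i..<N - 1}. n/(2*R) * ?D j + R/n*((u (Suc j))^2 + (u j)^2))"
  proof (rule sum_mono)
   fix j
   define d s where "d = u j - u (Suc j)" and "s = u j + u (Suc j)"
   have "0 <= (n*d - R * s)^2/(2*n*R)" using R n_pos by simp
   also have "... = n/(2*R)*d^2 + R/(2*n) * s^2 - d * s"
    using R(1) n_pos by (simp add: power2_eq_square field_simps)
   finally have "d * s <= n/(2*R)*d^2 + R/(2*n) * s^2" by simp
   also have "d^2 = ?D j" by (simp add: d_def power2_commute)
   also have "R/(2*n) * s^2 <= R/(2*n)*(2*((u (Suc j))^2 + (u j)^2))"
    using R sum_squares_bound[of "u j" "u (Suc j)"] by (intro mult_left_mono) (auto simp: s_def power2_sum)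
   also have "R/(2*n)*(2*((u (Suc j))^2 + (u j)^2)) = R/n*((u (Suc j))^2 + (u j)^2)"
   proof -
    have "R/(2*n)*(2*x) = R/n*x" for x by simp
    thus ?thesis .
   qed
   also have "d * s = (u j)^2 - (u (Suc j))\<^sup>2" by (simp add: d_def s_def power2_eq_square algebra_simps)
   finally show "(u j)^2 - (u (Suc j))\<^sup>2 <= n/(2*R) * ?D j + R/n*((u (Suc j))^2 + (u j)^2)"
    by simp
  qed
  also have "... = n/(2*R)*(\<Sum>j\<in>{i..<N - 1}. ?D j) + R/n*((\<Sum>j\<in>{i..<N - 1}. (u (Suc j))\<^sup>2) + (\<Sum>j\<in>{i..<N - 1}. (u j)\<^sup>2))"
   by (simp only: sum.distrib sum_distrib_left[symmetric])
  also have "... <= 4*H/R + R/n*(2*H/(real i + 1) + 2*H/(real i + 1))"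
  proof (intro add_mono mult_left_mono)
   have "n*(\<Sum>j\<in>{i..<N - 1}. ?D j) <= n*(\<Sum>j<N - 1. ?D j)" by (intro mult_left_mono sum_mono2) auto
   hence "n*(\<Sum>j\<in>{i..<N - 1}. ?D j) <= 8*H" using kin by linarith
   hence "n*(\<Sum>j\<in>{i..<N - 1}. ?D j)/(2*R) <= 8*H/(2*R)" using R by (intro divide_right_mono) auto
   thus "n/(2*R)*(\<Sum>j\<in>{i..<N - 1}. ?D j) <= 4*H/R" by simp
   have "(\<Sum>j\<in>{i..<N - 1}. (u (Suc j))\<^sup>2) = (\<Sum>j\<in>{Suc i..<Suc (N - 1)}. (u j)\<^sup>2)"
    by (rule sum.shift_bounds_Suc_ivl[symmetric])
   also have "... <= (\<Sum>j\<in>{i..<p}. (u j)\<^sup>2)" by (rule sum_mono2) (use Nb in auto)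
   finally show "(\<Sum>j\<in>{i..<N - 1}. (u (Suc j))\<^sup>2) <= 2*H/(real i + 1)" using tail by linarith
   have "(\<Sum>j\<in>{i..<N - 1}. (u j)\<^sup>2) <= (\<Sum>j\<in>{i..<p}. (u j)\<^sup>2)" by (rule sum_mono2) (use Nb in auto)
   thus "(\<Sum>j\<in>{i..<N - 1}. (u j)\<^sup>2) <= 2*H/(real i + 1)" using tail by linarith
  qed (use R n_pos in auto)
  also have "R/n*(2*H/(real i + 1) + 2*H/(real i + 1)) = 4*H/R"
  proof -
   have "R/n*(4*H/(real i + 1)) = 4*H*(R/(n*(real i + 1)))" by simp
   also have "n*(real i + 1) = R*R" using R(3) by simp
   finally show ?thesis using R(1) by simp
  qed
  finally have "(u i)^2 <= (u (N - 1))^2 + 8*H/R" by simp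
  also have "(u (N - 1))^2 <= 4*H/R" using far[of "N - 1"] HR Nb by auto
  also have "4*H/R + 8*H/R <= 16*H/R" using H R by (simp add: field_simps)
  finally show ?thesis by (simp add: H_def R_def)
 qed
qed

text \<open>The diagonal entry of the projection is the largest squared value at \<open>i\<close> of
  a unit vector in the span of the first \<open>k\<close> eigenvectors. The maximiser
  \<open>u\<close> still has low energy, so the pointwise bound applies to it once, and no factor
  \<open>k\<close> is lost by summing over eigenvectors.\<close>

theorem projection_diagonal:
 fixes e :: "nat => real"
 assumes es: "eigen_system n p X w e" and k: "1 <= k" "k <= p" and low: "edge - h <= n*e (k - 1)" and h: "1 <= h" and i: "i < n"
 shows "(\<Sum>m<k. (w m i)\<^sup>2) <= 16*(h + K3) / sqrt (n*(real i + 1))"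
proof -
 define \<rho> where "\<rho> = (\<Sum>m<k. (w m i)\<^sup>2)"
 have \<rho>0: "0 <= \<rho>" by (simp add: \<rho>_def sum_nonneg)
 show ?thesis
 proof (cases "\<rho> = 0")
  case True
  thus ?thesis using h K3_nonneg by (simp add: \<rho>_def[symmetric])
 next
  case False
  hence \<rho>: "\<rho> > 0" using \<rho>0 by simp
  define c where "c m = w m i / sqrt \<rho>" for m
  define u where "u j = (\<Sum>m<k. c m*w m j)" for j
  have c2: "(\<Sum>m<k. (c m)\<^sup>2) = 1"
   using \<rho> by (simp add: c_def power_divide sum_divide_distrib[symmetric] \<rho>_def[symmetric])
  have o: "orthonormal p p w" by (rule es_orthonormal[OF es])
  have wu: "ip p (w a) u = (if a < k then c a else 0)" if "a < p" for a
  proof -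
   have "ip p (w a) u = (\<Sum>m<k. c m*ip p (w a) (w m))" unfolding u_def by (simp add: ip_sum_right ip_scale_right)
   also have "... = (\<Sum>m<k. if m = a then c a else 0)"
    using that k o by (intro sum.cong) (auto simp: orthonormal_def)
   finally show ?thesis by simp
  qed
  have ind: "(\<Sum>a<p. f a*(ip p (w a) u)^2) = (\<Sum>a<k. f a*(c a)^2)" for f
  proof -
   have "(\<Sum>a<p. f a*(ip p (w a) u)^2) = (\<Sum>a<p. f a*(if a < k then c a else 0)^2)"
    by (intro sum.cong refl) (simp add: wu)
   also have "... = (\<Sum>a<k. f a*(if a < k then c a else 0)^2)"
    by (rule sum.mono_neutral_right) (use k in auto)
   finally show ?thesis by simp
  qed
  have u1: "ip p u u = 1"
   using orthonormal_expand[OF o, of u u] ind[of "\<lambda>_. 1"] c2 by (simp add: power2_eq_square)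
  have "qf n p X u = n*(\<Sum>a<k. e a*(c a)^2)" unfolding es_qf_expand[OF es] ind ..
  also have "... \<ge> n*(\<Sum>a<k. e (k - 1)*(c a)^2)"
   by (intro mult_left_mono sum_mono mult_right_mono es_antimono[OF es]) (use k in auto)
  finally have "n*e (k - 1) <= qf n p X u" using c2 by (simp add: sum_distrib_left[symmetric])
  hence "edge - qf n p X u <= h" using low by linarith
  from low_energy_pointwise[OF u1 this h i] have "(u i)^2 <= 16*(h + K3) / sqrt (n*(real i + 1))" .
  moreover have "u i = sqrt \<rho>"
  proof -
   have "u i = (\<Sum>m<k. (w m i)\<^sup>2 / sqrt \<rho>)" by (simp add: u_def c_def power2_eq_square)
   also have "... = \<rho> / sqrt \<rho>" by (simp only: sum_divide_distrib[symmetric] \<rho>_def[symmetric])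
   finally show ?thesis using \<rho> by (simp add: real_div_sqrt)
  qed
  ultimately show ?thesis using \<rho> by (simp add: \<rho>_def)
 qed
qed

end

section \<open>The null law as a flat Gaussian array\<close>

lemma mat_inverse_eqI:
 fixes A :: "'a :: field mat"
 assumes "A \<in> carrier_mat n n" "C \<in> carrier_mat n n" "A*C = 1\<^sub>m n"
 shows "mat_inverse A = Some C"
proof -
 have CA: "C*A = 1\<^sub>m n" by (rule mat_mult_left_right_inverse[OF assms])
 hence "A \<in> Units (ring_mat TYPE('a) n ())"
  using assms by (auto simp: Units_def ring_mat_def)
 then obtain B where B: "mat_inverse A = Some B" using mat_inverse(1)[OF assms(1), of "()"] by (cases "mat_inverse A") auto
 from mat_inverse(2)[OF assms(1) B] have b: "B*A = 1\<^sub>m n" "B \<in> carrier_mat n n" by auto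
 have "B = B*(A*C)" using b assms by simp
 also have "... = C" using b assms assoc_mult_mat[of B n n A n C n] by simp
 finally show ?thesis using B by simp
qed

lemma mvnormal_one: "mvnormal p (1\<^sub>m p) = gauss {..<p}"
proof -
 have inv: "mat_inverse (1\<^sub>m p :: real mat) = Some (1\<^sub>m p)" by (rule mat_inverse_eqI[of _ p]) auto
 have "mvnormal_density p (1\<^sub>m p) x = (1 / sqrt (2*pi)) ^ card {..<p} * exp (- (\<Sum>i<p. (x i)\<^sup>2)/2)" for x
 proof -
  have "scalar_prod (vec p x) (1\<^sub>m p *\<^sub>v vec p x) = (\<Sum>i<p. (x i)\<^sup>2)"
   by (simp add: scalar_prod_def atLeast0LessThan power2_eq_square)
  hence "mvnormal_density p (1\<^sub>m p) x = exp (- (\<Sum>i<p. (x i)\<^sup>2)/2) / sqrt ((2*pi) ^ p*1)"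
   unfolding mvnormal_density_def inv option.sel by (simp only:) simp
  moreover have "sqrt ((2*pi) ^ p*1) = sqrt (2*pi) ^ p" by (simp only: mult_1_right real_sqrt_power)
  ultimately have d: "mvnormal_density p (1\<^sub>m p) x = exp (- (\<Sum>i<p. (x i)\<^sup>2)/2) / sqrt (2*pi) ^ p" by (simp only:)
  show ?thesis unfolding d card_lessThan power_one_over times_divide_eq_left mult_1 ..
 qed
 thus ?thesis by (simp add: mvnormal_def gauss_density)
qed

definition curry_grid :: "nat => nat => (nat \<times> nat => real) => nat => nat => real" where
 "curry_grid n p \<xi> = (\<lambda>i\<in>{1..n}. \<lambda>j\<in>{..<p}. \<xi> (i, j))"

lemma curry_grid_measurable:
 assumes "sets M = sets (PiM (grid n p) (\<lambda>_. borel))"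
 shows "curry_grid n p \<in> measurable M (data_space n p)"
proof -
 have "curry_grid n p \<in> measurable (PiM (grid n p) (\<lambda>_. borel)) (data_space n p)"
  unfolding data_space_def curry_grid_def[abs_def]
 proof (rule measurable_restrict)
  fix i assume i: "i \<in> {1..n}"
  show "(\<lambda>\<xi>. \<lambda>j\<in>{..<p}. \<xi> (i, j)) \<in> measurable (PiM (grid n p) (\<lambda>_. borel)) (PiM {..<p} (\<lambda>_. borel))"
   by (rule measurable_restrict, rule measurable_component_singleton) (use i in auto)
 qed
 thus ?thesis using assms by (simp cong: measurable_cong_sets)
qed

text \<open>Reflections and concentration use an array indexed by pairs, the data are a family of
  rows; independence of disjoint blocks identifies the two laws.\<close>

lemma curry_grid_law:
 assumes n: "n \<ge> 1" and p: "p \<ge> 1"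
 shows "distr (gauss (grid n p)) (data_space n p) (curry_grid n p) = PiM {1..n} (\<lambda>_. gauss {..<p})"
proof -
 let ?I = "grid n p" and ?G = "gauss (grid n p)"
 interpret G: prob_space ?G by (rule prob_space_gauss)
 have "(1, 0) \<in> ?I" using n p by auto
 hence ne: "?I ~= {}" by blast
 have comp: "distr ?G std_gauss (\<lambda>\<xi>. \<xi> k) = std_gauss" if "k \<in> ?I" for k
  unfolding gauss_def by (rule distr_PiM_component) (use that in auto)
 have rv: "(\<lambda>\<xi>. \<xi> k) \<in> measurable ?G std_gauss" if "k \<in> ?I" for k
  unfolding gauss_def by (rule measurable_component_singleton[OF that])
 have "distr ?G (PiM ?I (\<lambda>_. std_gauss)) (\<lambda>\<xi>. \<lambda>k\<in>?I. \<xi> k) = PiM ?I (\<lambda>k. distr ?G std_gauss (\<lambda>\<xi>. \<xi> k))"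
 proof -
  have "distr ?G (PiM ?I (\<lambda>_. std_gauss)) (\<lambda>\<xi>. \<lambda>k\<in>?I. \<xi> k) = distr ?G ?G (\<lambda>\<xi>. \<xi>)"
   by (rule distr_cong) (auto simp: gauss_def space_PiM PiE_restrict)
  also have "... = ?G" by (rule distr_id)
  also have "... = PiM ?I (\<lambda>k. distr ?G std_gauss (\<lambda>\<xi>. \<xi> k))"
   unfolding gauss_def[of ?I] by (rule PiM_cong) (use comp in \<open>auto simp: gauss_def\<close>)
  finally show ?thesis .
 qed
 hence ind: "G.indep_vars (\<lambda>_. std_gauss) (\<lambda>k \<xi>. \<xi> k) ?I"
  by (subst G.indep_vars_iff_distr_eq_PiM'[OF ne rv]) auto
 have "G.indep_vars (\<lambda>i. PiM ({i} \<times> {..<p}) (\<lambda>_. std_gauss)) (\<lambda>i \<xi>. restrict (\<lambda>k. \<xi> k) ({i} \<times> {..<p})) {1..n}"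
  by (rule G.indep_vars_restrict[OF ind]) (auto simp: disjoint_family_on_def)
 from G.indep_vars_compose2[OF this, of "\<lambda>i x. \<lambda>j\<in>{..<p}. x (i, j)" "\<lambda>_. gauss {..<p}"]
 have ind2: "G.indep_vars (\<lambda>_. gauss {..<p}) (\<lambda>i \<xi>. \<lambda>j\<in>{..<p}. \<xi> (i, j)) {1..n}"
 proof -
  have m: "(\<lambda>x. \<lambda>j\<in>{..<p}. x (i, j)) \<in> measurable (PiM ({i} \<times> {..<p}) (\<lambda>_. std_gauss)) (gauss {..<p})" for i :: nat
   unfolding gauss_def by (rule measurable_restrict, rule measurable_component_singleton) auto
  have eq: "(\<lambda>i \<xi>. \<lambda>j\<in>{..<p}. restrict (\<lambda>k. \<xi> k) ({i} \<times> {..<p}) (i, j)) = (\<lambda>i \<xi>. \<lambda>j\<in>{..<p}. \<xi> (i, j))"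
   by (auto simp: fun_eq_iff restrict_def)
  show ?thesis
   using G.indep_vars_compose2[OF \<open>G.indep_vars (\<lambda>i. PiM ({i} \<times> {..<p}) (\<lambda>_. std_gauss)) _ _\<close> m] unfolding eq .
 qed
 have row: "(\<lambda>\<xi>. \<lambda>j\<in>{..<p}. \<xi> (i, j)) \<in> measurable ?G (gauss {..<p})" if "i \<in> {1..n}" for i
  unfolding gauss_def by (rule measurable_restrict, rule measurable_component_singleton) (use that in auto)
 have rowlaw: "distr ?G (gauss {..<p}) (\<lambda>\<xi>. \<lambda>j\<in>{..<p}. \<xi> (i, j)) = gauss {..<p}" if "i \<in> {1..n}" for i
  unfolding gauss_def using distr_PiM_reindex[of ?I "\<lambda>_. std_gauss" "Pair i" "{..<p}"] that by (auto simp: inj_on_def)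
 have "distr ?G (PiM {1..n} (\<lambda>_. gauss {..<p})) (\<lambda>\<xi>. \<lambda>i\<in>{1..n}. \<lambda>j\<in>{..<p}. \<xi> (i, j))
   = PiM {1..n} (\<lambda>i. distr ?G (gauss {..<p}) (\<lambda>\<xi>. \<lambda>j\<in>{..<p}. \<xi> (i, j)))"
  using ind2 G.indep_vars_iff_distr_eq_PiM'[of "{1..n}" "\<lambda>i \<xi>. \<lambda>j\<in>{..<p}. \<xi> (i, j)" "\<lambda>_. gauss {..<p}"] row n by auto
 also have "... = PiM {1..n} (\<lambda>_. gauss {..<p})" by (rule PiM_cong) (use rowlaw in auto)
 finally have "distr ?G (PiM {1..n} (\<lambda>_. gauss {..<p})) (curry_grid n p) = PiM {1..n} (\<lambda>_. gauss {..<p})"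
  by (simp add: curry_grid_def[abs_def])
 moreover have "sets (data_space n p) = sets (PiM {1..n} (\<lambda>_. gauss {..<p}))"
  unfolding data_space_def by (rule sets_PiM_cong) (simp_all add: sets_gauss)
 ultimately show ?thesis by (metis distr_cong)
qed

lemma null_law_gauss: "null_law n p = PiM {1..n} (\<lambda>_. gauss {..<p})"
 by (simp add: null_law_def iid_mvnormal_def mvnormal_one)

lemma sets_null_law [measurable_cong]: "sets (null_law n p) = sets (data_space n p)"
 unfolding null_law_gauss data_space_def by (rule sets_PiM_cong) (simp_all add: sets_gauss)

lemma space_null_law: "space (null_law n p) = space (data_space n p)"
 by (rule sets_eq_imp_space_eq[OF sets_null_law])

lemma prob_space_null_law: "prob_space (null_law n p)"
 unfolding null_law_gauss by (rule prob_space_PiM) (rule prob_space_gauss)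

lemma partial_sum_cong:
 "(!!i j. i \<in> {1..n} ==> j < p ==> X i j = Y i j) ==> partial_sum n p k X = partial_sum n p k Y"
proof -
 assume eq: "!!i j. i \<in> {1..n} ==> j < p ==> X i j = Y i j"
 have "sample_cov n p X = sample_cov n p Y"
  unfolding sample_cov_def by (rule cong_mat) (auto intro!: sum.cong simp: eq)
 thus ?thesis by (simp add: partial_sum_def)
qed

lemma partial_sum_curry_grid: "partial_sum n p k (curry_grid n p \<xi>) = partial_sum n p k (\<lambda>i j. \<xi> (i, j))"
 by (rule partial_sum_cong) (simp add: curry_grid_def)

theorem null_law_bidiag:
 fixes \<Psi> :: "(nat => nat => real) => ennreal"
 assumes n: "n \<ge> 1" and np: "n <= p" and \<Psi>: "\<Psi> \<in> borel_measurable (data_space n p)"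
  and spec: "!!X Y. (!!k. k <= p ==> partial_sum n p k X = partial_sum n p k Y) ==> \<Psi> X = \<Psi> Y"
 shows "(\<integral>\<^sup>+X. \<Psi> X \<partial>null_law n p) = (\<integral>\<^sup>+\<xi>. \<Psi> (curry_grid n p \<xi>) \<partial>PiM (grid n p) (bidiag n p))"
proof -
 have "(\<integral>\<^sup>+X. \<Psi> X \<partial>null_law n p) = (\<integral>\<^sup>+X. \<Psi> X \<partial>distr (gauss (grid n p)) (data_space n p) (curry_grid n p))"
  using curry_grid_law[OF n, of p] n np by (simp add: null_law_gauss)
 also have "... = (\<integral>\<^sup>+\<xi>. \<Psi> (curry_grid n p \<xi>) \<partial>gauss (grid n p))"
  by (rule nn_integral_distr[OF curry_grid_measurable]) (simp_all add: sets_gauss \<Psi>)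
 also have "... = (\<integral>\<^sup>+\<xi>. \<Psi> (curry_grid n p \<xi>) \<partial>PiM (grid n p) (bidiag n p))"
 proof (rule bidiagonalisation[OF np])
  show "(\<lambda>\<xi>. \<Psi> (curry_grid n p \<xi>)) \<in> borel_measurable (PiM (grid n p) (\<lambda>_. borel))"
   by (rule measurable_compose[OF curry_grid_measurable \<Psi>]) simp
  show "\<forall>R u \<xi>. R \<subseteq> {..<p} --> \<xi> \<in> extensional (grid n p) -->
   \<Psi> (curry_grid n p (act (grid n p) snd fst R (fst ` grid n p) u \<xi>)) = \<Psi> (curry_grid n p \<xi>)"
   by (intro allI impI spec) (simp only: partial_sum_curry_grid partial_sum_act_coord[OF n])
  show "\<forall>R u \<xi>. R \<subseteq> {1..n} --> \<xi> \<in> extensional (grid n p) -->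
   \<Psi> (curry_grid n p (act (grid n p) fst snd R (snd ` grid n p) u \<xi>)) = \<Psi> (curry_grid n p \<xi>)"
   by (intro allI impI spec) (simp only: partial_sum_curry_grid partial_sum_act_sample[OF n])
 qed
 finally show ?thesis .
qed

subsection \<open>Fluctuations under the null law\<close>

text \<open>The value 0 past the end encodes the boundary of the bidiagonal matrix, so formulas
  mentioning \<open>Suc j\<close> hold up to the last index.\<close>

definition amean :: "nat => nat => nat => real" where
 "amean n p j = (if j < n then (\<integral>x. x \<partial>bidiag n p (Suc j, j)) else 0)"

definition bmean :: "nat => nat => nat => real" where
 "bmean n p j = (if j + 2 <= n then (\<integral>x. x \<partial>bidiag n p (j + 2, j)) else 0)"

definition aval :: "nat => (nat \<times> nat => real) => nat => real" where
 "aval n \<xi> j = (if j < n then \<xi> (Suc j, j) else 0)"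

definition bval :: "nat => (nat \<times> nat => real) => nat => real" where
 "bval n \<xi> j = (if j + 2 <= n then \<xi> (j + 2, j) else 0)"

text \<open>The expression \<open>lin\<close> of the deterministic setting, available outside it so
  that its block sums can enter the definition of the good event.\<close>

definition lin_noise :: "nat => nat => (nat \<times> nat => real) => nat => real" where
 "lin_noise n p \<xi> j = 2*amean n p j*(aval n \<xi> j - amean n p j) + 2*bmean n p j*(bval n \<xi> j - bmean n p j)
   + amean n p (Suc j)*(bval n \<xi> j - bmean n p j) + bmean n p j*(aval n \<xi> (Suc j) - amean n p (Suc j))
   + (if j = 0 then 0 else amean n p j*(bval n \<xi> (j - 1) - bmean n p (j - 1)) + bmean n p (j - 1)*(aval n \<xi> j - amean n p j))"

definition band :: "nat \<times> nat => bool" where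
 "band k \<longleftrightarrow> fst k = Suc (snd k) \<or> fst k = snd k + 2"

text \<open>Off the band the entries vanish almost surely, but this is demanded pointwise because
  later estimates speak of individual arrays. The block sums are allowed \<open>L\<close> times
  \<open>sqrt (n * l)\<close>, the order of their standard deviation.\<close>

definition good_event :: "nat => nat => nat => real => (nat \<times> nat => real) set" where
 "good_event n p l L = {\<xi> \<in> space (PiM (grid n p) (bidiag n p)).
   (\<forall>k\<in>grid n p. if band k then 0 <= \<xi> k \<and> \<bar>\<xi> k - (\<integral>x. x \<partial>bidiag n p k)\<bar> <= L else \<xi> k = 0) \<and>
   (\<forall>c\<in>{..<n div (2*l)}. \<forall>r\<in>{..l}. \<bar>\<Sum>j\<in>{c*l..<c*l + r}. lin_noise n p \<xi> j\<bar> <= sqrt (real n*l)*L)}"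

lemma bidiag_band:
 assumes "k \<in> grid n p" "band k" "n <= p"
 obtains C :: "(nat \<times> nat) set" where "bidiag n p k = chi C" "finite C" "C ~= {}"
  "card C = (if fst k = Suc (snd k) then p - snd k else n - 1 - snd k)"
proof -
 obtain i j where k: "k = (i, j)" by (cases k)
 consider "i = Suc j" | "i = j + 2" using assms(2) by (auto simp: band_def k)
 thus ?thesis
 proof cases
  case 1
  thus ?thesis using assms
   by (intro that[of "{i} \<times> {j..<p}"]) (auto simp: bidiag_def k)
 next
  case 2
  have "card ({i..n} \<times> {j}) = n - 1 - j" using 2 by (simp add: card_cartesian_product)
  thus ?thesis using assms 2
   by (intro that[of "{i..n} \<times> {j}"]) (auto simp: bidiag_def k)
 qed
qed

lemma bidiag_off_band: "\<not> band k ==> bidiag n p k = point0"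
 by (auto simp: band_def bidiag_def case_prod_beta)

lemma tame_bidiag: "k \<in> grid n p ==> n <= p ==> tame (bidiag n p k)"
 by (metis bidiag_band bidiag_off_band tame_chi tame_point0)

lemma bidiag_mean_integrable:
 assumes "k \<in> grid n p" "n <= p"
 shows "integrable (bidiag n p k) (\<lambda>x. x)"
proof (cases "band k")
 case True
 thus ?thesis using bidiag_band[OF assms(1) True assms(2)] chi_mean(1) by metis
next
 case False
 have "integrable (return borel (0::real)) (\<lambda>x. x)"
  by (rule integrableI_bounded) (simp_all add: nn_integral_return)
 thus ?thesis by (simp add: bidiag_off_band[OF False])
qed

lemmas prob_space_bidiag = prob_array.prob\<mu>[OF prob_array_bidiag]
 and sets_bidiag = prob_array.sets\<mu>[OF prob_array_bidiag]

lemma prob_space_PiM_bidiag: "prob_space (PiM (grid n p) (bidiag n p))"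
 by (rule prob_space_PiM) (rule prob_space_bidiag)

lemma sets_PiM_bidiag [measurable_cong]: "sets (PiM (grid n p) (bidiag n p)) = sets (PiM (grid n p) (\<lambda>_. borel))"
 by (rule sets_PiM_cong) (simp_all add: sets_bidiag)

lemma entry_measurable: "k \<in> grid n p ==> (\<lambda>\<xi>. \<xi> k) \<in> borel_measurable (PiM (grid n p) (bidiag n p))"
 using measurable_component_singleton[of k "grid n p" "bidiag n p"]
 by (simp add: sets_bidiag cong: measurable_cong_sets)

lemma entry_law: "k \<in> grid n p ==> distr (PiM (grid n p) (bidiag n p)) (bidiag n p k) (\<lambda>\<xi>. \<xi> k) = bidiag n p k"
 by (rule distr_PiM_component) (auto simp: prob_space_bidiag)

lemma entry_integral:
 assumes k: "k \<in> grid n p" and np: "n <= p"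
 shows "integrable (PiM (grid n p) (bidiag n p)) (\<lambda>\<xi>. \<xi> k)"
  "(\<integral>\<xi>. \<xi> k \<partial>PiM (grid n p) (bidiag n p)) = (\<integral>x. x \<partial>bidiag n p k)"
proof -
 let ?P = "PiM (grid n p) (bidiag n p)"
 have m: "(\<lambda>\<xi>. \<xi> k) \<in> measurable ?P (bidiag n p k)" by (rule measurable_component_singleton[OF k])
 have id: "(\<lambda>x. x) \<in> borel_measurable (bidiag n p k)" by (simp add: sets_bidiag cong: measurable_cong_sets)
 have "integrable (distr ?P (bidiag n p k) (\<lambda>\<xi>. \<xi> k)) (\<lambda>x. x)"
  unfolding entry_law[OF k] by (rule bidiag_mean_integrable[OF k np])
 thus "integrable ?P (\<lambda>\<xi>. \<xi> k)" using integrable_distr_eq[OF m id] by simp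
 show "(\<integral>\<xi>. \<xi> k \<partial>?P) = (\<integral>x. x \<partial>bidiag n p k)"
  using integral_distr[OF m id] unfolding entry_law[OF k] by simp
qed

lemma entry_nonneg_AE:
 assumes k: "k \<in> grid n p"
 shows "AE \<xi> in PiM (grid n p) (bidiag n p). 0 <= \<xi> k \<and> (\<not> band k --> \<xi> k = 0)"
proof -
 have "AE x in bidiag n p k. 0 <= x \<and> (\<not> band k --> x = 0)"
 proof (cases "band k")
  case True
  have "\<exists>C :: (nat \<times> nat) set. bidiag n p k = chi C" using True by (auto simp: band_def bidiag_def case_prod_beta)
  then obtain C :: "(nat \<times> nat) set" where C: "bidiag n p k = chi C" by blast
  have "AE x in chi C. 0 <= x"
   unfolding chi_def by (subst AE_distr_iff[OF measurable_sqnorm]) (auto simp: sum_nonneg)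
  thus ?thesis unfolding C using True by simp
 next
  case False
  have "AE x in point0. 0 <= x \<and> (\<not> band k --> x = (0 :: real))" by (subst AE_return) auto
  thus ?thesis unfolding bidiag_off_band[OF False] .
 qed
 thus ?thesis
  by (intro AE_PiM_component[of "grid n p" "bidiag n p" k "\<lambda>x. 0 <= x \<and> (\<not> band k --> x = 0)"]) (use k prob_space_bidiag in auto)
qed

lemma aval_eq: "j < n ==> aval n \<xi> j = \<xi> (Suc j, j)" and bval_eq: "j + 2 <= n ==> bval n \<xi> j = \<xi> (j + 2, j)"
 by (simp_all add: aval_def bval_def)

lemma grid_band: "n <= p ==> j < n ==> (Suc j, j) \<in> grid n p" "n <= p ==> j + 2 <= n ==> (j + 2, j) \<in> grid n p"
 by auto

lemma qf_banded:
 assumes np: "n <= p" and n: "1 <= n" and z: "!!k. k \<in> grid n p ==> \<not> band k ==> \<xi> k = 0"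
 shows "ip p (\<lambda>j. \<xi> (1, j)) w = aval n \<xi> 0*w 0"
  and "i < n - 1 ==> ip p (\<lambda>j. \<xi> (i + 2, j)) w = aval n \<xi> (Suc i)*w (Suc i) + bval n \<xi> i*w i"
  and "qf n p (\<lambda>i j. \<xi> (i, j)) w = (aval n \<xi> 0*w 0)^2 + (\<Sum>i<n - 1. (aval n \<xi> (Suc i)*w (Suc i) + bval n \<xi> i*w i)\<^sup>2)"
proof -
 show 1: "ip p (\<lambda>j. \<xi> (1, j)) w = aval n \<xi> 0*w 0"
 proof -
  have "ip p (\<lambda>j. \<xi> (1, j)) w = (\<Sum>j\<in>{0}. \<xi> (1, j)*w j)"
   unfolding ip_def by (rule sum.mono_neutral_right) (use np n z in \<open>auto simp: band_def\<close>)
  thus ?thesis using n by (simp add: aval_def)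
 qed
 show 2: "ip p (\<lambda>j. \<xi> (i + 2, j)) w = aval n \<xi> (Suc i)*w (Suc i) + bval n \<xi> i*w i" if i: "i < n - 1" for i
 proof -
  have "ip p (\<lambda>j. \<xi> (i + 2, j)) w = (\<Sum>j\<in>{Suc i, i}. \<xi> (i + 2, j)*w j)"
   unfolding ip_def by (rule sum.mono_neutral_right) (use np n z i in \<open>auto simp: band_def\<close>)
  thus ?thesis using i by (simp add: aval_def bval_def)
 qed
 show "qf n p (\<lambda>i j. \<xi> (i, j)) w = (aval n \<xi> 0*w 0)^2 + (\<Sum>i<n - 1. (aval n \<xi> (Suc i)*w (Suc i) + bval n \<xi> i*w i)\<^sup>2)"
 proof -
  obtain m where m: "n = Suc m" using n by (cases n) auto
  have "qf n p (\<lambda>i j. \<xi> (i, j)) w = (\<Sum>i<n. (ip p (\<lambda>j. \<xi> (Suc i, j)) w)\<^sup>2)"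
   unfolding qf_def by (simp add: sum.atLeast1_atMost_eq)
  also have "... = (ip p (\<lambda>j. \<xi> (1, j)) w)^2 + (\<Sum>i<m. (ip p (\<lambda>j. \<xi> (i + 2, j)) w)\<^sup>2)"
   unfolding m by (subst sum.lessThan_Suc_shift) simp
  also have "... = (aval n \<xi> 0*w 0)^2 + (\<Sum>i<m. (aval n \<xi> (Suc i)*w (Suc i) + bval n \<xi> i*w i)\<^sup>2)"
   unfolding 1 by (intro arg_cong2[where f = plus] refl sum.cong) (use 2 m in auto)
  finally show ?thesis using m by simp
 qed
qed

lemma amean_bounds:
 assumes np: "n <= p" and j: "j < n"
 shows "0 <= amean n p j \<and> real p - j - 144 <= (amean n p j)^2 \<and> (amean n p j)\<^sup>2 <= real p - j"
proof -
 have k: "(Suc j, j) \<in> grid n p" "band (Suc j, j)" using j np by (auto simp: band_def)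
 obtain C :: "(nat \<times> nat) set" where C: "bidiag n p (Suc j, j) = chi C" "finite C" "C ~= {}"
   "card C = (if fst (Suc j, j) = Suc (snd (Suc j, j)) then p - snd (Suc j, j) else n - 1 - snd (Suc j, j))"
  by (rule bidiag_band[OF k np]) (rule that)
 have "real (card C) = real p - j" using C(4) j np by simp
 thus ?thesis using chi_mean(3-5)[OF C(2,3)] j by (simp add: amean_def C(1))
qed

lemma bmean_bounds:
 assumes np: "n <= p" and j: "j + 2 <= n"
 shows "0 <= bmean n p j \<and> real n - 1 - j - 144 <= (bmean n p j)^2 \<and> (bmean n p j)\<^sup>2 <= real n - 1 - j"
proof -
 have k: "(j + 2, j) \<in> grid n p" "band (j + 2, j)" using j np by (auto simp: band_def)
 have ne: "fst (j + 2, j) ~= Suc (snd (j + 2, j))" by simp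
 obtain C :: "(nat \<times> nat) set" where C: "bidiag n p (j + 2, j) = chi C" "finite C" "C ~= {}"
   "card C = (if fst (j + 2, j) = Suc (snd (j + 2, j)) then p - snd (j + 2, j) else n - 1 - snd (j + 2, j))"
  by (rule bidiag_band[OF k np]) (rule that)
 have "real (card C) = real n - 1 - j" using C(4) j by (simp add: of_nat_diff)
 moreover have "bmean n p j = (\<integral>x. x \<partial>chi C)" using j C(1) by (simp add: bmean_def)
 ultimately show ?thesis using chi_mean(3-5)[OF C(2,3)] by simp
qed

lemma good_event_locale:
 fixes \<Gamma> L :: real
 assumes np: "n <= p" and p\<Gamma>: "real p <= \<Gamma>*n" and \<Gamma>1: "1 <= \<Gamma>" and L1: "1 <= L"
  and large: "2 ^ 20*\<Gamma>\<^sup>2*L ^ 4 <= n" and l: "1 <= l" "16*l <= n"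
  and \<xi>: "\<xi> \<in> good_event n p l L"
 shows "good_bidiagonal n p l (n div (2*l)) \<Gamma> L (aval n \<xi>) (bval n \<xi>) (amean n p) (bmean n p) (\<lambda>i j. \<xi> (i, j))"
proof -
 have n1: "1 <= n" using l by simp
 have g: "k \<in> grid n p ==> band k ==> 0 <= \<xi> k \<and> \<bar>\<xi> k - (\<integral>x. x \<partial>bidiag n p k)\<bar> <= L"
  "k \<in> grid n p ==> \<not> band k ==> \<xi> k = 0" for k
  using \<xi> by (auto simp: good_event_def)
 have bs: "band (Suc j, j)" "band (j + 2, j)" for j by (auto simp: band_def)
 note ga = g(1)[OF grid_band(1)[OF np] bs(1)] and gb = g(1)[OF grid_band(2)[OF np] bs(2)]
 show ?thesis
 proof
  show "0 <= aval n \<xi> j" for j using ga[of j] by (auto simp: aval_def)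
  show "0 <= bval n \<xi> j" for j using gb[of j] by (auto simp: bval_def)
  show "\<bar>aval n \<xi> j - amean n p j\<bar> <= L" for j using ga[of j] L1 by (auto simp: aval_def amean_def)
  show "\<bar>bval n \<xi> j - bmean n p j\<bar> <= L" for j using gb[of j] L1 by (auto simp: bval_def bmean_def)
  show "qf n p (\<lambda>i j. \<xi> (i, j)) w = (aval n \<xi> 0*w 0)^2 + (\<Sum>i<n - 1. (aval n \<xi> (Suc i)*w (Suc i) + bval n \<xi> i*w i)\<^sup>2)" for w
   by (rule qf_banded(3)[OF np n1 g(2)])
  show "\<bar>\<Sum>j\<in>{c*l..<c*l + r}. 2*amean n p j*(aval n \<xi> j - amean n p j) + 2*bmean n p j*(bval n \<xi> j - bmean n p j)
   + amean n p (Suc j)*(bval n \<xi> j - bmean n p j) + bmean n p j*(aval n \<xi> (Suc j) - amean n p (Suc j))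
   + (if j = 0 then 0 else amean n p j*(bval n \<xi> (j - 1) - bmean n p (j - 1)) + bmean n p (j - 1)*(aval n \<xi> j - amean n p j))\<bar>
   <= sqrt (real n*l)*L" if "c < n div (2*l)" "r <= l" for c r
   using \<xi> that unfolding good_event_def lin_noise_def by (simp add: Ball_def)
 qed (use assms amean_bounds[OF np] bmean_bounds[OF np] in \<open>auto simp: aval_def bval_def amean_def bmean_def\<close>)
qed

lemma PiM_bidiag_concentration:
 fixes g :: "(nat \<times> nat => real) => real"
 assumes np: "n <= p" and g: "g \<in> borel_measurable (PiM (grid n p) (bidiag n p))" and \<sigma>: "\<sigma> > 0"
  and c: "!!k. k \<in> grid n p ==> 0 <= c k" and c2: "(\<Sum>k\<in>grid n p. (c k)\<^sup>2) <= \<sigma>\<^sup>2"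
  and lip: "!!x y. x \<in> space (PiM (grid n p) (bidiag n p)) ==> y \<in> space (PiM (grid n p) (bidiag n p)) ==>
   g x - g y <= (\<Sum>k\<in>grid n p. c k*\<bar>x k - y k\<bar>)"
 shows "integrable (PiM (grid n p) (bidiag n p)) g"
  "measure (PiM (grid n p) (bidiag n p)) {x \<in> space (PiM (grid n p) (bidiag n p)). \<bar>g x - (\<integral>x. g x \<partial>PiM (grid n p) (bidiag n p))\<bar> \<ge> L*\<sigma>}
   <= 2*exp (8 - L/4)"
proof -
 have fin: "finite (grid n p)" by simp
 note tm = tame_bidiag[OF _ np]
 show "integrable (PiM (grid n p) (bidiag n p)) g"
  by (rule tame_concentration(1)[OF fin tm g \<sigma> c c2 lip])
 show "measure (PiM (grid n p) (bidiag n p)) {x \<in> space (PiM (grid n p) (bidiag n p)). \<bar>g x - (\<integral>x. g x \<partial>PiM (grid n p) (bidiag n p))\<bar> \<ge> L*\<sigma>}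
   <= 2*exp (8 - L/4)"
  by (rule tame_concentration(2)[OF fin tm g \<sigma> c c2 lip])
qed

text \<open>In a sum of consecutive terms an entry occurs only with its neighbours. The coefficients
  are at most sqrt p, and their multiplicities 2 + 2 + 1 + 1 + 1 + 1 add up to 8.\<close>

lemma lin_noise_lipschitz:
 assumes np: "n <= p" and S: "S \<subseteq> {..<n - 2}" and fin: "finite S"
 defines "S' \<equiv> {k \<in> grid n p. band k \<and> (snd k \<in> S \<or> Suc (snd k) \<in> S \<or> (\<exists>j\<in>S. snd k = Suc j))}"
 shows "(\<Sum>j\<in>S. lin_noise n p x j) - (\<Sum>j\<in>S. lin_noise n p y j) <= (\<Sum>k\<in>S'. 8 * sqrt p*\<bar>x k - y k\<bar>)"
proof -
 define d where "d k = \<bar>x k - y k\<bar>" for k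
 have fS': "finite S'" by (auto simp: S'_def)
 have Ale: "0 <= amean n p j \<and> amean n p j <= sqrt p" for j
 proof (cases "j < n")
  case True
  have "(amean n p j)^2 <= p" using amean_bounds[OF np True] by simp
  thus ?thesis using amean_bounds[OF np True] by (auto intro: real_le_rsqrt)
 qed (simp add: amean_def)
 have Ble: "0 <= bmean n p j \<and> bmean n p j <= sqrt p" for j
 proof (cases "j + 2 <= n")
  case True
  have "(bmean n p j)^2 <= p" using bmean_bounds[OF np True] np by simp
  thus ?thesis using bmean_bounds[OF np True] by (auto intro: real_le_rsqrt)
 qed (simp add: bmean_def)
 have grp: "(\<Sum>j\<in>U. m j*d (f j)) <= sqrt p*(\<Sum>k\<in>S'. d k)"
  if "U \<subseteq> S" "inj_on f U" "f ` U \<subseteq> S'" "!!j. m j <= sqrt p" for U f and m :: "nat => real"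
 proof -
  have "(\<Sum>j\<in>U. m j*d (f j)) <= (\<Sum>j\<in>U. sqrt p*d (f j))"
   by (intro sum_mono mult_right_mono that) (simp add: d_def)
  also have "... = sqrt p*(\<Sum>k\<in>f ` U. d k)" using that(2) by (simp add: sum_distrib_left sum.reindex)
  also have "... <= sqrt p*(\<Sum>k\<in>S'. d k)" by (intro mult_left_mono sum_mono2 fS' that) (auto simp: d_def)
  finally show ?thesis .
 qed
 define E where "E = (\<Sum>k\<in>S'. d k)"
 have mem: "(Suc j, j) \<in> S'" "(j + 2, j) \<in> S'" "(Suc (Suc j), Suc j) \<in> S'" if "j \<in> S" for j
  using S that np by (auto simp: S'_def band_def)
 have mem0: "(j + 1, j - 1) \<in> S'" if "j \<in> S - {0}" for j
  using S that np by (auto simp: S'_def band_def)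
 have g1: "(\<Sum>j\<in>S. amean n p j*d (Suc j, j)) <= sqrt p*E" unfolding E_def
  by (rule grp) (use mem Ale in \<open>auto simp: inj_on_def\<close>)
 have g2: "(\<Sum>j\<in>S. bmean n p j*d (j + 2, j)) <= sqrt p*E" unfolding E_def
  by (rule grp) (use mem Ble in \<open>auto simp: inj_on_def\<close>)
 have g3: "(\<Sum>j\<in>S. amean n p (Suc j)*d (j + 2, j)) <= sqrt p*E" unfolding E_def
  by (rule grp[of S "\<lambda>j. (j + 2, j)" "\<lambda>j. amean n p (Suc j)"]) (use mem Ale in \<open>auto simp: inj_on_def\<close>)
 have g4: "(\<Sum>j\<in>S. bmean n p j*d (Suc (Suc j), Suc j)) <= sqrt p*E" unfolding E_def
  by (rule grp) (use mem Ble in \<open>auto simp: inj_on_def\<close>)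
 have g5: "(\<Sum>j\<in>S - {0}. amean n p j*d (j + 1, j - 1)) <= sqrt p*E" unfolding E_def
 proof (rule grp)
  show "(\<lambda>j. (j + 1, j - 1)) ` (S - {0}) \<subseteq> S'" using mem0 by blast
  show "inj_on (\<lambda>j. (j + 1, j - 1)) (S - {0})" by (auto simp: inj_on_def)
 qed (use Ale in auto)
 have g6: "(\<Sum>j\<in>S - {0}. bmean n p (j - 1)*d (Suc j, j)) <= sqrt p*E" unfolding E_def
  by (rule grp[of "S - {0}" "\<lambda>j. (Suc j, j)" "\<lambda>j. bmean n p (j - 1)"]) (use mem Ble in \<open>auto simp: inj_on_def\<close>)
 have pt: "lin_noise n p x j - lin_noise n p y j <= 2*(amean n p j*d (Suc j, j)) + 2*(bmean n p j*d (j + 2, j))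
   + amean n p (Suc j)*d (j + 2, j) + bmean n p j*d (Suc (Suc j), Suc j)
   + (if j \<in> S - {0} then amean n p j*d (j + 1, j - 1) + bmean n p (j - 1)*d (Suc j, j) else 0)" if j: "j \<in> S" for j
 proof -
  have jn: "j < n" "Suc j < n" "j + 2 <= n" "j - 1 + 2 <= n" using S j by auto
  have ml: "m*(x k - y k) <= m*d k" if "0 <= m" for m k
   using that by (intro mult_left_mono) (auto simp: d_def)
  have e: "lin_noise n p x j - lin_noise n p y j = 2*(amean n p j*(x (Suc j, j) - y (Suc j, j)))
   + 2*(bmean n p j*(x (j + 2, j) - y (j + 2, j))) + amean n p (Suc j)*(x (j + 2, j) - y (j + 2, j))
   + bmean n p j*(x (Suc (Suc j), Suc j) - y (Suc (Suc j), Suc j))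
   + (if j = 0 then 0 else amean n p j*(x (j - 1 + 2, j - 1) - y (j - 1 + 2, j - 1)) + bmean n p (j - 1)*(x (Suc j, j) - y (Suc j, j)))"
   using jn unfolding lin_noise_def
   by (simp only: aval_eq bval_eq) (simp add: algebra_simps)
  show ?thesis
  proof (cases "j = 0")
   case True
   thus ?thesis unfolding e
    using ml[of "amean n p j" "(Suc j, j)"] ml[of "bmean n p j" "(j + 2, j)"] ml[of "amean n p (Suc j)" "(j + 2, j)"]
     ml[of "bmean n p j" "(Suc (Suc j), Suc j)"] Ale Ble by simp
  next
   case False
   hence "j - 1 + 2 = j + 1" by simp
   thus ?thesis unfolding e
    using ml[of "amean n p j" "(Suc j, j)"] ml[of "bmean n p j" "(j + 2, j)"] ml[of "amean n p (Suc j)" "(j + 2, j)"]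
     ml[of "bmean n p j" "(Suc (Suc j), Suc j)"] ml[of "amean n p j" "(j + 1, j - 1)"] ml[of "bmean n p (j - 1)" "(Suc j, j)"] Ale Ble False j
    by simp
  qed
 qed
 have "(\<Sum>j\<in>S. lin_noise n p x j) - (\<Sum>j\<in>S. lin_noise n p y j)
   <= (\<Sum>j\<in>S. 2*(amean n p j*d (Suc j, j)) + 2*(bmean n p j*d (j + 2, j))
   + amean n p (Suc j)*d (j + 2, j) + bmean n p j*d (Suc (Suc j), Suc j)
   + (if j \<in> S - {0} then amean n p j*d (j + 1, j - 1) + bmean n p (j - 1)*d (Suc j, j) else 0))"
  unfolding sum_subtractf[symmetric] by (intro sum_mono pt)
 also have "... = 2*(\<Sum>j\<in>S. amean n p j*d (Suc j, j)) + 2*(\<Sum>j\<in>S. bmean n p j*d (j + 2, j))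
   + (\<Sum>j\<in>S. amean n p (Suc j)*d (j + 2, j)) + (\<Sum>j\<in>S. bmean n p j*d (Suc (Suc j), Suc j))
   + ((\<Sum>j\<in>S - {0}. amean n p j*d (j + 1, j - 1)) + (\<Sum>j\<in>S - {0}. bmean n p (j - 1)*d (Suc j, j)))"
 proof -
  have "(\<Sum>j\<in>S. if j \<in> S - {0} then amean n p j*d (j + 1, j - 1) + bmean n p (j - 1)*d (Suc j, j) else 0)
   = (\<Sum>j\<in>S - {0}. if j \<in> S - {0} then amean n p j*d (j + 1, j - 1) + bmean n p (j - 1)*d (Suc j, j) else 0)"
   by (rule sum.mono_neutral_right[OF fin]) auto
  also have "... = (\<Sum>j\<in>S - {0}. amean n p j*d (j + 1, j - 1) + bmean n p (j - 1)*d (Suc j, j))"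
   by (rule sum.cong) auto
  finally show ?thesis by (simp only: sum.distrib sum_distrib_left[symmetric])
 qed
 also have "... <= 8*(sqrt p*E)" using g1 g2 g3 g4 g5 g6 by linarith
 finally show ?thesis by (simp add: E_def d_def sum_distrib_left mult.assoc)
qed

declare One_nat_def [simp del]

lemma aval_measurable: "n <= p ==> (\<lambda>\<xi>. aval n \<xi> j) \<in> borel_measurable (PiM (grid n p) (bidiag n p))"
 by (cases "j < n") (simp_all add: aval_def entry_measurable)

lemma bval_measurable: "n <= p ==> (\<lambda>\<xi>. bval n \<xi> j) \<in> borel_measurable (PiM (grid n p) (bidiag n p))"
 by (cases "j + 2 <= n") (simp_all add: bval_def entry_measurable)

lemma lin_noise_measurable:
 assumes "n <= p"
 shows "(\<lambda>\<xi>. lin_noise n p \<xi> j) \<in> borel_measurable (PiM (grid n p) (bidiag n p))"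
 unfolding lin_noise_def using aval_measurable[OF assms] bval_measurable[OF assms]
 by (cases "j = 0") (simp_all add: borel_measurable_add borel_measurable_times borel_measurable_diff)

lemma aval_centred:
 assumes "n <= p"
 shows "has_bochner_integral (PiM (grid n p) (bidiag n p)) (\<lambda>\<xi>. aval n \<xi> j - amean n p j) 0"
proof (cases "j < n")
 case True
 interpret prob_space "PiM (grid n p) (bidiag n p)" by (rule prob_space_PiM_bidiag)
 have k: "(Suc j, j) \<in> grid n p" using True assms by auto
 show ?thesis
  using entry_integral[OF k assms] True by (simp add: has_bochner_integral_iff aval_def amean_def prob_space)
qed (simp add: aval_def amean_def has_bochner_integral_zero)

lemma bval_centred:
 assumes "n <= p"
 shows "has_bochner_integral (PiM (grid n p) (bidiag n p)) (\<lambda>\<xi>. bval n \<xi> j - bmean n p j) 0"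
proof (cases "j + 2 <= n")
 case True
 interpret prob_space "PiM (grid n p) (bidiag n p)" by (rule prob_space_PiM_bidiag)
 have k: "(j + 2, j) \<in> grid n p" using True assms by auto
 show ?thesis
  using entry_integral[OF k assms] True by (simp add: has_bochner_integral_iff bval_def bmean_def prob_space)
qed (simp add: bval_def bmean_def has_bochner_integral_zero)

lemma lin_noise_centred:
 assumes np: "n <= p"
 shows "has_bochner_integral (PiM (grid n p) (bidiag n p)) (\<lambda>\<xi>. lin_noise n p \<xi> j) 0"
proof -
 let ?P = "PiM (grid n p) (bidiag n p)"
 have a: "has_bochner_integral ?P (\<lambda>\<xi>. c*(aval n \<xi> i - amean n p i)) 0" for c i
  using has_bochner_integral_mult_right[OF aval_centred[OF np], of c i] by simp
 have b: "has_bochner_integral ?P (\<lambda>\<xi>. c*(bval n \<xi> i - bmean n p i)) 0" for c i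
  using has_bochner_integral_mult_right[OF bval_centred[OF np], of c i] by simp
 have add: "has_bochner_integral ?P (\<lambda>\<xi>. f \<xi> + g \<xi>) 0"
  if "has_bochner_integral ?P f 0" "has_bochner_integral ?P g 0" for f g :: "_ => real"
  using has_bochner_integral_add[OF that] by simp
 show ?thesis
 proof (cases "j = 0")
  case True
  thus ?thesis unfolding lin_noise_def by (simp only: refl if_True add_0_right) (intro add a b)
 next
  case False
  thus ?thesis unfolding lin_noise_def by (simp only: if_False) (intro add a b)
 qed
qed

lemma good_event_sets:
 assumes "n <= p"
 shows "good_event n p l L \<in> sets (PiM (grid n p) (bidiag n p))"
 unfolding good_event_def
proof (intro sets.sets_Collect_conj sets.sets_Collect_finite_All)
 let ?P = "PiM (grid n p) (bidiag n p)"
 fix k assume "k \<in> grid n p"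
 note [measurable] = entry_measurable[OF this]
 show "{\<xi> \<in> space ?P. if band k then 0 <= \<xi> k \<and> \<bar>\<xi> k - (\<integral>x. x \<partial>bidiag n p k)\<bar> <= L else \<xi> k = 0} \<in> sets ?P"
  by (cases "band k") simp_all
next
 let ?P = "PiM (grid n p) (bidiag n p)"
 note [measurable] = lin_noise_measurable[OF assms]
 fix c r
 show "{\<xi> \<in> space ?P. \<bar>\<Sum>j = c*l..<c*l + r. lin_noise n p \<xi> j\<bar> <= sqrt (real n*l)*L} \<in> sets ?P"
  by measurable
qed auto

lemma entry_deviation:
 assumes np: "n <= p" and k: "k \<in> grid n p"
 shows "measure (PiM (grid n p) (bidiag n p)) {\<xi> \<in> space (PiM (grid n p) (bidiag n p)). L <= \<bar>\<xi> k - (\<integral>x. x \<partial>bidiag n p k)\<bar>} <= 2*exp (8 - L/4)"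
proof -
 let ?c = "\<lambda>i. if i = k then 1 else 0 :: real"
 have s: "(\<Sum>i\<in>grid n p. (?c i)\<^sup>2) = (\<Sum>i\<in>grid n p. ?c i)" by (intro sum.cong) auto
 have "measure (PiM (grid n p) (bidiag n p)) {\<xi> \<in> space (PiM (grid n p) (bidiag n p)). L*1 <= \<bar>\<xi> k - (\<integral>\<xi>. \<xi> k \<partial>PiM (grid n p) (bidiag n p))\<bar>} <= 2*exp (8 - L/4)"
 proof (rule PiM_bidiag_concentration(2)[OF np entry_measurable[OF k], of 1 ?c])
  show "(\<Sum>i\<in>grid n p. (?c i)\<^sup>2) <= 1\<^sup>2" unfolding s using k by (subst sum.delta) auto
  fix x y :: "nat \<times> nat => real"
  have "(\<Sum>i\<in>grid n p. ?c i*\<bar>x i - y i\<bar>) = (\<Sum>i\<in>grid n p. if i = k then \<bar>x i - y i\<bar> else 0)" by (intro sum.cong) auto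
  also have "... = \<bar>x k - y k\<bar>" using k by (subst sum.delta) auto
  finally show "x k - y k <= (\<Sum>i\<in>grid n p. ?c i*\<bar>x i - y i\<bar>)" by simp
 qed auto
 thus ?thesis unfolding entry_integral(2)[OF k np] by simp
qed

text \<open>A block sum depends on at most 6l entries with coefficients 8 sqrt p. The squared
  Lipschitz constants add up to at most 384 \<Gamma> n l, rounded up to (20 sqrt(\<Gamma> n l))^2.
  With sqrt \<Gamma> at most \<Gamma>, the deviation \<open>sqrt (n * l) * L\<close> is at least
  L/(20 \<Gamma>) times this scale.\<close>

lemma block_deviation:
 fixes \<Gamma> L :: real
 assumes np: "n <= p" and p\<Gamma>: "real p <= \<Gamma>*n" and \<Gamma>1: "1 <= \<Gamma>" and L: "0 <= L" and l: "1 <= l" and n4: "4 <= n"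
  and c: "c < n div (2*l)" and r: "r <= l"
 shows "measure (PiM (grid n p) (bidiag n p)) {\<xi> \<in> space (PiM (grid n p) (bidiag n p)).
   sqrt (real n*l)*L <= \<bar>\<Sum>j\<in>{c*l..<c*l + r}. lin_noise n p \<xi> j\<bar>} <= 2*exp (8 - L/(80*\<Gamma>))"
proof -
 let ?P = "PiM (grid n p) (bidiag n p)"
 define S where "S = {c*l..<c*l + r}"
 define S' where "S' = {k \<in> grid n p. band k \<and> (snd k \<in> S \<or> Suc (snd k) \<in> S \<or> (\<exists>j\<in>S. snd k = Suc j))}"
 have fS': "finite S'" by (auto simp: S'_def)
 have Sn: "S \<subseteq> {..<n - 2}"
 proof -
  have "c*l + r <= Suc c*l" using r by simp
  also have "... <= n div (2*l)*l" using c by (intro mult_right_mono) auto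
  finally have "2*(c*l + r) <= n div (2*l)*(2*l)" by simp
  also have "... <= n" by (rule div_times_less_eq_dividend)
  finally show ?thesis using n4 by (auto simp: S_def)
 qed
 have cS': "card S' <= 6*l"
 proof -
  define T where "T = S \<union> Suc ` S \<union> (\<lambda>j. j - 1) ` S"
  have "card T <= card S + card S + card S"
   unfolding T_def by (intro order_trans[OF card_Un_le] add_mono card_image_le order_refl) (auto simp: S_def)
  hence cT: "card T <= 3*l" using r by (simp add: S_def)
  have fT: "finite T" by (auto simp: T_def S_def)
  have "S' \<subseteq> (\<lambda>t. (Suc t, t)) ` T \<union> (\<lambda>t. (t + 2, t)) ` T"
  proof
   fix k assume k: "k \<in> S'"
   obtain i t where it: "k = (i, t)" by (cases k)
   have "t \<in> T" using k by (force simp: S'_def T_def it)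
   thus "k \<in> (\<lambda>t. (Suc t, t)) ` T \<union> (\<lambda>t. (t + 2, t)) ` T" using k by (auto simp: S'_def it band_def)
  qed
  hence "card S' <= card ((\<lambda>t. (Suc t, t)) ` T \<union> (\<lambda>t. (t + 2, t)) ` T)" using fT by (intro card_mono) auto
  also have "... <= card T + card T" by (intro order_trans[OF card_Un_le] add_mono card_image_le fT)
  finally show ?thesis using cT by simp
 qed
 define \<sigma> where "\<sigma> = 20 * sqrt (\<Gamma>*n*l)"
 have pos: "0 < \<Gamma>*n*l" using \<Gamma>1 n4 l by simp
 have \<sigma>: "\<sigma> > 0" using pos by (simp add: \<sigma>_def)
 define d where "d k = (if k \<in> S' then 8 * sqrt p else 0)" for k
 have sumd: "(\<Sum>k\<in>grid n p. d k*f k) = (\<Sum>k\<in>S'. 8 * sqrt p*f k)" for f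
 proof -
  have "(\<Sum>k\<in>grid n p. d k*f k) = (\<Sum>k\<in>S'. d k*f k)"
   by (rule sum.mono_neutral_right) (auto simp: d_def S'_def)
  thus ?thesis by (simp add: d_def)
 qed
 have d2: "(\<Sum>k\<in>grid n p. (d k)\<^sup>2) <= \<sigma>\<^sup>2"
 proof -
  have "(\<Sum>k\<in>grid n p. (d k)\<^sup>2) = (\<Sum>k\<in>grid n p. d k*(8 * sqrt p))" by (intro sum.cong) (auto simp: d_def power2_eq_square)
  also have "... = card S'*(64*real p)" unfolding sumd by simp
  also have "... <= real (6*l)*(64*(\<Gamma>*n))" using cS' p\<Gamma> by (intro mult_mono) auto
  also have "... = 384*(\<Gamma>*n*l)" by simp
  also have "... <= 400*(\<Gamma>*n*l)" using pos by linarith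
  also have "... = 400*(sqrt (\<Gamma>*n*l))^2" by (subst real_sqrt_pow2) (use pos in linarith)+
  also have "... = \<sigma>\<^sup>2" unfolding \<sigma>_def power_mult_distrib by (rule arg_cong2[where f = times]) simp_all
  finally show ?thesis .
 qed
 let ?g = "\<lambda>\<xi>. \<Sum>j\<in>S. lin_noise n p \<xi> j"
 have Eg: "(\<integral>\<xi>. ?g \<xi> \<partial>?P) = 0"
  using has_bochner_integral_sum[of S ?P "\<lambda>j \<xi>. lin_noise n p \<xi> j" "\<lambda>_. 0"] lin_noise_centred[OF np]
  by (simp add: has_bochner_integral_integral_eq)
 have gm: "?g \<in> borel_measurable ?P" by (intro borel_measurable_sum lin_noise_measurable np)
 have bound: "measure ?P {\<xi> \<in> space ?P. L/(20*\<Gamma>)*\<sigma> <= \<bar>?g \<xi> - (\<integral>\<xi>. ?g \<xi> \<partial>?P)\<bar>} <= 2*exp (8 - L/(20*\<Gamma>)/4)"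
 proof (rule PiM_bidiag_concentration(2)[OF np gm \<sigma> _ d2])
  fix x y :: "nat \<times> nat => real"
  show "?g x - ?g y <= (\<Sum>k\<in>grid n p. d k*\<bar>x k - y k\<bar>)"
   unfolding sumd S'_def by (rule lin_noise_lipschitz[OF np Sn]) (simp add: S_def)
 qed (auto simp: d_def)
 interpret prob_space ?P by (rule prob_space_PiM_bidiag)
 have th: "L/(20*\<Gamma>)*\<sigma> <= sqrt (real n*l)*L"
 proof -
  have "sqrt \<Gamma> <= \<Gamma>" using \<Gamma>1 real_sqrt_le_mono[of \<Gamma> "\<Gamma>\<^sup>2"] by (simp add: power2_eq_square)
  hence "sqrt \<Gamma>/\<Gamma> <= 1" using \<Gamma>1 by simp
  hence "sqrt \<Gamma>/\<Gamma>*(sqrt (real n*l)*L) <= 1*(sqrt (real n*l)*L)" using L by (intro mult_right_mono) auto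
  moreover have "L/(20*\<Gamma>)*\<sigma> = sqrt \<Gamma>/\<Gamma>*(sqrt (real n*l)*L)"
   by (simp add: \<sigma>_def real_sqrt_mult)
  ultimately show ?thesis by simp
 qed
 have "measure ?P {\<xi> \<in> space ?P. sqrt (real n*l)*L <= \<bar>?g \<xi>\<bar>} <= measure ?P {\<xi> \<in> space ?P. L/(20*\<Gamma>)*\<sigma> <= \<bar>?g \<xi> - (\<integral>\<xi>. ?g \<xi> \<partial>?P)\<bar>}"
 proof (rule finite_measure_mono)
  note gm[measurable]
  show "{\<xi> \<in> space ?P. L/(20*\<Gamma>)*\<sigma> <= \<bar>?g \<xi> - (\<integral>\<xi>. ?g \<xi> \<partial>?P)\<bar>} \<in> sets ?P" by measurable
 qed (use th in \<open>auto simp: Eg\<close>)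
 thus ?thesis using bound by (simp add: S_def)
qed

text \<open>Union bound over at most 2n band entries and at most n pairs of a block and a length
  within it; the worse of the two exponents is used for all.\<close>

theorem good_event_prob:
 fixes \<Gamma> L :: real
 assumes np: "n <= p" and p\<Gamma>: "real p <= \<Gamma>*n" and \<Gamma>1: "1 <= \<Gamma>" and L: "0 <= L" and l: "1 <= l" and n4: "4 <= n"
 shows "measure (PiM (grid n p) (bidiag n p)) (space (PiM (grid n p) (bidiag n p)) - good_event n p l L) <= 6*real n*exp (8 - L/(80*\<Gamma>))"
proof -
 let ?P = "PiM (grid n p) (bidiag n p)"
 interpret prob_space ?P by (rule prob_space_PiM_bidiag)
 define Bd where "Bd = {k \<in> grid n p. band k}"
 define CR where "CR = {..<n div (2*l)} \<times> {..l}"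
 define F where "F k = {\<xi> \<in> space ?P. L <= \<bar>\<xi> k - (\<integral>x. x \<partial>bidiag n p k)\<bar>}" for k
 define G where "G cr = {\<xi> \<in> space ?P. sqrt (real n*l)*L <= \<bar>\<Sum>j\<in>{fst cr*l..<fst cr*l + snd cr}. lin_noise n p \<xi> j\<bar>}" for cr
 define Z where "Z = {\<xi> \<in> space ?P. \<not> (\<forall>k\<in>grid n p. 0 <= \<xi> k \<and> (\<not> band k --> \<xi> k = 0))}"
 have fin: "finite Bd" "finite CR" by (auto simp: Bd_def CR_def)
 have Fs: "F k \<in> sets ?P" if "k \<in> Bd" for k
 proof -
  have [measurable]: "(\<lambda>\<xi>. \<xi> k) \<in> borel_measurable ?P" by (rule entry_measurable) (use that in \<open>simp add: Bd_def\<close>)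
  show ?thesis unfolding F_def by measurable
 qed
 have Gs: "G cr \<in> sets ?P" for cr
  unfolding G_def by (intro borel_measurable_le borel_measurable_abs borel_measurable_sum lin_noise_measurable np borel_measurable_const)
 have aez: "AE \<xi> in ?P. \<forall>k\<in>grid n p. 0 <= \<xi> k \<and> (\<not> band k --> \<xi> k = 0)"
  by (intro AE_finite_allI entry_nonneg_AE) auto
 have Zn: "Z \<in> null_sets ?P"
 proof -
  have "Z \<in> sets ?P" unfolding Z_def
  proof (intro sets.sets_Collect_neg sets.sets_Collect_finite_All)
   fix k assume "k \<in> grid n p"
   note [measurable] = entry_measurable[OF this]
   show "{\<xi> \<in> space ?P. 0 <= \<xi> k \<and> (\<not> band k --> \<xi> k = 0)} \<in> sets ?P" by measurable
  qed auto
  thus ?thesis using aez unfolding Z_def by (simp only: AE_iff_null)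
 qed
 have sub: "space ?P - good_event n p l L \<subseteq> Z \<union> ((\<Union>k\<in>Bd. F k) \<union> (\<Union>cr\<in>CR. G cr))"
 proof
  fix \<xi> assume w: "\<xi> \<in> space ?P - good_event n p l L"
  show "\<xi> \<in> Z \<union> ((\<Union>k\<in>Bd. F k) \<union> (\<Union>cr\<in>CR. G cr))"
  proof (rule ccontr)
   assume a: "\<not> ?thesis"
   hence z: "\<forall>k\<in>grid n p. 0 <= \<xi> k \<and> (\<not> band k --> \<xi> k = 0)" using w by (auto simp: Z_def)
   have f: "\<bar>\<xi> k - (\<integral>x. x \<partial>bidiag n p k)\<bar> <= L" if "k \<in> grid n p" "band k" for k
   proof -
    have "\<xi> \<notin> F k" using a that by (auto simp: Bd_def)
    thus ?thesis using w by (simp add: F_def)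
   qed
   have g: "\<bar>\<Sum>j\<in>{c*l..<c*l + r}. lin_noise n p \<xi> j\<bar> <= sqrt (real n*l)*L" if "c \<in> {..<n div (2*l)}" "r \<in> {..l}" for c r
   proof -
    have "(c, r) \<in> CR" using that by (simp add: CR_def)
    hence "\<xi> \<notin> G (c, r)" using a by blast
    thus ?thesis using w by (simp add: G_def)
   qed
   have "\<xi> \<in> good_event n p l L" unfolding good_event_def using w z f g by auto
   thus False using w by simp
  qed
 qed
 have cB: "card Bd <= 2*n"
 proof -
  have "Bd \<subseteq> (\<lambda>j. (Suc j, j)) ` {..<n} \<union> (\<lambda>j. (j + 2, j)) ` {..<n}" by (auto simp: Bd_def band_def)
  hence "card Bd <= card ((\<lambda>j. (Suc j, j)) ` {..<n} \<union> (\<lambda>j. (j + 2, j)) ` {..<n})" by (intro card_mono) auto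
  also have "... <= card {..<n} + card {..<n}" by (intro order_trans[OF card_Un_le] add_mono card_image_le) auto
  finally show ?thesis by simp
 qed
 have cC: "card CR <= n"
 proof -
  have "card CR = n div (2*l)*(l + 1)" by (simp only: CR_def card_cartesian_product card_lessThan card_atMost Suc_eq_plus1)
  also have "... <= n div (2*l)*(2*l)" using l by (intro mult_left_mono) auto
  also have "... <= n" by (rule div_times_less_eq_dividend)
  finally show ?thesis .
 qed
 define q where "q = 2*exp (8 - L/(80*\<Gamma>))"
 have q0: "0 <= q" by (simp add: q_def)
 have Fq: "measure ?P (F k) <= q" if "k \<in> Bd" for k
 proof -
  have "measure ?P (F k) <= 2*exp (8 - L/4)" unfolding F_def using entry_deviation[OF np, of k L] that by (simp add: Bd_def)
  also have "... <= q"
  proof -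
   have "L/(80*\<Gamma>) <= L/4" using L \<Gamma>1 by (intro divide_left_mono) auto
   thus ?thesis by (simp add: q_def)
  qed
  finally show ?thesis .
 qed
 have Gq: "measure ?P (G cr) <= q" if "cr \<in> CR" for cr
  unfolding G_def q_def using that by (intro block_deviation[OF assms]) (auto simp: CR_def)
 have "measure ?P (space ?P - good_event n p l L) <= measure ?P (Z \<union> ((\<Union>k\<in>Bd. F k) \<union> (\<Union>cr\<in>CR. G cr)))"
  using Zn Fs Gs fin by (intro finite_measure_mono[OF sub] sets.Un sets.finite_UN) auto
 also have "... <= measure ?P Z + (measure ?P (\<Union>k\<in>Bd. F k) + measure ?P (\<Union>cr\<in>CR. G cr))"
  using Zn Fs Gs fin by (intro order_trans[OF measure_Un_le] add_left_mono measure_Un_le sets.Un sets.finite_UN) auto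
 also have "... <= 0 + ((\<Sum>k\<in>Bd. q) + (\<Sum>cr\<in>CR. q))"
 proof (intro add_mono)
  show "measure ?P Z <= 0" using Zn by (simp add: measure_eq_0_null_sets)
  show "measure ?P (\<Union>k\<in>Bd. F k) <= (\<Sum>k\<in>Bd. q)"
   by (rule order_trans[OF measure_UNION_le[OF fin(1) Fs] sum_mono[OF Fq]])
  show "measure ?P (\<Union>cr\<in>CR. G cr) <= (\<Sum>cr\<in>CR. q)"
   by (rule order_trans[OF measure_UNION_le[OF fin(2) Gs] sum_mono[OF Gq]])
 qed
 also have "... = (real (card Bd) + real (card CR))*q" by (simp add: distrib_right)
 also have "... <= (2*real n + real n)*q" using cB cC q0 by (intro mult_right_mono add_mono) linarith+
 finally show ?thesis by (simp add: q_def)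
qed

section \<open>Lipschitz constants of the eigenvalue sums\<close>

lemma sum_inverse_le_ln:
 assumes "1 <= n"
 shows "(\<Sum>j<n. 1/(real j + 1)) <= 1 + ln n"
proof -
 obtain m where m: "n = Suc m" using assms by (cases n) auto
 have "harm (Suc m) - ln (real (Suc m)) <= harm (Suc 0) - ln (real (Suc 0))"
  by (rule decseqD[OF decseq_harm_diff_ln]) simp
 hence "harm (Suc m) <= 1 + ln (real (Suc m))" by (simp add: harm_def)
 moreover have "harm (Suc m) = (\<Sum>j<n. 1/(real j + 1))"
  unfolding harm_def m by (simp only: sum.atLeast1_atMost_eq One_nat_def) (simp add: field_simps)
 ultimately show ?thesis using m by simp
qed

context good_bidiagonal
begin

lemma edge_le: "edge <= 4*\<Gamma>*n"
proof -
 have "sqrt p <= sqrt (\<Gamma>*n)" using p\<Gamma> by simp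
 moreover have "sqrt n <= sqrt (\<Gamma>*n)" using \<Gamma>1 by (simp add: mult_le_cancel_right1)
 ultimately have "(sqrt p + sqrt n)^2 <= (2 * sqrt (\<Gamma>*n))^2" by (intro power_mono) (linarith, simp)
 also have "... = 4*\<Gamma>*n" using \<Gamma>1 by (simp add: power_mult_distrib)
 finally show ?thesis unfolding edge_def .
qed

text \<open>For a block length \<open>l\<close> of order y = n^(1/3) both parts of \<open>K3\<close>
  are of order \<open>y\<close>: T/l is about sqrt(n/l), and T^2/n is about \<open>l\<close>.
  Shorter blocks would worsen the first part, longer ones the second.\<close>

lemma K3_le:
 fixes y :: real
 assumes y: "y ^ 3 = n" "1 <= y" "y <= l" "l <= 2*y"
 shows "K3 <= 4300*L ^ 4*y"
proof -
 define s where "s = sqrt (real n*l)"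
 have s0: "0 <= s" by (simp add: s_def)
 have s2: "s^2 = y ^ 3*l" by (simp add: s_def y(1))
 have lp: "0 < real l" "real l <= 2*y" using y by linarith+
 have n: "0 < real n" using n_pos by simp
 have LL: "1 <= L\<^sup>2" "L\<^sup>2 <= L ^ 4" "L <= L ^ 4" "1 <= L ^ 4" using L1 power_increasing[of 2 4 L] power_increasing[of 1 4 L] by auto
 have sl: "s <= y*l"
 proof (rule power2_le_imp_le)
  have "y ^ 3*l <= y^2*l*l" using y(2,3) lp by (simp add: power3_eq_cube power2_eq_square mult_left_mono mult_right_mono)
  thus "s^2 <= (y*l)^2" unfolding s2 by (simp add: power2_eq_square mult_ac)
 qed (use lp y in simp)
 have Tl: "T/l <= 5*L ^ 4*y"
 proof -
  have "T/l = s/l*L + 4*L\<^sup>2" using lp by (simp add: T_def s_def[symmetric] add_divide_distrib)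
  also have "... <= y*L ^ 4 + 4*(L ^ 4*y)"
  proof (rule add_mono)
   have "s/l <= y" using sl lp by (simp add: divide_le_eq)
   thus "s/l*L <= y*L ^ 4" by (rule mult_mono) (use y LL L1 in auto)
   show "4*L\<^sup>2 <= 4*(L ^ 4*y)" using LL y(2) mult_mono[of "L\<^sup>2" "L ^ 4" 1 y] by simp
  qed
  finally show ?thesis by (simp add: mult_ac)
 qed
 have "T\<^sup>2 <= 2*(s*L)^2 + 2*(4*l*L\<^sup>2)^2"
  unfolding T_def s_def[symmetric] using sum_squares_bound[of "s*L" "4*l*L\<^sup>2"] by (simp add: power2_sum)
 also have "... = 2*(y ^ 3*l)*L\<^sup>2 + 32*(real l)^2*L ^ 4" by (simp add: power_mult_distrib s2)
 also have "... <= 2*(y ^ 3*(2*y))*L ^ 4 + 32*(2*y)^2*L ^ 4"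
 proof (rule add_mono)
  have "0 <= y ^ 3" using y(2) by simp
  with lp have "2*(y ^ 3*l) <= 2*(y ^ 3*(2*y))" "0 <= 2*(y ^ 3*(2*y))" using y(2) by (simp_all add: mult_left_mono)
  thus "2*(y ^ 3*l)*L\<^sup>2 <= 2*(y ^ 3*(2*y))*L ^ 4" by (rule mult_mono[OF _ LL(2)]) simp
  have "(real l)^2 <= (2*y)^2" using lp by (intro power_mono) auto
  thus "32*(real l)^2*L ^ 4 <= 32*(2*y)^2*L ^ 4" using LL(4) by (intro mult_right_mono mult_left_mono) linarith+
 qed
 also have "... = (4*y ^ 4 + 128*y^2)*L ^ 4" by (simp add: algebra_simps power4_eq_xxxx power3_eq_cube power2_eq_square)
 also have "... <= (4*y ^ 4 + 128*y ^ 4)*L ^ 4"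
  using LL y power_increasing[of 2 4 y] by (intro mult_right_mono) auto
 also have "... = n*(132*L ^ 4*y)" unfolding y(1)[symmetric] by (simp add: algebra_simps power4_eq_xxxx power3_eq_cube)
 finally have "T\<^sup>2/n <= 132*L ^ 4*y" using n by (simp add: divide_le_eq mult.commute)
 hence "32*T\<^sup>2/n <= 4224*L ^ 4*y" by simp
 moreover have "0 <= L ^ 4*y" using LL y by simp
 ultimately show ?thesis using Tl unfolding K3_def by linarith
qed

text \<open>With x = (k/n)^(1/3), half-width m of about 1/x balances the potential m k against the
  kinetic energy n/m^2; both are of order n x^2. The constant 4020 is 2 * 2000 + 20. If the tents do
  not fit below \<open>N\<close>, then n is at most 16 n x^2, and nonnegativity of eigenvalues with
  \<open>edge_le\<close> suffices.\<close>

lemma eigenvalue_near_edge: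
 fixes e :: "nat => real" and x :: real
 assumes es: "eigen_system n p X w e" and k: "1 <= k" "k <= n" and x: "0 < x" "x ^ 3*n = k"
 shows "edge - (4020*\<Gamma>*(n*x^2) + K3) <= n*e (k - 1)"
proof -
 define m where "m = nat \<lceil>1/x\<rceil>"
 have n: "0 < real n" using n_pos by simp
 have x1: "x <= 1"
 proof (rule ccontr)
  assume "\<not> x <= 1"
  hence "1*real n < x ^ 3*n" using n by (intro mult_strict_right_mono) auto
  thus False using x k by simp
 qed
 have mx: "1/x <= m" "m <= 2/x" "1 <= m"
 proof -
  have ge1: "1 <= 1/x" using x x1 by simp
  have "1/x <= m" unfolding m_def by (rule real_nat_ceiling_ge)
  moreover have "real m < 1/x + 1" using ge1 unfolding m_def by linarith
  ultimately have "real m < 1/x + 1" "1/x <= m" by simp_all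
  thus "1/x <= m" "m <= 2/x" "1 <= m" using ge1 by auto
 qed
 have mk: "m * k <= 2*(n*x^2)"
 proof -
  have "real m * k <= 2/x * k" using mx by (intro mult_right_mono) auto
  also have "... = 2*(n*x^2)" using x by (simp add: field_simps power2_eq_square power3_eq_cube flip: x(2))
  finally show ?thesis by simp
 qed
 show ?thesis
 proof (cases "2*m * k < N")
  case True
  have "20*\<Gamma>*n/(real m)^2 <= 20*\<Gamma>*n/(1/x)^2"
   using mx x n \<Gamma>1 by (intro divide_left_mono power_mono mult_pos_pos) auto
  also have "... = 20*\<Gamma>*(n*x^2)" by (simp add: field_simps)
  finally have 1: "20*\<Gamma>*n/(real m)^2 <= 20*\<Gamma>*(n*x^2)" .
  have "\<Gamma>*(real m * k) <= \<Gamma>*(2*(n*x^2))" using mk \<Gamma>1 by (intro mult_left_mono) auto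
  thus ?thesis using eigenvalue_lower[OF es mx(3) True k(1)] 1 by (simp add: algebra_simps)
 next
  case False
  have "7*real n <= 16*real N" using N_bounds(2) by linarith
  moreover have "real N <= 2*(real m * k)" using False by (simp flip: of_nat_mult)
  ultimately have "n <= 16*(n*x^2)" using mk by simp
  hence "\<Gamma>*n <= \<Gamma>*(16*(n*x^2))" using \<Gamma>1 by (intro mult_left_mono) auto
  moreover have "0 <= \<Gamma>*(n*x^2)" using \<Gamma>1 by simp
  moreover have "0 <= n*e (k - 1)" using es_nonneg[OF es, of "k - 1"] k np by simp
  ultimately show ?thesis using edge_le K3_nonneg by simp
 qed
qed

text \<open>Since k is at least 1, the noise scale n^(1/3) is at most n x^2, so \<open>K3\<close> is
  absorbed into the energy scale of the \<open>k\<close>-th eigenvalue at the price of L^4.\<close>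

lemma projection_bound:
 fixes e :: "nat => real" and x y :: real
 assumes es: "eigen_system n p X w e" and k: "1 <= k" "k <= n" and x: "0 < x" "x ^ 3*n = k"
  and y: "y ^ 3 = n" "1 <= y" "y <= l" "l <= 2*y" and i: "i < n"
 shows "(\<Sum>m<k. (w m i)\<^sup>2) <= 208000*\<Gamma>*L ^ 4*x^2*n / sqrt (n*(real i + 1))"
proof -
 define z where "z = real n*x^2"
 have n: "0 < real n" using n_pos by simp
 have yz: "y <= z"
 proof -
  have "(x*y) ^ 3 = k" using x(2) y(1) by (simp add: power_mult_distrib)
  moreover have "1 <= real k" using k by simp
  ultimately have xy: "1 <= x*y" using x y power_less_one_iff[of "x*y" 3] by (metis linorder_not_less mult_nonneg_nonneg order_less_imp_le zero_le_one order_trans zero_less_numeral)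
  have "z = y*(x*y)^2" unfolding z_def y(1)[symmetric] by (simp add: power2_eq_square power3_eq_cube mult_ac)
  thus ?thesis using one_le_power[OF xy, of 2] y(2) by simp
 qed
 have LL: "1 <= L ^ 4" using L1 by auto
 have "4300*L ^ 4*y <= 4300*L ^ 4*z" using yz LL by (intro mult_left_mono) auto
 hence K3z: "K3 <= 4300*(L ^ 4*z)" using K3_le[OF y] by simp
 define h where "h = 4020*\<Gamma>*z + K3"
 have z1: "1 <= z" using yz y by simp
 have "\<Gamma>*z*1 <= \<Gamma>*z*L ^ 4" using LL z1 \<Gamma>1 by (intro mult_left_mono) auto
 moreover have "1*(L ^ 4*z) <= \<Gamma>*(L ^ 4*z)" using LL z1 \<Gamma>1 by (intro mult_right_mono) auto
 moreover have pos: "0 <= \<Gamma>*(L ^ 4*z)" using LL z1 \<Gamma>1 by simp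
 ultimately have hK: "h + K3 <= 13000*(\<Gamma>*L ^ 4*z)" unfolding h_def using K3z pos by (simp only: mult_ac)
 have "1*1 <= \<Gamma>*z" using \<Gamma>1 z1 by (intro mult_mono) auto
 hence h1: "1 <= h" unfolding h_def using K3_nonneg by simp
 have kp: "k <= p" using k np by simp
 have "(\<Sum>m<k. (w m i)\<^sup>2) <= 16*(h + K3) / sqrt (n*(real i + 1))"
  by (rule projection_diagonal[OF es k(1) kp _ h1 i])
   (use eigenvalue_near_edge[OF es k x] in \<open>simp add: h_def z_def\<close>)
 also have "... <= 16*(13000*(\<Gamma>*L ^ 4*z)) / sqrt (n*(real i + 1))"
  using hK by (intro divide_right_mono) auto
 finally show ?thesis by (simp add: z_def mult_ac)
qed

end

text \<open>The factor 1/sqrt(j + 1) is inherited from the diagonal of the spectral projection. Its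
  squares form a harmonic sum, so only a logarithm is lost.\<close>

definition lip_coeff :: "nat => real => nat \<times> nat => real" where
 "lip_coeff n h k = (if band k then h/(n * sqrt (real (snd k) + 1)) else 0)"

lemma lip_coeff_square_sum:
 assumes n: "1 <= n" and np: "n <= p"
 shows "(\<Sum>k\<in>grid n p. (lip_coeff n h k)\<^sup>2) <= 2*(h/n)^2*(1 + ln n)"
proof -
 define g where "g j = (h/n)^2*(1/(real j + 1))" for j
 have g0: "0 <= g j" for j by (simp add: g_def)
 have sq: "(lip_coeff n h k)^2 = (if band k then g (snd k) else 0)" for k
  by (simp add: lip_coeff_def g_def power_divide power_mult_distrib)
 define U where "U = (\<lambda>j. (Suc j, j)) ` {..<n}"
 define V where "V = (\<lambda>j. (j + 2, j)) ` {..<n}"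
 have fin: "finite U" "finite V" by (auto simp: U_def V_def)
 have "(\<Sum>k\<in>grid n p. (lip_coeff n h k)\<^sup>2) = (\<Sum>k\<in>{k \<in> grid n p. band k}. g (snd k))"
  unfolding sq by (simp add: sum.If_cases Int_def)
 also have "... <= (\<Sum>k\<in>U \<union> V. g (snd k))"
  by (rule sum_mono2) (use fin g0 in \<open>auto simp: U_def V_def band_def\<close>)
 also have "... <= (\<Sum>k\<in>U. g (snd k)) + (\<Sum>k\<in>V. g (snd k))"
  using sum_nonneg[of "U \<inter> V" "\<lambda>k. g (snd k)"] g0 fin by (simp add: sum_Un)
 also have "(\<Sum>k\<in>U. g (snd k)) = (\<Sum>j<n. g j)" unfolding U_def by (subst sum.reindex) (auto simp: inj_on_def)
 also have "(\<Sum>k\<in>V. g (snd k)) = (\<Sum>j<n. g j)" unfolding V_def by (subst sum.reindex) (auto simp: inj_on_def)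
 also have "(\<Sum>j<n. g j) + (\<Sum>j<n. g j) = 2*(h/n)^2*(\<Sum>j<n. 1/(real j + 1))"
  by (simp add: g_def sum_distrib_left)
 also have "... <= 2*(h/n)^2*(1 + ln n)" using sum_inverse_le_ln[OF n] by (intro mult_left_mono) auto
 finally show ?thesis .
qed

text \<open>
 The derivative of a sum of top eigenvalues in a matrix entry is controlled by the diagonal of
 the spectral projection, which is small by delocalisation; convexity makes the estimate one-sided
 and global in the second point.
\<close>

theorem partial_sum_lipschitz:
 fixes \<Gamma> L x y :: real
 assumes np: "n <= p" and p\<Gamma>: "real p <= \<Gamma>*n" and \<Gamma>1: "1 <= \<Gamma>" and L1: "1 <= L"
  and large: "2 ^ 20*\<Gamma>\<^sup>2*L ^ 4 <= n" and l: "1 <= l" "16*l <= n"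
  and \<xi>: "\<xi> \<in> good_event n p l L" and off: "!!k. k \<in> grid n p ==> \<not> band k ==> \<xi>' k = 0"
  and k: "1 <= k" "k <= n" and x: "0 < x" "x ^ 3*n = k"
  and y: "y ^ 3 = n" "1 <= y" "y <= l" "l <= 2*y"
 shows "partial_sum n p k (\<lambda>i j. \<xi> (i, j)) - partial_sum n p k (\<lambda>i j. \<xi>' (i, j))
  <= (\<Sum>q\<in>grid n p. lip_coeff n (3000000*\<Gamma>\<^sup>2*L ^ 4*x^2*n) q*\<bar>\<xi> q - \<xi>' q\<bar>)"
proof -
 interpret good_bidiagonal n p l "n div (2*l)" \<Gamma> L "aval n \<xi>" "bval n \<xi>" "amean n p" "bmean n p" "\<lambda>i j. \<xi> (i, j)"
  by (rule good_event_locale[OF np p\<Gamma> \<Gamma>1 L1 large l \<xi>])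
 define X where "X = (\<lambda>i j. \<xi> (i, j))"
 define Y where "Y = (\<lambda>i j. \<xi>' (i, j))"
 have n1: "1 <= n" and n0: "0 < real n" using n_pos by auto
 have off': "!!k. k \<in> grid n p ==> \<not> band k ==> \<xi> k = 0" using \<xi> by (auto simp: good_event_def)
 have kp: "k <= p" using k np by simp
 obtain w e where es: "eigen_system n p X w e" using eigen_system_exists[OF n1] .
 define \<rho> where "\<rho> j = (\<Sum>m<k. (w m j)\<^sup>2)" for j
 define H where "H = 208000*\<Gamma>*L ^ 4*x^2*n"
 have H0: "0 <= H" using \<Gamma>1 by (simp add: H_def)
 have \<rho>0: "0 <= \<rho> j" for j by (simp add: \<rho>_def sum_nonneg)
 have \<rho>: "sqrt n*\<rho> i <= H / sqrt (real i + 1)" if "i < n" for i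
 proof -
  have "\<rho> i <= H/(sqrt n * sqrt (real i + 1))"
   using projection_bound[OF es[unfolded X_def] k x y that] unfolding \<rho>_def H_def by (simp only: real_sqrt_mult)
  hence "sqrt n*\<rho> i <= sqrt n*(H/(sqrt n * sqrt (real i + 1)))" by (intro mult_left_mono) auto
  also have "... = H / sqrt (real i + 1)" using n0 by simp
  finally show ?thesis .
 qed
 \<comment> \<open>The data matrix times the spectral projection onto the first \<open>k\<close>
   eigenvectors; 2 \<open>S i j\<close> is the derivative of n times the eigenvalue sum in the entry
   (i, j).\<close>
 define S where "S i j = (\<Sum>m<k. ip p (X i) (w m)*w m j)" for i j
 \<comment> \<open>Off-diagonal entries of the projection are bounded by the mean of two diagonal
   ones, applied termwise. A row of a bidiagonal matrix involves at most two of them.\<close>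
 have two: "\<bar>\<Sum>m<k. (a*w m i + b*w m j)*w m j'\<bar> <= sqrt n*(2*\<Gamma>)*((\<rho> i + \<rho> j')/2) + sqrt n*(2*\<Gamma>)*((\<rho> j + \<rho> j')/2)"
  if a: "0 <= a" "a <= 2*\<Gamma> * sqrt n" and b: "0 <= b" "b <= 2*\<Gamma> * sqrt n" for a b i j j'
 proof -
  have "\<bar>\<Sum>m<k. (a*w m i + b*w m j)*w m j'\<bar> <= (\<Sum>m<k. a*(((w m i)^2 + (w m j')^2)/2) + b*(((w m j)^2 + (w m j')^2)/2))"
  proof (rule order_trans[OF sum_abs], rule sum_mono)
   fix m
   have q: "\<bar>u * v\<bar> <= (u^2 + v^2)/2" for u v :: real
    using sum_squares_bound[of "\<bar>u\<bar>" "\<bar>v\<bar>"] by (simp add: abs_mult)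
   have "\<bar>(a*w m i + b*w m j)*w m j'\<bar> <= a*\<bar>w m i*w m j'\<bar> + b*\<bar>w m j*w m j'\<bar>"
    using abs_triangle_ineq[of "a*(w m i*w m j')" "b*(w m j*w m j')"] a b by (simp add: abs_mult algebra_simps)
   also have "... <= a*(((w m i)^2 + (w m j')^2)/2) + b*(((w m j)^2 + (w m j')^2)/2)"
    using a b by (intro add_mono mult_left_mono q)
   finally show "\<bar>(a*w m i + b*w m j)*w m j'\<bar> <= ..." .
  qed
  also have "... = a*((\<rho> i + \<rho> j')/2) + b*((\<rho> j + \<rho> j')/2)"
   by (simp only: \<rho>_def sum.distrib sum_distrib_left[symmetric] sum_divide_distrib[symmetric])
  also have "... <= (sqrt n*(2*\<Gamma>))*((\<rho> i + \<rho> j')/2) + (sqrt n*(2*\<Gamma>))*((\<rho> j + \<rho> j')/2)"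
   using a b \<rho>0 by (intro add_mono mult_right_mono) (auto simp: mult_ac add_nonneg_nonneg)
  finally show ?thesis .
 qed
 have ab: "0 <= aval n \<xi> j" "aval n \<xi> j <= 2*\<Gamma> * sqrt n" "0 <= bval n \<xi> j" "bval n \<xi> j <= 2*\<Gamma> * sqrt n" for j
 proof -
  have "2 * sqrt n <= 2*\<Gamma> * sqrt n" using \<Gamma>1 by (intro mult_right_mono) auto
  thus "0 <= aval n \<xi> j" "aval n \<xi> j <= 2*\<Gamma> * sqrt n" "0 <= bval n \<xi> j" "bval n \<xi> j <= 2*\<Gamma> * sqrt n"
   using ab(1,2)[of j] a_le[of j] b_le[of j] by linarith+
 qed
 \<comment> \<open>Neighbouring coordinates have comparable bounds: j + 1 is at most 4(i + 1), which
   costs a factor 2 after the square root.\<close>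
 have near: "sqrt n*\<rho> i <= 2*(H / sqrt (real j + 1))" if "i < n" "j <= Suc i" for i j
 proof -
  have "real (j + 1) <= real (4*(i + 1))" using that by (intro of_nat_mono) auto
  hence "real j + 1 <= 4*(real i + 1)" by simp
  hence "sqrt (real j + 1) <= sqrt 4 * sqrt (real i + 1)" unfolding real_sqrt_mult[symmetric] by (rule real_sqrt_le_mono)
  hence "sqrt (real j + 1) <= 2 * sqrt (real i + 1)" by simp
  hence "H/(2 * sqrt (real i + 1)) <= H / sqrt (real j + 1)" using H0 by (intro divide_left_mono) auto
  thus ?thesis using \<rho>[OF that(1)] by simp
 qed
 have q1: "ip p (\<lambda>j. \<xi> (1, j)) v = aval n \<xi> 0 * v 0" for v by (rule qf_banded(1)[OF np n1]) (rule off')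
 have q2: "ip p (\<lambda>j. \<xi> (i + 2, j)) v = aval n \<xi> (Suc i) * v (Suc i) + bval n \<xi> i * v i" if "i < n - 1" for i v
  by (rule qf_banded(2)[OF np n1 _ that]) (rule off')
 have Sbound: "2*\<bar>S i j\<bar> <= 14*\<Gamma>*(H / sqrt (real j + 1))" if ij: "(i, j) \<in> grid n p" "band (i, j)" for i j
 proof -
  have jn: "j < n" using ij by (auto simp: band_def)
  define R where "R = H / sqrt (real j + 1)"
  have R0: "0 <= R" using H0 by (simp add: R_def)
  have comb: "2*\<bar>S i j\<bar> <= 14*\<Gamma>*R"
   if S: "\<bar>S i j\<bar> <= sqrt n*(2*\<Gamma>)*((\<rho> i1 + \<rho> j)/2) + sqrt n*(2*\<Gamma>)*((\<rho> i2 + \<rho> j)/2)"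
    and r: "sqrt n*\<rho> i1 + sqrt n*\<rho> i2 <= 3*R" "sqrt n*\<rho> j <= R" for i1 i2
  proof -
   have "2*\<bar>S i j\<bar> <= \<Gamma>*(2*(sqrt n*\<rho> i1 + sqrt n*\<rho> i2) + 4*(sqrt n*\<rho> j))"
    using S by (simp add: field_simps)
   also have "... <= \<Gamma>*(2*(3*R) + 4*R)" using r \<Gamma>1 by (intro mult_left_mono) auto
   also have "... <= 14*\<Gamma>*R" using R0 \<Gamma>1 by simp
   finally show ?thesis .
  qed
  have rj: "sqrt n*\<rho> j <= R" using \<rho>[OF jn] by (simp add: R_def)
  \<comment> \<open>The first row has a single nonzero entry; the other band positions are on the
    diagonal or below it, in rows with two.\<close>
  consider "i = 1" "j = 0" | j' where "j = Suc j'" "i = j' + 2" | "i = j + 2"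
   using ij by (cases j) (auto simp: band_def)
  hence "2*\<bar>S i j\<bar> <= 14*\<Gamma>*R"
  proof cases
   case 1
   have S: "S i j = (\<Sum>m<k. (aval n \<xi> 0*w m 0 + 0*w m 0)*w m j)"
    unfolding S_def X_def 1 q1 by simp
   show ?thesis
    by (rule comb[of 0 0, OF _ _ rj], unfold S, rule two[OF ab(1,2)]) (use rj R0 \<Gamma>1 in \<open>simp_all add: 1 mult_ac\<close>)
  next
   case 2
   have i: "j' < n - 1" using 2 ij by auto
   have S: "S i j = (\<Sum>m<k. (aval n \<xi> j*w m j + bval n \<xi> j'*w m j')*w m j)"
    unfolding S_def X_def 2 q2[OF i] by simp
   have "sqrt n*\<rho> j' <= 2*R" unfolding R_def by (rule near) (use 2 i in auto)
   thus ?thesis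
    by (intro comb[of j j', OF _ _ rj], unfold S) (rule two[OF ab(1,2,3,4)], use rj in linarith)
  next
   case 3
   have i: "j < n - 1" using 3 ij by auto
   have S: "S i j = (\<Sum>m<k. (aval n \<xi> (Suc j)*w m (Suc j) + bval n \<xi> j*w m j)*w m j)"
    unfolding S_def X_def 3 q2[OF i] by simp
   have "sqrt n*\<rho> (Suc j) <= 2*R" unfolding R_def by (rule near) (use i in auto)
   thus ?thesis
    by (intro comb[of "Suc j" j, OF _ _ rj], unfold S) (rule two[OF ab(1,2,3,4)], use rj in linarith)
  qed
  thus ?thesis by (simp add: R_def)
 qed
 \<comment> \<open>The eigenvectors of \<open>X\<close> serve both arrays: they are optimal for
   \<open>X\<close> and merely admissible for \<open>Y\<close>. This is why only the first array has
   to be good.\<close>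
 have "n*partial_sum n p k X - n*partial_sum n p k Y <= (\<Sum>m<k. qf n p X (w m)) - (\<Sum>m<k. qf n p Y (w m))"
  using Ky_Fan_attained[OF n1 kp es] Ky_Fan[OF n1 orthonormal_mono[OF es_orthonormal[OF es] kp], of Y] by simp
 also have "... = (\<Sum>m<k. \<Sum>i=1..n. (ip p (X i) (w m))\<^sup>2 - (ip p (Y i) (w m))\<^sup>2)"
  unfolding qf_def sum_subtractf ..
 also have "... <= (\<Sum>m<k. \<Sum>i=1..n. 2*ip p (X i) (w m)*ip p (\<lambda>j. X i j - Y i j) (w m))"
 proof (intro sum_mono)
  fix m i
  have "0 <= (ip p (X i) (w m) - ip p (Y i) (w m))^2" by simp
  thus "(ip p (X i) (w m))^2 - (ip p (Y i) (w m))\<^sup>2 <= 2*ip p (X i) (w m)*ip p (\<lambda>j. X i j - Y i j) (w m)"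
   unfolding ip_diff_left by (simp add: power2_eq_square algebra_simps)
 qed
 also have "... = (\<Sum>i=1..n. \<Sum>j<p. 2*S i j*(X i j - Y i j))"
  unfolding S_def ip_def[of p "\<lambda>j. X _ j - Y _ j"]
  by (simp only: sum_distrib_left sum_distrib_right) (subst sum.swap, rule sum.cong[OF refl], subst sum.swap, simp add: mult_ac)
 also have "... = (\<Sum>q\<in>grid n p. 2*S (fst q) (snd q)*(\<xi> q - \<xi>' q))"
  by (simp add: sum.cartesian_product X_def Y_def case_prod_beta)
 also have "... <= (\<Sum>q\<in>grid n p. n*(lip_coeff n (3000000*\<Gamma>\<^sup>2*L ^ 4*x^2*n) q*\<bar>\<xi> q - \<xi>' q\<bar>))"
 proof (rule sum_mono)
  fix q assume q: "q \<in> grid n p"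
  show "2*S (fst q) (snd q)*(\<xi> q - \<xi>' q) <= n*(lip_coeff n (3000000*\<Gamma>\<^sup>2*L ^ 4*x^2*n) q*\<bar>\<xi> q - \<xi>' q\<bar>)"
  proof (cases "band q")
   case True
   define s where "s = sqrt (real (snd q) + 1)"
   have s: "0 < s" by (simp add: s_def)
   have "2*\<bar>S (fst q) (snd q)\<bar> <= 14*\<Gamma>*(H / s)" using Sbound[of "fst q" "snd q"] q True by (simp add: s_def)
   also have "... = 2912000*(\<Gamma>\<^sup>2*L ^ 4*x^2*n / s)" by (simp add: H_def power2_eq_square mult_ac)
   also have "... <= 3000000*(\<Gamma>\<^sup>2*L ^ 4*x^2*n / s)" using s L1 by (intro mult_right_mono) auto
   also have "... = n*lip_coeff n (3000000*\<Gamma>\<^sup>2*L ^ 4*x^2*n) q" using True n0 s by (simp add: lip_coeff_def s_def)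
   finally have b: "2*\<bar>S (fst q) (snd q)\<bar> <= n*lip_coeff n (3000000*\<Gamma>\<^sup>2*L ^ 4*x^2*n) q" .
   have "2*S (fst q) (snd q)*(\<xi> q - \<xi>' q) <= 2*\<bar>S (fst q) (snd q)\<bar>*\<bar>\<xi> q - \<xi>' q\<bar>"
    using abs_ge_self[of "2*S (fst q) (snd q)*(\<xi> q - \<xi>' q)"] by (simp add: abs_mult)
   also have "... <= n*lip_coeff n (3000000*\<Gamma>\<^sup>2*L ^ 4*x^2*n) q*\<bar>\<xi> q - \<xi>' q\<bar>"
    using b by (intro mult_right_mono) auto
   finally show ?thesis by (simp add: mult.assoc)
  next
   case False
   thus ?thesis using off[OF q] off'[OF q] by (simp add: lip_coeff_def)
  qed
 qed
 also have "... = n*(\<Sum>q\<in>grid n p. lip_coeff n (3000000*\<Gamma>\<^sup>2*L ^ 4*x^2*n) q*\<bar>\<xi> q - \<xi>' q\<bar>)" by (simp add: sum_distrib_left)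
 finally show ?thesis using n0 unfolding X_def Y_def right_diff_distrib[symmetric] by (simp only: mult_le_cancel_left_pos)
qed

text \<open>A crude bound through the trace. It supplies the level at which the Lipschitz extension
  is capped.\<close>

lemma partial_sum_good_le:
 fixes \<Gamma> L :: real
 assumes np: "n <= p" and p\<Gamma>: "real p <= \<Gamma>*n" and \<Gamma>1: "1 <= \<Gamma>" and L1: "1 <= L"
  and large: "2 ^ 20*\<Gamma>\<^sup>2*L ^ 4 <= n" and l: "1 <= l" "16*l <= n"
  and \<xi>: "\<xi> \<in> good_event n p l L" and k: "k <= p"
 shows "partial_sum n p k (\<lambda>i j. \<xi> (i, j)) <= 8*\<Gamma>\<^sup>2*n"
proof -
 interpret good_bidiagonal n p l "n div (2*l)" \<Gamma> L "aval n \<xi>" "bval n \<xi>" "amean n p" "bmean n p" "\<lambda>i j. \<xi> (i, j)"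
  by (rule good_event_locale[OF np p\<Gamma> \<Gamma>1 L1 large l \<xi>])
 have n1: "1 <= n" and n0: "0 < real n" using n_pos by auto
 have off: "!!k. k \<in> grid n p ==> \<not> band k ==> \<xi> k = 0" using \<xi> by (auto simp: good_event_def)
 define U where "U = (\<lambda>j. (Suc j, j)) ` {..<n}"
 define V where "V = (\<lambda>j. (j + 2, j)) ` {j. j + 2 <= n}"
 have fV: "finite {j. j + 2 <= n}" by (rule finite_subset[of _ "{..n}"]) auto
 have fin: "finite U" "finite V" using fV by (auto simp: U_def V_def)
 have "n*partial_sum n p k (\<lambda>i j. \<xi> (i, j)) <= (\<Sum>i=1..n. \<Sum>j<p. (\<xi> (i, j))\<^sup>2)" by (rule partial_sum_le_trace[OF n1 k])
 also have "... = (\<Sum>q\<in>grid n p. (\<xi> q)\<^sup>2)" by (simp add: sum.cartesian_product case_prod_beta)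
 also have "... = (\<Sum>q\<in>{k \<in> grid n p. band k}. (\<xi> q)\<^sup>2)" by (rule sum.mono_neutral_right) (use off in auto)
 also have "... <= (\<Sum>q\<in>U \<union> V. (\<xi> q)\<^sup>2)" by (rule sum_mono2) (use fin in \<open>auto simp: U_def V_def band_def\<close>)
 also have "... <= (\<Sum>q\<in>U. (\<xi> q)\<^sup>2) + (\<Sum>q\<in>V. (\<xi> q)\<^sup>2)"
  using sum_nonneg[of "U \<inter> V" "\<lambda>q. (\<xi> q)\<^sup>2"] fin by (simp add: sum_Un)
 also have "(\<Sum>q\<in>U. (\<xi> q)\<^sup>2) = (\<Sum>j<n. (aval n \<xi> j)\<^sup>2)"
  unfolding U_def by (subst sum.reindex) (auto simp: inj_on_def aval_def)
 also have "(\<Sum>q\<in>V. (\<xi> q)\<^sup>2) = (\<Sum>j\<in>{j. j + 2 <= n}. (bval n \<xi> j)\<^sup>2)"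
  unfolding V_def by (subst sum.reindex) (auto simp: inj_on_def bval_def)
 also have "(\<Sum>j\<in>{j. j + 2 <= n}. (bval n \<xi> j)\<^sup>2) <= (\<Sum>j<n. (bval n \<xi> j)\<^sup>2)" by (rule sum_mono2) auto
 also have "(\<Sum>j<n. (aval n \<xi> j)\<^sup>2) + (\<Sum>j<n. (bval n \<xi> j)\<^sup>2) <= (\<Sum>j<n. (2*\<Gamma> * sqrt n)\<^sup>2) + (\<Sum>j<n. (2 * sqrt n)\<^sup>2)"
  using ab a_le b_le by (intro add_mono sum_mono power_mono) auto
 also have "... = n*(4*(\<Gamma>\<^sup>2*n) + 4*real n)" by (simp add: power_mult_distrib algebra_simps)
 also have "... <= n*(8*\<Gamma>\<^sup>2*n)"
 proof (rule mult_left_mono)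
  have "1*real n <= \<Gamma>\<^sup>2*n" using \<Gamma>1 by (intro mult_right_mono one_le_power) auto
  thus "4*(\<Gamma>\<^sup>2*n) + 4*real n <= 8*\<Gamma>\<^sup>2*n" by linarith
 qed simp
 finally show ?thesis using n0 by simp
qed

section \<open>Extension off the good event and concentration\<close>

text \<open>The infimum runs over a countable dense part of \<open>G\<close>, which keeps the
  extension measurable; continuity of the distance then recovers the values on all of
  \<open>G\<close>. Coefficients may vanish, so the distance is only a pseudometric.\<close>

lemma McShane_extension:
 fixes f :: "('i :: countable => real) => real"
 assumes I: "finite I" and c: "!!i. i \<in> I ==> 0 <= c i" and ne: "G ~= {}" and f0: "!!x. x \<in> G ==> 0 <= f x"
  and lip: "!!x y. x \<in> G ==> y \<in> G ==> f x - f y <= (\<Sum>i\<in>I. c i*\<bar>x i - y i\<bar>)"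
 obtains g where "g \<in> borel_measurable (PiM I (\<lambda>_. borel))" "!!x. x \<in> G ==> g x = f x" "!!x. 0 <= g x"
  "!!x y. g x - g y <= (\<Sum>i\<in>I. c i*\<bar>x i - y i\<bar>)"
proof -
 obtain D where D: "countable D" "D \<subseteq> G" "G \<subseteq> closure D" using separable[of G] by blast
 have Dne: "D ~= {}" using D(3) ne by auto
 define d where "d x y = (\<Sum>i\<in>I. c i*\<bar>x i - y i\<bar>)" for x y
 have d0: "0 <= d x y" and dc: "d x y = d y x" for x y
  using c by (auto simp: d_def intro!: sum_nonneg sum.cong)
 have dt: "d x z <= d x y + d y z" for x y z
  unfolding d_def sum.distrib[symmetric] distrib_left[symmetric] using c by (intro sum_mono mult_left_mono) auto
 define g where "g x = (INF y\<in>D. f y + d y x)" for x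
 have nn: "0 <= f y + d y x" if "y \<in> D" for x y using that D(2) f0[of y] d0[of y x] by auto
 hence bdd: "bdd_below ((\<lambda>y. f y + d y x) ` D)" for x by (intro bdd_belowI2[of _ 0])
 show thesis
 proof (rule that[of g])
  show "g \<in> borel_measurable (PiM I (\<lambda>_. borel))"
   unfolding g_def
  proof (rule borel_measurable_cINF[OF D(1) _ bdd])
   fix y
   show "(\<lambda>x. f y + d y x) \<in> borel_measurable (PiM I (\<lambda>_. borel))" unfolding d_def
    by (intro borel_measurable_add borel_measurable_sum borel_measurable_times borel_measurable_abs borel_measurable_diff borel_measurable_const)
     (rule measurable_component_singleton)
  qed
  show "0 <= g x" for x unfolding g_def by (rule cINF_greatest[OF Dne nn])
  show "g x - g y <= (\<Sum>i\<in>I. c i*\<bar>x i - y i\<bar>)" for x y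
  proof -
   have "g x - d x y <= g y" unfolding g_def[of y]
   proof (rule cINF_greatest[OF Dne])
    fix z assume "z \<in> D"
    hence "g x <= f z + d z x" unfolding g_def by (rule cINF_lower[OF bdd])
    thus "g x - d x y <= f z + d z y" using dt[of z x y] dc[of x y] by linarith
   qed
   thus ?thesis by (simp add: d_def)
  qed
  fix x assume x: "x \<in> G"
  show "g x = f x"
  proof (rule antisym)
   have "g x <= f x + 2*d y x" if "y \<in> D" for y
   proof -
    have "g x <= f y + d y x" unfolding g_def by (rule cINF_lower[OF bdd that])
    moreover have "f y - f x <= d y x" unfolding d_def by (rule lip) (use that D x in auto)
    ultimately show ?thesis by simp
   qed
   moreover have "continuous_on (closure D) (\<lambda>y. f x + 2*d y x)" unfolding d_def
    by (intro continuous_intros continuous_on_product_then_coordinatewise continuous_on_id)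
   ultimately have "g x <= f x + 2*d x x"
    using continuous_ge_on_closure[of D "\<lambda>y. f x + 2*d y x" x "g x"] x D(3) by blast
   thus "g x <= f x" by (simp add: d_def)
   show "f x <= g x" unfolding g_def
   proof (rule cINF_greatest[OF Dne])
    fix y assume "y \<in> D"
    hence "f x - f y <= d x y" unfolding d_def by (intro lip x) (use D in auto)
    thus "f x <= f y + d y x" using dc[of x y] by simp
   qed
  qed
 qed
qed

lemma null_law_distr:
 assumes n: "1 <= n" and np: "n <= p"
 shows "null_law n p = distr (gauss (grid n p)) (data_space n p) (curry_grid n p)"
 using curry_grid_law[OF n, of p] n np by (simp add: null_law_gauss)

text \<open>A crude moment bound that controls the contribution of the bad event to the mean. The
  exponential moment of the total squared norm is taken at t = 1/(4np), where Bernoulli's inequality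
  keeps (1 - 2t)^(np) at least 1/2.\<close>

lemma null_second_moment:
 assumes n: "1 <= n" and np: "n <= p" and k: "k <= p"
 shows "(\<integral>\<^sup>+X. ennreal ((partial_sum n p k X)^2) \<partial>null_law n p) <= ennreal (64*(real p)^2)"
proof -
 define m where "m = real n*real p"
 have m: "1 <= m" unfolding m_def using n np by (metis le_trans mult_le_mono nat_mult_1 of_nat_1 of_nat_le_iff of_nat_mult)
 define t where "t = 1/(4*m)"
 have t: "t < 1/2" using m by (simp add: t_def)
 have cm: "real (card (grid n p)) = m" by (simp add: m_def card_cartesian_product)
 define S where "S X = (\<Sum>i=1..n. \<Sum>j<p. (X i j)\<^sup>2)" for X :: "nat => nat => real"
 have Sm: "S \<in> borel_measurable (data_space n p)" unfolding S_def
  by (intro borel_measurable_sum borel_measurable_power measurable_entry) auto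
 have pt: "(partial_sum n p k X)^2 <= 32*(real p)^2*exp (t*S X)" for X
 proof -
  have S0: "0 <= S X" by (simp add: S_def sum_nonneg)
  have "0 <= t*S X" using S0 m by (simp add: t_def)
  hence "(t*S X)^2/2 <= exp (t*S X)" using exp_lower_Taylor_quadratic[of "t*S X"] by simp
  moreover have "t*S X = S X/(4*m)" by (simp add: t_def)
  ultimately have 1: "(S X)^2 <= 32*m^2*exp (t*S X)" using m by (simp add: power_divide divide_le_eq power_mult_distrib mult_ac)
  have "(n*partial_sum n p k X)^2 <= (S X)^2"
   using partial_sum_le_trace[OF n k] partial_sum_nonneg[OF n k] unfolding S_def by (intro power_mono) auto
  also note 1
  finally have "(real n)^2*(partial_sum n p k X)^2 <= (real n)^2*(32*(real p)^2*exp (t*S X))"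
   by (simp add: m_def power_mult_distrib mult_ac)
  thus ?thesis using n by simp
 qed
 have "(\<integral>\<^sup>+X. ennreal ((partial_sum n p k X)^2) \<partial>null_law n p) <= (\<integral>\<^sup>+X. ennreal (32*(real p)^2)*ennreal (exp (t*S X)) \<partial>null_law n p)"
  using pt by (intro nn_integral_mono) (simp add: ennreal_mult[symmetric])
 also have "... = ennreal (32*(real p)^2)*(\<integral>\<^sup>+X. ennreal (exp (t*S X)) \<partial>null_law n p)"
  using Sm by (intro nn_integral_cmult) (simp add: sets_null_law cong: measurable_cong_sets)
 also have "(\<integral>\<^sup>+X. ennreal (exp (t*S X)) \<partial>null_law n p) = (\<integral>\<^sup>+\<xi>. ennreal (exp (t*S (curry_grid n p \<xi>))) \<partial>gauss (grid n p))"
  unfolding null_law_distr[OF n np] using Sm by (intro nn_integral_distr curry_grid_measurable) (simp_all add: sets_gauss)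
 also have "... = (\<integral>\<^sup>+\<xi>. ennreal (exp (t*(\<Sum>q\<in>grid n p. (\<xi> q)\<^sup>2) + (\<Sum>q\<in>grid n p. 0*\<xi> q))) \<partial>gauss (grid n p))"
 proof (intro nn_integral_cong)
  fix \<xi>
  have "S (curry_grid n p \<xi>) = (\<Sum>i=1..n. \<Sum>j<p. (\<xi> (i, j))\<^sup>2)"
   unfolding S_def by (intro sum.cong refl) (simp add: curry_grid_def)
  hence "S (curry_grid n p \<xi>) = (\<Sum>q\<in>grid n p. (\<xi> q)\<^sup>2)" by (simp add: sum.cartesian_product case_prod_beta)
  thus "ennreal (exp (t*S (curry_grid n p \<xi>))) = ennreal (exp (t*(\<Sum>q\<in>grid n p. (\<xi> q)\<^sup>2) + (\<Sum>q\<in>grid n p. 0*\<xi> q)))" by simp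
 qed
 also have "... = ennreal (1 / sqrt (1 - 2*t) ^ card (grid n p))"
  by (subst gauss_exp_quadratic[OF _ t]) auto
 also have "... <= ennreal 2"
 proof (rule ennreal_leI)
  define c where "c = card (grid n p)"
  have c: "real c = m" unfolding c_def by (rule cm)
  have "1 + real c*(- (1/(2*m))) <= (1 + (- (1/(2*m)))) ^ c"
   by (rule Bernoulli_inequality) (use m in simp)
  hence "1/2 <= (1 - 2*t) ^ c" unfolding c using m by (simp add: t_def)
  hence "sqrt (1/2) <= sqrt ((1 - 2*t) ^ c)" by (rule real_sqrt_le_mono)
  moreover have "1/2 <= sqrt (1/2)" by (rule real_le_rsqrt) (simp add: power2_eq_square)
  ultimately have "1/2 <= sqrt (1 - 2*t) ^ c" by (simp only: real_sqrt_power)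
  thus "1 / sqrt (1 - 2*t) ^ c <= 2" by (simp add: divide_le_eq)
 qed
 also have "ennreal (32*(real p)^2)*ennreal 2 = ennreal (64*(real p)^2)" by (subst ennreal_mult[symmetric]) auto
 finally show ?thesis by (simp add: mult_left_mono)
qed

lemma grid_partial_sum:
 assumes n: "1 <= n" and np: "n <= p" and k: "k <= p"
 defines "F \<equiv> \<lambda>\<xi>. partial_sum n p k (\<lambda>i j. \<xi> (i, j))"
 shows "F \<in> borel_measurable (PiM (grid n p) (bidiag n p))"
  and "(\<integral>X. partial_sum n p k X \<partial>null_law n p) = (\<integral>\<xi>. F \<xi> \<partial>PiM (grid n p) (bidiag n p))"
  and "integrable (PiM (grid n p) (bidiag n p)) (\<lambda>\<xi>. (F \<xi>)\<^sup>2)"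
  and "(\<integral>\<xi>. (F \<xi>)\<^sup>2 \<partial>PiM (grid n p) (bidiag n p)) <= 64*(real p)^2"
  and "integrable (PiM (grid n p) (bidiag n p)) F"
proof -
 let ?P = "PiM (grid n p) (bidiag n p)"
 interpret prob_space ?P by (rule prob_space_PiM_bidiag)
 note pm = borel_measurable_partial_sum[OF n k]
 have F: "F = (\<lambda>\<xi>. partial_sum n p k (curry_grid n p \<xi>))" unfolding F_def by (simp only: partial_sum_curry_grid)
 show Fm: "F \<in> borel_measurable ?P" unfolding F by (rule measurable_compose[OF curry_grid_measurable pm]) (rule sets_PiM_bidiag)
 have F0: "0 <= F \<xi>" for \<xi> unfolding F_def by (rule partial_sum_nonneg[OF n k])
 have tr: "(\<integral>\<^sup>+X. ennreal (h (partial_sum n p k X)) \<partial>null_law n p) = (\<integral>\<^sup>+\<xi>. ennreal (h (F \<xi>)) \<partial>?P)"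
  if "h \<in> borel_measurable borel" for h :: "real => real"
  unfolding F by (rule null_law_bidiag[OF n np]) (use that pm k in auto)
 have "(\<integral>X. partial_sum n p k X \<partial>null_law n p) = enn2real (\<integral>\<^sup>+X. ennreal (partial_sum n p k X) \<partial>null_law n p)"
  using pm partial_sum_nonneg[OF n k] by (intro integral_eq_nn_integral) (auto simp: sets_null_law cong: measurable_cong_sets)
 also have "... = enn2real (\<integral>\<^sup>+\<xi>. ennreal (F \<xi>) \<partial>?P)" using tr[of "\<lambda>x. x"] by simp
 also have "... = (\<integral>\<xi>. F \<xi> \<partial>?P)" using Fm F0 by (intro integral_eq_nn_integral[symmetric]) auto
 finally show "(\<integral>X. partial_sum n p k X \<partial>null_law n p) = (\<integral>\<xi>. F \<xi> \<partial>?P)" .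
 have b: "(\<integral>\<^sup>+\<xi>. ennreal ((F \<xi>)^2) \<partial>?P) <= ennreal (64*(real p)^2)"
  using null_second_moment[OF n np k] tr[of "\<lambda>x. x\<^sup>2"] by simp
 have F2m: "(\<lambda>\<xi>. (F \<xi>)\<^sup>2) \<in> borel_measurable ?P" using Fm by (rule borel_measurable_power)
 show i2: "integrable ?P (\<lambda>\<xi>. (F \<xi>)\<^sup>2)"
  by (rule integrableI_nonneg[OF F2m]) (use b le_less_trans[OF b] in auto)
 show "(\<integral>\<xi>. (F \<xi>)\<^sup>2 \<partial>?P) <= 64*(real p)^2"
  using b by (subst integral_eq_nn_integral[OF F2m]) (auto intro: enn2real_leI)
 show "integrable ?P F" by (rule square_integrable_imp_integrable[OF Fm i2])
qed

text \<open>On the good event the eigenvalue sum coincides with a capped Lipschitz extension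
  \<open>g\<close>, and \<open>g\<close> concentrates around its own mean. The statement is centred
  at the mean of \<open>F\<close> instead, and \<open>\<epsilon>\<close> bounds the distance between
  the two means.\<close>

lemma partial_sum_deviation:
 fixes \<Gamma> L R \<epsilon> x y :: real and l :: nat
 assumes np: "n <= p" and p\<Gamma>: "real p <= \<Gamma>*n" and \<Gamma>1: "1 <= \<Gamma>" and L1: "1 <= L"
  and large: "2 ^ 20*\<Gamma>\<^sup>2*L ^ 4 <= n" and l: "1 <= l" "16*l <= n"
  and k: "1 <= k" "k <= n" and x: "0 < x" "x ^ 3*n = k"
  and y: "y ^ 3 = n" "1 <= y" "y <= l" "l <= 2*y"
  and R: "0 < R" and \<epsilon>: "64*(real p)^2/R + (R + 8*\<Gamma>\<^sup>2*n)*(6*real n*exp (8 - L/(80*\<Gamma>))) <= \<epsilon>"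
  and ne: "good_event n p l L ~= {}"
 defines "F \<equiv> \<lambda>\<xi>. partial_sum n p k (\<lambda>i j. \<xi> (i, j))"
 defines "P \<equiv> PiM (grid n p) (bidiag n p)"
 obtains A where "A \<in> sets P" "measure P A <= 2*exp (8 - L/4)"
  "!!\<xi>. \<xi> \<in> good_event n p l L ==> \<xi> \<notin> A ==>
    \<bar>F \<xi> - (\<integral>\<xi>. F \<xi> \<partial>P)\<bar> <= L*(5000000*\<Gamma>\<^sup>2*L ^ 4 * sqrt (1 + ln n)*x^2) + \<epsilon>"
proof -
 interpret prob_space P unfolding P_def by (rule prob_space_PiM_bidiag)
 have n1: "1 <= n" "4 <= n" and n0: "0 < real n" using l by auto
 have kp: "k <= p" using k np by simp
 define G where "G = good_event n p l L"
 have Gs: "G \<in> sets P" unfolding G_def P_def by (rule good_event_sets[OF np])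
 have Gsp: "\<xi> \<in> G ==> \<xi> \<in> space P" for \<xi> using sets.sets_into_space[OF Gs] by auto
 have bad: "measure P (space P - G) <= 6*real n*exp (8 - L/(80*\<Gamma>))"
  unfolding G_def P_def by (rule good_event_prob[OF np p\<Gamma> \<Gamma>1 _ l(1) n1(2)]) (use L1 in simp)
 define h where "h = 3000000*\<Gamma>\<^sup>2*L ^ 4*x^2*n"
 define c where "c = lip_coeff n h"
 have c0: "0 <= c q" for q unfolding c_def lip_coeff_def h_def by auto
 have lipF: "F \<xi> - F \<xi>' <= (\<Sum>q\<in>grid n p. c q*\<bar>\<xi> q - \<xi>' q\<bar>)" if "\<xi> \<in> G" "\<xi>' \<in> G" for \<xi> \<xi>'
 proof -
  have off: "!!q. q \<in> grid n p ==> \<not> band q ==> \<xi>' q = 0" using that(2) by (auto simp: G_def good_event_def)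
  show ?thesis unfolding F_def c_def h_def
   by (rule partial_sum_lipschitz[OF np p\<Gamma> \<Gamma>1 L1 large l that(1)[unfolded G_def] _ k x y]) (rule off)
 qed
 have F0: "0 <= F \<xi>" for \<xi> unfolding F_def by (rule partial_sum_nonneg[OF n1(1) kp])
 have fing: "finite (grid n p)" by simp
 obtain g0 where g0: "g0 \<in> borel_measurable (PiM (grid n p) (\<lambda>_. borel))" "!!\<xi>. \<xi> \<in> G ==> g0 \<xi> = F \<xi>" "!!\<xi>. 0 <= g0 \<xi>"
  "!!\<xi> \<xi>'. g0 \<xi> - g0 \<xi>' <= (\<Sum>q\<in>grid n p. c q*\<bar>\<xi> q - \<xi>' q\<bar>)"
  by (rule McShane_extension[OF fing c0 ne[folded G_def] F0]) (erule (1) lipF, rule that)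
 define M where "M = 8*\<Gamma>\<^sup>2*n"
 have M0: "0 <= M" by (simp add: M_def)
 define g where "g \<xi> = min (g0 \<xi>) M" for \<xi>
 have gF: "g \<xi> = F \<xi>" if "\<xi> \<in> G" for \<xi>
  using g0(2)[OF that] partial_sum_good_le[OF np p\<Gamma> \<Gamma>1 L1 large l that[unfolded G_def] kp] by (simp add: g_def F_def M_def)
 have g0': "0 <= g \<xi>" "g \<xi> <= M" for \<xi> using g0(3) M0 by (auto simp: g_def)
 have sP: "sets P = sets (PiM (grid n p) (\<lambda>_. borel))" unfolding P_def by (rule sets_PiM_bidiag)
 have gm: "g \<in> borel_measurable P" unfolding g_def using g0(1)
  by (intro borel_measurable_min borel_measurable_const) (simp add: sP cong: measurable_cong_sets)
 have glip: "g \<xi> - g \<xi>' <= (\<Sum>q\<in>grid n p. c q*\<bar>\<xi> q - \<xi>' q\<bar>)" for \<xi> \<xi>'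
 proof -
  have "0 <= (\<Sum>q\<in>grid n p. c q*\<bar>\<xi> q - \<xi>' q\<bar>)" using c0 by (intro sum_nonneg) auto
  thus ?thesis using g0(4)[of \<xi> \<xi>'] unfolding g_def min_def by (auto split: if_splits)
 qed
 define \<sigma> where "\<sigma> = 5000000*\<Gamma>\<^sup>2*L ^ 4 * sqrt (1 + ln n)*x^2"
 have ln0: "0 <= ln (real n)" using n1 by simp
 have \<sigma>0: "0 < \<sigma>" unfolding \<sigma>_def using \<Gamma>1 L1 x ln0 by (intro mult_pos_pos) auto
 have c2: "(\<Sum>q\<in>grid n p. (c q)\<^sup>2) <= \<sigma>\<^sup>2"
 proof -
  define a where "a = (\<Gamma>\<^sup>2*L ^ 4*x^2)^2*(1 + ln n)"
  have a0: "0 <= a" using ln0 by (simp add: a_def)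
  have "(\<Sum>q\<in>grid n p. (c q)\<^sup>2) <= 2*(h/n)^2*(1 + ln n)" unfolding c_def by (rule lip_coeff_square_sum[OF n1(1) np])
  \<comment> \<open>Twice the square of 3000000, rounded up below to the square of 5000000.\<close>
  also have "... = 18000000000000*a" using n0 by (simp add: h_def a_def power_mult_distrib)
  also have "... <= 25000000000000*a" using a0 by simp
  also have "... = \<sigma>\<^sup>2" using ln0 by (simp add: \<sigma>_def a_def power_mult_distrib)
  finally show ?thesis .
 qed
 have gi: "integrable P g"
  and conc: "measure P {\<xi> \<in> space P. L*\<sigma> <= \<bar>g \<xi> - (\<integral>\<xi>. g \<xi> \<partial>P)\<bar>} <= 2*exp (8 - L/4)"
  unfolding P_def
  by (rule PiM_bidiag_concentration[OF np gm[unfolded P_def] \<sigma>0 c0 c2 glip])+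
 have Fm: "F \<in> borel_measurable P" and F2i: "integrable P (\<lambda>\<xi>. (F \<xi>)\<^sup>2)"
  and F2: "(\<integral>\<xi>. (F \<xi>)\<^sup>2 \<partial>P) <= 64*(real p)^2" and Fi: "integrable P F"
  unfolding P_def F_def using grid_partial_sum[OF n1(1) np kp] by blast+
 have bi: "integrable P (indicator (space P - G) :: _ => real)"
  using Gs by (intro integrable_real_indicator) (auto simp: emeasure_eq_measure)
 \<comment> \<open>Off the good event F is at most F^2/R + R and g is at most M. The first term is
   paid for by the second moment, the others by the small probability of the event.\<close>
 have diff: "\<bar>(\<integral>\<xi>. F \<xi> \<partial>P) - (\<integral>\<xi>. g \<xi> \<partial>P)\<bar> <= \<epsilon>"
 proof -
  have "\<bar>(\<integral>\<xi>. F \<xi> \<partial>P) - (\<integral>\<xi>. g \<xi> \<partial>P)\<bar> = \<bar>\<integral>\<xi>. F \<xi> - g \<xi> \<partial>P\<bar>" using Fi gi by simp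
  also have "... <= (\<integral>\<xi>. \<bar>F \<xi> - g \<xi>\<bar> \<partial>P)" by (rule integral_abs_bound)
  also have "... <= (\<integral>\<xi>. (F \<xi>)\<^sup>2/R + (R + M)*indicator (space P - G) \<xi> \<partial>P)"
  proof (rule integral_mono)
   fix \<xi> assume w: "\<xi> \<in> space P"
   show "\<bar>F \<xi> - g \<xi>\<bar> <= (F \<xi>)^2/R + (R + M)*indicator (space P - G) \<xi>"
   proof (cases "\<xi> \<in> G")
    case True
    thus ?thesis using gF R by simp
   next
    case False
    have "F \<xi> <= (F \<xi>)^2/R + R"
    proof (cases "F \<xi> <= R")
     case True
     thus ?thesis using R by (simp add: add_increasing)
    next
     case False
     hence "F \<xi>*R <= F \<xi>*F \<xi>" using F0 by (intro mult_left_mono) auto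
     hence "F \<xi> <= (F \<xi>)^2/R" using R by (simp add: le_divide_eq power2_eq_square)
     thus ?thesis using R by simp
    qed
    thus ?thesis using False w g0'[of \<xi>] F0[of \<xi>] by simp
   qed
  qed (use Fi gi F2i bi in auto)
  also have "... = (\<integral>\<xi>. (F \<xi>)\<^sup>2 \<partial>P)/R + (R + M)*measure P (space P - G)"
   using F2i bi Gs by simp
  also have "... <= 64*(real p)^2/R + (R + M)*(6*real n*exp (8 - L/(80*\<Gamma>)))"
   using F2 R bad M0 by (intro add_mono divide_right_mono mult_left_mono) auto
  also have "... <= \<epsilon>" using \<epsilon> by (simp add: M_def)
  finally show ?thesis .
 qed
 show thesis
 proof (rule that[of "{\<xi> \<in> space P. L*\<sigma> <= \<bar>g \<xi> - (\<integral>\<xi>. g \<xi> \<partial>P)\<bar>}"])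
  show "{\<xi> \<in> space P. L*\<sigma> <= \<bar>g \<xi> - (\<integral>\<xi>. g \<xi> \<partial>P)\<bar>} \<in> sets P" using gm by measurable
  show "measure P {\<xi> \<in> space P. L*\<sigma> <= \<bar>g \<xi> - (\<integral>\<xi>. g \<xi> \<partial>P)\<bar>} <= 2*exp (8 - L/4)" by (rule conc)
  fix \<xi> assume "\<xi> \<in> good_event n p l L" "\<xi> \<notin> {\<xi> \<in> space P. L*\<sigma> <= \<bar>g \<xi> - (\<integral>\<xi>. g \<xi> \<partial>P)\<bar>}"
  thus "\<bar>F \<xi> - (\<integral>\<xi>. F \<xi> \<partial>P)\<bar> <= L*(5000000*\<Gamma>\<^sup>2*L ^ 4 * sqrt (1 + ln n)*x^2) + \<epsilon>"
   using gF[of \<xi>] Gsp[of \<xi>] diff unfolding G_def[symmetric] \<sigma>_def[symmetric] by auto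
 qed
qed

theorem null_deviation:
 fixes \<Gamma> L R \<epsilon> y :: real and l :: nat and x :: "nat => real"
 assumes np: "n <= p" and p\<Gamma>: "real p <= \<Gamma>*n" and \<Gamma>1: "1 <= \<Gamma>" and L1: "1 <= L"
  and large: "2 ^ 20*\<Gamma>\<^sup>2*L ^ 4 <= n" and l: "1 <= l" "16*l <= n"
  and x: "!!k. 1 <= k ==> k <= n ==> 0 < x k \<and> x k ^ 3*n = k"
  and y: "y ^ 3 = n" "1 <= y" "y <= l" "l <= 2*y"
  and R: "0 < R" and \<epsilon>: "64*(real p)^2/R + (R + 8*\<Gamma>\<^sup>2*n)*(6*real n*exp (8 - L/(80*\<Gamma>))) <= \<epsilon>"
 shows "measure (null_law n p) {X \<in> space (data_space n p). \<exists>k\<in>{1..n}.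
   L*(5000000*\<Gamma>\<^sup>2*L ^ 4 * sqrt (1 + ln n)*(x k)^2) + \<epsilon> < \<bar>centred_sum n p k X\<bar>}
  <= 6*real n*exp (8 - L/(80*\<Gamma>)) + 2*real n*exp (8 - L/4)"
proof -
 define P where "P = PiM (grid n p) (bidiag n p)"
 interpret prob_space P unfolding P_def by (rule prob_space_PiM_bidiag)
 interpret N: prob_space "null_law n p" by (rule prob_space_null_law)
 have n1: "1 <= n" "4 <= n" using l by auto
 define G where "G = good_event n p l L"
 have Gs: "G \<in> sets P" unfolding G_def P_def by (rule good_event_sets[OF np])
 have bad: "measure P (space P - G) <= 6*real n*exp (8 - L/(80*\<Gamma>))"
  unfolding G_def P_def by (rule good_event_prob[OF np p\<Gamma> \<Gamma>1 _ l(1) n1(2)]) (use L1 in simp)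
 define \<tau> where "\<tau> k = L*(5000000*\<Gamma>\<^sup>2*L ^ 4 * sqrt (1 + ln n)*(x k)^2) + \<epsilon>" for k
 define B where "B = {X \<in> space (data_space n p). \<exists>k\<in>{1..n}. \<tau> k < \<bar>centred_sum n p k X\<bar>}"
 have pm: "partial_sum n p k \<in> borel_measurable (data_space n p)" if "k \<in> {1..n}" for k
  by (rule borel_measurable_partial_sum[OF n1(1)]) (use that np in auto)
 have Bs: "B \<in> sets (data_space n p)" unfolding B_def
 proof (rule sets.sets_Collect_finite_Ex)
  fix k assume "k \<in> {1..n}"
  note [measurable] = pm[OF this]
  show "{X \<in> space (data_space n p). \<tau> k < \<bar>centred_sum n p k X\<bar>} \<in> sets (data_space n p)"
   unfolding centred_sum_def by measurable
 qed auto
 define B' where "B' = {\<xi> \<in> space P. \<exists>k\<in>{1..n}. \<tau> k < \<bar>centred_sum n p k (curry_grid n p \<xi>)\<bar>}"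
 have cgm: "curry_grid n p \<in> measurable P (data_space n p)"
  unfolding P_def by (rule curry_grid_measurable) (rule sets_PiM_bidiag)
 have B': "B' = curry_grid n p -` B \<inter> space P" using measurable_space[OF cgm] by (auto simp: B_def B'_def)
 have B's: "B' \<in> sets P" unfolding B' by (rule measurable_sets[OF cgm Bs])
 \<comment> \<open>Defined by the condition alone, without membership in the data space, because the
   transfer to the bidiagonal array requires a functional that depends only on the eigenvalue
   sums.\<close>
 define \<Psi> :: "(nat => nat => real) => ennreal" where "\<Psi> X = (if \<exists>k\<in>{1..n}. \<tau> k < \<bar>centred_sum n p k X\<bar> then 1 else 0)" for X
 have PsiB: "\<Psi> X = indicator B X" if "X \<in> space (data_space n p)" for X using that by (auto simp: \<Psi>_def B_def)
 have "emeasure (null_law n p) B = (\<integral>\<^sup>+X. \<Psi> X \<partial>null_law n p)"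
 proof -
  have "emeasure (null_law n p) B = (\<integral>\<^sup>+X. indicator B X \<partial>null_law n p)"
   using Bs by (intro nn_integral_indicator[symmetric]) (simp add: sets_null_law)
  also have "... = (\<integral>\<^sup>+X. \<Psi> X \<partial>null_law n p)" by (rule nn_integral_cong) (simp add: PsiB space_null_law)
  finally show ?thesis .
 qed
 also have "... = (\<integral>\<^sup>+\<xi>. \<Psi> (curry_grid n p \<xi>) \<partial>P)"
  unfolding P_def
 proof (rule null_law_bidiag[OF n1(1) np])
  have "(\<lambda>X. indicator B X :: ennreal) \<in> borel_measurable (data_space n p)" using Bs by simp
  thus "\<Psi> \<in> borel_measurable (data_space n p)" using PsiB by (simp cong: measurable_cong)
  fix X Y assume "!!k. k <= p ==> partial_sum n p k X = partial_sum n p k Y"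
  hence "centred_sum n p k X = centred_sum n p k Y" if "k \<in> {1..n}" for k using that np by (simp add: centred_sum_def)
  thus "\<Psi> X = \<Psi> Y" by (simp add: \<Psi>_def)
 qed
 also have "... = (\<integral>\<^sup>+\<xi>. indicator B' \<xi> \<partial>P)" by (intro nn_integral_cong) (auto simp: \<Psi>_def B'_def)
 also have "... = emeasure P B'" using B's by simp
 finally have BB': "measure (null_law n p) B = measure P B'" by (simp add: measure_def)
 have "measure P B' <= 6*real n*exp (8 - L/(80*\<Gamma>)) + 2*real n*exp (8 - L/4)"
 \<comment> \<open>The extension starts from a nonempty good event. If it is empty, the bound on its
   complement already covers the whole space.\<close>
 proof (cases "G = {}")
  case True
  have "measure P B' <= measure P (space P - G)" using True sets.sets_into_space[OF B's] by (intro finite_measure_mono) auto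
  also note bad
  also have "6*real n*exp (8 - L/(80*\<Gamma>)) <= 6*real n*exp (8 - L/(80*\<Gamma>)) + 2*real n*exp (8 - L/4)" by simp
  finally show ?thesis .
 next
  case False
  have "\<exists>A. A \<in> sets P \<and> measure P A <= 2*exp (8 - L/4) \<and>
   (\<forall>\<xi>\<in>G. \<xi> \<notin> A --> \<bar>centred_sum n p k (curry_grid n p \<xi>)\<bar> <= \<tau> k)" if k: "k \<in> {1..n}" for k
  proof -
   have k': "1 <= k" "k <= n" and kp: "k <= p" using k np by auto
   have xk: "0 < x k" "x k ^ 3*n = k" using x[OF k'] by auto
   let ?P = "PiM (grid n p) (bidiag n p)"
   obtain A where "A \<in> sets ?P" "measure ?P A <= 2*exp (8 - L/4)"
    "!!\<xi>. \<xi> \<in> good_event n p l L ==> \<xi> \<notin> A ==> \<bar>partial_sum n p k (\<lambda>i j. \<xi> (i, j)) - (\<integral>\<xi>. partial_sum n p k (\<lambda>i j. \<xi> (i, j)) \<partial>?P)\<bar>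
     <= L*(5000000*\<Gamma>\<^sup>2*L ^ 4 * sqrt (1 + ln n)*(x k)^2) + \<epsilon>"
    by (rule partial_sum_deviation[OF np p\<Gamma> \<Gamma>1 L1 large l k' xk y R \<epsilon> False[unfolded G_def]]) (rule that)
   note A = this[folded P_def G_def \<tau>_def]
   have "centred_sum n p k (curry_grid n p \<xi>) = partial_sum n p k (\<lambda>i j. \<xi> (i, j)) - (\<integral>\<xi>. partial_sum n p k (\<lambda>i j. \<xi> (i, j)) \<partial>P)" for \<xi>
    unfolding centred_sum_def partial_sum_curry_grid grid_partial_sum(2)[OF n1(1) np kp] P_def ..
   with A show ?thesis by (intro exI[of _ A]) simp
  qed
  then obtain A where A: "!!k. k \<in> {1..n} ==> A k \<in> sets P" "!!k. k \<in> {1..n} ==> measure P (A k) <= 2*exp (8 - L/4)"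
   "!!k \<xi>. k \<in> {1..n} ==> \<xi> \<in> G ==> \<xi> \<notin> A k ==> \<bar>centred_sum n p k (curry_grid n p \<xi>)\<bar> <= \<tau> k" by metis
  have UA: "(\<Union>k\<in>{1..n}. A k) \<in> sets P" using A(1) by (intro sets.finite_UN) auto
  have "B' \<subseteq> (space P - G) \<union> (\<Union>k\<in>{1..n}. A k)" using A(3) by (force simp: B'_def)
  hence "measure P B' <= measure P ((space P - G) \<union> (\<Union>k\<in>{1..n}. A k))" using Gs UA by (intro finite_measure_mono) auto
  also have "... <= measure P (space P - G) + measure P (\<Union>k\<in>{1..n}. A k)" using Gs UA by (intro measure_Un_le) auto
  also have "measure P (\<Union>k\<in>{1..n}. A k) <= (\<Sum>k\<in>{1..n}. measure P (A k))" using A(1) by (intro measure_UNION_le) auto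
  also have "... <= (\<Sum>k\<in>{1..n}. 2*exp (8 - L/4))" by (rule sum_mono[OF A(2)])
  also have "... = 2*real n*exp (8 - L/4)" by simp
  finally show ?thesis using bad by simp
 qed
 thus ?thesis using BB' by (simp add: B_def \<tau>_def)
qed

subsection \<open>The spiked alternative\<close>

definition stiefel_col :: "real mat => nat => nat => real" where
 "stiefel_col Q a j = Q $$ (j, a)"

lemma stiefelD:
 assumes "Q \<in> stiefel p r"
 shows "Q \<in> carrier_mat p r" "transpose_mat Q*Q = 1\<^sub>m r"
 using assms by (auto simp: stiefel_def)

lemma gram_entry:
 "Q \<in> carrier_mat p r ==> a < r ==> b < r ==> (transpose_mat Q*Q) $$ (a, b) = ip p (stiefel_col Q a) (stiefel_col Q b)"
 by (simp add: scalar_prod_def ip_def stiefel_col_def atLeast0LessThan)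

lemma stiefel_orthonormal: "Q \<in> stiefel p r ==> orthonormal p r (stiefel_col Q)"
 unfolding orthonormal_def by (metis gram_entry stiefelD index_one_mat(1))

context
 fixes p r :: nat and Q :: "real mat" and \<delta> :: real
 assumes Q: "Q \<in> stiefel p r" and \<delta>: "0 < \<delta>" "\<delta> < 1"
begin

lemma proj_idem: "(Q*transpose_mat Q)*(Q*transpose_mat Q) = Q*transpose_mat Q"
proof -
 note c = stiefelD(1)[OF Q]
 have "(Q*transpose_mat Q)*(Q*transpose_mat Q) = Q*(transpose_mat Q*(Q*transpose_mat Q))"
  using c by (intro assoc_mult_mat[of _ p r _ p _ p]) auto
 also have "transpose_mat Q*(Q*transpose_mat Q) = (transpose_mat Q*Q)*transpose_mat Q"
  using c by (intro assoc_mult_mat[symmetric, of _ r p _ r _ p]) auto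
 finally show ?thesis using c stiefelD(2)[OF Q] by simp
qed

text \<open>Q Q' is a projection, and for \<epsilon> = \<delta>/(1 - \<delta>) the coefficient
  \<epsilon> - \<delta> - \<epsilon>\<delta> vanishes. This parametrisation of the spike makes
  \<delta> itself the coefficient in the likelihood ratio.\<close>

lemma mat_inverse_spiked_cov:
 "mat_inverse (spiked_cov p \<delta> Q) = Some (1\<^sub>m p + (- \<delta>) \<cdot>\<^sub>m (Q*transpose_mat Q))"
proof (rule mat_inverse_eqI)
 define P where "P = Q*transpose_mat Q"
 have P: "P \<in> carrier_mat p p" using stiefelD(1)[OF Q] by (simp add: P_def)
 have PP: "P*P = P" using proj_idem by (simp add: P_def)
 define \<epsilon> where "\<epsilon> = \<delta>/(1 - \<delta>)"
 have e0: "\<epsilon> - \<delta> - \<epsilon>*\<delta> = 0" using \<delta> by (simp add: \<epsilon>_def field_simps)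
 show "spiked_cov p \<delta> Q \<in> carrier_mat p p" "1\<^sub>m p + (- \<delta>) \<cdot>\<^sub>m (Q*transpose_mat Q) \<in> carrier_mat p p"
  using stiefelD(1)[OF Q] by (auto simp: spiked_cov_def)
 have "(\<epsilon> \<cdot>\<^sub>m P)*((- \<delta>) \<cdot>\<^sub>m P) = (- \<epsilon>*\<delta>) \<cdot>\<^sub>m P"
  using P PP by (simp only: mult_smult_assoc_mat[of _ p p _ p] mult_smult_distrib[of _ p p _ p] smult_carrier_mat) (intro eq_matI, auto)
 hence "(1\<^sub>m p + \<epsilon> \<cdot>\<^sub>m P)*(1\<^sub>m p + (- \<delta>) \<cdot>\<^sub>m P) = (1\<^sub>m p + (- \<delta>) \<cdot>\<^sub>m P) + (\<epsilon> \<cdot>\<^sub>m P + (- \<epsilon>*\<delta>) \<cdot>\<^sub>m P)"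
  using P by (subst add_mult_distrib_mat[of _ p p _ _ p], simp, simp, simp, subst (2) mult_add_distrib_mat[of _ p p _ p], simp, simp, simp)
   (simp add: right_mult_one_mat[of _ p p])
 also have "... = 1\<^sub>m p"
 proof (rule eq_matI)
  fix i j assume "i < dim_row (1\<^sub>m p :: real mat)" "j < dim_col (1\<^sub>m p :: real mat)"
  moreover have "P $$ (i, j)*(\<epsilon> - \<delta> - \<epsilon>*\<delta>) = 0" unfolding e0 by simp
  ultimately show "((1\<^sub>m p + (- \<delta>) \<cdot>\<^sub>m P) + (\<epsilon> \<cdot>\<^sub>m P + (- \<epsilon>*\<delta>) \<cdot>\<^sub>m P)) $$ (i, j) = 1\<^sub>m p $$ (i, j)"
   using P by (simp add: algebra_simps)
 qed (use P in auto)
 finally show "spiked_cov p \<delta> Q*(1\<^sub>m p + (- \<delta>) \<cdot>\<^sub>m (Q*transpose_mat Q)) = 1\<^sub>m p"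
  unfolding spiked_cov_def P_def[symmetric] \<epsilon>_def[symmetric] .
qed

text \<open>Sylvester's identity: both sides are the determinant of one block matrix.\<close>

lemma det_spiked_cov: "Determinant.det (spiked_cov p \<delta> Q) = (1/(1 - \<delta>)) ^ r"
proof -
 define \<epsilon> where "\<epsilon> = \<delta>/(1 - \<delta>)"
 have c: "Q \<in> carrier_mat p r" "transpose_mat Q \<in> carrier_mat r p" using stiefelD(1)[OF Q] by auto
 define M where "M = four_block_mat (1\<^sub>m r) (- transpose_mat Q) (\<epsilon> \<cdot>\<^sub>m Q) (1\<^sub>m p)"
 define E where "E = four_block_mat (1\<^sub>m r) (transpose_mat Q) (0\<^sub>m p r) (1\<^sub>m p :: real mat)"
 have ME: "M \<in> carrier_mat (r + p) (r + p)" "E \<in> carrier_mat (r + p) (r + p)"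
  unfolding M_def E_def using c by (auto intro!: four_block_carrier_mat)
 have detE: "Determinant.det E = 1"
  unfolding E_def using c by (subst det_four_block_mat_lower_left_zero[of _ r _ p]) auto
 have "M*E = four_block_mat (1\<^sub>m r*1\<^sub>m r + (- transpose_mat Q)*0\<^sub>m p r) (1\<^sub>m r*transpose_mat Q + (- transpose_mat Q)*1\<^sub>m p)
   (\<epsilon> \<cdot>\<^sub>m Q*1\<^sub>m r + 1\<^sub>m p*0\<^sub>m p r) (\<epsilon> \<cdot>\<^sub>m Q*transpose_mat Q + 1\<^sub>m p*1\<^sub>m p)"
  unfolding M_def E_def using c by (intro mult_four_block_mat[of _ r r _ p _ p]) auto
 also have "... = four_block_mat (1\<^sub>m r) (0\<^sub>m r p) (\<epsilon> \<cdot>\<^sub>m Q) (spiked_cov p \<delta> Q)"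
 proof -
  have "1\<^sub>m r*transpose_mat Q + (- transpose_mat Q)*1\<^sub>m p = 0\<^sub>m r p" using c by (intro eq_matI) auto
  moreover have "\<epsilon> \<cdot>\<^sub>m Q*transpose_mat Q + 1\<^sub>m p*1\<^sub>m p = spiked_cov p \<delta> Q"
   using c by (simp add: spiked_cov_def \<epsilon>_def mult_smult_assoc_mat[of _ p r _ p] comm_add_mat[of _ p p])
  ultimately show ?thesis using c by simp
 qed
 finally have "Determinant.det (M*E) = Determinant.det (1\<^sub>m r :: real mat)*Determinant.det (spiked_cov p \<delta> Q)"
  using c by (simp only:) (intro det_four_block_mat_upper_right_zero, auto simp: spiked_cov_def)
 hence 1: "Determinant.det M = Determinant.det (spiked_cov p \<delta> Q)" using det_mult[OF ME] detE by simp
 have "E*M = four_block_mat (1\<^sub>m r*1\<^sub>m r + transpose_mat Q*(\<epsilon> \<cdot>\<^sub>m Q)) (1\<^sub>m r*(- transpose_mat Q) + transpose_mat Q*1\<^sub>m p)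
   (0\<^sub>m p r*1\<^sub>m r + 1\<^sub>m p*(\<epsilon> \<cdot>\<^sub>m Q)) (0\<^sub>m p r*(- transpose_mat Q) + 1\<^sub>m p*1\<^sub>m p)"
  unfolding M_def E_def using c by (intro mult_four_block_mat[of _ r r _ p _ p]) auto
 also have "... = four_block_mat ((1 + \<epsilon>) \<cdot>\<^sub>m 1\<^sub>m r) (0\<^sub>m r p) (\<epsilon> \<cdot>\<^sub>m Q) (1\<^sub>m p)"
 proof -
  have "1\<^sub>m r*(- transpose_mat Q) + transpose_mat Q*1\<^sub>m p = 0\<^sub>m r p" using c by (intro eq_matI) auto
  moreover have "1\<^sub>m r*1\<^sub>m r + transpose_mat Q*(\<epsilon> \<cdot>\<^sub>m Q) = (1 + \<epsilon>) \<cdot>\<^sub>m 1\<^sub>m r"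
   using c stiefelD(2)[OF Q] by (simp add: mult_smult_distrib[of _ r p _ r]) (intro eq_matI, auto)
  moreover have "0\<^sub>m p r*(- transpose_mat Q) + 1\<^sub>m p*1\<^sub>m p = (1\<^sub>m p :: real mat)" using c by (intro eq_matI) auto
  moreover have "0\<^sub>m p r*1\<^sub>m r + 1\<^sub>m p*(\<epsilon> \<cdot>\<^sub>m Q) = \<epsilon> \<cdot>\<^sub>m Q" using c by (intro eq_matI) auto
  ultimately show ?thesis by (simp only:)
 qed
 finally have "Determinant.det (E*M) = Determinant.det ((1 + \<epsilon>) \<cdot>\<^sub>m 1\<^sub>m r)*Determinant.det (1\<^sub>m p :: real mat)"
  using c by (simp only:) (intro det_four_block_mat_upper_right_zero, auto)
 hence "Determinant.det M = (1 + \<epsilon>) ^ r" using det_mult[OF ME(2,1)] detE by (simp add: det_smult)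
 moreover have "1 + \<epsilon> = 1/(1 - \<delta>)" using \<delta> by (simp add: \<epsilon>_def field_simps)
 ultimately show ?thesis using 1 by simp
qed

lemma quadratic_form_inverse:
 "scalar_prod (vec p x) ((1\<^sub>m p + (- \<delta>) \<cdot>\<^sub>m (Q*transpose_mat Q)) *\<^sub>v vec p x)
  = (\<Sum>j<p. (x j)\<^sup>2) - \<delta>*(\<Sum>a<r. (ip p (stiefel_col Q a) x)\<^sup>2)"
proof -
 have c: "Q \<in> carrier_mat p r" "transpose_mat Q \<in> carrier_mat r p" using stiefelD(1)[OF Q] by auto
 define v where "v = vec p x"
 have v: "v \<in> carrier_vec p" by (simp add: v_def)
 define z where "z = transpose_mat Q *\<^sub>v v"
 have z: "z \<in> carrier_vec r" using c v by (simp add: z_def)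
 have zi: "z $ a = ip p (stiefel_col Q a) x" if "a < r" for a
  using c that by (simp add: z_def v_def scalar_prod_def ip_def stiefel_col_def atLeast0LessThan)
 have mvz: "(Q*transpose_mat Q) *\<^sub>v v = Q *\<^sub>v z" unfolding z_def using c v by (intro assoc_mult_mat_vec) auto
 have mv: "(1\<^sub>m p + (- \<delta>) \<cdot>\<^sub>m (Q*transpose_mat Q)) *\<^sub>v v = v + (- \<delta>) \<cdot>\<^sub>v (Q *\<^sub>v z)"
 proof -
  have PQ: "Q*transpose_mat Q \<in> carrier_mat p p" using c by simp
  have "((- \<delta>) \<cdot>\<^sub>m (Q*transpose_mat Q)) *\<^sub>v v = (- \<delta>) \<cdot>\<^sub>v ((Q*transpose_mat Q) *\<^sub>v v)"
   using PQ v by (intro eq_vecI) (auto simp: scalar_prod_def sum_distrib_left mult.assoc simp del: index_mult_mat(1))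
  with mvz PQ v show ?thesis by (subst add_mult_distrib_mat_vec[of _ p p]) auto
 qed
 have Qz: "Q *\<^sub>v z \<in> carrier_vec p" using c z by simp
 have "scalar_prod v (v + (- \<delta>) \<cdot>\<^sub>v (Q *\<^sub>v z)) = scalar_prod v v + - \<delta> * scalar_prod v (Q *\<^sub>v z)"
  using v Qz by (simp add: scalar_prod_add_distrib[of _ p])
 also have "scalar_prod v (Q *\<^sub>v z) = scalar_prod z z"
  using transpose_vec_mult_scalar[OF c(1) z v] by (simp add: z_def)
 also have "scalar_prod z z = (\<Sum>a<r. (ip p (stiefel_col Q a) x)\<^sup>2)"
  using z zi by (simp add: scalar_prod_def atLeast0LessThan power2_eq_square)
 also have "scalar_prod v v = (\<Sum>j<p. (x j)\<^sup>2)"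
  by (simp add: v_def scalar_prod_def atLeast0LessThan power2_eq_square)
 finally show ?thesis unfolding mv v_def[symmetric] by simp
qed

lemma mvnormal_spiked:
 "mvnormal p (spiked_cov p \<delta> Q) = density (gauss {..<p})
   (\<lambda>x. ennreal (sqrt (1 - \<delta>) ^ r*exp (\<delta>/2*(\<Sum>a<r. (ip p (stiefel_col Q a) x)\<^sup>2))))"
proof -
 define g where "g x = (1 / sqrt (2*pi)) ^ p*exp (- (\<Sum>j<p. (x j)\<^sup>2)/2)" for x :: "nat => real"
 define f where "f x = sqrt (1 - \<delta>) ^ r*exp (\<delta>/2*(\<Sum>a<r. (ip p (stiefel_col Q a) x)\<^sup>2))" for x
 have d: "mvnormal_density p (spiked_cov p \<delta> Q) x = g x*f x" for x
 proof -
  define S where "S = (\<Sum>j<p. (x j)\<^sup>2)"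
  define q where "q = (\<Sum>a<r. (ip p (stiefel_col Q a) x)\<^sup>2)"
  have "mvnormal_density p (spiked_cov p \<delta> Q) x = exp (- (S - \<delta>*q)/2) / sqrt ((2*pi) ^ p*(1/(1 - \<delta>)) ^ r)"
   unfolding mvnormal_density_def mat_inverse_spiked_cov option.sel quadratic_form_inverse det_spiked_cov S_def q_def ..
  also have "exp (- (S - \<delta>*q)/2) = exp (- S/2)*exp (\<delta>/2*q)" unfolding exp_add[symmetric] by (simp add: field_simps)
  also have "sqrt ((2*pi) ^ p*(1/(1 - \<delta>)) ^ r) = sqrt (2*pi) ^ p*(1 / sqrt (1 - \<delta>)) ^ r"
   by (simp only: real_sqrt_mult real_sqrt_power real_sqrt_divide real_sqrt_one)
  finally have "mvnormal_density p (spiked_cov p \<delta> Q) x = exp (- S/2)*exp (\<delta>/2*q)/(sqrt (2*pi) ^ p*(1 / sqrt (1 - \<delta>)) ^ r)" .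
  thus ?thesis unfolding g_def f_def S_def[symmetric] q_def[symmetric] using \<delta> by (simp add: power_one_over field_simps)
 qed
 have nn: "0 <= g x" "0 <= f x" for x using \<delta> by (auto simp: g_def f_def)
 have cm: "(\<lambda>x :: nat => real. x j) \<in> borel_measurable (PiM {..<p} (\<lambda>_. lborel))" if "j < p" for j
  using measurable_component_singleton[of j "{..<p}" "\<lambda>_. lborel"] that by simp
 have m: "(\<lambda>x. ennreal (g x)) \<in> borel_measurable (PiM {..<p} (\<lambda>_. lborel))" "(\<lambda>x. ennreal (f x)) \<in> borel_measurable (PiM {..<p} (\<lambda>_. lborel))"
  unfolding g_def f_def ip_def using cm by measurable
 have G: "gauss {..<p} = density (PiM {..<p} (\<lambda>_. lborel)) (\<lambda>x. ennreal (g x))" by (simp add: gauss_density g_def)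
 show ?thesis unfolding mvnormal_def d G f_def[symmetric]
  by (subst density_density_eq[OF m]) (simp add: ennreal_mult nn)
qed

end

section \<open>Gaussian integrals with spiked exponents\<close>

text \<open>The exponential of d z^2/2 is the Laplace transform of a standard normal at sqrt(d) z.
  An auxiliary Gaussian \<open>y\<close> thus linearises the quadratic exponent, and Fubini moves it
  outside.\<close>

lemma Hubbard_Stratonovich:
 assumes A: "finite A" and M: "sigma_finite_measure M" and F[measurable]: "F \<in> borel_measurable M"
  and z[measurable]: "!!a. a \<in> A ==> z a \<in> borel_measurable M" and d: "0 <= d"
 shows "(\<integral>\<^sup>+x. F x*ennreal (exp (d/2*(\<Sum>a\<in>A. (z a x)\<^sup>2))) \<partial>M)
  = (\<integral>\<^sup>+y. \<integral>\<^sup>+x. F x*ennreal (exp (\<Sum>a\<in>A. sqrt d*z a x*y a)) \<partial>M \<partial>gauss A)"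
proof -
 interpret M: sigma_finite_measure M by (rule M)
 interpret G: prob_space "gauss A" by (rule prob_space_gauss)
 interpret pair_sigma_finite M "gauss A" ..
 note [measurable] = measurable_gauss_component
 have "(\<integral>\<^sup>+x. F x*ennreal (exp (d/2*(\<Sum>a\<in>A. (z a x)\<^sup>2))) \<partial>M)
   = (\<integral>\<^sup>+x. \<integral>\<^sup>+y. F x*ennreal (exp (\<Sum>a\<in>A. sqrt d*z a x*y a)) \<partial>gauss A \<partial>M)"
 proof (rule nn_integral_cong)
  fix x
  have "(\<integral>\<^sup>+y. ennreal (exp (0*(\<Sum>a\<in>A. (y a)\<^sup>2) + (\<Sum>a\<in>A. (sqrt d*z a x)*y a))) \<partial>gauss A)
   = ennreal (exp ((\<Sum>a\<in>A. (sqrt d*z a x)\<^sup>2)/(2*(1 - 2*0))) / sqrt (1 - 2*0) ^ card A)"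
   by (rule gauss_exp_quadratic[OF A]) simp
  also have "(\<Sum>a\<in>A. (sqrt d*z a x)\<^sup>2) = d*(\<Sum>a\<in>A. (z a x)\<^sup>2)" using d by (simp add: power_mult_distrib sum_distrib_left)
  finally have "(\<integral>\<^sup>+y. ennreal (exp (\<Sum>a\<in>A. sqrt d*z a x*y a)) \<partial>gauss A) = ennreal (exp (d/2*(\<Sum>a\<in>A. (z a x)\<^sup>2)))" by simp
  thus "F x*ennreal (exp (d/2*(\<Sum>a\<in>A. (z a x)\<^sup>2))) = (\<integral>\<^sup>+y. F x*ennreal (exp (\<Sum>a\<in>A. sqrt d*z a x*y a)) \<partial>gauss A)"
   by (subst nn_integral_cmult) auto
 qed
 also have "... = (\<integral>\<^sup>+y. \<integral>\<^sup>+x. F x*ennreal (exp (\<Sum>a\<in>A. sqrt d*z a x*y a)) \<partial>M \<partial>gauss A)"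
  by (rule Fubini'[symmetric]) measurable
 finally show ?thesis .
qed

text \<open>Trades a Gaussian integral over \<open>C\<close> whose exponent contains
  \<open>card A\<close> squares of linear forms for one over \<open>A\<close>. No diagonalisation of
  the quadratic form takes place.\<close>

lemma gauss_duality:
 assumes C: "finite C" and A: "finite A" and t: "t < 1/2" and d: "0 <= d"
 shows "(\<integral>\<^sup>+x. ennreal (exp (t*(\<Sum>j\<in>C. (x j)\<^sup>2) + (\<Sum>j\<in>C. s j*x j) + d/2*(\<Sum>a\<in>A. (\<Sum>j\<in>C. W a j*x j)\<^sup>2))) \<partial>gauss C)
  = (\<integral>\<^sup>+y. ennreal (exp ((\<Sum>j\<in>C. (s j + sqrt d*(\<Sum>a\<in>A. W a j*y a))\<^sup>2)/(2*(1 - 2*t))) / sqrt (1 - 2*t) ^ card C) \<partial>gauss A)"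
proof -
 interpret G: prob_space "gauss C" by (rule prob_space_gauss)
 note [measurable] = measurable_gauss_component
 let ?F = "\<lambda>x. ennreal (exp (t*(\<Sum>j\<in>C. (x j)\<^sup>2) + (\<Sum>j\<in>C. s j*x j)))"
 have "(\<integral>\<^sup>+x. ennreal (exp (t*(\<Sum>j\<in>C. (x j)\<^sup>2) + (\<Sum>j\<in>C. s j*x j) + d/2*(\<Sum>a\<in>A. (\<Sum>j\<in>C. W a j*x j)\<^sup>2))) \<partial>gauss C)
  = (\<integral>\<^sup>+x. ?F x*ennreal (exp (d/2*(\<Sum>a\<in>A. (\<Sum>j\<in>C. W a j*x j)\<^sup>2))) \<partial>gauss C)"
  by (simp add: exp_add ennreal_mult)
 also have "... = (\<integral>\<^sup>+y. \<integral>\<^sup>+x. ?F x*ennreal (exp (\<Sum>a\<in>A. sqrt d*(\<Sum>j\<in>C. W a j*x j)*y a)) \<partial>gauss C \<partial>gauss A)"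
  by (rule Hubbard_Stratonovich[OF A G.sigma_finite_measure_axioms _ _ d]) measurable
 also have "... = (\<integral>\<^sup>+y. \<integral>\<^sup>+x. ennreal (exp (t*(\<Sum>j\<in>C. (x j)\<^sup>2) + (\<Sum>j\<in>C. (s j + sqrt d*(\<Sum>a\<in>A. W a j*y a))*x j))) \<partial>gauss C \<partial>gauss A)"
 proof (intro nn_integral_cong)
  fix x y
  have "(\<Sum>a\<in>A. sqrt d*(\<Sum>j\<in>C. W a j*x j)*y a) = (\<Sum>j\<in>C. sqrt d*(\<Sum>a\<in>A. W a j*y a)*x j)"
   unfolding sum_distrib_left sum_distrib_right by (subst sum.swap) (simp add: mult_ac)
  thus "?F x*ennreal (exp (\<Sum>a\<in>A. sqrt d*(\<Sum>j\<in>C. W a j*x j)*y a))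
   = ennreal (exp (t*(\<Sum>j\<in>C. (x j)\<^sup>2) + (\<Sum>j\<in>C. (s j + sqrt d*(\<Sum>a\<in>A. W a j*y a))*x j)))"
   by (simp add: ennreal_mult[symmetric] exp_add[symmetric] distrib_right sum.distrib)
 qed
 also have "... = (\<integral>\<^sup>+y. ennreal (exp ((\<Sum>j\<in>C. (s j + sqrt d*(\<Sum>a\<in>A. W a j*y a))\<^sup>2)/(2*(1 - 2*t))) / sqrt (1 - 2*t) ^ card C) \<partial>gauss A)"
  by (simp only: gauss_exp_quadratic[OF C t])
 finally show ?thesis .
qed

lemma orthonormal_shift_norm:
 assumes w: "orthonormal p r w"
 shows "(\<Sum>j<p. (s j + c*(\<Sum>a<r. w a j*y a))\<^sup>2) = (\<Sum>j<p. (s j)\<^sup>2) + 2*c*(\<Sum>a<r. ip p (w a) s*y a) + c^2*(\<Sum>a<r. (y a)\<^sup>2)"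
proof -
 define v where "v = (\<lambda>j. \<Sum>a<r. y a*w a j)"
 have vv: "ip p v v = (\<Sum>a<r. (y a)\<^sup>2)"
 proof -
  have "ip p v v = (\<Sum>a<r. \<Sum>b<r. y a*(y b*ip p (w a) (w b)))"
   unfolding v_def by (simp add: ip_sum_left ip_sum_right ip_scale_left ip_scale_right)
  also have "... = (\<Sum>a<r. \<Sum>b<r. if b = a then y a*y b else 0)"
   by (intro sum.cong refl) (use orthonormalD[OF w] in auto)
  also have "... = (\<Sum>a<r. (y a)\<^sup>2)" by (simp add: power2_eq_square)
  finally show ?thesis .
 qed
 have vs: "ip p v s = (\<Sum>a<r. ip p (w a) s*y a)" unfolding v_def by (simp add: ip_sum_left ip_scale_left mult.commute)
 have "(\<Sum>j<p. (s j + c*(\<Sum>a<r. w a j*y a))\<^sup>2) = ip p (\<lambda>j. s j + c * v j) (\<lambda>j. s j + c * v j)"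
  unfolding ip_self_eq v_def by (simp add: mult.commute)
 also have "... = ip p s s + 2*c*ip p v s + c^2*ip p v v"
  by (simp add: ip_add_left ip_add_right ip_scale_left ip_scale_right ip_commute[of p s v] power2_eq_square algebra_simps)
 finally show ?thesis unfolding vv vs by (simp add: ip_self_eq)
qed

text \<open>Serves three purposes: t = 0 and d = \<delta> normalises the spiked density, t =
  -\<theta> yields the lower tail of the trace, and a single direction yields the Laplace transform
  of a squared overlap.\<close>

lemma gauss_spike_Laplace:
 assumes w: "orthonormal p r w" and t: "t < 1/2" and d: "0 <= d" "d < 1 - 2*t"
 shows "(\<integral>\<^sup>+x. ennreal (exp (t*(\<Sum>j<p. (x j)\<^sup>2) + d/2*(\<Sum>a<r. (ip p (w a) x)\<^sup>2))) \<partial>gauss {..<p})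
  = ennreal (1/(sqrt (1 - 2*t) ^ p * sqrt (1 - d/(1 - 2*t)) ^ r))"
proof -
 define c where "c = 1 / sqrt (1 - 2*t) ^ p"
 have c0: "0 <= c" using t by (simp add: c_def)
 have z: "ip p (w a) (\<lambda>j. 0) = 0" for a by (simp add: ip_def)
 have "(\<integral>\<^sup>+x. ennreal (exp (t*(\<Sum>j<p. (x j)\<^sup>2) + d/2*(\<Sum>a<r. (ip p (w a) x)\<^sup>2))) \<partial>gauss {..<p})
  = (\<integral>\<^sup>+y. ennreal (exp ((\<Sum>j<p. (0 + sqrt d*(\<Sum>a<r. w a j*y a))\<^sup>2)/(2*(1 - 2*t))) / sqrt (1 - 2*t) ^ p) \<partial>gauss {..<r})"
  using gauss_duality[of "{..<p}" "{..<r}" t d "\<lambda>_. 0" w, OF _ _ t d(1)] by (simp add: ip_def)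
 also have "... = (\<integral>\<^sup>+y. ennreal c*ennreal (exp (d/(2*(1 - 2*t))*(\<Sum>a<r. (y a)\<^sup>2) + (\<Sum>a<r. 0*y a))) \<partial>gauss {..<r})"
  unfolding orthonormal_shift_norm[OF w] using d c0
  by (intro nn_integral_cong) (simp add: ennreal_mult[symmetric] c_def z)
 also have "... = ennreal c*ennreal (exp ((\<Sum>a<r. 0\<^sup>2)/(2*(1 - 2*(d/(2*(1 - 2*t)))))) / sqrt (1 - 2*(d/(2*(1 - 2*t)))) ^ card {..<r})"
 proof (subst nn_integral_cmult)
  note [measurable] = measurable_gauss_component
  show "(\<lambda>y. ennreal (exp (d/(2*(1 - 2*t))*(\<Sum>a<r. (y a)\<^sup>2) + (\<Sum>a<r. 0*y a)))) \<in> borel_measurable (gauss {..<r})"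
   by measurable
  have "d/(2*(1 - 2*t)) < 1/2" using t d by (simp add: field_simps)
  thus "ennreal c*(\<integral>\<^sup>+y. ennreal (exp (d/(2*(1 - 2*t))*(\<Sum>a<r. (y a)\<^sup>2) + (\<Sum>a<r. 0*y a))) \<partial>gauss {..<r}) = 
   ennreal c*ennreal (exp ((\<Sum>a<r. 0\<^sup>2)/(2*(1 - 2*(d/(2*(1 - 2*t)))))) / sqrt (1 - 2*(d/(2*(1 - 2*t)))) ^ card {..<r})"
   by (subst gauss_exp_quadratic) auto
 qed
 also have "... = ennreal (c*(1 / sqrt (1 - d/(1 - 2*t)) ^ r))"
 proof -
  have "2*(d/(2*u)) = d/u" for u by simp
  hence "1 - 2*(d/(2*(1 - 2*t))) = 1 - d/(1 - 2*t)" by (simp only:)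
  moreover have "0 <= 1 - d/(1 - 2*t)" using t d by simp
  ultimately show ?thesis using c0 by (simp add: ennreal_mult[symmetric])
 qed
 finally show ?thesis by (simp add: c_def)
qed

lemma gauss_spike_linear:
 assumes w: "orthonormal p r w" and d: "0 <= d" "d < 1"
 shows "(\<integral>\<^sup>+x. ennreal (exp (d/2*(\<Sum>a<r. (ip p (w a) x)\<^sup>2))*exp (\<Sum>j<p. s j*x j)) \<partial>gauss {..<p})
  = ennreal (exp ((\<Sum>j<p. (s j)\<^sup>2)/2 + d/(2*(1 - d))*(\<Sum>a<r. (ip p (w a) s)\<^sup>2)) / sqrt (1 - d) ^ r)"
proof -
 define c where "c = exp ((\<Sum>j<p. (s j)\<^sup>2)/2)"
 have "(\<integral>\<^sup>+x. ennreal (exp (d/2*(\<Sum>a<r. (ip p (w a) x)\<^sup>2))*exp (\<Sum>j<p. s j*x j)) \<partial>gauss {..<p})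
  = (\<integral>\<^sup>+y. ennreal (exp ((\<Sum>j<p. (s j + sqrt d*(\<Sum>a<r. w a j*y a))\<^sup>2)/2)) \<partial>gauss {..<r})"
  using gauss_duality[of "{..<p}" "{..<r}" 0 d s w, OF _ _ _ d(1)] by (simp add: ip_def exp_add mult.commute)
 also have "... = (\<integral>\<^sup>+y. ennreal c*ennreal (exp (d/2*(\<Sum>a<r. (y a)\<^sup>2) + (\<Sum>a<r. (sqrt d*ip p (w a) s)*y a))) \<partial>gauss {..<r})"
 proof (rule nn_integral_cong)
  fix y
  have "(\<Sum>a<r. (sqrt d*ip p (w a) s)*y a) = sqrt d*(\<Sum>a<r. ip p (w a) s*y a)" by (simp add: sum_distrib_left mult.assoc)
  thus "ennreal (exp ((\<Sum>j<p. (s j + sqrt d*(\<Sum>a<r. w a j*y a))\<^sup>2)/2))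
   = ennreal c*ennreal (exp (d/2*(\<Sum>a<r. (y a)\<^sup>2) + (\<Sum>a<r. (sqrt d*ip p (w a) s)*y a)))"
   unfolding orthonormal_shift_norm[OF w] using d
   by (simp add: ennreal_mult[symmetric] c_def exp_add[symmetric] add_divide_distrib)
 qed
 also have "... = ennreal c*(\<integral>\<^sup>+y. ennreal (exp (d/2*(\<Sum>a<r. (y a)\<^sup>2) + (\<Sum>a<r. (sqrt d*ip p (w a) s)*y a))) \<partial>gauss {..<r})"
 proof (rule nn_integral_cmult)
  note [measurable] = measurable_gauss_component
  show "(\<lambda>y. ennreal (exp (d/2*(\<Sum>a<r. (y a)\<^sup>2) + (\<Sum>a<r. (sqrt d*ip p (w a) s)*y a)))) \<in> borel_measurable (gauss {..<r})"
   by measurable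
 qed
 also have "... = ennreal c*ennreal (exp ((\<Sum>a<r. (sqrt d*ip p (w a) s)\<^sup>2)/(2*(1 - 2*(d/2)))) / sqrt (1 - 2*(d/2)) ^ card {..<r})"
  using d by (subst gauss_exp_quadratic) auto
 also have "(\<Sum>a<r. (sqrt d*ip p (w a) s)\<^sup>2) = d*(\<Sum>a<r. (ip p (w a) s)\<^sup>2)" using d by (simp add: power_mult_distrib sum_distrib_left)
 finally show ?thesis using d
  by (simp add: c_def ennreal_mult[symmetric] exp_add)
qed

lemma exp_convex_mixture:
 fixes u b :: "'a => real"
 assumes A: "finite A" and u: "!!a. a \<in> A ==> 0 <= u a" and u1: "(\<Sum>a\<in>A. u a) = 1"
 shows "exp (\<Sum>a\<in>A. u a*b a) <= (\<Sum>a\<in>A. u a*exp (b a))"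
proof -
 have "A ~= {}" using u1 by auto
 have "exp (\<Sum>a\<in>A. u a *\<^sub>R b a) <= (\<Sum>a\<in>A. u a*exp (b a))"
  by (rule convex_on_sum[OF A \<open>A ~= {}\<close> exp_convex u1]) (use u in auto)
 thus ?thesis by simp
qed

text \<open>
 The chi-square overlap of two spikes is handled by the same transformation once the exponent is
 split over the rows of the overlap matrix, with weights proportional to their squared norms.
\<close>

lemma gauss_two_spikes:
 assumes w: "orthonormal p r w" and w': "orthonormal p r w'" and d: "0 < d" "d < 1"
  and small: "(d/(1 - d))^2*(\<Sum>a<r. \<Sum>b<r. (ip p (w a) (w' b))\<^sup>2) <= 1/2"
 shows "(\<integral>\<^sup>+x. ennreal (exp (d/2*(\<Sum>a<r. (ip p (w a) x)\<^sup>2))*exp (d/2*(\<Sum>a<r. (ip p (w' a) x)\<^sup>2))) \<partial>gauss {..<p})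
  <= ennreal (exp ((d/(1 - d))^2*(\<Sum>a<r. \<Sum>b<r. (ip p (w a) (w' b))\<^sup>2)) / sqrt (1 - d) ^ (2*r))"
proof -
 interpret Gp: prob_space "gauss {..<p}" by (rule prob_space_gauss)
 interpret Gr: prob_space "gauss {..<r}" by (rule prob_space_gauss)
 note [measurable] = measurable_gauss_component
 define m where "m a b = ip p (w a) (w' b)" for a b
 define N where "N a = (\<Sum>b<r. (m a b)\<^sup>2)" for a
 define F where "F = (\<Sum>a<r. N a)"
 define c where "c = 1 / sqrt (1 - d) ^ r"
 have c0: "0 <= c" using d by (simp add: c_def)
 have N0: "0 <= N a" for a by (simp add: N_def sum_nonneg)
 have F0: "0 <= F" using N0 by (simp add: F_def sum_nonneg)
 have Fs: "(d/(1 - d))^2*F <= 1/2" using small by (simp add: F_def N_def m_def)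
 define q where "q y = exp (d/2*(\<Sum>b<r. (y b)\<^sup>2))" for y :: "nat => real"
 define e where "e a y = (\<Sum>b<r. m a b*y b)" for a and y :: "nat => real"
 have "(\<integral>\<^sup>+x. ennreal (exp (d/2*(\<Sum>a<r. (ip p (w a) x)\<^sup>2))*exp (d/2*(\<Sum>a<r. (ip p (w' a) x)\<^sup>2))) \<partial>gauss {..<p})
  = (\<integral>\<^sup>+y. \<integral>\<^sup>+x. ennreal (exp (d/2*(\<Sum>a<r. (ip p (w a) x)\<^sup>2)))*ennreal (exp (\<Sum>b<r. sqrt d*ip p (w' b) x*y b)) \<partial>gauss {..<p} \<partial>gauss {..<r})"
 proof -
  have fr: "finite {..<r}" by simp
  have m1: "(\<lambda>x. ennreal (exp (d/2*(\<Sum>a<r. (ip p (w a) x)\<^sup>2)))) \<in> borel_measurable (gauss {..<p})" unfolding ip_def by measurable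
  have m2: "\<forall>b. (\<lambda>x. ip p (w' b) x) \<in> borel_measurable (gauss {..<p})" unfolding ip_def by measurable
  show ?thesis
   using Hubbard_Stratonovich[OF fr Gp.sigma_finite_measure_axioms m1 m2[rule_format] less_imp_le[OF d(1)]]
   by (simp add: ennreal_mult)
 qed
 also have "... = (\<integral>\<^sup>+y. ennreal (c*(q y*exp (d^2/(2*(1 - d))*(\<Sum>a<r. (e a y)\<^sup>2)))) \<partial>gauss {..<r})"
 proof (rule nn_integral_cong)
  fix y
  define s where "s j = 0 + sqrt d*(\<Sum>b<r. w' b j*y b)" for j
  have lin: "(\<Sum>b<r. sqrt d*ip p (w' b) x*y b) = (\<Sum>j<p. s j*x j)" for x
   unfolding ip_def s_def sum_distrib_left sum_distrib_right add_0_left by (subst sum.swap) (simp add: mult_ac sum_distrib_right)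
  have ss: "(\<Sum>j<p. (s j)\<^sup>2) = d*(\<Sum>b<r. (y b)\<^sup>2)"
   unfolding s_def orthonormal_shift_norm[OF w'] using d by (simp add: ip_def)
  have es: "ip p (w a) s = sqrt d*e a y" for a
  proof -
   have "ip p (w a) s = ip p (w a) (\<lambda>j. sqrt d*(\<Sum>b<r. y b*w' b j))" by (rule ip_cong) (simp_all add: s_def mult.commute)
   thus ?thesis by (simp add: ip_scale_right ip_sum_right e_def m_def mult.commute)
  qed
  have "(\<integral>\<^sup>+x. ennreal (exp (d/2*(\<Sum>a<r. (ip p (w a) x)\<^sup>2)))*ennreal (exp (\<Sum>b<r. sqrt d*ip p (w' b) x*y b)) \<partial>gauss {..<p})
   = (\<integral>\<^sup>+x. ennreal (exp (d/2*(\<Sum>a<r. (ip p (w a) x)\<^sup>2))*exp (\<Sum>j<p. s j*x j)) \<partial>gauss {..<p})"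
   unfolding lin by (simp add: ennreal_mult)
  also have "... = ennreal (exp ((\<Sum>j<p. (s j)\<^sup>2)/2 + d/(2*(1 - d))*(\<Sum>a<r. (ip p (w a) s)\<^sup>2)) / sqrt (1 - d) ^ r)"
   by (rule gauss_spike_linear[OF w]) (use d in auto)
  also have "... = ennreal (c*(q y*exp (d^2/(2*(1 - d))*(\<Sum>a<r. (e a y)\<^sup>2))))"
   unfolding ss es power_mult_distrib using d
   by (simp add: c_def q_def exp_add sum_distrib_left[symmetric] power2_eq_square)
  finally show "(\<integral>\<^sup>+x. ennreal (exp (d/2*(\<Sum>a<r. (ip p (w a) x)\<^sup>2)))*ennreal (exp (\<Sum>b<r. sqrt d*ip p (w' b) x*y b)) \<partial>gauss {..<p}) = ..." .
 qed
 also have "... <= ennreal (c*(c*exp ((d/(1 - d))^2*F)))"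
 proof (cases "F = 0")
  case True
  have "N a = 0" if "a < r" for a using True N0 that unfolding F_def by (simp add: sum_nonneg_eq_0_iff)
  hence "m a b = 0" if "a < r" "b < r" for a b using that unfolding N_def by (simp add: sum_nonneg_eq_0_iff)
  hence e0: "e a y = 0" if "a < r" for a y using that by (simp add: e_def)
  have "(\<integral>\<^sup>+y. ennreal (q y) \<partial>gauss {..<r}) = ennreal c"
   using gauss_exp_quadratic[of "{..<r}" "d/2" "\<lambda>_. 0"] d by (simp add: q_def c_def)
  thus ?thesis using c0 by (simp add: e0 True ennreal_mult nn_integral_cmult q_def)
 next
  case False
  hence Fp: "0 < F" using F0 by simp
  \<comment> \<open>Rows of norm zero are removed because the weights enter through
    \<open>F/N a\<close>; they contribute nothing to the exponent.\<close>
  define A where "A = {a \<in> {..<r}. N a ~= 0}"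
  have fA: "finite A" by (simp add: A_def)
  have NF: "(\<Sum>a\<in>A. N a/F) = 1"
  proof -
   have "(\<Sum>a\<in>A. N a) = F" unfolding F_def by (rule sum.mono_neutral_left) (auto simp: A_def)
   thus ?thesis using False by (simp add: sum_divide_distrib[symmetric])
  qed
  define g where "g a y = exp (d^2/(2*(1 - d))*(F/N a)*(e a y)^2)" for a y
  have pt: "exp (d^2/(2*(1 - d))*(\<Sum>a<r. (e a y)\<^sup>2)) <= (\<Sum>a\<in>A. N a/F*g a y)" for y
  proof -
   have "e a y = 0" if "a < r" "a \<notin> A" for a
   proof -
    have "N a = 0" using that by (simp add: A_def)
    hence "m a b = 0" if "b < r" for b using that unfolding N_def by (simp add: sum_nonneg_eq_0_iff)
    thus ?thesis by (simp add: e_def)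
   qed
   hence "(\<Sum>a<r. (e a y)\<^sup>2) = (\<Sum>a\<in>A. (e a y)\<^sup>2)" by (intro sum.mono_neutral_right) (auto simp: A_def)
   hence "d^2/(2*(1 - d))*(\<Sum>a<r. (e a y)\<^sup>2) = (\<Sum>a\<in>A. d\<^sup>2/(2*(1 - d))*(e a y)^2)" by (simp only: sum_distrib_left)
   also have "... = (\<Sum>a\<in>A. N a/F*(d^2/(2*(1 - d))*(F/N a)*(e a y)^2))"
    using False by (intro sum.cong refl) (simp add: A_def)
   also have "exp ... <= (\<Sum>a\<in>A. N a/F*g a y)" unfolding g_def
    using N0 F0 by (intro exp_convex_mixture[OF fA _ NF]) simp
   finally show ?thesis .
  qed
  \<comment> \<open>A single squared linear form is left, so duality with a one-point index set
    reduces the integral to a one-dimensional Gaussian. The weights are such that its exponent T/2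
    z^2 is the same for every row, and T <= 1/2 allows 1/sqrt(1 - T) <= exp T.\<close>
  have each: "(\<integral>\<^sup>+y. ennreal (q y*g a y) \<partial>gauss {..<r}) <= ennreal (c*exp ((d/(1 - d))^2*F))" if a: "a \<in> A" for a
  proof -
   have Na: "0 < N a" using a N0[of a] by (simp add: A_def)
   define k where "k = d^2/(1 - d)*(F/N a)"
   have k0: "0 <= k" using d F0 Na by (simp add: k_def)
   define T where "T = (d/(1 - d))^2*F"
   have T: "0 <= T" "T <= 1/2" using Fs F0 by (auto simp: T_def)
   have kT: "k*N a/(1 - d) = T" using Na d by (simp add: k_def T_def power_divide power2_eq_square)
   have "(\<integral>\<^sup>+y. ennreal (q y*g a y) \<partial>gauss {..<r})
    = (\<integral>\<^sup>+y. ennreal (exp (d/2*(\<Sum>b\<in>{..<r}. (y b)\<^sup>2) + (\<Sum>b\<in>{..<r}. 0*y b) + k/2*(\<Sum>i\<in>{0 :: nat}. (\<Sum>b\<in>{..<r}. m a b*y b)\<^sup>2))) \<partial>gauss {..<r})"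
   proof -
    have "x/(2*u) * v = (x/u * v)/2" for x u v :: real by simp
    hence "d^2/(2*(1 - d))*(F/N a) = k/2" by (simp only: k_def)
    thus ?thesis unfolding q_def g_def e_def by (simp only:) (simp add: exp_add)
   qed
   also have "... = (\<integral>\<^sup>+z. ennreal (exp ((\<Sum>b\<in>{..<r}. (0 + sqrt k*(\<Sum>i\<in>{0 :: nat}. m a b*z i))\<^sup>2)/(2*(1 - 2*(d/2)))) / sqrt (1 - 2*(d/2)) ^ card {..<r}) \<partial>gauss {0 :: nat})"
    using d k0 by (intro gauss_duality[of "{..<r}" "{0 :: nat}" "d/2" k "\<lambda>_. 0" "\<lambda>_ b. m a b"]) simp_all
   also have "... = (\<integral>\<^sup>+z. ennreal c*ennreal (exp (T/2*(\<Sum>i\<in>{0 :: nat}. (z i)\<^sup>2) + (\<Sum>i\<in>{0 :: nat}. 0*z i))) \<partial>gauss {0 :: nat})"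
   proof (rule nn_integral_cong)
    fix z :: "nat => real"
    have "(\<Sum>b<r. (0 + sqrt k*(\<Sum>i\<in>{0 :: nat}. m a b*z i))\<^sup>2) = k*N a*(z 0)^2"
     using k0 by (simp add: power_mult_distrib N_def sum_distrib_left sum_distrib_right mult_ac)
    hence "(\<Sum>b<r. (0 + sqrt k*(\<Sum>i\<in>{0 :: nat}. m a b*z i))\<^sup>2)/(2*(1 - 2*(d/2))) = T/2*(z 0)^2"
     using d by (simp add: kT[symmetric])
    thus "ennreal (exp ((\<Sum>b\<in>{..<r}. (0 + sqrt k*(\<Sum>i\<in>{0 :: nat}. m a b*z i))\<^sup>2)/(2*(1 - 2*(d/2)))) / sqrt (1 - 2*(d/2)) ^ card {..<r})
     = ennreal c*ennreal (exp (T/2*(\<Sum>i\<in>{0 :: nat}. (z i)\<^sup>2) + (\<Sum>i\<in>{0 :: nat}. 0*z i)))"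
     using c0 by (simp add: ennreal_mult[symmetric] c_def)
   qed
   also have "... = ennreal c*(\<integral>\<^sup>+z. ennreal (exp (T/2*(\<Sum>i\<in>{0 :: nat}. (z i)\<^sup>2) + (\<Sum>i\<in>{0 :: nat}. 0*z i))) \<partial>gauss {0 :: nat})"
    by (rule nn_integral_cmult) measurable
   also have "... = ennreal c*ennreal (1 / sqrt (1 - T))"
    using T by (subst gauss_exp_quadratic) auto
   also have "... <= ennreal c*ennreal (exp T)"
   proof (intro mult_left_mono ennreal_leI)
    have "exp (- (2*T)) <= 1 - T"
    proof -
     have "1 + 2*T <= exp (2*T)" by (rule exp_ge_add_one_self)
     hence "exp (- (2*T)) <= 1/(1 + 2*T)" using T by (simp add: exp_minus inverse_eq_divide frac_le)
     also have "T*(2*T) <= T*1" using T by (intro mult_left_mono) auto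
     hence "1 <= (1 - T)*(1 + 2*T)" by (simp add: algebra_simps)
     hence "1/(1 + 2*T) <= 1 - T" using T by (subst pos_divide_le_eq) auto
     finally show ?thesis .
    qed
    hence "sqrt (exp (- (2*T))) <= sqrt (1 - T)" by (rule real_sqrt_le_mono)
    moreover have "sqrt (exp (- (2*T))) = exp (- T)"
     by (rule real_sqrt_unique) (simp_all add: power2_eq_square exp_add[symmetric])
    ultimately have "exp (- T) <= sqrt (1 - T)" by simp
    hence "1 / sqrt (1 - T) <= 1/exp (- T)" by (intro divide_left_mono) (use T in auto)
    thus "1 / sqrt (1 - T) <= exp T" by (simp add: exp_minus inverse_eq_divide)
   qed auto
   finally show ?thesis using c0 by (simp add: ennreal_mult T_def)
  qed
  have "(\<integral>\<^sup>+y. ennreal (c*(q y*exp (d^2/(2*(1 - d))*(\<Sum>a<r. (e a y)\<^sup>2)))) \<partial>gauss {..<r})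
   <= (\<integral>\<^sup>+y. (\<Sum>a\<in>A. ennreal (c*(N a/F))*ennreal (q y*g a y)) \<partial>gauss {..<r})"
  proof (rule nn_integral_mono)
   fix y
   have nn: "0 <= c*(N a/F)" "0 <= q y*g a y" for a using c0 N0 F0 by (auto simp: q_def g_def)
   have "c*(q y*exp (d^2/(2*(1 - d))*(\<Sum>a<r. (e a y)\<^sup>2))) <= c*(q y*(\<Sum>a\<in>A. N a/F*g a y))"
    using pt c0 by (intro mult_left_mono) (auto simp: q_def)
   also have "... = (\<Sum>a\<in>A. c*(N a/F)*(q y*g a y))" by (simp add: sum_distrib_left mult_ac)
   finally have "ennreal (c*(q y*exp (d^2/(2*(1 - d))*(\<Sum>a<r. (e a y)\<^sup>2)))) <= ennreal (\<Sum>a\<in>A. c*(N a/F)*(q y*g a y))"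
    by (rule ennreal_leI)
   also have "... = (\<Sum>a\<in>A. ennreal (c*(N a/F))*ennreal (q y*g a y))"
   proof -
    have "ennreal (\<Sum>a\<in>A. c*(N a/F)*(q y*g a y)) = (\<Sum>a\<in>A. ennreal (c*(N a/F)*(q y*g a y)))"
     by (rule sum_ennreal[symmetric]) (rule mult_nonneg_nonneg[OF nn])
    thus ?thesis by (simp only: ennreal_mult[OF nn])
   qed
   finally show "ennreal (c*(q y*exp (d^2/(2*(1 - d))*(\<Sum>a<r. (e a y)\<^sup>2)))) <= ..." .
  qed
  also have "... = (\<Sum>a\<in>A. ennreal (c*(N a/F))*(\<integral>\<^sup>+y. ennreal (q y*g a y) \<partial>gauss {..<r}))"
   unfolding q_def g_def e_def by (subst nn_integral_sum) (auto simp: nn_integral_cmult)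
  also have "... <= (\<Sum>a\<in>A. ennreal (c*(N a/F))*ennreal (c*exp ((d/(1 - d))^2*F)))"
   by (intro sum_mono mult_left_mono each) auto
  also have "... = (\<Sum>a\<in>A. ennreal (c*(c*exp ((d/(1 - d))^2*F))*(N a/F)))"
   using c0 N0 F0 by (intro sum.cong refl) (subst ennreal_mult[symmetric], auto simp: mult_ac)
  also have "... = ennreal (\<Sum>a\<in>A. c*(c*exp ((d/(1 - d))^2*F))*(N a/F))"
   using c0 N0 F0 by (intro sum_ennreal) auto
  also have "... = ennreal (c*(c*exp ((d/(1 - d))^2*F)))"
   unfolding sum_distrib_left[symmetric] NF by simp
  finally show ?thesis .
 qed
 also have "c*(c*exp ((d/(1 - d))^2*F)) = exp ((d/(1 - d))^2*(\<Sum>a<r. \<Sum>b<r. (ip p (w a) (w' b))\<^sup>2)) / sqrt (1 - d) ^ (2*r)"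
  by (simp add: c_def F_def N_def m_def mult_2 power_add)
 finally show ?thesis .
qed

section \<open>Likelihood ratio, prior and second moment\<close>

text \<open>The likelihood ratio of the data given \<open>Q\<close> against the null law.\<close>

definition spike_density :: "nat => nat => nat => real => real mat => (nat => nat => real) => real" where
 "spike_density n p r \<delta> Q X = (\<Prod>i=1..n. sqrt (1 - \<delta>) ^ r*exp (\<delta>/2*(\<Sum>a<r. (ip p (stiefel_col Q a) (X i))\<^sup>2)))"

locale spiked_model =
 fixes n p r :: nat and \<delta> :: real and \<nu> :: "real mat measure"
 assumes n1: "1 <= n" and np: "n <= p" and \<delta>: "0 < \<delta>" "\<delta> < 1" and r1: "1 <= r"
  and \<nu>: "uniform_on_stiefel p r \<nu>"
begin

sublocale prior: prob_space \<nu>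
 using \<nu> by (simp add: uniform_on_stiefel_def)

sublocale null: prob_space "null_law n p"
 by (rule prob_space_null_law)

abbreviation "G \<equiv> gauss {..<p}"

sublocale row: prob_space G
 by (rule prob_space_gauss)

sublocale joint: pair_sigma_finite \<nu> "null_law n p" ..
sublocale joint_row: pair_sigma_finite \<nu> G ..

abbreviation "f \<equiv> spike_density n p r \<delta>"
abbreviation "P1 \<equiv> alt_law n p \<delta> \<nu>"

lemma f_nonneg: "0 <= f Q X"
 using \<delta> by (auto simp: spike_density_def intro!: prod_nonneg)

lemma sets_prior: "sets \<nu> = sets (stiefel_borel p r)"
 using \<nu> by (simp add: uniform_on_stiefel_def)

lemma space_prior: "space \<nu> = stiefel p r"
 using sets_eq_imp_space_eq[OF sets_prior] by (simp add: stiefel_borel_def)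

lemma prior_entry_measurable [measurable]:
 assumes "j < p" "a < r"
 shows "(\<lambda>Q. Q $$ (j, a)) \<in> borel_measurable \<nu>"
proof -
 let ?F = "\<lambda>Q :: real mat. \<lambda>ij\<in>{..<p} \<times> {..<r}. Q $$ ij"
 have "?F \<in> measurable (stiefel_borel p r) (PiM ({..<p} \<times> {..<r}) (\<lambda>_. borel))"
  unfolding stiefel_borel_def by (rule measurable_vimage_algebra1) (auto simp: space_PiM)
 hence "(\<lambda>Q. ?F Q (j, a)) \<in> borel_measurable (stiefel_borel p r)"
  by (rule measurable_compose) (rule measurable_component_singleton, use assms in auto)
 thus ?thesis using assms by (simp add: sets_prior cong: measurable_cong_sets)
qed

lemma prior_overlap_measurable [measurable]: "a < r ==> (\<lambda>Q. ip p u (stiefel_col Q a)) \<in> borel_measurable \<nu>"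
 unfolding ip_def stiefel_col_def by (intro borel_measurable_sum borel_measurable_times borel_measurable_const prior_entry_measurable) auto

lemma joint_overlap_measurable [measurable]:
 assumes "a < r" "i \<in> {1..n}"
 shows "(\<lambda>z. ip p (stiefel_col (fst z) a) (snd z i)) \<in> borel_measurable (\<nu> \<Otimes>\<^sub>M null_law n p)"
 unfolding ip_def stiefel_col_def
proof (intro borel_measurable_sum borel_measurable_times)
 fix j assume j: "j \<in> {..<p}"
 show "(\<lambda>z. fst z $$ (j, a)) \<in> borel_measurable (\<nu> \<Otimes>\<^sub>M null_law n p)"
  by (rule measurable_compose[OF measurable_fst]) (use j assms in simp)
 have "(\<lambda>X. X i j) \<in> borel_measurable (null_law n p)"
  using measurable_entry[OF assms(2), of j p] j by (simp add: sets_null_law cong: measurable_cong_sets)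
 thus "(\<lambda>z. snd z i j) \<in> borel_measurable (\<nu> \<Otimes>\<^sub>M null_law n p)"
  by (rule measurable_compose[OF measurable_snd])
qed

lemma joint_density_measurable [measurable]:
 "(\<lambda>z. ennreal (f (fst z) (snd z))) \<in> borel_measurable (\<nu> \<Otimes>\<^sub>M null_law n p)"
 unfolding spike_density_def
 by (intro measurable_compose[OF _ measurable_ennreal] borel_measurable_prod borel_measurable_times borel_measurable_const
   measurable_compose[OF _ borel_measurable_exp] borel_measurable_sum borel_measurable_power joint_overlap_measurable) auto

lemma joint_density_measurable' [measurable]:
 "(\<lambda>(Q, X). ennreal (f Q X)) \<in> borel_measurable (\<nu> \<Otimes>\<^sub>M null_law n p)"
 using joint_density_measurable by (simp add: case_prod_beta)

lemma density_measurable [measurable]: "Q \<in> space \<nu> ==> (\<lambda>X. ennreal (f Q X)) \<in> borel_measurable (null_law n p)"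
 using measurable_compose[OF measurable_Pair1' joint_density_measurable, of Q] by simp

lemma prior_density_measurable [measurable]: "X \<in> space (null_law n p) ==> (\<lambda>Q. ennreal (f Q X)) \<in> borel_measurable \<nu>"
 using measurable_compose[OF measurable_Pair2' joint_density_measurable, of X] by simp

lemma ip_measurable_row [measurable]: "(\<lambda>x. ip p w x) \<in> borel_measurable G"
 unfolding ip_def by (intro borel_measurable_sum borel_measurable_times borel_measurable_const measurable_gauss_component) auto

lemma row_density_measurable [measurable]:
 "(\<lambda>x. ennreal (sqrt (1 - \<delta>) ^ r*exp (\<delta>/2*(\<Sum>a<r. (ip p (stiefel_col Q a) x)\<^sup>2)))) \<in> borel_measurable G"
 by measurable

lemma prob_space_mvnormal_spiked:
 assumes Q: "Q \<in> stiefel p r"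
 shows "prob_space (mvnormal p (spiked_cov p \<delta> Q))"
proof
 let ?h = "\<lambda>x. exp (\<delta>/2*(\<Sum>a<r. (ip p (stiefel_col Q a) x)\<^sup>2))"
 have "emeasure (mvnormal p (spiked_cov p \<delta> Q)) (space (mvnormal p (spiked_cov p \<delta> Q)))
  = (\<integral>\<^sup>+x. ennreal (sqrt (1 - \<delta>) ^ r * ?h x) \<partial>G)"
  unfolding mvnormal_spiked[OF Q \<delta>] by (subst emeasure_density) (auto intro!: nn_integral_cong)
 also have "... = ennreal (sqrt (1 - \<delta>) ^ r)*(\<integral>\<^sup>+x. ennreal (?h x) \<partial>G)"
  using \<delta> by (subst nn_integral_cmult[symmetric]) (auto simp: ennreal_mult)
 also have "(\<integral>\<^sup>+x. ennreal (?h x) \<partial>G) = ennreal (1 / sqrt (1 - \<delta>) ^ r)"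
  using gauss_spike_Laplace[OF stiefel_orthonormal[OF Q], of 0 \<delta>] \<delta> by simp
 also have "ennreal (sqrt (1 - \<delta>) ^ r)*ennreal (1 / sqrt (1 - \<delta>) ^ r) = 1"
  using \<delta> by (subst ennreal_mult[symmetric]) auto
 finally show "emeasure (mvnormal p (spiked_cov p \<delta> Q)) (space (mvnormal p (spiked_cov p \<delta> Q))) = 1" .
qed

lemma iid_spiked_density:
 assumes Q: "Q \<in> stiefel p r"
 shows "iid_mvnormal n p (spiked_cov p \<delta> Q) = density (null_law n p) (\<lambda>X. ennreal (f Q X))"
proof -
 interpret mv: prob_space "mvnormal p (spiked_cov p \<delta> Q)" by (rule prob_space_mvnormal_spiked[OF Q])
 have "PiM {1..n} (\<lambda>i. density G (\<lambda>x. ennreal (sqrt (1 - \<delta>) ^ r*exp (\<delta>/2*(\<Sum>a<r. (ip p (stiefel_col Q a) x)\<^sup>2)))))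
  = density (PiM {1..n} (\<lambda>_. G)) (\<lambda>X. \<Prod>i=1..n. ennreal (sqrt (1 - \<delta>) ^ r*exp (\<delta>/2*(\<Sum>a<r. (ip p (stiefel_col Q a) (X i))\<^sup>2))))"
  by (rule PiM_density) (simp, rule row.sigma_finite_measure_axioms,
   rule mv.sigma_finite_measure_axioms[unfolded mvnormal_spiked[OF Q \<delta>]], rule row_density_measurable)
 thus ?thesis
  unfolding iid_mvnormal_def mvnormal_spiked[OF Q \<delta>] null_law_gauss spike_density_def
  using \<delta> by (simp add: prod_ennreal)
qed

lemma prob_space_iid_spiked: "Q \<in> stiefel p r ==> prob_space (iid_mvnormal n p (spiked_cov p \<delta> Q))"
 unfolding iid_mvnormal_def by (rule prob_space_PiM) (rule prob_space_mvnormal_spiked)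

lemma iid_spiked_emeasure:
 assumes "Q \<in> stiefel p r" "A \<in> sets (data_space n p)"
 shows "emeasure (iid_mvnormal n p (spiked_cov p \<delta> Q)) A = (\<integral>\<^sup>+X. ennreal (f Q X)*indicator A X \<partial>null_law n p)"
 unfolding iid_spiked_density[OF assms(1)] using assms
 by (intro emeasure_density density_measurable) (simp_all add: space_prior sets_null_law)

lemma iid_spiked_kernel:
 "(\<lambda>Q. iid_mvnormal n p (spiked_cov p \<delta> Q)) \<in> measurable \<nu> (subprob_algebra (data_space n p))"
proof (rule measurable_subprob_algebra)
 fix Q assume Q: "Q \<in> space \<nu>"
 hence Q': "Q \<in> stiefel p r" by (simp add: space_prior)
 show "subprob_space (iid_mvnormal n p (spiked_cov p \<delta> Q))"
  by (rule prob_space_imp_subprob_space[OF prob_space_iid_spiked[OF Q']])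
 show "sets (iid_mvnormal n p (spiked_cov p \<delta> Q)) = sets (data_space n p)"
  unfolding iid_spiked_density[OF Q'] by (simp add: sets_null_law)
next
 fix A assume A: "A \<in> sets (data_space n p)"
 hence A': "A \<in> sets (null_law n p)" by (simp add: sets_null_law)
 have "(\<lambda>Q. \<integral>\<^sup>+X. ennreal (f Q X)*indicator A X \<partial>null_law n p) \<in> borel_measurable \<nu>"
  by (rule null.borel_measurable_nn_integral) (use A' in measurable)
 thus "(\<lambda>Q. emeasure (iid_mvnormal n p (spiked_cov p \<delta> Q)) A) \<in> borel_measurable \<nu>"
  by (rule measurable_cong[THEN iffD2, rotated]) (simp add: iid_spiked_emeasure A space_prior)
qed

lemma sets_alt: "sets P1 = sets (data_space n p)"
 unfolding alt_law_def using sets_bind[OF sets_kernel[OF iid_spiked_kernel] prior.not_empty] by simp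

lemma alt_emeasure:
 assumes A: "A \<in> sets (data_space n p)"
 shows "emeasure P1 A = (\<integral>\<^sup>+Q. \<integral>\<^sup>+X. ennreal (f Q X)*indicator A X \<partial>null_law n p \<partial>\<nu>)"
 unfolding alt_law_def emeasure_bind[OF prior.not_empty iid_spiked_kernel A]
 by (rule nn_integral_cong) (simp add: iid_spiked_emeasure A space_prior)

lemma prob_space_alt: "prob_space P1"
proof
 have sp: "space P1 = space (data_space n p)" by (rule sets_eq_imp_space_eq[OF sets_alt])
 have "emeasure P1 (space (data_space n p)) = (\<integral>\<^sup>+Q. 1 \<partial>\<nu>)"
  unfolding alt_law_def emeasure_bind[OF prior.not_empty iid_spiked_kernel sets.top]
 proof (rule nn_integral_cong)
  fix Q assume "Q \<in> space \<nu>"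
  hence Q: "Q \<in> stiefel p r" by (simp add: space_prior)
  have "space (iid_mvnormal n p (spiked_cov p \<delta> Q)) = space (data_space n p)"
   unfolding iid_spiked_density[OF Q] by (simp add: space_null_law)
  thus "emeasure (iid_mvnormal n p (spiked_cov p \<delta> Q)) (space (data_space n p)) = 1"
   using prob_space.emeasure_space_1[OF prob_space_iid_spiked[OF Q]] by simp
 qed
 thus "emeasure P1 (space P1) = 1" by (simp add: sp prior.emeasure_space_1)
qed

lemma stiefel_mult_measurable:
 assumes U: "U \<in> stiefel p p"
 shows "(\<lambda>Q. U*Q) \<in> measurable \<nu> \<nu>"
proof -
 have mem: "U*Q \<in> stiefel p r" if Q: "Q \<in> stiefel p r" for Q
 proof -
  note c = stiefelD(1)[OF U] stiefelD(1)[OF Q]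
  have "transpose_mat (U*Q)*(U*Q) = (transpose_mat Q*transpose_mat U)*(U*Q)"
   using transpose_mult[OF c] by simp
  also have "... = transpose_mat Q*(transpose_mat U*(U*Q))" using c by (intro assoc_mult_mat[of _ r p _ p _ r]) auto
  also have "transpose_mat U*(U*Q) = (transpose_mat U*U)*Q" using c by (intro assoc_mult_mat[symmetric, of _ p p _ p _ r]) auto
  finally show ?thesis using c stiefelD(2)[OF U] stiefelD(2)[OF Q] by (simp add: stiefel_def)
 qed
 have "(\<lambda>Q. U*Q) \<in> measurable \<nu> (stiefel_borel p r)"
  unfolding stiefel_borel_def
 proof (rule measurable_vimage_algebra2)
  show "(\<lambda>Q. U*Q) \<in> space \<nu> \<rightarrow> stiefel p r" using mem by (auto simp: space_prior)
  show "(\<lambda>Q. \<lambda>ij\<in>{..<p} \<times> {..<r}. (U*Q) $$ ij) \<in> measurable \<nu> (PiM ({..<p} \<times> {..<r}) (\<lambda>_. borel))"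
  proof (rule measurable_restrict)
   fix ij assume ij: "ij \<in> {..<p} \<times> {..<r}"
   have "(\<lambda>Q. \<Sum>k<p. U $$ (fst ij, k)*Q $$ (k, snd ij)) \<in> borel_measurable \<nu>"
    by (intro borel_measurable_sum borel_measurable_times borel_measurable_const prior_entry_measurable) (use ij in auto)
   moreover have "(U*Q) $$ ij = (\<Sum>k<p. U $$ (fst ij, k)*Q $$ (k, snd ij))" if "Q \<in> space \<nu>" for Q
    using that ij stiefelD(1)[OF U] stiefelD(1)[of Q p r] by (auto simp: space_prior scalar_prod_def atLeast0LessThan)
   ultimately show "(\<lambda>Q. (U*Q) $$ ij) \<in> borel_measurable \<nu>" by (simp cong: measurable_cong)
  qed
 qed
 thus ?thesis by (simp add: sets_prior cong: measurable_cong_sets)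
qed

text \<open>The reflection exchanging the unit vectors \<open>u\<close> and \<open>v\<close> is
  orthogonal and the prior is invariant under it, so the law of the overlap does not depend on the
  direction.\<close>

lemma prior_rotation:
 fixes h :: "real => ennreal"
 assumes u: "ip p u u = 1" and v: "ip p v v = 1" and b: "b < r" and h[measurable]: "h \<in> borel_measurable borel"
 shows "(\<integral>\<^sup>+Q. h (ip p u (stiefel_col Q b)) \<partial>\<nu>) = (\<integral>\<^sup>+Q. h (ip p v (stiefel_col Q b)) \<partial>\<nu>)"
proof -
 define w where "w j = u j - v j" for j
 show ?thesis
 proof (cases "ip p w w = 0")
  case True
  hence "u j = v j" if "j < p" for j using ip_self_0[of p w j] that by (simp add: w_def)
  hence "ip p u x = ip p v x" for x by (intro ip_cong) auto
  thus ?thesis by simp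
 next
  case False
  define c where "c = 2/ip p w w"
  define U where "U = mat p p (\<lambda>(i, j). (if i = j then 1 else 0) - c*w i*w j)"
  have Uc: "U \<in> carrier_mat p p" by (simp add: U_def)
  have ent: "(U*Q) $$ (j, a) = Q $$ (j, a) - c*w j*ip p w (stiefel_col Q a)"
   if Q: "Q \<in> carrier_mat p m" and "j < p" "a < m" for Q m j a
  proof -
   have "(U*Q) $$ (j, a) = (\<Sum>k<p. (if j = k then Q $$ (k, a) else 0) - c*w j*(w k*Q $$ (k, a)))"
    using that Uc by (auto simp: scalar_prod_def atLeast0LessThan U_def algebra_simps intro!: sum.cong)
   thus ?thesis using that by (simp add: sum_subtractf sum_distrib_left[symmetric] ip_def stiefel_col_def)
  qed
  have US: "U \<in> stiefel p p"
  proof -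
   have "transpose_mat U = U" by (rule eq_matI) (auto simp: U_def mult_ac)
   moreover have "U*U = 1\<^sub>m p"
   proof (rule eq_matI)
    fix i j assume "i < dim_row (1\<^sub>m p :: real mat)" "j < dim_col (1\<^sub>m p :: real mat)"
    hence ij: "i < p" "j < p" by auto
    have "ip p w (stiefel_col U j) = (\<Sum>k<p. (if k = j then w k else 0) - c*w j*(w k*w k))"
     unfolding ip_def using ij by (auto simp: stiefel_col_def U_def algebra_simps intro!: sum.cong)
    also have "... = w j - c*w j*ip p w w" using ij by (simp add: sum_subtractf sum_distrib_left[symmetric] ip_def)
    also have "... = - w j" using False by (simp add: c_def)
    finally have "ip p w (stiefel_col U j) = - w j" .
    thus "(U*U) $$ (i, j) = 1\<^sub>m p $$ (i, j)" unfolding ent[OF Uc ij] using ij by (simp add: U_def)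
   qed (use Uc in auto)
   ultimately show ?thesis using Uc by (simp add: stiefel_def)
  qed
  have ww: "ip p w w = 2 - 2*ip p u v" "ip p u w = 1 - ip p u v"
   unfolding w_def using u v by (simp_all add: ip_diff_left ip_diff_right ip_commute[of p v u])
  hence cw: "c*ip p u w = 1" using False by (simp add: c_def field_simps)
  have rot: "ip p u (stiefel_col (U*Q) b) = ip p v (stiefel_col Q b)" if "Q \<in> space \<nu>" for Q
  proof -
   have Q: "Q \<in> carrier_mat p r" using that stiefelD(1) by (simp add: space_prior)
   have "ip p u (stiefel_col (U*Q) b) = ip p u (\<lambda>j. stiefel_col Q b j - (c*ip p w (stiefel_col Q b))*w j)"
    by (rule ip_cong) (simp_all add: stiefel_col_def[of "U*Q"] ent[OF Q _ b] stiefel_col_def[of Q] mult_ac)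
   also have "... = ip p u (stiefel_col Q b) - (c*ip p u w)*ip p w (stiefel_col Q b)"
    unfolding ip_diff_right ip_scale_right by (simp add: mult_ac)
   also have "... = ip p v (stiefel_col Q b)" unfolding cw w_def by (simp add: ip_diff_left)
   finally show ?thesis .
  qed
  have m: "(\<lambda>Q. h (ip p u (stiefel_col Q b))) \<in> borel_measurable \<nu>" using b by measurable
  have "(\<integral>\<^sup>+Q. h (ip p u (stiefel_col Q b)) \<partial>\<nu>) = (\<integral>\<^sup>+Q. h (ip p u (stiefel_col Q b)) \<partial>distr \<nu> \<nu> (\<lambda>Q. U*Q))"
   using \<nu> US by (simp add: uniform_on_stiefel_def)
  also have "... = (\<integral>\<^sup>+Q. h (ip p u (stiefel_col (U*Q) b)) \<partial>\<nu>)"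
   by (rule nn_integral_distr[OF stiefel_mult_measurable[OF US]]) (use m in simp)
  also have "... = (\<integral>\<^sup>+Q. h (ip p v (stiefel_col Q b)) \<partial>\<nu>)" by (rule nn_integral_cong) (simp add: rot)
  finally show ?thesis .
 qed
qed

text \<open>A uniform direction is compared with a Gaussian vector, whose squared norm has mean \<open>p\<close>.\<close>

lemma prior_overlap_Laplace:
 fixes t :: real
 assumes u: "ip p u u = 1" and b: "b < r" and t: "0 <= t" "t < 1/2"
 shows "(\<integral>\<^sup>+Q. ennreal (exp (t*p*(ip p u (stiefel_col Q b))^2)) \<partial>\<nu>) <= ennreal (1 / sqrt (1 - 2*t))"
proof -
 have pm: "(\<lambda>z. ip p (snd z) (stiefel_col (fst z) b)) \<in> borel_measurable (\<nu> \<Otimes>\<^sub>M G)"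
  unfolding ip_def stiefel_col_def
 proof (intro borel_measurable_sum borel_measurable_times)
  fix j assume j: "j \<in> {..<p}"
  show "(\<lambda>z. fst z $$ (j, b)) \<in> borel_measurable (\<nu> \<Otimes>\<^sub>M G)"
   by (rule measurable_compose[OF measurable_fst]) (use j b in simp)
  show "(\<lambda>z. snd z j) \<in> borel_measurable (\<nu> \<Otimes>\<^sub>M G)"
   by (rule measurable_compose[OF measurable_snd]) (use j in \<open>simp add: measurable_gauss_component\<close>)
 qed
 have um: "(\<lambda>z. ip p u (stiefel_col (fst z) b)) \<in> borel_measurable (\<nu> \<Otimes>\<^sub>M G)"
  by (rule measurable_compose[OF measurable_fst]) (use b in simp)
 have nm: "(\<lambda>z. ip p (snd z) (snd z)) \<in> borel_measurable (\<nu> \<Otimes>\<^sub>M G)"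
  unfolding ip_def by (intro borel_measurable_sum borel_measurable_times measurable_compose[OF measurable_snd] measurable_gauss_component) auto
 have col: "ip p (stiefel_col Q b) (stiefel_col Q b) = 1" if "Q \<in> space \<nu>" for Q
  using orthonormalD[OF stiefel_orthonormal b b] that by (simp add: space_prior)
 \<comment> \<open>Rotation invariance merges the norm of \<open>x\<close> with the overlap of the
   fixed direction. After exchanging the integrals, what remains is the inner product of a Gaussian
   vector with a fixed unit vector, a standard normal.\<close>
 have scale: "(\<integral>\<^sup>+Q. ennreal (exp (t*(ip p x (stiefel_col Q b))^2)) \<partial>\<nu>) = (\<integral>\<^sup>+Q. ennreal (exp (t*(ip p x x*(ip p u (stiefel_col Q b))^2))) \<partial>\<nu>)" for x
 proof (cases "ip p x x = 0")
  case True
  hence "x j = 0" if "j < p" for j using ip_self_0 that by blast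
  hence "ip p x y = 0" for y by (simp add: ip_def)
  thus ?thesis using True by simp
 next
  case False
  define s where "s = sqrt (ip p x x)"
  have s: "0 < s" using False ip_self_nonneg[of p x] unfolding s_def by (simp add: less_le)
  have s2: "s^2 = ip p x x" by (simp add: s_def)
  define v where "v j = x j / s" for j
  have v: "ip p v v = 1" unfolding v_def ip_divide_left ip_divide_right s2[symmetric] using s by (simp add: power2_eq_square)
  have xv: "ip p x y = s*ip p v y" for y unfolding v_def ip_divide_left using s by simp
  have "(\<integral>\<^sup>+Q. ennreal (exp (t*(s*ip p v (stiefel_col Q b))^2)) \<partial>\<nu>) = (\<integral>\<^sup>+Q. ennreal (exp (t*(s*ip p u (stiefel_col Q b))^2)) \<partial>\<nu>)"
   by (rule prior_rotation[OF v u b, of "\<lambda>y. ennreal (exp (t*(s*y)^2))"]) measurable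
  thus ?thesis unfolding xv[symmetric] power_mult_distrib s2 .
 qed
 have "(\<integral>\<^sup>+Q. ennreal (exp (t*p*(ip p u (stiefel_col Q b))^2)) \<partial>\<nu>)
  <= (\<integral>\<^sup>+Q. \<integral>\<^sup>+x. ennreal (exp (t*(ip p x x*(ip p u (stiefel_col Q b))^2))) \<partial>G \<partial>\<nu>)"
 proof (rule nn_integral_mono)
  \<comment> \<open>The number \<open>p\<close> is replaced by the squared norm of a Gaussian
    vector, whose mean it is. The resulting Jensen inequality is checked on the explicit Laplace
    transform (1 - 2ts)^(-p/2), which is at least exp(tps).\<close>
  fix Q assume Q: "Q \<in> space \<nu>"
  define s where "s = (ip p u (stiefel_col Q b))^2"
  have "s <= 1"
   using Bessel[of p 1 "\<lambda>_. stiefel_col Q b" u] col[OF Q] u by (simp add: orthonormal_def s_def ip_commute)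
  hence ts: "t * s < 1/2" "0 <= t * s" using t mult_left_mono[of s 1 t] by (auto simp: s_def)
  have "(\<integral>\<^sup>+x. ennreal (exp (t*(ip p x x * s))) \<partial>G) = (\<integral>\<^sup>+x. ennreal (exp (t * s*(\<Sum>j\<in>{..<p}. (x j)\<^sup>2) + (\<Sum>j\<in>{..<p}. 0*x j))) \<partial>G)"
   by (simp add: ip_self_eq mult_ac)
  also have "... = ennreal (1 / sqrt (1 - 2*(t * s)) ^ p)"
   using ts by (subst gauss_exp_quadratic) auto
  finally have e: "(\<integral>\<^sup>+x. ennreal (exp (t*(ip p x x * s))) \<partial>G) = ennreal (1 / sqrt (1 - 2*(t * s)) ^ p)" .
  have "1 - 2*(t * s) <= exp (- (2*(t * s)))" using exp_ge_add_one_self[of "- (2*(t * s))"] by simp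
  hence "sqrt (1 - 2*(t * s)) <= sqrt (exp (- (2*(t * s))))" by (rule real_sqrt_le_mono)
  also have "... = exp (- (t * s))" by (rule real_sqrt_unique) (simp_all add: power2_eq_square exp_add[symmetric])
  finally have "sqrt (1 - 2*(t * s)) ^ p <= exp (- (t * s)) ^ p" by (rule power_mono) (use ts in simp)
  hence "1/exp (- (t * s)) ^ p <= 1 / sqrt (1 - 2*(t * s)) ^ p" using ts by (intro divide_left_mono mult_pos_pos) auto
  moreover have "1/exp (- (t * s)) ^ p = exp (t*p * s)" by (simp add: exp_minus power_inverse exp_of_nat_mult[symmetric] inverse_eq_divide[symmetric] mult_ac)
  ultimately show "ennreal (exp (t*p*(ip p u (stiefel_col Q b))^2)) <= (\<integral>\<^sup>+x. ennreal (exp (t*(ip p x x*(ip p u (stiefel_col Q b))^2))) \<partial>G)"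
   unfolding s_def[symmetric] e by (intro ennreal_leI) simp
 qed
 also have "... = (\<integral>\<^sup>+x. \<integral>\<^sup>+Q. ennreal (exp (t*(ip p x x*(ip p u (stiefel_col Q b))^2))) \<partial>\<nu> \<partial>G)"
  by (rule joint_row.Fubini'[symmetric]) (use um nm in \<open>simp add: case_prod_beta\<close>)
 also have "... = (\<integral>\<^sup>+x. \<integral>\<^sup>+Q. ennreal (exp (t*(ip p x (stiefel_col Q b))^2)) \<partial>\<nu> \<partial>G)" by (simp only: scale)
 also have "... = (\<integral>\<^sup>+Q. \<integral>\<^sup>+x. ennreal (exp (t*(ip p x (stiefel_col Q b))^2)) \<partial>G \<partial>\<nu>)"
  by (rule joint_row.Fubini') (use pm in \<open>simp add: case_prod_beta\<close>)
 also have "... = (\<integral>\<^sup>+Q. ennreal (1 / sqrt (1 - 2*t)) \<partial>\<nu>)"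
 proof (rule nn_integral_cong)
  fix Q assume Q: "Q \<in> space \<nu>"
  have "orthonormal p 1 (\<lambda>_. stiefel_col Q b)" using col[OF Q] by (simp add: orthonormal_def)
  from gauss_spike_Laplace[OF this, of 0 "2*t"] t
  show "(\<integral>\<^sup>+x. ennreal (exp (t*(ip p x (stiefel_col Q b))^2)) \<partial>G) = ennreal (1 / sqrt (1 - 2*t))"
   by (simp add: ip_commute)
 qed
 also have "... = ennreal (1 / sqrt (1 - 2*t))" by (simp add: prior.emeasure_space_1)
 finally show ?thesis .
qed

lemma prior_overlap_sum_Laplace:
 fixes \<epsilon> :: real
 assumes w: "orthonormal p r w" and \<epsilon>: "0 <= \<epsilon>" "\<epsilon>*r <= 1/2"
 shows "(\<integral>\<^sup>+Q. ennreal (exp (n*(\<epsilon>\<^sup>2*(\<Sum>a<r. \<Sum>b<r. (ip p (w a) (stiefel_col Q b))\<^sup>2)))) \<partial>\<nu>) <= 2"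
proof -
 define t where "t = (\<epsilon>*r)^2"
 have t: "0 <= t" "t <= 1/4" using power_mono[OF \<epsilon>(2), of 2] \<epsilon> by (auto simp: t_def power_divide)
 define A where "A = {..<r} \<times> {..<r}"
 have cA: "real (card A) = (real r)^2" by (simp add: A_def power2_eq_square)
 have r0: "0 < real r" using r1 by simp
 have pt: "exp (n*(\<epsilon>\<^sup>2*(\<Sum>a<r. \<Sum>b<r. (ip p (w a) (stiefel_col Q b))\<^sup>2))) <= (\<Sum>ab\<in>A. 1/(real r)^2*exp (t*p*(ip p (w (fst ab)) (stiefel_col Q (snd ab)))^2))" for Q
 proof -
  define m where "m ab = (ip p (w (fst ab)) (stiefel_col Q (snd ab)))^2" for ab
  have "real n*(\<epsilon>\<^sup>2*(\<Sum>a<r. \<Sum>b<r. (ip p (w a) (stiefel_col Q b))\<^sup>2)) = (\<Sum>ab\<in>A. 1/(real r)^2*(t*n*m ab))"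
   using r0 by (simp add: A_def sum.cartesian_product case_prod_beta m_def t_def power_mult_distrib sum_distrib_left mult_ac)
  also have "exp ... <= (\<Sum>ab\<in>A. 1/(real r)^2*exp (t*n*m ab))"
   using cA r0 by (intro exp_convex_mixture) (auto simp: A_def)
  also have "... <= (\<Sum>ab\<in>A. 1/(real r)^2*exp (t*p*m ab))"
  proof (intro sum_mono mult_left_mono)
   fix ab
   have "t*n*m ab <= t*p*m ab" using t np by (intro mult_right_mono mult_left_mono) (auto simp: m_def)
   thus "exp (t*n*m ab) <= exp (t*p*m ab)" by simp
  qed auto
  finally show ?thesis by (simp add: m_def)
 qed
 have "(\<integral>\<^sup>+Q. ennreal (exp (n*(\<epsilon>\<^sup>2*(\<Sum>a<r. \<Sum>b<r. (ip p (w a) (stiefel_col Q b))\<^sup>2)))) \<partial>\<nu>)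
   <= (\<integral>\<^sup>+Q. (\<Sum>ab\<in>A. ennreal (1/(real r)^2)*ennreal (exp (t*p*(ip p (w (fst ab)) (stiefel_col Q (snd ab)))^2))) \<partial>\<nu>)"
 proof (rule nn_integral_mono)
  fix Q
  have "ennreal (exp (n*(\<epsilon>\<^sup>2*(\<Sum>a<r. \<Sum>b<r. (ip p (w a) (stiefel_col Q b))\<^sup>2))))
   <= ennreal (\<Sum>ab\<in>A. 1/(real r)^2*exp (t*p*(ip p (w (fst ab)) (stiefel_col Q (snd ab)))^2))" by (rule ennreal_leI[OF pt])
  also have "... = (\<Sum>ab\<in>A. ennreal (1/(real r)^2*exp (t*p*(ip p (w (fst ab)) (stiefel_col Q (snd ab)))^2)))"
   by (rule sum_ennreal[symmetric]) auto
  also have "... = (\<Sum>ab\<in>A. ennreal (1/(real r)^2)*ennreal (exp (t*p*(ip p (w (fst ab)) (stiefel_col Q (snd ab)))^2)))"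
   by (intro sum.cong refl ennreal_mult) auto
  finally show "ennreal (exp (n*(\<epsilon>\<^sup>2*(\<Sum>a<r. \<Sum>b<r. (ip p (w a) (stiefel_col Q b))\<^sup>2)))) <= ..." .
 qed
 also have "... = (\<Sum>ab\<in>A. ennreal (1/(real r)^2)*(\<integral>\<^sup>+Q. ennreal (exp (t*p*(ip p (w (fst ab)) (stiefel_col Q (snd ab)))^2)) \<partial>\<nu>))"
 proof (subst nn_integral_sum)
  have m: "(\<lambda>Q. ennreal (exp (t*p*(ip p (w (fst ab)) (stiefel_col Q (snd ab)))^2))) \<in> borel_measurable \<nu>" if "ab \<in> A" for ab
   using prior_overlap_measurable[of "snd ab" "w (fst ab)"] that by (auto simp: A_def)
  show "(\<lambda>Q. ennreal (1/(real r)^2)*ennreal (exp (t*p*(ip p (w (fst ab)) (stiefel_col Q (snd ab)))^2))) \<in> borel_measurable \<nu>" if "ab \<in> A" for ab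
   using m[OF that] by measurable
  show "(\<Sum>ab\<in>A. \<integral>\<^sup>+Q. ennreal (1/(real r)^2)*ennreal (exp (t*p*(ip p (w (fst ab)) (stiefel_col Q (snd ab)))^2)) \<partial>\<nu>)
   = (\<Sum>ab\<in>A. ennreal (1/(real r)^2)*(\<integral>\<^sup>+Q. ennreal (exp (t*p*(ip p (w (fst ab)) (stiefel_col Q (snd ab)))^2)) \<partial>\<nu>))"
   by (intro sum.cong refl nn_integral_cmult m)
 qed
 also have "... <= (\<Sum>ab\<in>A. ennreal (1/(real r)^2)*ennreal 2)"
 proof (intro sum_mono mult_left_mono)
  fix ab assume ab: "ab \<in> A"
  have "(\<integral>\<^sup>+Q. ennreal (exp (t*p*(ip p (w (fst ab)) (stiefel_col Q (snd ab)))^2)) \<partial>\<nu>) <= ennreal (1 / sqrt (1 - 2*t))"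
   by (rule prior_overlap_Laplace) (use ab t orthonormalD[OF w] in \<open>auto simp: A_def\<close>)
  also have "... <= ennreal 2"
  proof (rule ennreal_leI)
   have "1/2 <= sqrt (1 - 2*t)" using t by (intro real_le_rsqrt) (simp add: power2_eq_square)
   moreover have "0 < sqrt (1 - 2*t)" using t by simp
   ultimately show "1 / sqrt (1 - 2*t) <= 2" by (simp add: pos_divide_le_eq)
  qed
  finally show "(\<integral>\<^sup>+Q. ennreal (exp (t*p*(ip p (w (fst ab)) (stiefel_col Q (snd ab)))^2)) \<partial>\<nu>) <= ennreal 2" .
 qed auto
 also have "ennreal (1/(real r)^2)*ennreal 2 = ennreal (1/(real r)^2*2)" by (rule ennreal_mult[symmetric]) auto
 also have "(\<Sum>ab\<in>A. ennreal (1/(real r)^2*2)) = ennreal (\<Sum>ab\<in>A. 1/(real r)^2*2)" by (rule sum_ennreal) simp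
 also have "(\<Sum>ab\<in>A. 1/(real r)^2*2) = 2" using r0 cA by simp
 finally show ?thesis by simp
qed

lemma null_prod_integral:
 fixes h :: "(nat => real) => ennreal"
 assumes "h \<in> borel_measurable G"
 shows "(\<integral>\<^sup>+X. (\<Prod>i=1..n. h (X i)) \<partial>null_law n p) = (\<integral>\<^sup>+x. h x \<partial>G) ^ n"
proof -
 interpret product_sigma_finite "\<lambda>_ :: nat. G" by (rule product_sigma_finite.intro) (rule row.sigma_finite_measure_axioms)
 show ?thesis unfolding null_law_gauss using product_nn_integral_prod[of "{1..n}" "\<lambda>_. h"] assms by simp
qed

text \<open>The rows are independent, so the overlap integral of one row is raised to the power
  \<open>n\<close>. By Bessel's inequality the squared overlaps sum to at most \<open>r\<close>,
  which reduces the smallness condition of \<open>gauss_two_spikes\<close> to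
  \<open>small\<close>.\<close>

lemma two_density_integral:
 assumes Q: "Q \<in> stiefel p r" and Q': "Q' \<in> stiefel p r" and small: "\<delta>/(1 - \<delta>)*r <= 1/2"
 shows "(\<integral>\<^sup>+X. ennreal (f Q X)*ennreal (f Q' X) \<partial>null_law n p)
  <= ennreal (exp (n*((\<delta>/(1 - \<delta>))^2*(\<Sum>a<r. \<Sum>b<r. (ip p (stiefel_col Q a) (stiefel_col Q' b))\<^sup>2))))"
proof -
 define \<epsilon> where "\<epsilon> = \<delta>/(1 - \<delta>)"
 have \<epsilon>0: "0 <= \<epsilon>" using \<delta> by (simp add: \<epsilon>_def)
 define F where "F = (\<Sum>a<r. \<Sum>b<r. (ip p (stiefel_col Q a) (stiefel_col Q' b))\<^sup>2)"
 let ?q = "\<lambda>Q x. exp (\<delta>/2*(\<Sum>a<r. (ip p (stiefel_col Q a) x)\<^sup>2))"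
 have "F <= (\<Sum>a<r. 1)" unfolding F_def
 proof (rule sum_mono)
  fix a assume a: "a \<in> {..<r}"
  have "(\<Sum>b<r. (ip p (stiefel_col Q' b) (stiefel_col Q a))\<^sup>2) <= ip p (stiefel_col Q a) (stiefel_col Q a)"
   by (rule Bessel[OF stiefel_orthonormal[OF Q']])
  thus "(\<Sum>b<r. (ip p (stiefel_col Q a) (stiefel_col Q' b))\<^sup>2) <= 1"
   using a orthonormalD[OF stiefel_orthonormal[OF Q], of a a] by (simp add: ip_commute)
 qed
 hence Fr: "F <= r" by simp
 have "real r*1 <= real r*real r" using r1 by (intro mult_left_mono) auto
 hence "\<epsilon>\<^sup>2*F <= \<epsilon>\<^sup>2*(real r*real r)" using Fr by (intro mult_left_mono) (linarith, simp)
 also have "... = (\<epsilon>*r)^2" by (simp add: power_mult_distrib power2_eq_square)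
 also have "... <= (1/2)^2" using small \<epsilon>0 unfolding \<epsilon>_def[symmetric] by (intro power_mono) auto
 finally have sm: "\<epsilon>\<^sup>2*F <= 1/2" by (simp add: power2_eq_square)
 define h where "h x = ennreal (sqrt (1 - \<delta>) ^ (2*r))*ennreal (?q Q x * ?q Q' x)" for x
 have hm: "h \<in> borel_measurable G" unfolding h_def by measurable
 have "ennreal (f Q X)*ennreal (f Q' X) = (\<Prod>i=1..n. h (X i))" for X
 proof -
  have "f Q X*f Q' X = (\<Prod>i=1..n. sqrt (1 - \<delta>) ^ (2*r)*(?q Q (X i) * ?q Q' (X i)))"
   unfolding spike_density_def prod.distrib[symmetric] mult_2 power_add by (intro prod.cong refl) (simp add: mult_ac)
  hence "ennreal (f Q X)*ennreal (f Q' X) = ennreal (\<Prod>i=1..n. sqrt (1 - \<delta>) ^ (2*r)*(?q Q (X i) * ?q Q' (X i)))"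
   using f_nonneg by (simp add: ennreal_mult[symmetric])
  also have "... = (\<Prod>i=1..n. ennreal (sqrt (1 - \<delta>) ^ (2*r)*(?q Q (X i) * ?q Q' (X i))))"
   using \<delta> by (intro prod_ennreal[symmetric]) auto
  finally show ?thesis using \<delta> by (simp add: h_def ennreal_mult)
 qed
 hence "(\<integral>\<^sup>+X. ennreal (f Q X)*ennreal (f Q' X) \<partial>null_law n p) = (\<integral>\<^sup>+x. h x \<partial>G) ^ n"
  using null_prod_integral[OF hm] by simp
 also have "(\<integral>\<^sup>+x. h x \<partial>G) <= ennreal (exp (\<epsilon>\<^sup>2*F))"
 proof -
  have "(\<integral>\<^sup>+x. h x \<partial>G) = ennreal (sqrt (1 - \<delta>) ^ (2*r))*(\<integral>\<^sup>+x. ennreal (?q Q x * ?q Q' x) \<partial>G)"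
   unfolding h_def by (rule nn_integral_cmult) measurable
  also have "... <= ennreal (sqrt (1 - \<delta>) ^ (2*r))*ennreal (exp (\<epsilon>\<^sup>2*F) / sqrt (1 - \<delta>) ^ (2*r))"
   unfolding F_def \<epsilon>_def
   by (intro mult_left_mono gauss_two_spikes stiefel_orthonormal Q Q' \<delta>) (use sm in \<open>simp_all add: \<epsilon>_def F_def\<close>)
  also have "... = ennreal (exp (\<epsilon>\<^sup>2*F))" using \<delta> by (subst ennreal_mult[symmetric]) auto
  finally show ?thesis .
 qed
 hence "(\<integral>\<^sup>+x. h x \<partial>G) ^ n <= ennreal (exp (\<epsilon>\<^sup>2*F)) ^ n" by (rule power_mono) simp
 also have "... = ennreal (exp (n*(\<epsilon>\<^sup>2*F)))" by (simp add: ennreal_power exp_of_nat_mult)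
 finally show ?thesis by (simp add: F_def \<epsilon>_def)
qed

text \<open>The likelihood ratio \<open>\<Lambda>\<close> averaged over the prior has second moment
  at most 2, by integrating the overlap of two independent draws. The pointwise bound 2 \<Lambda> <=
  s \<Lambda>^2 + 1/s on \<open>A\<close> then transfers small null probabilities, with
  \<open>s\<close> free to be optimised.\<close>

theorem alt_contiguity:
 fixes s :: real
 assumes small: "\<delta>/(1 - \<delta>)*r <= 1/2" and A: "A \<in> sets (data_space n p)" and s: "0 < s"
 shows "measure P1 A <= s + measure (null_law n p) A / s"
proof -
 interpret alt: prob_space P1 by (rule prob_space_alt)
 have A': "A \<in> sets (null_law n p)" using A by (simp add: sets_null_law)
 define \<Lambda> where "\<Lambda> X = (\<integral>\<^sup>+Q. ennreal (f Q X) \<partial>\<nu>)" for X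
 have \<Lambda>m [measurable]: "\<Lambda> \<in> borel_measurable (null_law n p)" unfolding \<Lambda>_def
  by (rule prior.borel_measurable_nn_integral)
   (use measurable_compose[OF measurable_pair_swap' joint_density_measurable] in \<open>simp add: case_prod_beta\<close>)
 have P1A: "emeasure P1 A = (\<integral>\<^sup>+X. \<Lambda> X*indicator A X \<partial>null_law n p)"
 proof -
  have "emeasure P1 A = (\<integral>\<^sup>+X. \<integral>\<^sup>+Q. ennreal (f Q X)*indicator A X \<partial>\<nu> \<partial>null_law n p)"
   unfolding alt_emeasure[OF A] by (rule joint.Fubini'[symmetric]) (use A' in measurable)
  also have "... = (\<integral>\<^sup>+X. \<Lambda> X*indicator A X \<partial>null_law n p)"
   unfolding \<Lambda>_def by (intro nn_integral_cong nn_integral_multc prior_density_measurable)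
  finally show ?thesis .
 qed
 have second: "(\<integral>\<^sup>+X. \<Lambda> X*\<Lambda> X \<partial>null_law n p) <= 2"
 proof -
  have "(\<integral>\<^sup>+X. \<Lambda> X*\<Lambda> X \<partial>null_law n p) = (\<integral>\<^sup>+X. \<integral>\<^sup>+Q. ennreal (f Q X)*\<Lambda> X \<partial>\<nu> \<partial>null_law n p)"
   unfolding \<Lambda>_def by (intro nn_integral_cong nn_integral_multc[symmetric] prior_density_measurable)
  also have "... = (\<integral>\<^sup>+Q. \<integral>\<^sup>+X. ennreal (f Q X)*\<Lambda> X \<partial>null_law n p \<partial>\<nu>)"
   by (rule joint.Fubini') measurable
  also have "... = (\<integral>\<^sup>+Q. \<integral>\<^sup>+X. \<integral>\<^sup>+Q'. ennreal (f Q X)*ennreal (f Q' X) \<partial>\<nu> \<partial>null_law n p \<partial>\<nu>)"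
   unfolding \<Lambda>_def by (intro nn_integral_cong nn_integral_cmult[symmetric] prior_density_measurable)
  also have "... = (\<integral>\<^sup>+Q. \<integral>\<^sup>+Q'. \<integral>\<^sup>+X. ennreal (f Q X)*ennreal (f Q' X) \<partial>null_law n p \<partial>\<nu> \<partial>\<nu>)"
  proof (rule nn_integral_cong)
   fix Q assume Q: "Q \<in> space \<nu>"
   have "(\<lambda>z. ennreal (f Q (snd z))) \<in> borel_measurable (\<nu> \<Otimes>\<^sub>M null_law n p)"
    by (rule measurable_compose[OF measurable_snd density_measurable[OF Q]])
   hence "(\<lambda>z. ennreal (f Q (snd z))*ennreal (f (fst z) (snd z))) \<in> borel_measurable (\<nu> \<Otimes>\<^sub>M null_law n p)"
    by (rule borel_measurable_times_ennreal) (rule joint_density_measurable)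
   thus "(\<integral>\<^sup>+X. \<integral>\<^sup>+Q'. ennreal (f Q X)*ennreal (f Q' X) \<partial>\<nu> \<partial>null_law n p) = (\<integral>\<^sup>+Q'. \<integral>\<^sup>+X. ennreal (f Q X)*ennreal (f Q' X) \<partial>null_law n p \<partial>\<nu>)"
    by (intro joint.Fubini') (simp add: case_prod_beta)
  qed
  also have "... <= (\<integral>\<^sup>+Q. \<integral>\<^sup>+Q'. ennreal (exp (n*((\<delta>/(1 - \<delta>))^2*(\<Sum>a<r. \<Sum>b<r. (ip p (stiefel_col Q a) (stiefel_col Q' b))\<^sup>2)))) \<partial>\<nu> \<partial>\<nu>)"
   by (intro nn_integral_mono two_density_integral small) (simp_all add: space_prior)
  also have "... <= (\<integral>\<^sup>+Q. 2 \<partial>\<nu>)"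
   by (intro nn_integral_mono prior_overlap_sum_Laplace stiefel_orthonormal small) (use \<delta> in \<open>auto simp: space_prior\<close>)
  also have "... = 2" by (simp add: prior.emeasure_space_1)
  finally show ?thesis .
 qed
 have "2*emeasure P1 A = (\<integral>\<^sup>+X. 2*(\<Lambda> X*indicator A X) \<partial>null_law n p)"
  unfolding P1A by (rule nn_integral_cmult[symmetric]) (use A' in measurable)
 also have "... <= (\<integral>\<^sup>+X. ennreal s*(\<Lambda> X*\<Lambda> X) + ennreal (1 / s)*indicator A X \<partial>null_law n p)"
 proof (rule nn_integral_mono)
  fix X
  \<comment> \<open>The square of s y - 1, divided by \<open>s\<close>. The infinite value is
    treated apart because \<open>\<Lambda>\<close> is extended-real valued.\<close>
  have "2*x <= ennreal s*(x*x) + ennreal (1 / s)" for x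
  proof (cases x)
   case (real y)
   have "0 <= (s*y - 1)^2 / s" using s by simp
   also have "(s*y - 1)^2 / s = s*(y*y) + 1 / s - 2*y" using s by (simp add: power2_eq_square field_simps)
   finally have "2*y <= s*(y*y) + 1 / s" by simp
   hence "ennreal (2*y) <= ennreal (s*(y*y) + 1 / s)" by (rule ennreal_leI)
   thus ?thesis using real s by (simp add: ennreal_mult)
  next
   case top
   thus ?thesis using s by (simp add: ennreal_mult_top ennreal_top_mult)
  qed
  from this[of "\<Lambda> X"] show "2*(\<Lambda> X*indicator A X) <= ennreal s*(\<Lambda> X*\<Lambda> X) + ennreal (1 / s)*indicator A X"
   by (cases "X \<in> A") auto
 qed
 also have "... = ennreal s*(\<integral>\<^sup>+X. \<Lambda> X*\<Lambda> X \<partial>null_law n p) + ennreal (1 / s)*emeasure (null_law n p) A"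
  using A' by (subst nn_integral_add) (auto simp: nn_integral_cmult)
 also have "... <= ennreal s*2 + ennreal (1 / s)*emeasure (null_law n p) A"
  by (intro add_right_mono mult_left_mono second) simp
 finally have "ennreal (2*measure P1 A) <= ennreal (s*2 + 1 / s*measure (null_law n p) A)"
 proof -
  let ?N = "measure (null_law n p) A"
  assume *: "2*emeasure P1 A <= ennreal s*2 + ennreal (1 / s)*emeasure (null_law n p) A"
  have "ennreal (s*2 + 1 / s * ?N) = ennreal (s*2) + ennreal (1 / s * ?N)" by (rule ennreal_plus) (use s in auto)
  also have "ennreal (s*2) = ennreal s*2" using s by (simp add: ennreal_mult)
  also have "ennreal (1 / s * ?N) = ennreal (1 / s)*ennreal ?N" by (rule ennreal_mult) (use s in auto)
  finally show ?thesis using*unfolding alt.emeasure_eq_measure null.emeasure_eq_measure by (simp add: ennreal_mult)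
 qed
 hence "2*measure P1 A <= s*2 + 1 / s*measure (null_law n p) A"
  using s by (subst (asm) ennreal_le_iff) auto
 moreover have "0 <= 1 / s*measure (null_law n p) A" using s by simp
 ultimately show ?thesis by (simp add: field_simps)
qed

text \<open>With D = 1 + 2\<theta>, each of the \<open>r\<close> spike directions contributes
  sqrt((1 - \<delta>)/(1 - \<delta>/D)), at most exp(-\<theta>\<delta>/2). This rests on
  \<theta>\<delta>(1 - 2\<theta> + \<delta>) >= 0, hence on \<theta> <= 1/2. Each of the
  \<open>p\<close> coordinates contributes D^(-1/2), expanded to second order.\<close>

lemma spike_Laplace_factor:
 fixes \<theta> :: real
 assumes \<theta>: "0 < \<theta>" "\<theta> <= 1/2"
 shows "sqrt (1 - \<delta>) ^ r*(1/(sqrt (1 + 2*\<theta>) ^ p * sqrt (1 - \<delta>/(1 + 2*\<theta>)) ^ r)) <= exp (p*(2*\<theta>\<^sup>2 - \<theta>) - r*(\<theta>*\<delta>/2))"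
proof -
 define D where "D = 1 + 2*\<theta>"
 have D: "1 < D" using \<theta> by (simp add: D_def)
 have se: "sqrt (exp x) = exp (x/2)" for x :: real
  by (rule real_sqrt_unique) (simp_all add: power2_eq_square exp_add[symmetric])
 have dD: "0 < 1 - \<delta>/D" using D \<delta> by simp
 have a: "1 - \<delta> <= exp (- (\<theta>*\<delta>))*(1 - \<delta>/D)"
 proof -
  have "0 <= \<theta>*\<delta>*(1 - 2*\<theta> + \<delta>)" using \<theta> \<delta> by simp
  hence "(1 - \<delta>)*D <= (1 - \<theta>*\<delta>)*(D - \<delta>)" by (simp add: D_def algebra_simps)
  hence "1 - \<delta> <= (1 - \<theta>*\<delta>)*(1 - \<delta>/D)" using D by (simp add: field_simps)
  also have "... <= exp (- (\<theta>*\<delta>))*(1 - \<delta>/D)"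
   using exp_ge_add_one_self[of "- (\<theta>*\<delta>)"] dD by (intro mult_right_mono) auto
  finally show ?thesis .
 qed
 have "sqrt (1 - \<delta>) <= exp (- (\<theta>*\<delta>)/2) * sqrt (1 - \<delta>/D)"
  using real_sqrt_le_mono[OF a] unfolding real_sqrt_mult se .
 hence "sqrt (1 - \<delta>) ^ r <= (exp (- (\<theta>*\<delta>)/2) * sqrt (1 - \<delta>/D)) ^ r" by (rule power_mono) (use \<delta> in simp)
 hence A: "sqrt (1 - \<delta>) ^ r / sqrt (1 - \<delta>/D) ^ r <= exp (- (\<theta>*\<delta>)/2) ^ r"
  using dD by (simp add: power_mult_distrib divide_le_eq)
 have "2*\<theta> - (2*\<theta>)\<^sup>2 <= ln (1 + 2*\<theta>)" by (rule ln_one_plus_pos_lower_bound) (use \<theta> in auto)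
 hence "exp (2*\<theta> - (2*\<theta>)\<^sup>2) <= D" using D by (simp add: D_def ln_ge_iff)
 hence "exp ((2*\<theta> - (2*\<theta>)\<^sup>2)/2) <= sqrt D" unfolding se[symmetric] by (rule real_sqrt_le_mono)
 hence "1 / sqrt D <= 1/exp ((2*\<theta> - (2*\<theta>)\<^sup>2)/2)" using D by (intro divide_left_mono) auto
 also have "... = exp (2*\<theta>\<^sup>2 - \<theta>)" unfolding inverse_eq_divide[symmetric] exp_minus[symmetric] by (simp add: power_mult_distrib diff_divide_distrib)
 finally have "(1 / sqrt D) ^ p <= exp (2*\<theta>\<^sup>2 - \<theta>) ^ p" by (rule power_mono) (use D in simp)
 hence "sqrt (1 - \<delta>) ^ r / sqrt (1 - \<delta>/D) ^ r*(1 / sqrt D) ^ p <= exp (- (\<theta>*\<delta>)/2) ^ r*exp (2*\<theta>\<^sup>2 - \<theta>) ^ p"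
  using A \<delta> dD D by (intro mult_mono) auto
 also have "... = exp (p*(2*\<theta>\<^sup>2 - \<theta>) - r*(\<theta>*\<delta>/2))"
  unfolding exp_of_nat_mult[symmetric] exp_add[symmetric] by (simp add: algebra_simps)
 finally show ?thesis unfolding D_def[symmetric] by (simp add: power_one_over mult_ac)
qed

text \<open>Chernoff's bound conditionally on \<open>Q\<close>. The Laplace transform of the trace
  depends on \<open>Q\<close> only through the orthonormality of its columns, so the same bound
  survives averaging over the prior.\<close>

theorem alt_trace_lower_tail:
 fixes \<theta> c :: real
 assumes \<theta>: "0 < \<theta>" "\<theta> <= 1/2"
 shows "measure P1 {X \<in> space (data_space n p). (\<Sum>i=1..n. \<Sum>j<p. (X i j)\<^sup>2) < n*c} <= exp (n*(\<theta>*c + p*(2*\<theta>\<^sup>2 - \<theta>) - r*(\<theta>*\<delta>/2)))"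
proof -
 interpret alt: prob_space P1 by (rule prob_space_alt)
 define S where "S X = (\<Sum>i=1..n. \<Sum>j<p. (X i j)\<^sup>2)" for X :: "nat => nat => real"
 have Sm: "S \<in> borel_measurable (data_space n p)" unfolding S_def
  by (intro borel_measurable_sum borel_measurable_power measurable_entry) auto
 define A where "A = {X \<in> space (data_space n p). S X < n*c}"
 have A: "A \<in> sets (data_space n p)" unfolding A_def using Sm by measurable
 define k where "k = exp (p*(2*\<theta>\<^sup>2 - \<theta>) - r*(\<theta>*\<delta>/2))"
 have "emeasure P1 A <= (\<integral>\<^sup>+Q. ennreal (exp (\<theta>*(n*c)) * k ^ n) \<partial>\<nu>)"
  unfolding alt_emeasure[OF A]
 proof (rule nn_integral_mono)
  fix Q assume "Q \<in> space \<nu>"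
  hence Q: "Q \<in> stiefel p r" by (simp add: space_prior)
  let ?q = "\<lambda>x :: nat => real. exp (- \<theta>*(\<Sum>j<p. (x j)\<^sup>2) + \<delta>/2*(\<Sum>a<r. (ip p (stiefel_col Q a) x)\<^sup>2))"
  define h where "h x = ennreal (sqrt (1 - \<delta>) ^ r)*ennreal (?q x)" for x
  have qm: "(\<lambda>x. ennreal (?q x)) \<in> borel_measurable G"
  proof -
   have "(\<lambda>x. \<Sum>j<p. (x j)\<^sup>2) \<in> borel_measurable G" by (intro borel_measurable_sum borel_measurable_power measurable_gauss_component)
   thus ?thesis by measurable
  qed
  hence hm: "h \<in> borel_measurable G" unfolding h_def by measurable
  have "(\<integral>\<^sup>+X. ennreal (f Q X)*indicator A X \<partial>null_law n p) <= (\<integral>\<^sup>+X. ennreal (exp (\<theta>*(n*c)))*(\<Prod>i=1..n. h (X i)) \<partial>null_law n p)"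
  proof (rule nn_integral_mono)
   fix X
   have "(\<Prod>i=1..n. h (X i)) = ennreal (\<Prod>i=1..n. sqrt (1 - \<delta>) ^ r * ?q (X i))"
    unfolding h_def using \<delta> by (subst prod_ennreal[symmetric]) (auto simp: ennreal_mult)
   also have "(\<Prod>i=1..n. sqrt (1 - \<delta>) ^ r * ?q (X i)) = f Q X*exp (- \<theta>*S X)"
    unfolding spike_density_def S_def sum_distrib_left exp_sum[OF finite_atLeastAtMost] prod.distrib[symmetric]
    by (intro prod.cong refl) (simp add: exp_add sum_distrib_left)
   finally have e: "ennreal (exp (\<theta>*(n*c)))*(\<Prod>i=1..n. h (X i)) = ennreal (f Q X*exp (\<theta>*(n*c - S X)))"
    using f_nonneg by (simp add: ennreal_mult[symmetric] exp_add[symmetric] right_diff_distrib exp_diff exp_minus field_simps)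
   show "ennreal (f Q X)*indicator A X <= ennreal (exp (\<theta>*(n*c)))*(\<Prod>i=1..n. h (X i))"
   proof (cases "X \<in> A")
    case True
    hence "1 <= exp (\<theta>*(n*c - S X))" using \<theta> by (simp add: A_def)
    hence "f Q X*1 <= f Q X*exp (\<theta>*(n*c - S X))" by (intro mult_left_mono f_nonneg)
    thus ?thesis unfolding e using True by (simp add: ennreal_leI)
   qed simp
  qed
  also have "... = ennreal (exp (\<theta>*(n*c)))*(\<integral>\<^sup>+x. h x \<partial>G) ^ n"
  proof -
   have "(\<lambda>X. h (X i)) \<in> borel_measurable (null_law n p)" if "i \<in> {1..n}" for i
    unfolding null_law_gauss by (rule measurable_compose[OF measurable_component_singleton[OF that] hm])
   hence "(\<lambda>X. \<Prod>i=1..n. h (X i)) \<in> borel_measurable (null_law n p)" by (intro borel_measurable_prod_ennreal) auto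
   thus ?thesis by (subst nn_integral_cmult) (simp_all only: null_prod_integral[OF hm])
  qed
  also have "(\<integral>\<^sup>+x. h x \<partial>G) <= ennreal k"
  proof -
   have "(\<integral>\<^sup>+x. h x \<partial>G) = ennreal (sqrt (1 - \<delta>) ^ r)*ennreal (1/(sqrt (1 - 2*(- \<theta>)) ^ p * sqrt (1 - \<delta>/(1 - 2*(- \<theta>))) ^ r))"
    unfolding h_def using \<theta> \<delta> gauss_spike_Laplace[OF stiefel_orthonormal[OF Q], of "- \<theta>" \<delta>]
    by (subst nn_integral_cmult[OF qm]) simp_all
   also have "... = ennreal (sqrt (1 - \<delta>) ^ r*(1/(sqrt (1 + 2*\<theta>) ^ p * sqrt (1 - \<delta>/(1 + 2*\<theta>)) ^ r)))"
   proof -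
    have e: "1 - 2 * - \<theta> = 1 + 2*\<theta>" by simp
    show ?thesis unfolding e by (rule ennreal_mult'[symmetric]) (use \<delta> in simp)
   qed
   also have "... <= ennreal k" unfolding k_def by (rule ennreal_leI[OF spike_Laplace_factor[OF \<theta>]])
   finally show ?thesis .
  qed
  hence "ennreal (exp (\<theta>*(n*c)))*(\<integral>\<^sup>+x. h x \<partial>G) ^ n <= ennreal (exp (\<theta>*(n*c)))*ennreal k ^ n"
   by (intro mult_left_mono power_mono) auto
  also have "... = ennreal (exp (\<theta>*(n*c)) * k ^ n)" by (simp add: ennreal_power ennreal_mult k_def)
  finally show "(\<integral>\<^sup>+X. ennreal (f Q X)*indicator A X \<partial>null_law n p) <= ennreal (exp (\<theta>*(n*c)) * k ^ n)" .
 qed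
 also have "... = ennreal (exp (\<theta>*(n*c)) * k ^ n)" by (simp add: prior.emeasure_space_1)
 also have "exp (\<theta>*(n*c)) * k ^ n = exp (n*(\<theta>*c + p*(2*\<theta>\<^sup>2 - \<theta>) - r*(\<theta>*\<delta>/2)))"
  unfolding k_def exp_of_nat_mult[symmetric] exp_add[symmetric] by (simp add: algebra_simps)
 finally show ?thesis unfolding A_def S_def alt.emeasure_eq_measure by simp
qed

end

section \<open>Assembling the asymptotics\<close>

lemma cusum_rejects_eq:
 assumes "1 <= n"
 shows "cusum_rejects n p = {X \<in> space (data_space n p). \<exists>k\<in>{1..n}. L_tilde n*(real k/real n) powr (2/3) <= centred_sum n p k X}"
proof -
 have "L_tilde n <= cusum_stat n p X \<longleftrightarrow> (\<exists>k\<in>{1..n}. L_tilde n*(real k/real n) powr (2/3) <= centred_sum n p k X)" for X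
 proof -
  have "L_tilde n <= cusum_stat n p X \<longleftrightarrow> (\<exists>k\<in>{1..n}. L_tilde n <= centred_sum n p k X/(real k/real n) powr (2/3))"
   unfolding cusum_stat_def by (subst Max_ge_iff) (use assms in auto)
  also have "... \<longleftrightarrow> (\<exists>k\<in>{1..n}. L_tilde n*(real k/real n) powr (2/3) <= centred_sum n p k X)"
  proof (intro bex_cong refl)
   fix k assume "k \<in> {1..n}"
   hence "0 < (real k/real n) powr (2/3)" by simp
   thus "L_tilde n <= centred_sum n p k X/(real k/real n) powr (2/3) \<longleftrightarrow> L_tilde n*(real k/real n) powr (2/3) <= centred_sum n p k X"
    by (rule pos_le_divide_eq)
  qed
  finally show ?thesis .
 qed
 thus ?thesis by (simp add: cusum_rejects_def)
qed

lemma centred_sum_measurable: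
 assumes "1 <= n" "n <= p" "k \<in> {1..n}"
 shows "centred_sum n p k \<in> borel_measurable (data_space n p)"
proof -
 have [measurable]: "partial_sum n p k \<in> borel_measurable (data_space n p)"
  by (rule borel_measurable_partial_sum) (use assms in auto)
 show ?thesis unfolding centred_sum_def[abs_def] by measurable
qed

lemma cusum_rejects_sets:
 assumes "1 <= n" "n <= p"
 shows "cusum_rejects n p \<in> sets (data_space n p)"
 unfolding cusum_rejects_eq[OF assms(1)]
proof (rule sets.sets_Collect_finite_Ex)
 fix k assume "k \<in> {1..n}"
 note [measurable] = centred_sum_measurable[OF assms this]
 show "{X \<in> space (data_space n p). L_tilde n*(real k/real n) powr (2/3) <= centred_sum n p k X} \<in> sets (data_space n p)"
  by measurable
qed auto

text \<open>
 With \<open>L = ln^2 n\<close> the failure probability of the rigidity estimate is superpolynomially small,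
 while its width stays polylogarithmic and hence below any multiple of \<open>L_tilde n\<close>.
\<close>

lemma rigidity_asymptotics:
 fixes \<Gamma> :: real
 assumes \<Gamma>: "1 <= \<Gamma>"
 shows "\<forall>\<^sub>F n in sequentially. 2 ^ 20*\<Gamma>\<^sup>2*((ln (real n))^2) ^ 4 <= real n"
  and "\<forall>\<^sub>F n in sequentially. 1 <= (ln (real n))^2"
  and "\<forall>\<^sub>F n in sequentially. 16*(2*root 3 (real n)) <= real n"
  and "\<forall>\<^sub>F n in sequentially. 6*real n*exp (8 - (ln (real n))\<^sup>2/(80*\<Gamma>)) + 2*real n*exp (8 - (ln (real n))\<^sup>2/4) <= 1/(real n)^2"
  and "\<forall>\<^sub>F n in sequentially. 64*(\<Gamma>*real n)^2/real n ^ 4 + (real n ^ 4 + 8*\<Gamma>\<^sup>2*real n)*(6*real n*exp (8 - (ln (real n))\<^sup>2/(80*\<Gamma>))) <= 1/real n"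
  and "\<forall>\<^sub>F n in sequentially. (ln (real n))\<^sup>2*(5000000*\<Gamma>\<^sup>2*((ln (real n))^2) ^ 4 * sqrt (1 + ln (real n))) + 1 < L_tilde n"
proof -
 have \<Gamma>0: "0 < \<Gamma>" using \<Gamma> by simp
 show "\<forall>\<^sub>F n in sequentially. 2 ^ 20*\<Gamma>\<^sup>2*((ln (real n))^2) ^ 4 <= real n" using \<Gamma>0 by real_asymp
 show "\<forall>\<^sub>F n in sequentially. 1 <= (ln (real n))^2" by real_asymp
 have "\<forall>\<^sub>F n in sequentially. 16*(2*real n powr (1/3)) <= real n" by real_asymp
 thus "\<forall>\<^sub>F n in sequentially. 16*(2*root 3 (real n)) <= real n"
  using eventually_gt_at_top[of 0] by eventually_elim (simp add: root_powr_inverse)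
 show "\<forall>\<^sub>F n in sequentially. 6*real n*exp (8 - (ln (real n))\<^sup>2/(80*\<Gamma>)) + 2*real n*exp (8 - (ln (real n))\<^sup>2/4) <= 1/(real n)^2"
 proof -
  have "\<forall>\<^sub>F n in sequentially. 6*real n*exp (8 - (ln (real n))\<^sup>2/(80*\<Gamma>)) <= 1/(2*(real n)^2)" using \<Gamma>0 by real_asymp
  moreover have "\<forall>\<^sub>F n in sequentially. 2*real n*exp (8 - (ln (real n))\<^sup>2/4) <= 1/(2*(real n)^2)" by real_asymp
  ultimately show ?thesis by eventually_elim (simp add: field_simps)
 qed
 show "\<forall>\<^sub>F n in sequentially. 64*(\<Gamma>*real n)^2/real n ^ 4 + (real n ^ 4 + 8*\<Gamma>\<^sup>2*real n)*(6*real n*exp (8 - (ln (real n))\<^sup>2/(80*\<Gamma>))) <= 1/real n"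
  using \<Gamma>0 by real_asymp
 have "\<forall>\<^sub>F n in sequentially. (ln (real n))\<^sup>2*(5000000*\<Gamma>\<^sup>2*((ln (real n))^2) ^ 4 * sqrt (1 + ln (real n))) + 1 < ln (real n) powr 12"
  using \<Gamma>0 by real_asymp
 \<comment> \<open>The width just bounded is of order (ln n)^(21/2). The power 12 is a convenient
   one above it, and the exponent of \<open>L_tilde\<close> tends to infinity.\<close>
 moreover have "\<forall>\<^sub>F n in sequentially. ln (real n) powr 12 <= L_tilde n" unfolding L_tilde_def by real_asymp
 ultimately show "\<forall>\<^sub>F n in sequentially. (ln (real n))\<^sup>2*(5000000*\<Gamma>\<^sup>2*((ln (real n))^2) ^ 4 * sqrt (1 + ln (real n))) + 1 < L_tilde n"
  by eventually_elim simp
qed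

text \<open>The bound 1/n^2 is what the change of measure consumes: with s = 1/n it costs a factor n
  and still leaves 1/n.\<close>

lemma null_rigidity:
 fixes p :: "nat => nat" and \<Gamma> :: real
 assumes \<Gamma>: "1 <= \<Gamma>" and p_ge: "!!n. n \<ge> 1 ==> p n \<ge> n" and p_le: "\<forall>\<^sub>F n in sequentially. real (p n) <= \<Gamma>*n"
 shows "\<forall>\<^sub>F n in sequentially. measure (null_law n (p n)) {X \<in> space (data_space n (p n)). \<exists>k\<in>{1..n}.
  L_tilde n*(real k/real n) powr (2/3) <= \<bar>centred_sum n (p n) k X\<bar>} <= 1/(real n)^2"
 using rigidity_asymptotics[OF \<Gamma>] p_le eventually_ge_at_top[of 1]
proof eventually_elim
 case (elim n)
 interpret null: prob_space "null_law n (p n)" by (rule prob_space_null_law)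
 \<comment> \<open>Fixes the free parameters: \<open>y\<close> is the Airy length, \<open>l\<close>
   its integer rounding as block length, and \<open>x k\<close> the energy scale parameter whose
   square is the normalisation of the statistic.\<close>
 define L where "L = (ln (real n))^2"
 define y where "y = root 3 (real n)"
 define l where "l = nat \<lceil>y\<rceil>"
 define x where "x k = root 3 (real k/real n)" for k :: nat
 have n1: "1 <= n" and n0: "0 < real n" using elim by auto
 have np: "n <= p n" by (rule p_ge[OF n1])
 have y1: "1 <= y" unfolding y_def using n1 by simp
 have y: "y ^ 3 = n" "1 <= y" "y <= l" "l <= 2*y"
 proof -
  show "y ^ 3 = n" by (simp add: y_def)
  show "y <= l" unfolding l_def by (rule real_nat_ceiling_ge)
  have "real l < y + 1" unfolding l_def using y1 by linarith
  thus "l <= 2*y" using y1 by simp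
 qed (rule y1)
 have l: "1 <= l" "16*l <= n"
 proof -
  have "1 <= real l" using y by linarith
  thus "1 <= l" by simp
  have "16*real l <= real n" using y(4) elim(3) unfolding y_def by linarith
  thus "16*l <= n" by linarith
 qed
 have x: "0 < x k \<and> x k ^ 3*n = k" if "1 <= k" "k <= n" for k
  using that n0 by (simp add: x_def)
 have x2: "(x k)^2 = (real k/real n) powr (2/3)" if "k \<in> {1..n}" for k
 proof -
  have "0 < real k/real n" using that n0 by simp
  thus ?thesis unfolding x_def by (simp add: root_powr_inverse power2_eq_square powr_add[symmetric])
 qed
 \<comment> \<open>The truncation level is R = n^4: the second-moment term is then of order n^(-2),
   and the polynomial factors of the other term are beaten by exp(-(ln n)^2/(80 \<Gamma>)).\<close>
 have \<epsilon>: "64*(real (p n))^2/real n ^ 4 + (real n ^ 4 + 8*\<Gamma>\<^sup>2*n)*(6*real n*exp (8 - L/(80*\<Gamma>))) <= 1/real n"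
 proof -
  have "64*(real (p n))^2/real n ^ 4 <= 64*(\<Gamma>*real n)^2/real n ^ 4"
   using elim by (intro divide_right_mono mult_left_mono power_mono) auto
  thus ?thesis using elim(5) by (simp only: L_def)
 qed
 have le: "measure (null_law n (p n)) {X \<in> space (data_space n (p n)). \<exists>k\<in>{1..n}.
   L*(5000000*\<Gamma>\<^sup>2*L ^ 4 * sqrt (1 + ln n)*(x k)^2) + 1/real n < \<bar>centred_sum n (p n) k X\<bar>}
   <= 6*real n*exp (8 - L/(80*\<Gamma>)) + 2*real n*exp (8 - L/4)"
  by (rule null_deviation[OF np _ \<Gamma> _ _ l x y _ \<epsilon>]) (use elim n0 in \<open>simp_all add: L_def\<close>)
 have "measure (null_law n (p n)) {X \<in> space (data_space n (p n)). \<exists>k\<in>{1..n}.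
   L_tilde n*(real k/real n) powr (2/3) <= \<bar>centred_sum n (p n) k X\<bar>}
  <= measure (null_law n (p n)) {X \<in> space (data_space n (p n)). \<exists>k\<in>{1..n}.
   L*(5000000*\<Gamma>\<^sup>2*L ^ 4 * sqrt (1 + ln n)*(x k)^2) + 1/real n < \<bar>centred_sum n (p n) k X\<bar>}"
 proof (rule null.finite_measure_mono)
  have "{X \<in> space (data_space n (p n)). \<exists>k\<in>{1..n}.
   L*(5000000*\<Gamma>\<^sup>2*L ^ 4 * sqrt (1 + ln n)*(x k)^2) + 1/real n < \<bar>centred_sum n (p n) k X\<bar>} \<in> sets (data_space n (p n))"
  proof (rule sets.sets_Collect_finite_Ex)
   fix k assume "k \<in> {1..n}"
   note [measurable] = centred_sum_measurable[OF n1 np this]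
   show "{X \<in> space (data_space n (p n)). L*(5000000*\<Gamma>\<^sup>2*L ^ 4 * sqrt (1 + ln n)*(x k)^2) + 1/real n < \<bar>centred_sum n (p n) k X\<bar>} \<in> sets (data_space n (p n))"
    by measurable
  qed auto
  thus "{X \<in> space (data_space n (p n)). \<exists>k\<in>{1..n}.
   L*(5000000*\<Gamma>\<^sup>2*L ^ 4 * sqrt (1 + ln n)*(x k)^2) + 1/real n < \<bar>centred_sum n (p n) k X\<bar>} \<in> null.events"
   by (simp only: sets_null_law)
  \<comment> \<open>The additive error 1/n is at most k/n and hence at most (k/n)^(2/3), so it costs
    just one unit of the coefficient.\<close>
  have th: "L*(5000000*\<Gamma>\<^sup>2*L ^ 4 * sqrt (1 + ln n)*(x k)^2) + 1/real n < L_tilde n*(real k/real n) powr (2/3)" if k: "k \<in> {1..n}" for k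
  proof -
   define z where "z = (x k)^2"
   have z0: "0 < z" using x[of k] k by (simp add: z_def)
   have "1/real n <= real k/real n" using k n0 by (intro divide_right_mono) auto
   also have "real k/real n = (real k/real n) powr 1" using k n0 by simp
   also have "... <= (real k/real n) powr (2/3)" using k n0 by (intro powr_mono') auto
   also have "... = z" using x2[OF k] by (simp add: z_def)
   finally have "1/real n <= z" .
   hence "L*(5000000*\<Gamma>\<^sup>2*L ^ 4 * sqrt (1 + ln n)*z) + 1/real n <= (L*(5000000*\<Gamma>\<^sup>2*L ^ 4 * sqrt (1 + ln n)) + 1)*z"
    by (simp add: algebra_simps)
   also have "... < L_tilde n*z" using elim(6) z0 unfolding L_def by (intro mult_strict_right_mono)
   finally show ?thesis unfolding x2[OF k, symmetric] z_def .
  qed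
  show "{X \<in> space (data_space n (p n)). \<exists>k\<in>{1..n}. L_tilde n*(real k/real n) powr (2/3) <= \<bar>centred_sum n (p n) k X\<bar>}
   \<subseteq> {X \<in> space (data_space n (p n)). \<exists>k\<in>{1..n}.
   L*(5000000*\<Gamma>\<^sup>2*L ^ 4 * sqrt (1 + ln n)*(x k)^2) + 1/real n < \<bar>centred_sum n (p n) k X\<bar>}"
   using less_le_trans[OF th] by blast
 qed
 also note le
 also have "6*real n*exp (8 - L/(80*\<Gamma>)) + 2*real n*exp (8 - L/4) <= 1/(real n)^2" using elim(4) by (simp only: L_def)
 finally show ?case .
qed

lemma null_trace_mean_le:
 assumes n: "1 <= n" and np: "n <= p"
 shows "(\<integral>X. partial_sum n p n X \<partial>null_law n p) <= p"
proof -
 interpret null: prob_space "null_law n p" by (rule prob_space_null_law)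
 note pm = borel_measurable_partial_sum[OF n np]
 have n0: "0 < real n" using n by simp
 have Sm: "(\<lambda>X. ennreal ((\<Sum>i=1..n. \<Sum>j<p. (X i j)\<^sup>2))) \<in> borel_measurable (data_space n p)"
  by (intro measurable_compose[OF _ measurable_ennreal] borel_measurable_sum borel_measurable_power measurable_entry) auto
 have "(\<integral>\<^sup>+X. ennreal (real n*partial_sum n p n X) \<partial>null_law n p) = (\<integral>\<^sup>+X. ennreal (\<Sum>i=1..n. \<Sum>j<p. (X i j)\<^sup>2) \<partial>null_law n p)"
  by (simp only: partial_sum_eq_trace[OF n np])
 also have "... = (\<integral>\<^sup>+\<xi>. ennreal (\<Sum>i=1..n. \<Sum>j<p. (curry_grid n p \<xi> i j)\<^sup>2) \<partial>gauss (grid n p))"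
  unfolding null_law_distr[OF n np] using Sm by (intro nn_integral_distr curry_grid_measurable) (simp_all add: sets_gauss)
 also have "... = (\<integral>\<^sup>+\<xi>. ennreal (\<Sum>q\<in>grid n p. (\<xi> q)\<^sup>2) \<partial>gauss (grid n p))"
 proof (rule nn_integral_cong)
  fix \<xi>
  have "(\<Sum>i=1..n. \<Sum>j<p. (curry_grid n p \<xi> i j)\<^sup>2) = (\<Sum>i=1..n. \<Sum>j<p. (\<xi> (i, j))\<^sup>2)"
   by (intro sum.cong refl) (simp add: curry_grid_def)
  thus "ennreal (\<Sum>i=1..n. \<Sum>j<p. (curry_grid n p \<xi> i j)\<^sup>2) = ennreal (\<Sum>q\<in>grid n p. (\<xi> q)\<^sup>2)"
   by (simp add: sum.cartesian_product case_prod_beta)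
 qed
 also have "... = (\<integral>\<^sup>+x. ennreal (x^2) \<partial>chi (grid n p))"
  unfolding chi_def by (subst nn_integral_distr[OF measurable_sqnorm]) (auto simp: sum_nonneg)
 also have "... = ennreal (real n*real p)"
  by (subst nn_integral_chi_sq) (simp_all add: card_cartesian_product ennreal_of_nat_eq_real_of_nat)
 finally have "(\<integral>\<^sup>+X. ennreal (real n*partial_sum n p n X) \<partial>null_law n p) = ennreal (real n*real p)" .
 hence "(\<integral>X. real n*partial_sum n p n X \<partial>null_law n p) = real n*real p"
  using pm partial_sum_nonneg[OF n np] by (subst integral_eq_nn_integral) (auto simp: sets_null_law cong: measurable_cong_sets)
 thus ?thesis using n0 by simp
qed

theorem theorem1p2:
  fixes \<alpha> \<beta> \<gamma> :: real and p r :: "nat \<Rightarrow> nat" and \<delta> :: "nat \<Rightarrow> real"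
    and \<nu> :: "nat \<Rightarrow> real mat measure"
  assumes "0 < \<alpha>" "\<alpha> < 1" and "0 < \<beta>" "\<beta> < 1" and "\<gamma> \<ge> 1"
    and p_ge: "\<And>n. n \<ge> 1 \<Longrightarrow> p n \<ge> n"
    and p_lim: "(\<lambda>n. real (p n) / real n) \<longlonglongrightarrow> \<gamma>"
    and r_round: "\<And>n. n \<ge> 1 \<Longrightarrow> \<bar>real (r n) - real n powr (1 - \<beta>)\<bar> < 1"
    and \<delta>: "\<And>n. n \<ge> 1 \<Longrightarrow> \<delta> n = real n powr (- \<alpha>)"
    and \<nu>: "\<And>n. n \<ge> 1 \<Longrightarrow> uniform_on_stiefel (p n) (r n) (\<nu> n)"
  shows "(\<alpha> + \<beta> < 1 \<longrightarrow>
            (\<lambda>n. test_level n (p n) (cusum_rejects n (p n))) \<longlonglongrightarrow> 0 \<and>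
            (\<lambda>n. test_power n (p n) (\<delta> n) (\<nu> n) (cusum_rejects n (p n))) \<longlonglongrightarrow> 1) \<and>
         (\<alpha> + \<beta> > 1 \<longrightarrow>
            (\<exists>C > 0. \<forall>\<^sub>F n in sequentially.
               measure (alt_law n (p n) (\<delta> n) (\<nu> n))
                 {X \<in> space (data_space n (p n)). \<forall>k\<in>{1..n}.
                    \<bar>centred_sum n (p n) k X\<bar> \<le> C * L_tilde n * (real k / real n) powr (2/3)}
               \<ge> 1 - C * ln (real n) * real n powr (1 - (\<alpha> + \<beta>))))"
proof -
 note \<delta>_eq = \<delta>
 \<comment> \<open>Any constant above the limit bounds p/n eventually; the added 1 provides the
   room.\<close>
 define \<Gamma> where "\<Gamma> = \<gamma> + 1"
 have \<Gamma>: "1 <= \<Gamma>" "0 < \<Gamma>" using \<open>\<gamma> \<ge> 1\<close> by (auto simp: \<Gamma>_def)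
 have p_le: "\<forall>\<^sub>F n in sequentially. real (p n) <= \<Gamma>*n"
 proof -
  have "\<forall>\<^sub>F n in sequentially. real (p n)/real n < \<Gamma>"
   by (rule order_tendstoD(2)[OF p_lim]) (simp add: \<Gamma>_def)
  thus ?thesis using eventually_gt_at_top[of 0] by eventually_elim (simp add: field_simps)
 qed
 have r_bounds: "\<forall>\<^sub>F n in sequentially. real n powr (1 - \<beta>)/2 <= r n \<and> real (r n) <= 2*real n powr (1 - \<beta>) \<and> 1 <= r n"
 proof -
  have "\<forall>\<^sub>F n in sequentially. 2 <= real n powr (1 - \<beta>)" using \<open>\<beta> < 1\<close> by real_asymp
  thus ?thesis using eventually_ge_at_top[of 1]
  proof eventually_elim
   case (elim n)
   thus ?case using r_round[of n] by (auto simp: abs_less_iff)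
  qed
 qed
 have \<delta>_bounds: "\<forall>\<^sub>F n in sequentially. 0 < \<delta> n \<and> \<delta> n <= 1/2"
 proof -
  have "\<forall>\<^sub>F n in sequentially. real n powr (- \<alpha>) <= 1/2" using \<open>0 < \<alpha>\<close> by real_asymp
  thus ?thesis using eventually_ge_at_top[of 1] by eventually_elim (simp add: \<delta>)
 qed
 have model: "\<forall>\<^sub>F n in sequentially. spiked_model n (p n) (r n) (\<delta> n) (\<nu> n)"
  using r_bounds \<delta>_bounds eventually_ge_at_top[of 1]
  by eventually_elim (unfold_locales, use p_ge \<nu> in auto)
 have rigid: "\<forall>\<^sub>F n in sequentially. measure (null_law n (p n)) {X \<in> space (data_space n (p n)). \<exists>k\<in>{1..n}.
  L_tilde n*(real k/real n) powr (2/3) <= \<bar>centred_sum n (p n) k X\<bar>} <= 1/(real n)^2"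
  by (rule null_rigidity[OF \<Gamma>(1) p_ge p_le])
 define bad where "bad n = {X \<in> space (data_space n (p n)). \<exists>k\<in>{1..n}. L_tilde n*(real k/real n) powr (2/3) <= \<bar>centred_sum n (p n) k X\<bar>}" for n
 have bad_sets: "bad n \<in> sets (data_space n (p n))" if n: "1 <= n" for n
  unfolding bad_def
 proof (rule sets.sets_Collect_finite_Ex)
  fix k assume "k \<in> {1..n}"
  note [measurable] = centred_sum_measurable[OF n p_ge[OF n] this]
  show "{X \<in> space (data_space n (p n)). L_tilde n*(real k/real n) powr (2/3) <= \<bar>centred_sum n (p n) k X\<bar>} \<in> sets (data_space n (p n))"
   by measurable
 qed auto
 have rn_\<delta>: "real n powr (1 - \<beta>)*real n powr (- \<alpha>) = real n powr (1 - (\<alpha> + \<beta>))" for n :: nat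
  by (simp add: powr_add[symmetric] algebra_simps)
 show ?thesis
 proof (intro conjI impI)
  assume ab: "\<alpha> + \<beta> < 1"
  show "(\<lambda>n. test_level n (p n) (cusum_rejects n (p n))) \<longlonglongrightarrow> 0"
  proof (rule tendsto_sandwich[OF _ _ tendsto_const])
   show "\<forall>\<^sub>F n in sequentially. 0 <= test_level n (p n) (cusum_rejects n (p n))" by (simp add: test_level_def)
   show "\<forall>\<^sub>F n in sequentially. test_level n (p n) (cusum_rejects n (p n)) <= 1/(real n)^2"
    using rigid eventually_ge_at_top[of 1]
   proof eventually_elim
    case (elim n)
    interpret null: prob_space "null_law n (p n)" by (rule prob_space_null_law)
    have "measure (null_law n (p n)) (cusum_rejects n (p n)) <= measure (null_law n (p n)) (bad n)"
    proof (rule null.finite_measure_mono)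
     show "cusum_rejects n (p n) \<subseteq> bad n" unfolding cusum_rejects_eq[OF elim(2)] bad_def using order_trans[OF _ abs_ge_self] by blast
     show "bad n \<in> null.events" using bad_sets[OF elim(2)] by (simp add: sets_null_law)
    qed
    thus ?case using elim(1) by (simp add: test_level_def bad_def)
   qed
   show "(\<lambda>n. 1/(real n)^2) \<longlonglongrightarrow> 0" by real_asymp
  qed
  show "(\<lambda>n. test_power n (p n) (\<delta> n) (\<nu> n) (cusum_rejects n (p n))) \<longlonglongrightarrow> 1"
  proof (rule tendsto_sandwich[OF _ _ _ tendsto_const])
   \<comment> \<open>Up to constants this is r \<delta>, the order by which the spike raises the
     trace. It is a positive power of n, so it dominates \<open>L_tilde\<close>.\<close>
   define s where "s n = real n powr (1 - (\<alpha> + \<beta>))" for n :: nat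
   have "\<forall>\<^sub>F n in sequentially. L_tilde n <= s n/16"
    unfolding L_tilde_def s_def using ab by real_asymp
   moreover note model r_bounds \<delta>_bounds p_le eventually_ge_at_top[of 1]
   ultimately show "\<forall>\<^sub>F n in sequentially. 1 - exp (- (s n)\<^sup>2/(256*\<Gamma>)) <= test_power n (p n) (\<delta> n) (\<nu> n) (cusum_rejects n (p n))"
   proof eventually_elim
    case (elim n)
    interpret spiked_model n "p n" "r n" "\<delta> n" "\<nu> n" by (rule elim)
    interpret alt: prob_space P1 by (rule prob_space_alt)
    note n1' = \<open>1 <= n\<close>
    have n0: "0 < real n" using n1' by simp
    have p0: "0 < real (p n)" using p_ge[OF n1'] n1' by simp
    define d where "d = real (r n)*\<delta> n"
    have sd: "s n/2 <= d"
    proof -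
     have "s n/2 = real n powr (1 - \<beta>)/2*real n powr (- \<alpha>)" using rn_\<delta>[of n] by (simp add: s_def)
     also have "... <= d" unfolding d_def \<delta>_eq[OF n1'] using elim by (intro mult_right_mono) auto
     finally show ?thesis .
    qed
    have s0: "0 < s n" using n0 by (simp add: s_def)
    hence d0: "0 < d" using sd by linarith
    \<comment> \<open>The prior is a probability measure, so the Stiefel manifold is nonempty, which
      forces r <= p.\<close>
    have rp: "real (r n) <= p n"
    proof -
     obtain Q where Q: "Q \<in> stiefel (p n) (r n)" using prior.not_empty space_prior by blast
     thus ?thesis using orthonormal_card[OF stiefel_orthonormal[OF Q]] by simp
    qed
    \<comment> \<open>The exponent per observation is \<theta>(L_tilde + 2p\<theta> - d/2). This
      choice makes 2p\<theta> = d/4, and L_tilde <= s/16 <= d/8 leaves at most -\<theta>d/8.\<close>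
    define \<theta> where "\<theta> = d/(8*p n)"
    have dp: "d <= p n" unfolding d_def using rp elim mult_mono[of "real (r n)" "p n" "\<delta> n" 1] by simp
    have \<theta>: "0 < \<theta>" "\<theta> <= 1/2" using d0 p0 dp by (auto simp: \<theta>_def field_simps)
    define A where "A = {X \<in> space (data_space n (p n)). (\<Sum>i=1..n. \<Sum>j<p n. (X i j)\<^sup>2) < n*(p n + L_tilde n)}"
    \<comment> \<open>Only the index k = n is used, where the weight is 1 and the eigenvalue sum is
      the trace divided by n.\<close>
    have sub: "space P1 - cusum_rejects n (p n) \<subseteq> A"
    proof
     fix X assume X: "X \<in> space P1 - cusum_rejects n (p n)"
     hence Xs: "X \<in> space (data_space n (p n))" using sets_eq_imp_space_eq[OF sets_alt] by simp
     have "\<not> L_tilde n*(real n/real n) powr (2/3) <= centred_sum n (p n) n X"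
     proof -
      have "n \<in> {1..n}" using n1' by simp
      thus ?thesis using X Xs unfolding cusum_rejects_eq[OF n1'] by blast
     qed
     hence "centred_sum n (p n) n X < L_tilde n" using n0 by simp
     hence "partial_sum n (p n) n X < p n + L_tilde n"
      using null_trace_mean_le[OF n1' p_ge[OF n1']] unfolding centred_sum_def by linarith
     hence "real n*partial_sum n (p n) n X < n*(p n + L_tilde n)" using n0 by simp
     thus "X \<in> A" unfolding A_def partial_sum_eq_trace[OF n1' p_ge[OF n1']] using Xs by simp
    qed
    have "measure P1 A <= exp (n*(\<theta>*(p n + L_tilde n) + p n*(2*\<theta>\<^sup>2 - \<theta>) - r n*(\<theta>*\<delta> n/2)))"
     unfolding A_def by (rule alt_trace_lower_tail[OF \<theta>])
    also have "... <= exp (- (s n)\<^sup>2/(256*\<Gamma>))"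
    proof -
     have p\<theta>: "p n*\<theta> = d/8" using p0 by (simp add: \<theta>_def)
     have "\<theta>*(p n + L_tilde n) + p n*(2*\<theta>\<^sup>2 - \<theta>) - r n*(\<theta>*\<delta> n/2) = \<theta>*(L_tilde n + 2*(p n*\<theta>) - d/2)"
      by (simp add: d_def power2_eq_square algebra_simps)
     also have "... = \<theta>*(L_tilde n - d/4)" unfolding p\<theta> by simp
     also have "... <= \<theta>*(- d/8)" using elim(1) sd \<theta> by (intro mult_left_mono) auto
     finally have "n*(\<theta>*(p n + L_tilde n) + p n*(2*\<theta>\<^sup>2 - \<theta>) - r n*(\<theta>*\<delta> n/2)) <= n*(\<theta>*(- d/8))"
      by (intro mult_left_mono) auto
     also have "... = - (n/p n*d^2/64)" by (simp add: \<theta>_def power2_eq_square)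
     also have "... <= - (1/\<Gamma>*(s n/2)^2/64)"
     proof -
      have "1/\<Gamma> <= n/p n" using elim(5) p0 \<Gamma> by (simp add: field_simps)
      moreover have "(s n/2)^2 <= d^2" using sd s0 by (intro power_mono) auto
      ultimately have "1/\<Gamma>*(s n/2)^2 <= n/p n*d^2" using \<Gamma> by (intro mult_mono) auto
      hence "1/\<Gamma>*(s n/2)^2/64 <= n/p n*d^2/64" by (rule divide_right_mono) simp
      thus ?thesis by linarith
     qed
     also have "... = - (s n)\<^sup>2/(256*\<Gamma>)" by (simp add: power_divide)
     finally show ?thesis by simp
    qed
    finally have "measure P1 A <= exp (- (s n)\<^sup>2/(256*\<Gamma>))" .
    moreover have "measure P1 (space P1 - cusum_rejects n (p n)) <= measure P1 A"
    proof (rule alt.finite_measure_mono[OF sub])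
     have "(\<lambda>X. \<Sum>i=1..n. \<Sum>j<p n. (X i j)\<^sup>2) \<in> borel_measurable (data_space n (p n))"
      by (intro borel_measurable_sum borel_measurable_power measurable_entry) auto
     hence "A \<in> sets (data_space n (p n))" unfolding A_def by measurable
     thus "A \<in> alt.events" by (simp add: sets_alt)
    qed
    moreover have "measure P1 (space P1 - cusum_rejects n (p n)) = 1 - measure P1 (cusum_rejects n (p n))"
     using cusum_rejects_sets[OF n1' p_ge[OF n1']] by (intro alt.prob_compl) (simp add: sets_alt)
    ultimately show ?case by (simp add: test_power_def)
   qed
   show "\<forall>\<^sub>F n in sequentially. test_power n (p n) (\<delta> n) (\<nu> n) (cusum_rejects n (p n)) <= 1"
    using model
   proof eventually_elim
    case (elim n)
    interpret spiked_model n "p n" "r n" "\<delta> n" "\<nu> n" by (rule elim)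
    show ?case unfolding test_power_def by (rule prob_space.prob_le_1[OF prob_space_alt])
   qed
   show "(\<lambda>n. 1 - exp (- (s n)\<^sup>2/(256*\<Gamma>))) \<longlonglongrightarrow> 1" unfolding s_def using ab \<Gamma>(2) by real_asymp
  qed
 next
  assume ab: "\<alpha> + \<beta> > 1"
  have "\<forall>\<^sub>F n in sequentially. 1 - 2*ln (real n)*real n powr (1 - (\<alpha> + \<beta>)) <= measure (alt_law n (p n) (\<delta> n) (\<nu> n))
     {X \<in> space (data_space n (p n)). \<forall>k\<in>{1..n}. \<bar>centred_sum n (p n) k X\<bar> <= 2*L_tilde n*(real k/real n) powr (2/3)}"
  proof -
   have "\<forall>\<^sub>F n in sequentially. 8*real n powr (1 - (\<alpha> + \<beta>)) <= 1" using ab by real_asymp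
   \<comment> \<open>Since \<alpha> + \<beta> < 2, the power n^(1-(\<alpha>+\<beta>)) decays more
     slowly than 1/n, so the claimed error leaves room for the bound 2/n obtained below.\<close>
   moreover have "\<forall>\<^sub>F n in sequentially. 2/real n <= 2*ln (real n)*real n powr (1 - (\<alpha> + \<beta>))"
    using \<open>\<alpha> < 1\<close> \<open>\<beta> < 1\<close> by real_asymp
   moreover have "\<forall>\<^sub>F n in sequentially. 0 <= L_tilde n" by (simp add: L_tilde_def)
   moreover note model r_bounds \<delta>_bounds rigid eventually_ge_at_top[of 1]
   ultimately show ?thesis
   proof eventually_elim
    case (elim n)
    interpret spiked_model n "p n" "r n" "\<delta> n" "\<nu> n" by (rule elim)
    interpret alt: prob_space P1 by (rule prob_space_alt)
    note n1' = \<open>1 <= n\<close>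
    have n0: "0 < real n" using n1' by simp
    have "\<delta> n/(1 - \<delta> n) <= \<delta> n/(1/2)" using elim by (intro divide_left_mono) auto
    hence "\<delta> n/(1 - \<delta> n)*r n <= (2*\<delta> n)*(2*real n powr (1 - \<beta>))" using elim by (intro mult_mono) auto
    also have "... = 4*real n powr (1 - (\<alpha> + \<beta>))" unfolding \<delta>_eq[OF n1'] using rn_\<delta>[of n] by (simp add: mult_ac)
    also have "... <= 1/2" using elim(1) by simp
    finally have small: "\<delta> n/(1 - \<delta> n)*r n <= 1/2" .
    \<comment> \<open>With s = 1/n and null probability at most 1/n^2, both terms are at most
      1/n.\<close>
    have "measure P1 (bad n) <= 1/real n + measure (null_law n (p n)) (bad n)/(1/real n)"
     by (rule alt_contiguity[OF small bad_sets[OF n1']]) (use n0 in simp)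
    also have "... <= 1/real n + (1/(real n)^2)/(1/real n)"
     using elim(7) n0 by (intro add_left_mono divide_right_mono) (auto simp: bad_def)
    also have "... = 2/real n" using n0 by (simp add: power2_eq_square)
    also have "... <= 2*ln (real n)*real n powr (1 - (\<alpha> + \<beta>))" by (rule elim)
    finally have bad: "measure P1 (bad n) <= 2*ln (real n)*real n powr (1 - (\<alpha> + \<beta>))" .
    define good where "good = {X \<in> space (data_space n (p n)). \<forall>k\<in>{1..n}. \<bar>centred_sum n (p n) k X\<bar> <= 2*L_tilde n*(real k/real n) powr (2/3)}"
    have sp: "space P1 = space (data_space n (p n))" by (rule sets_eq_imp_space_eq[OF sets_alt])
    have "1 - measure P1 (bad n) = measure P1 (space P1 - bad n)"
     using bad_sets[OF n1'] by (intro alt.prob_compl[symmetric]) (simp add: sets_alt)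
    also have "... <= measure P1 good"
    proof (rule alt.finite_measure_mono)
     show "space P1 - bad n \<subseteq> good"
     proof
      fix X assume X: "X \<in> space P1 - bad n"
      have "\<bar>centred_sum n (p n) k X\<bar> <= 2*L_tilde n*(real k/real n) powr (2/3)" if "k \<in> {1..n}" for k
      proof -
       have "\<bar>centred_sum n (p n) k X\<bar> < L_tilde n*(real k/real n) powr (2/3)" using X that by (force simp: bad_def sp)
       moreover have "0 <= L_tilde n*(real k/real n) powr (2/3)" using elim(3) by simp
       ultimately show ?thesis by simp
      qed
      thus "X \<in> good" using X by (simp add: good_def sp)
     qed
     have "good \<in> sets (data_space n (p n))" unfolding good_def
     proof (rule sets.sets_Collect_finite_All)
      fix k assume "k \<in> {1..n}"
      note [measurable] = centred_sum_measurable[OF n1' p_ge[OF n1'] this]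
      show "{X \<in> space (data_space n (p n)). \<bar>centred_sum n (p n) k X\<bar> <= 2*L_tilde n*(real k/real n) powr (2/3)} \<in> sets (data_space n (p n))"
       by measurable
     qed auto
     thus "good \<in> alt.events" by (simp add: sets_alt)
    qed
    finally show ?case using bad by (simp add: good_def)
   qed
  qed
  thus "\<exists>C > 0. \<forall>\<^sub>F n in sequentially.
        measure (alt_law n (p n) (\<delta> n) (\<nu> n))
         {X \<in> space (data_space n (p n)). \<forall>k\<in>{1..n}.
          \<bar>centred_sum n (p n) k X\<bar> <= C*L_tilde n*(real k/real n) powr (2/3)}
        \<ge> 1 - C*ln (real n)*real n powr (1 - (\<alpha> + \<beta>))"
   by (intro exI[of _ 2]) simp
 qed
qed

end
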